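(* Let $(X_i,d_i,\mu_i)$, $i=1,2$, be spaces of homogeneous type with upper dimensions $\omega_i$ and wavelet bases of Hölder exponents $\eta_i$. Suppose $\beta_i\in(0,\eta_i)$, $\gamma_i>0$ for $i=1,2$, and $\max\{\frac{\omega_1}{\omega_1+\eta_1},\frac{\omega_2}{\omega_2+\eta_2}\}<p<\infty$. Take $N_1,N_2\in\mathbb{N}$. Then there is a constant $C>0$ such that for all $f\in(\mathring{G}(\beta_1,\beta_2;\gamma_1,\gamma_2))'$, $$\Big\|\Big\{\sum_{k_1'}\sum_{\alpha_1'\in\mathscr{X}^{k_1'+N_1}}\sum_{k_2'}\sum_{\alpha_2'\in\mathscr{X}^{k_2'+N_2}}\ \sup_{(z_1,z_2)\in Q_{\alpha_1'}^{k_1'+N_1}\times Q_{\alpha_2'}^{k_2'+N_2}}|D_{k_1'}D_{k_2'}(f)(z_1,z_2)|^2\,\chi_{Q_{\alpha_1'}^{k_1'+N_1}}(\cdot)\chi_{Q_{\alpha_2'}^{k_2'+N_2}}(\cdot)\Big\}^{1/2}\Big\|_{L^p(X_1\times X_2)}$$ $$\le C\Big\|\Big\{\sum_{k_1}\sum_{\alpha_1\in\mathscr{Y}^{k_1}}\sum_{k_2}\sum_{\alpha_2\in\mathscr{Y}^{k_2}}\big|\langle\psi_{\alpha_1}^{k_1}\psi_{\alpha_2}^{k_2},f\rangle\widetilde\chi_{Q_{\alpha_1}^{k_1}}(\cdot)\widetilde\chi_{Q_{\alpha_2}^{k_2}}(\cdot)\big|^2\Big\}^{1/2}\Big\|_{L^p(X_1\times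 X_2)}.$$ Further, suppose $N_1$ and $N_2$ are sufficiently large positive integers. Then there is a constant $C>0$ such that for all $f\in(\mathring{G}(\beta_1,\beta_2;\gamma_1,\gamma_2))'$, $$\Big\|\Big\{\sum_{k_1}\sum_{\alpha_1\in\mathscr{Y}^{k_1}}\sum_{k_2}\sum_{\alpha_2\in\mathscr{Y}^{k_2}}\big|\langle\psi_{\alpha_1}^{k_1}\psi_{\alpha_2}^{k_2},f\rangle\widetilde\chi_{Q_{\alpha_1}^{k_1}}(\cdot)\widetilde\chi_{Q_{\alpha_2}^{k_2}}(\cdot)\big|^2\Big\}^{1/2}\Big\|_{L^p(X_1\times X_2)}$$ $$\le C\Big\|\Big\{\sum_{k_1'}\sum_{\alpha_1'\in\mathscr{X}^{k_1'+N_1}}\sum_{k_2'}\sum_{\alpha_2'\in\mathscr{X}^{k_2'+N_2}}\ \inf_{(z_1,z_2)\in Q_{\alpha_1'}^{k_1'+N_1}\times Q_{\alpha_2'}^{k_2'+N_2}}|D_{k_1'}D_{k_2'}(f)(z_1,z_2)|^2\,\chi_{Q_{\alpha_1'}^{k_1'+N_1}}(\cdot)\chi_{Q_{\alpha_2'}^{k_2'+N_2}}(\cdot)\Big\}^{1/2}\Big\|_{L^p(X_1\times X_2)}.$$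
   Context: For $i=1,2$: $(X_i,d_i,\mu_i)$ is a space of homogeneous type, i.e. $d_i$ is a quasi-metric (symmetric, nonnegative, zero exactly on the diagonal, $d_i(x,y)\le A_0^{(i)}[d_i(x,z)+d_i(z,y)]$ with $A_0^{(i)}\ge1$) and $\mu_i$ is a nonzero measure with $\mu_i(B(x,2r))\le C_{\mu_i}\mu_i(B(x,r))<\infty$ for all $x,r$, $B(x,r)=\{y:d_i(x,y)<r\}$. Standing assumptions: $\mu_i(X_i)=\infty$, $\mu_i(B(x,r))>0$ always. An upper dimension of $\mu_i$ is $\omega_i>0$ with $\mu_i(B(x,\lambda r))\le C\lambda^{\omega_i}\mu_i(B(x,r))$ for all $x$, $\lambda\ge1$, $r>0$. Write $V_r(x)=\mu_i(B(x,r))$, $V(x,y)=\mu_i(B(x,d_i(x,y)))$. $X_1\times X_2$ carries $\mu_1\times\mu_2$. On each $X_i$ (suppressing $i$): fix a small $\delta\in(0,1)$ (e.g. $\delta\le10^{-3}A_0^{-10}$); $\mathscr{X}^0$ is a maximal $1$-separated subset and inductively $\mathscr{X}^k\supseteq\mathscr{X}^{k-1}$, $\mathscr{X}^{-k}\subseteq\mathscr{X}^{-(k-1)}$ are maximal $\delta^{k}$- and $\delta^{-k}$-separated collections (in $X$ and in $\mathscr{X}^{-(k-1)}$ respectively), $k\ge1$; $\mathscr{Y}^k=\mathscr{X}^{k+1}\setminus\mathscr{X}^k=\{y_\alpha^k\}_\alpha$ (indices identified with points). Half-open dyadic cubes (Hytönen--Kairema) $Q_\alpha^k$, $\alpha\in\mathscr{X}^k$,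 with center $x_\alpha^k$: for each $k$ they partition $X$, they are nested ($\ell\ge k$ implies $Q_\beta^\ell\subseteq Q_\alpha^k$ or disjoint), and $B(x_\alpha^k,c_1\delta^k)\subseteq Q_\alpha^k\subseteq B(x_\alpha^k,C_1\delta^k)$, $c_1=(3A_0^2)^{-1}$, $C_1=4A_0^2$. In sums over $\alpha\in\mathscr{Y}^k$, $Q_\alpha^k$ denotes the dyadic cube centered at $y_\alpha^k\in\mathscr{X}^{k+1}$ (of generation $k+1$). $\widetilde\chi_Q=\chi_Q\,\mu_i(Q)^{-1/2}$ for a cube $Q\subset X_i$. $\{\psi_\alpha^k\}_{k\in\mathbb{Z},\alpha\in\mathscr{Y}^k}$ is the Auscher--Hytönen orthonormal basis of $L^2(X)$, satisfying, with $a=(1+2\log_2A_0)^{-1}$ and $C<\infty,\nu>0,\eta\in(0,1]$ independent of $k,\alpha$ and points: $|\psi_\alpha^k(x)|\le C\mu(B(y_\alpha^k,\delta^k))^{-1/2}\exp(-\nu(d(y_\alpha^k,x)/\delta^k)^a)$; $|\psi_\alpha^k(x)-\psi_\alpha^k(y)|\le C\mu(B(y_\alpha^k,\delta^k))^{-1/2}(d(x,y)/\delta^k)^\eta\exp(-\nu(d(y_\alpha^k,x)/\delta^k)^a)$ for $d(x,y)\le\delta^k$; $\int\psi_\alpha^k\,d\mu=0$. The exponent for $X_i$ is $\eta_i$. $\psi_{\alpha_1}^{k_1}\psi_{\alpha_2}^{k_2}$ is the tensor product, $\psi_{\alpha_i}^{k_i}$ acting in the $X_i$ variable. $D_{k_1}D_{k_2}=D_{k_1}\otimes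 D_{k_2}$ is given by $D_{k_1}D_{k_2}(f)(x_1,x_2)=\sum_{\alpha_1\in\mathscr{Y}^{k_1}}\sum_{\alpha_2\in\mathscr{Y}^{k_2}}\langle\psi_{\alpha_1}^{k_1}\psi_{\alpha_2}^{k_2},f\rangle\psi_{\alpha_1}^{k_1}(x_1)\psi_{\alpha_2}^{k_2}(x_2)$. One-parameter test functions on $X$ ($x_0\in X$, $r>0$, $\beta\in(0,\eta]$, $\gamma>0$): $G(x_0,r,\beta,\gamma)$ is the set of $f$ for which there is $C>0$ with (i) $|f(x)|\le C\frac{1}{V_r(x_0)+V(x,x_0)}\big(\frac{r}{r+d(x,x_0)}\big)^\gamma$ for all $x$; (ii) $|f(x)-f(y)|\le C\big(\frac{d(x,y)}{r+d(x,x_0)}\big)^\beta\frac{1}{V_r(x_0)+V(x,x_0)}\big(\frac{r}{r+d(x,x_0)}\big)^\gamma$ if $d(x,y)<(2A_0)^{-1}(r+d(x,x_0))$; (iii) $\int f\,d\mu=0$; norm = infimum of such $C$. Product test functions: for $(x_0,y_0)\in X_1\times X_2$, $r=(r_1,r_2)$, $r_i>0$, $\beta_i\in(0,\eta_i]$, $\gamma_i>0$, $G(x_0,y_0;r;\beta;\gamma)$ is the set of $f$ on $X_1\times X_2$ such that $f(\cdot,y)\in G(x_0,r_1,\beta_1,\gamma_1)$ for each $y$, $f(x,\cdot)\in G(y_0,r_2,\beta_2,\gamma_2)$ for each $x$, and for some $C$: (i) $\|f(\cdot,y)\|_{G(x_0,r_1,\beta_1,\gamma_1)}\le C\frac{1}{V_{r_2}(y_0)+V(y,y_0)}\big(\frac{r_2}{r_2+d_2(y,y_0)}\big)^{\gamma_2}$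 for all $y$; (ii) $\|f(\cdot,y)-f(\cdot,y')\|_{G(x_0,r_1,\beta_1,\gamma_1)}\le C\big(\frac{d_2(y,y')}{r_2+d_2(y,y_0)}\big)^{\beta_2}\frac{1}{V_{r_2}(y_0)+V(y_0,y)}\big(\frac{r_2}{r_2+d_2(y,y_0)}\big)^{\gamma_2}$ if $d_2(y,y')\le(2A_0^{(2)})^{-1}(r_2+d_2(y,y_0))$; (iii) (i),(ii) hold with the roles of the two variables interchanged; (iv) $\int f(x,y)\,d\mu_1(x)=0$ for all $y$ and $\int f(x,y)\,d\mu_2(y)=0$ for all $x$. Norm = infimum of $C$ in (i)--(iii). Fix $(x_0,y_0)$ and set $G(\beta_1,\beta_2;\gamma_1,\gamma_2)=G(x_0,y_0;1,1;\beta;\gamma)$. $\mathring{G}(\beta_1,\beta_2;\gamma_1,\gamma_2)$ is the completion of $G(\eta_1,\eta_2;\gamma_1,\gamma_2)$ in the norm of $G(\beta_1,\beta_2;\gamma_1,\gamma_2)$, with that norm; $(\mathring{G}(\beta_1,\beta_2;\gamma_1,\gamma_2))'$ is the space of bounded linear functionals on it, $\langle\cdot,\cdot\rangle$ the pairing. *)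

theory Defs
  imports "HOL-Analysis.Analysis"
begin

record 'a qm_space =
  qdist :: "'a \<Rightarrow> 'a \<Rightarrow> real"
  qconst :: real
  qmeas :: "'a measure"

definition qball :: "'a qm_space \<Rightarrow> 'a \<Rightarrow> real \<Rightarrow> 'a set" where
  "qball S x r = {y. qdist S x y < r}"

definition quasi_metric :: "('a \<Rightarrow> 'a \<Rightarrow> real) \<Rightarrow> real \<Rightarrow> bool" where
  "quasi_metric d A \<longleftrightarrow>
     A \<ge> 1 \<and>
     (\<forall>x y. d x y = d y x) \<and>
     (\<forall>x y. 0 \<le> d x y) \<and>
     (\<forall>x y. d x y = 0 \<longleftrightarrow> x = y) \<and>
     (\<forall>x y z. d x y \<le> A * (d x z + d z y))"

text \<open>The underlying set is the whole type. Balls have to be measurable for the doubling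
  condition to be meaningful; no further relation between the sigma-algebra and the
  quasi-metric is imposed.\<close>

definition homogeneous_type :: "'a qm_space \<Rightarrow> bool" where
  "homogeneous_type S \<longleftrightarrow>
     quasi_metric (qdist S) (qconst S) \<and>
     space (qmeas S) = UNIV \<and>
     emeasure (qmeas S) UNIV \<noteq> 0 \<and>
     (\<forall>x r. qball S x r \<in> sets (qmeas S)) \<and>
     (\<exists>C::real. \<forall>x. \<forall>r>0.
        emeasure (qmeas S) (qball S x (2 * r)) \<le> ennreal C * emeasure (qmeas S) (qball S x r) \<and>
        emeasure (qmeas S) (qball S x r) < \<infinity>)"

definition upper_dimension :: "'a qm_space \<Rightarrow> real \<Rightarrow> bool" where
  "upper_dimension S \<omega> \<longleftrightarrow>
     \<omega> > 0 \<and>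
     (\<exists>C::real. \<forall>x. \<forall>t\<ge>1. \<forall>r>0.
        emeasure (qmeas S) (qball S x (t * r))
          \<le> ennreal (C * t powr \<omega>) * emeasure (qmeas S) (qball S x r))"

definition vol :: "'a qm_space \<Rightarrow> real \<Rightarrow> 'a \<Rightarrow> real" where
  "vol S r x = measure (qmeas S) (qball S x r)"

definition vol2 :: "'a qm_space \<Rightarrow> 'a \<Rightarrow> 'a \<Rightarrow> real" where
  "vol2 S x y = measure (qmeas S) (qball S x (qdist S x y))"

definition separated :: "'a qm_space \<Rightarrow> real \<Rightarrow> 'a set \<Rightarrow> bool" where
  "separated S r P \<longleftrightarrow> (\<forall>x\<in>P. \<forall>y\<in>P. x \<noteq> y \<longrightarrow> qdist S x y \<ge> r)"

definition max_separated :: "'a qm_space \<Rightarrow> real \<Rightarrow> 'a set \<Rightarrow> 'a set \<Rightarrow> bool" where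
  "max_separated S r E P \<longleftrightarrow>
     P \<subseteq> E \<and> separated S r P \<and>
     (\<forall>T. P \<subseteq> T \<and> T \<subseteq> E \<and> separated S r T \<longrightarrow> T = P)"

text \<open>No explicit smallness of \<open>\<delta>\<close> is demanded: it serves only to guarantee the existence of the
  dyadic cubes and of the wavelets, which are given data below.\<close>

definition reference_points :: "'a qm_space \<Rightarrow> real \<Rightarrow> (int \<Rightarrow> 'a set) \<Rightarrow> bool" where
  "reference_points S \<delta> X \<longleftrightarrow>
     0 < \<delta> \<and> \<delta> < 1 \<and>
     max_separated S 1 UNIV (X 0) \<and>
     (\<forall>k\<ge>1. X (k - 1) \<subseteq> X k \<and> max_separated S (\<delta> powi k) UNIV (X k)) \<and>
     (\<forall>k\<ge>1. max_separated S (\<delta> powi (- k)) (X (- (k - 1))) (X (- k)))"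

definition new_points :: "(int \<Rightarrow> 'a set) \<Rightarrow> int \<Rightarrow> 'a set" where
  "new_points X k = X (k + 1) - X k"

definition dyadic_cubes ::
  "'a qm_space \<Rightarrow> real \<Rightarrow> (int \<Rightarrow> 'a set) \<Rightarrow> (int \<Rightarrow> 'a \<Rightarrow> 'a set) \<Rightarrow> bool" where
  "dyadic_cubes S \<delta> X Q \<longleftrightarrow>
     (\<forall>k. \<forall>\<alpha>\<in>X k. Q k \<alpha> \<in> sets (qmeas S)) \<and>
     (\<forall>k. (\<Union>\<alpha>\<in>X k. Q k \<alpha>) = UNIV) \<and>
     (\<forall>k. \<forall>\<alpha>\<in>X k. \<forall>\<beta>\<in>X k. \<alpha> \<noteq> \<beta> \<longrightarrow> Q k \<alpha> \<inter> Q k \<beta> = {}) \<and>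
     (\<forall>k l. \<forall>\<alpha>\<in>X k. \<forall>\<beta>\<in>X l. l \<ge> k \<longrightarrow> Q l \<beta> \<subseteq> Q k \<alpha> \<or> Q l \<beta> \<inter> Q k \<alpha> = {}) \<and>
     (\<forall>k. \<forall>\<alpha>\<in>X k.
        qball S \<alpha> (1 / (3 * (qconst S)\<^sup>2) * \<delta> powi k) \<subseteq> Q k \<alpha> \<and>
        Q k \<alpha> \<subseteq> qball S \<alpha> (4 * (qconst S)\<^sup>2 * \<delta> powi k))"

definition square_integrable :: "'a measure \<Rightarrow> ('a \<Rightarrow> real) \<Rightarrow> bool" where
  "square_integrable M g \<longleftrightarrow> g \<in> borel_measurable M \<and> integrable M (\<lambda>x. (g x)\<^sup>2)"

definition orthonormal_basis_L2 :: "'a measure \<Rightarrow> 'i set \<Rightarrow> ('i \<Rightarrow> 'a \<Rightarrow> real) \<Rightarrow> bool" where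
  "orthonormal_basis_L2 M I e \<longleftrightarrow>
     (\<forall>i\<in>I. square_integrable M (e i)) \<and>
     (\<forall>i\<in>I. \<forall>j\<in>I. (\<integral>x. e i x * e j x \<partial>M) = (if i = j then 1 else 0)) \<and>
     (\<forall>g. square_integrable M g \<longrightarrow>
        (\<forall>\<epsilon>>0. \<exists>J c. finite J \<and> J \<subseteq> I \<and>
           (\<integral>x. (g x - (\<Sum>j\<in>J. c j * e j x))\<^sup>2 \<partial>M) < \<epsilon>))"

text \<open>Auscher--Hyt\<odieresis>nen wavelets. They are real-valued, so they are also an orthonormal basis of
  the complex \<open>L\<^sup>2\<close> space.\<close>

definition wavelet_basis ::
  "'a qm_space \<Rightarrow> real \<Rightarrow> (int \<Rightarrow> 'a set) \<Rightarrow> real \<Rightarrow> (int \<Rightarrow> 'a \<Rightarrow> 'a \<Rightarrow> real) \<Rightarrow> bool" where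
  "wavelet_basis S \<delta> X \<eta> \<psi> \<longleftrightarrow>
     0 < \<eta> \<and> \<eta> \<le> 1 \<and>
     orthonormal_basis_L2 (qmeas S) (SIGMA k:UNIV. new_points X k) (\<lambda>(k, \<alpha>). \<psi> k \<alpha>) \<and>
     (\<exists>C \<nu>::real. C > 0 \<and> \<nu> > 0 \<and>
        (\<forall>k. \<forall>\<alpha>\<in>new_points X k. \<forall>x.
           \<bar>\<psi> k \<alpha> x\<bar> \<le> C * vol S (\<delta> powi k) \<alpha> powr (- 1 / 2)
             * exp (- \<nu> * (qdist S \<alpha> x / \<delta> powi k) powr (1 / (1 + 2 * log 2 (qconst S))))) \<and>
        (\<forall>k. \<forall>\<alpha>\<in>new_points X k. \<forall>x y. qdist S x y \<le> \<delta> powi k \<longrightarrow>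
           \<bar>\<psi> k \<alpha> x - \<psi> k \<alpha> y\<bar> \<le> C * vol S (\<delta> powi k) \<alpha> powr (- 1 / 2)
             * (qdist S x y / \<delta> powi k) powr \<eta>
             * exp (- \<nu> * (qdist S \<alpha> x / \<delta> powi k) powr (1 / (1 + 2 * log 2 (qconst S)))))) \<and>
     (\<forall>k. \<forall>\<alpha>\<in>new_points X k. integrable (qmeas S) (\<psi> k \<alpha>) \<and> (\<integral>x. \<psi> k \<alpha> x \<partial>qmeas S) = 0)"

definition test_bound ::
  "'a qm_space \<Rightarrow> 'a \<Rightarrow> real \<Rightarrow> real \<Rightarrow> real \<Rightarrow> ('a \<Rightarrow> complex) \<Rightarrow> real \<Rightarrow> bool" where
  "test_bound S x0 r \<beta> \<gamma> f C \<longleftrightarrow>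
     C > 0 \<and>
     (\<forall>x. cmod (f x) \<le> C * (1 / (vol S r x0 + vol2 S x x0)) * (r / (r + qdist S x x0)) powr \<gamma>) \<and>
     (\<forall>x y. qdist S x y < 1 / (2 * qconst S) * (r + qdist S x x0) \<longrightarrow>
        cmod (f x - f y) \<le> C * (qdist S x y / (r + qdist S x x0)) powr \<beta>
          * (1 / (vol S r x0 + vol2 S x x0)) * (r / (r + qdist S x x0)) powr \<gamma>)"

definition test_space ::
  "'a qm_space \<Rightarrow> 'a \<Rightarrow> real \<Rightarrow> real \<Rightarrow> real \<Rightarrow> ('a \<Rightarrow> complex) set" where
  "test_space S x0 r \<beta> \<gamma> =
     {f. (\<exists>C. test_bound S x0 r \<beta> \<gamma> f C) \<and>
         integrable (qmeas S) f \<and> (\<integral>x. f x \<partial>qmeas S) = 0}"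

definition test_norm ::
  "'a qm_space \<Rightarrow> 'a \<Rightarrow> real \<Rightarrow> real \<Rightarrow> real \<Rightarrow> ('a \<Rightarrow> complex) \<Rightarrow> real" where
  "test_norm S x0 r \<beta> \<gamma> f = Inf {C. test_bound S x0 r \<beta> \<gamma> f C}"

text \<open>The product conditions in which the norm is taken in the first variable; the other half is
  obtained by swapping the variables.\<close>

definition half_product_bound ::
  "'a qm_space \<Rightarrow> 'b qm_space \<Rightarrow> 'a \<Rightarrow> 'b \<Rightarrow> real \<Rightarrow> real \<Rightarrow> real \<Rightarrow> real \<Rightarrow> real \<Rightarrow> real \<Rightarrow>
   ('a \<times> 'b \<Rightarrow> complex) \<Rightarrow> real \<Rightarrow> bool" where
  "half_product_bound S1 S2 x0 y0 r1 r2 \<beta>1 \<beta>2 \<gamma>1 \<gamma>2 f C \<longleftrightarrow>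
     (\<forall>y. test_norm S1 x0 r1 \<beta>1 \<gamma>1 (\<lambda>x. f (x, y))
        \<le> C * (1 / (vol S2 r2 y0 + vol2 S2 y y0)) * (r2 / (r2 + qdist S2 y y0)) powr \<gamma>2) \<and>
     (\<forall>y y'. qdist S2 y y' \<le> 1 / (2 * qconst S2) * (r2 + qdist S2 y y0) \<longrightarrow>
        test_norm S1 x0 r1 \<beta>1 \<gamma>1 (\<lambda>x. f (x, y) - f (x, y'))
          \<le> C * (qdist S2 y y' / (r2 + qdist S2 y y0)) powr \<beta>2
            * (1 / (vol S2 r2 y0 + vol2 S2 y0 y)) * (r2 / (r2 + qdist S2 y y0)) powr \<gamma>2)"

definition product_test_bound ::
  "'a qm_space \<Rightarrow> 'b qm_space \<Rightarrow> 'a \<Rightarrow> 'b \<Rightarrow> real \<Rightarrow> real \<Rightarrow> real \<Rightarrow> real \<Rightarrow> real \<Rightarrow> real \<Rightarrow>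
   ('a \<times> 'b \<Rightarrow> complex) \<Rightarrow> real \<Rightarrow> bool" where
  "product_test_bound S1 S2 x0 y0 r1 r2 \<beta>1 \<beta>2 \<gamma>1 \<gamma>2 f C \<longleftrightarrow>
     C > 0 \<and>
     half_product_bound S1 S2 x0 y0 r1 r2 \<beta>1 \<beta>2 \<gamma>1 \<gamma>2 f C \<and>
     half_product_bound S2 S1 y0 x0 r2 r1 \<beta>2 \<beta>1 \<gamma>2 \<gamma>1 (\<lambda>(y, x). f (x, y)) C"

definition product_test_space ::
  "'a qm_space \<Rightarrow> 'b qm_space \<Rightarrow> 'a \<Rightarrow> 'b \<Rightarrow> real \<Rightarrow> real \<Rightarrow> real \<Rightarrow> real \<Rightarrow> real \<Rightarrow> real \<Rightarrow>
   ('a \<times> 'b \<Rightarrow> complex) set" where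
  "product_test_space S1 S2 x0 y0 r1 r2 \<beta>1 \<beta>2 \<gamma>1 \<gamma>2 =
     {f. (\<forall>y. (\<lambda>x. f (x, y)) \<in> test_space S1 x0 r1 \<beta>1 \<gamma>1) \<and>
         (\<forall>x. (\<lambda>y. f (x, y)) \<in> test_space S2 y0 r2 \<beta>2 \<gamma>2) \<and>
         (\<exists>C. product_test_bound S1 S2 x0 y0 r1 r2 \<beta>1 \<beta>2 \<gamma>1 \<gamma>2 f C) \<and>
         (\<forall>y. (\<integral>x. f (x, y) \<partial>qmeas S1) = 0) \<and>
         (\<forall>x. (\<integral>y. f (x, y) \<partial>qmeas S2) = 0)}"

definition product_test_norm ::
  "'a qm_space \<Rightarrow> 'b qm_space \<Rightarrow> 'a \<Rightarrow> 'b \<Rightarrow> real \<Rightarrow> real \<Rightarrow> real \<Rightarrow> real \<Rightarrow> real \<Rightarrow> real \<Rightarrow>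
   ('a \<times> 'b \<Rightarrow> complex) \<Rightarrow> real" where
  "product_test_norm S1 S2 x0 y0 r1 r2 \<beta>1 \<beta>2 \<gamma>1 \<gamma>2 f =
     Inf {C. product_test_bound S1 S2 x0 y0 r1 r2 \<beta>1 \<beta>2 \<gamma>1 \<gamma>2 f C}"

text \<open>The completion of the \<open>(\<eta>1, \<eta>2)\<close>-space in the norm of the \<open>(\<beta>1, \<beta>2)\<close>-space, realised as its
  closure in the latter, which is complete; both with base point \<open>(x0, y0)\<close> and scales 1.\<close>

definition completed_test_space ::
  "'a qm_space \<Rightarrow> 'b qm_space \<Rightarrow> 'a \<Rightarrow> 'b \<Rightarrow> real \<Rightarrow> real \<Rightarrow> real \<Rightarrow> real \<Rightarrow> real \<Rightarrow> real \<Rightarrow>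
   ('a \<times> 'b \<Rightarrow> complex) set" where
  "completed_test_space S1 S2 x0 y0 \<eta>1 \<eta>2 \<beta>1 \<beta>2 \<gamma>1 \<gamma>2 =
     {f \<in> product_test_space S1 S2 x0 y0 1 1 \<beta>1 \<beta>2 \<gamma>1 \<gamma>2.
        \<exists>g. (\<forall>n::nat. g n \<in> product_test_space S1 S2 x0 y0 1 1 \<eta>1 \<eta>2 \<gamma>1 \<gamma>2) \<and>
            (\<lambda>n. product_test_norm S1 S2 x0 y0 1 1 \<beta>1 \<beta>2 \<gamma>1 \<gamma>2 (\<lambda>z. f z - g n z))
              \<longlonglongrightarrow> 0}"

text \<open>Functionals are represented by total functions; only their values on the completed test
  space matter.\<close>

definition distributions ::
  "'a qm_space \<Rightarrow> 'b qm_space \<Rightarrow> 'a \<Rightarrow> 'b \<Rightarrow> real \<Rightarrow> real \<Rightarrow> real \<Rightarrow> real \<Rightarrow> real \<Rightarrow> real \<Rightarrow>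
   (('a \<times> 'b \<Rightarrow> complex) \<Rightarrow> complex) set" where
  "distributions S1 S2 x0 y0 \<eta>1 \<eta>2 \<beta>1 \<beta>2 \<gamma>1 \<gamma>2 =
     (let G = completed_test_space S1 S2 x0 y0 \<eta>1 \<eta>2 \<beta>1 \<beta>2 \<gamma>1 \<gamma>2 in
      {f. (\<forall>g\<in>G. \<forall>h\<in>G. f (\<lambda>z. g z + h z) = f g + f h) \<and>
          (\<forall>c. \<forall>g\<in>G. f (\<lambda>z. c * g z) = c * f g) \<and>
          (\<exists>B. \<forall>g\<in>G. cmod (f g)
                 \<le> B * product_test_norm S1 S2 x0 y0 1 1 \<beta>1 \<beta>2 \<gamma>1 \<gamma>2 g)})"

definition wavelet_coeff ::
  "(int \<Rightarrow> 'a \<Rightarrow> 'a \<Rightarrow> real) \<Rightarrow> (int \<Rightarrow> 'b \<Rightarrow> 'b \<Rightarrow> real) \<Rightarrow> (('a \<times> 'b \<Rightarrow> complex) \<Rightarrow> complex) \<Rightarrow>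
   int \<Rightarrow> 'a \<Rightarrow> int \<Rightarrow> 'b \<Rightarrow> complex" where
  "wavelet_coeff \<psi>1 \<psi>2 f k1 \<alpha>1 k2 \<alpha>2 =
     f (\<lambda>(x1, x2). complex_of_real (\<psi>1 k1 \<alpha>1 x1 * \<psi>2 k2 \<alpha>2 x2))"

definition DD ::
  "(int \<Rightarrow> 'a set) \<Rightarrow> (int \<Rightarrow> 'b set) \<Rightarrow>
   (int \<Rightarrow> 'a \<Rightarrow> 'a \<Rightarrow> real) \<Rightarrow> (int \<Rightarrow> 'b \<Rightarrow> 'b \<Rightarrow> real) \<Rightarrow> int \<Rightarrow> int \<Rightarrow>
   (('a \<times> 'b \<Rightarrow> complex) \<Rightarrow> complex) \<Rightarrow> 'a \<times> 'b \<Rightarrow> complex" where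
  "DD X1 X2 \<psi>1 \<psi>2 k1 k2 f = (\<lambda>(x1, x2).
     \<Sum>\<^sub>\<infinity>\<alpha>1\<in>new_points X1 k1. \<Sum>\<^sub>\<infinity>\<alpha>2\<in>new_points X2 k2.
       wavelet_coeff \<psi>1 \<psi>2 f k1 \<alpha>1 k2 \<alpha>2
         * complex_of_real (\<psi>1 k1 \<alpha>1 x1) * complex_of_real (\<psi>2 k2 \<alpha>2 x2))"

definition normalized_indicator :: "'a measure \<Rightarrow> 'a set \<Rightarrow> 'a \<Rightarrow> real" where
  "normalized_indicator M Q x = indicator Q x * measure M Q powr (- 1 / 2)"

text \<open>Only used for positive exponents, hence \<open>\<infinity>\<close> at \<open>\<infinity>\<close>.\<close>

definition ennreal_powr :: "ennreal \<Rightarrow> real \<Rightarrow> ennreal" where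
  "ennreal_powr t p = (if t = \<infinity> then \<infinity> else ennreal (enn2real t powr p))"

definition Lp_norm :: "'a measure \<Rightarrow> real \<Rightarrow> ('a \<Rightarrow> ennreal) \<Rightarrow> ennreal" where
  "Lp_norm M p g = ennreal_powr (\<integral>\<^sup>+x. ennreal_powr (g x) p \<partial>M) (1 / p)"

text \<open>The cube attached to the wavelet with index \<open>\<alpha> \<in> new_points X k\<close> is the one centred at \<open>\<alpha>\<close> in
  generation \<open>k + 1\<close>.\<close>

definition coeff_square_function ::
  "'a qm_space \<Rightarrow> 'b qm_space \<Rightarrow> (int \<Rightarrow> 'a set) \<Rightarrow> (int \<Rightarrow> 'b set) \<Rightarrow>
   (int \<Rightarrow> 'a \<Rightarrow> 'a set) \<Rightarrow> (int \<Rightarrow> 'b \<Rightarrow> 'b set) \<Rightarrow>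
   (int \<Rightarrow> 'a \<Rightarrow> 'a \<Rightarrow> real) \<Rightarrow> (int \<Rightarrow> 'b \<Rightarrow> 'b \<Rightarrow> real) \<Rightarrow>
   (('a \<times> 'b \<Rightarrow> complex) \<Rightarrow> complex) \<Rightarrow> 'a \<times> 'b \<Rightarrow> ennreal" where
  "coeff_square_function S1 S2 X1 X2 Q1 Q2 \<psi>1 \<psi>2 f = (\<lambda>(x1, x2). ennreal_powr
     (\<Sum>\<^sub>\<infinity>k1. \<Sum>\<^sub>\<infinity>\<alpha>1\<in>new_points X1 k1. \<Sum>\<^sub>\<infinity>k2. \<Sum>\<^sub>\<infinity>\<alpha>2\<in>new_points X2 k2.
        ennreal ((cmod (wavelet_coeff \<psi>1 \<psi>2 f k1 \<alpha>1 k2 \<alpha>2)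
          * normalized_indicator (qmeas S1) (Q1 (k1 + 1) \<alpha>1) x1
          * normalized_indicator (qmeas S2) (Q2 (k2 + 1) \<alpha>2) x2)\<^sup>2)) (1 / 2))"

definition sup_square_function ::
  "(int \<Rightarrow> 'a set) \<Rightarrow> (int \<Rightarrow> 'b set) \<Rightarrow> (int \<Rightarrow> 'a \<Rightarrow> 'a set) \<Rightarrow> (int \<Rightarrow> 'b \<Rightarrow> 'b set) \<Rightarrow>
   (int \<Rightarrow> 'a \<Rightarrow> 'a \<Rightarrow> real) \<Rightarrow> (int \<Rightarrow> 'b \<Rightarrow> 'b \<Rightarrow> real) \<Rightarrow> nat \<Rightarrow> nat \<Rightarrow>
   (('a \<times> 'b \<Rightarrow> complex) \<Rightarrow> complex) \<Rightarrow> 'a \<times> 'b \<Rightarrow> ennreal" where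
  "sup_square_function X1 X2 Q1 Q2 \<psi>1 \<psi>2 N1 N2 f = (\<lambda>(x1, x2). ennreal_powr
     (\<Sum>\<^sub>\<infinity>k1. \<Sum>\<^sub>\<infinity>\<alpha>1\<in>X1 (k1 + int N1). \<Sum>\<^sub>\<infinity>k2. \<Sum>\<^sub>\<infinity>\<alpha>2\<in>X2 (k2 + int N2).
        (SUP z\<in>Q1 (k1 + int N1) \<alpha>1 \<times> Q2 (k2 + int N2) \<alpha>2.
           ennreal ((cmod (DD X1 X2 \<psi>1 \<psi>2 k1 k2 f z))\<^sup>2))
        * indicator (Q1 (k1 + int N1) \<alpha>1) x1 * indicator (Q2 (k2 + int N2) \<alpha>2) x2) (1 / 2))"

definition inf_square_function ::
  "(int \<Rightarrow> 'a set) \<Rightarrow> (int \<Rightarrow> 'b set) \<Rightarrow> (int \<Rightarrow> 'a \<Rightarrow> 'a set) \<Rightarrow> (int \<Rightarrow> 'b \<Rightarrow> 'b set) \<Rightarrow>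
   (int \<Rightarrow> 'a \<Rightarrow> 'a \<Rightarrow> real) \<Rightarrow> (int \<Rightarrow> 'b \<Rightarrow> 'b \<Rightarrow> real) \<Rightarrow> nat \<Rightarrow> nat \<Rightarrow>
   (('a \<times> 'b \<Rightarrow> complex) \<Rightarrow> complex) \<Rightarrow> 'a \<times> 'b \<Rightarrow> ennreal" where
  "inf_square_function X1 X2 Q1 Q2 \<psi>1 \<psi>2 N1 N2 f = (\<lambda>(x1, x2). ennreal_powr
     (\<Sum>\<^sub>\<infinity>k1. \<Sum>\<^sub>\<infinity>\<alpha>1\<in>X1 (k1 + int N1). \<Sum>\<^sub>\<infinity>k2. \<Sum>\<^sub>\<infinity>\<alpha>2\<in>X2 (k2 + int N2).
        (INF z\<in>Q1 (k1 + int N1) \<alpha>1 \<times> Q2 (k2 + int N2) \<alpha>2.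
           ennreal ((cmod (DD X1 X2 \<psi>1 \<psi>2 k1 k2 f z))\<^sup>2))
        * indicator (Q1 (k1 + int N1) \<alpha>1) x1 * indicator (Q2 (k2 + int N2) \<alpha>2) x2) (1 / 2))"

end

theory Submission
  imports Defs
begin

text \<open>After the Cauchy--Schwarz inequality both estimates concern positive sums of squares of the
  normalised coefficients with rapidly decaying weights \<open>(1 + d(x, \<alpha>) / \<delta>^k)^(-L)\<close> in place of the
  indicators of the cubes. Such sums are linear in the squares, so the product case follows by
  applying a scalar one-parameter inequality in each variable separately with the other one frozen, and
  no vector-valued or strong maximal function is needed. The one-parameter inequality holds for every
  exponent \<open>q = p / 2 > 0\<close>: one writes the \<open>q\<close>-th power of a sum over all scales as a sum over \<open>k\<close> of the
  \<open>k\<close>-th term times the \<open>(q - 1)\<close>-st power of the partial sum over coarser scales, and these partial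
  sums are essentially constant at scale \<open>\<delta>^k\<close>.

  Both square functions are diagonal in the scales \<open>(k1, k2)\<close>. The supremum is bounded by the
  pointwise decay of the wavelets. For the infimum, a coefficient is the integral of \<open>D_k1 D_k2 f\<close>
  against its wavelet; replacing \<open>D_k1 D_k2 f\<close> by its infimum on small cubes costs an error that is
  small by the Hoelder regularity of the wavelets and is absorbed. The quantity that absorbs it, a
  weighted supremum of the coefficients at the scales \<open>(k1, k2)\<close>, is finite because \<open>f\<close> is bounded on
  test functions, so its coefficients grow at most polynomially.\<close>

section \<open>Extended non-negative sums and powers\<close>

text \<open>Sums over points and scales are treated as nonnegative integrals over counting measures,
  so Fubini, monotone convergence and Cauchy-Schwarz apply without any question of convergence.
  Genuine complex summability enters only where a coefficient is recovered from its series and where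
  two values of the series are subtracted.

  The delicate point of the second estimate is the order of the constants. The cubes of generation k
  + N shrink with N, so the constants in comparisons of their volumes depend on N, while the
  smallness \<delta>^(N \<eta>) has to beat the constant of the error term. The error is therefore
  estimated by moving the base point of a weighted supremum, an operation in which the volumes of
  the small cubes do not occur. Its constant is fixed before N, and only the main term, where the
  infima stay, carries constants depending on N. In a weighted supremum a base point can be moved at
  the price of a power of the scaled distance, and the arbitrarily fast decay of the wavelets pays
  for it.\<close>

lemma infsum_eq_nn_integral_count_space:
  fixes f :: "'a \<Rightarrow> ennreal"
  assumes "countable A"
  shows "(\<Sum>\<^sub>\<infinity>x\<in>A. f x) = (\<integral>\<^sup>+x. f x \<partial>count_space A)"
proof (cases "finite A")
  case True
  then show ?thesis
    by (simp add: nn_integral_count_space_finite)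
next
  case False
  have bij: "bij_betw (from_nat_into A) UNIV A"
    using bij_betw_from_nat_into[OF assms False] .
  have "(\<Sum>\<^sub>\<infinity>x\<in>A. f x) = (\<Sum>\<^sub>\<infinity>n. f (from_nat_into A n))"
    by (rule infsum_reindex_bij_betw[OF bij, symmetric])
  also have "\<dots> = (\<Sum>n. f (from_nat_into A n))"
    by (rule sums_unique, rule has_sum_imp_sums, rule has_sum_infsum,
        rule nonneg_summable_on_complete) simp
  also have "\<dots> = (\<integral>\<^sup>+x. f x \<partial>count_space A)"
    by (simp add: nn_integral_bij_count_space[symmetric, OF bij] nn_integral_count_space_nat)
  finally show ?thesis .
qed

text \<open>The fibres \<open>B x\<close> vary with x, so the double sum is first extended by zero
  to all pairs, where it becomes an iterated sum over a product, and is then cut back to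
  \<open>Sigma A B\<close>.\<close>

lemma nn_integral_count_space_Sigma:
  fixes f :: "'a \<Rightarrow> 'b \<Rightarrow> ennreal"
  shows "(\<integral>\<^sup>+x. \<integral>\<^sup>+y. f x y \<partial>count_space (B x) \<partial>count_space A)
    = (\<integral>\<^sup>+z. f (fst z) (snd z) \<partial>count_space (Sigma A B))"
proof -
  have "(\<integral>\<^sup>+x. \<integral>\<^sup>+y. f x y \<partial>count_space (B x) \<partial>count_space A)
     = (\<integral>\<^sup>+x. \<integral>\<^sup>+y. f x y * indicator (Sigma A B) (x, y) \<partial>count_space UNIV \<partial>count_space UNIV)"
    by (subst (2) nn_integral_count_space_indicator, simp,
        subst nn_integral_count_space_indicator, simp)
       (auto intro!: nn_integral_cong simp: nn_integral_multc[symmetric] split: split_indicator)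
  also have "\<dots> = (\<integral>\<^sup>+z. f (fst z) (snd z) * indicator (Sigma A B) z \<partial>count_space UNIV)"
    by (subst nn_integral_fst_count_space[symmetric]) simp
  also have "\<dots> = (\<integral>\<^sup>+z. f (fst z) (snd z) \<partial>count_space (Sigma A B))"
    by (subst nn_integral_count_space_indicator[of "Sigma A B"]) simp_all
  finally show ?thesis .
qed

lemma nn_integral_count_space_swap:
  fixes f :: "'a \<Rightarrow> 'b \<Rightarrow> ennreal"
  assumes "countable A"
  shows "(\<integral>\<^sup>+x. \<integral>\<^sup>+y. f x y \<partial>count_space B \<partial>count_space A)
    = (\<integral>\<^sup>+y. \<integral>\<^sup>+x. f x y \<partial>count_space A \<partial>count_space B)"
  by (rule nn_integral_count_space_nn_integral[OF assms, symmetric]) simp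

lemma borel_measurable_nn_integral_count_space:
  fixes f :: "'i \<Rightarrow> 'a \<Rightarrow> ennreal"
  assumes "countable I" and [measurable]: "\<And>i. i \<in> I \<Longrightarrow> f i \<in> borel_measurable M"
  shows "(\<lambda>x. \<integral>\<^sup>+i. f i x \<partial>count_space I) \<in> borel_measurable M"
proof (cases "finite I")
  case True
  then show ?thesis
    by (simp add: nn_integral_count_space_finite)
next
  case False
  then have [simp]: "I \<noteq> {}"
    by auto
  have bij: "bij_betw (from_nat_into I) UNIV I"
    using bij_betw_from_nat_into[OF assms(1) False] .
  have "(\<lambda>x. \<integral>\<^sup>+i. f i x \<partial>count_space I) = (\<lambda>x. \<Sum>n. f (from_nat_into I n) x)"
    by (rule ext) (simp add: nn_integral_bij_count_space[symmetric, OF bij] nn_integral_count_space_nat)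
  also have "\<dots> \<in> borel_measurable M"
    by (intro borel_measurable_suminf_order assms(2) from_nat_into) simp
  finally show ?thesis .
qed

text \<open>The weight is split into two square roots, one of which goes to each factor.\<close>

lemma Cauchy_Schwarz_weighted_nn_integral:
  assumes [measurable]: "g \<in> borel_measurable M" "v \<in> borel_measurable M" and v: "\<And>x. 0 \<le> v x"
  shows "(\<integral>\<^sup>+x. g x * ennreal (v x) \<partial>M)\<^sup>2
    \<le> (\<integral>\<^sup>+x. ennreal (v x) \<partial>M) * (\<integral>\<^sup>+x. g x ^ 2 * ennreal (v x) \<partial>M)"
proof -
  have sq: "ennreal (sqrt (v x)) * ennreal (sqrt (v x)) = ennreal (v x)" for x
    using v[of x] by (simp flip: ennreal_mult)
  have "(\<integral>\<^sup>+x. ennreal (sqrt (v x)) * (g x * ennreal (sqrt (v x))) \<partial>M)\<^sup>2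
    \<le> (\<integral>\<^sup>+x. ennreal (sqrt (v x)) ^ 2 \<partial>M) * (\<integral>\<^sup>+x. (g x * ennreal (sqrt (v x))) ^ 2 \<partial>M)"
    by (rule Cauchy_Schwarz_nn_integral) auto
  then show ?thesis
    by (simp add: power2_eq_square mult.assoc mult.left_commute sq)
qed

text \<open>Complex summability is absolute summability, and a family that is not summable has
  \<open>infsum\<close> equal to 0 by convention; the bound therefore holds for every
  family.\<close>

lemma norm_infsum_le_nn_integral:
  fixes f :: "'a \<Rightarrow> complex"
  shows "ennreal (norm (infsum f A)) \<le> (\<integral>\<^sup>+x. ennreal (norm (f x)) \<partial>count_space A)"
proof (cases "f summable_on A")
  case True
  then have abs: "Infinite_Sum.abs_summable_on f A"
    by (simp add: summable_on_iff_abs_summable_on_complex)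
  then have "Infinite_Set_Sum.abs_summable_on f A"
    using abs_summable_equivalent by blast
  then have "integrable (count_space A) f" "infsetsum f A = infsum f A"
    by (simp_all add: Infinite_Set_Sum.abs_summable_on_def infsetsum_infsum)
  then show ?thesis
    using integral_norm_bound_ennreal[of "count_space A" f] by (simp add: infsetsum_def)
qed (simp add: infsum_not_exists)

lemma summable_on_if_nn_integral_finite:
  fixes f :: "'a \<Rightarrow> complex"
  assumes "(\<integral>\<^sup>+x. ennreal (norm (f x)) \<partial>count_space A) < \<infinity>"
  shows "f summable_on A" "integrable (count_space A) f" "infsum f A = (\<integral>x. f x \<partial>count_space A)"
proof -
  show int: "integrable (count_space A) f"
    using assms by (simp add: integrable_iff_bounded)
  then have abs: "Infinite_Set_Sum.abs_summable_on f A"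
    by (simp add: Infinite_Set_Sum.abs_summable_on_def)
  then show "f summable_on A"
    using abs_summable_equivalent abs_summable_summable by blast
  show "infsum f A = (\<integral>x. f x \<partial>count_space A)"
    using infsetsum_infsum[OF abs] by (simp add: infsetsum_def)
qed

section \<open>Powers on the extended half-line\<close>

lemma ennreal_powr_ennreal: "0 \<le> x \<Longrightarrow> ennreal_powr (ennreal x) p = ennreal (x powr p)"
  by (simp add: ennreal_powr_def)

lemma ennreal_powr_top [simp]: "ennreal_powr \<infinity> p = \<infinity>" "ennreal_powr top p = top"
  by (simp_all add: ennreal_powr_def)

lemma ennreal_powr_0 [simp]: "ennreal_powr 0 p = 0"
  by (simp add: ennreal_powr_def)

lemma ennreal_powr_mono:
  assumes "a \<le> b" "0 \<le> p"
  shows "ennreal_powr a p \<le> ennreal_powr b p"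
proof (cases "b = \<infinity>")
  case False
  with assms(1) have "a \<noteq> \<infinity>"
    by (auto simp: top_unique)
  with False assms show ?thesis
    by (auto simp: ennreal_powr_def intro!: ennreal_leI powr_mono2 enn2real_mono simp: less_top)
qed simp

lemma ennreal_powr_mult:
  assumes "0 < p"
  shows "ennreal_powr (a * b) p = ennreal_powr a p * ennreal_powr b p"
proof -
  have top: "ennreal_powr (top * b) p = top * ennreal_powr b p" for b
  proof (cases "b = 0")
    case False
    then have "ennreal_powr b p \<noteq> 0"
      using assms by (cases b) (auto simp: ennreal_powr_ennreal)
    with False show ?thesis
      by (simp add: ennreal_top_mult)
  qed simp
  show ?thesis
  proof (cases a; cases b)
    fix x y assume "a = ennreal x" "0 \<le> x" "b = ennreal y" "0 \<le> y"
    then show ?thesis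
      by (simp add: ennreal_powr_ennreal powr_mult ennreal_mult[symmetric])
  qed (use top[of a] top[of b] in \<open>auto simp: mult.commute\<close>)
qed

lemma ennreal_powr_powr:
  assumes "0 < p" "0 < q"
  shows "ennreal_powr (ennreal_powr a p) q = ennreal_powr a (p * q)"
  by (cases a) (auto simp: ennreal_powr_ennreal powr_powr)

lemma ennreal_powr_one [simp]: "ennreal_powr a 1 = a"
  by (cases a) (auto simp: ennreal_powr_ennreal)

lemma ennreal_powr_half_square: "(ennreal_powr a (1 / 2))\<^sup>2 = a"
  by (cases a)
     (auto simp: ennreal_powr_ennreal power2_eq_square ennreal_mult[symmetric] powr_half_sqrt ennreal_top_mult)

lemma borel_measurable_ennreal_powr [measurable (raw)]:
  assumes [measurable]: "f \<in> borel_measurable M"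
  shows "(\<lambda>x. ennreal_powr (f x) p) \<in> borel_measurable M"
  unfolding ennreal_powr_def by measurable

text \<open>A positive power is an order automorphism of the extended half-line, with the power 1 /
  p as its inverse, and so commutes with suprema. This carries monotone convergence from partial
  sums to their q-th powers.\<close>

lemma ennreal_powr_SUP:
  fixes f :: "nat \<Rightarrow> ennreal"
  assumes p: "0 < p" and f: "incseq f"
  shows "ennreal_powr (SUP n. f n) p = (SUP n. ennreal_powr (f n) p)"
proof (rule antisym)
  define s where "s = (SUP n. ennreal_powr (f n) p)"
  have "f n \<le> ennreal_powr s (1 / p)" for n
  proof -
    have "ennreal_powr (f n) p \<le> s"
      unfolding s_def by (rule SUP_upper) simp
    then have "ennreal_powr (ennreal_powr (f n) p) (1 / p) \<le> ennreal_powr s (1 / p)"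
      using p by (intro ennreal_powr_mono) auto
    then show ?thesis
      using p by (simp add: ennreal_powr_powr)
  qed
  then have "(SUP n. f n) \<le> ennreal_powr s (1 / p)"
    by (intro SUP_least)
  then have "ennreal_powr (SUP n. f n) p \<le> ennreal_powr (ennreal_powr s (1 / p)) p"
    using p by (intro ennreal_powr_mono) auto
  then show "ennreal_powr (SUP n. f n) p \<le> (SUP n. ennreal_powr (f n) p)"
    using p by (simp add: ennreal_powr_powr s_def)
  show "(SUP n. ennreal_powr (f n) p) \<le> ennreal_powr (SUP n. f n) p"
    using p by (intro SUP_least ennreal_powr_mono SUP_upper) auto
qed

text \<open>The square functions are square roots of series, so it suffices to compare the series
  with the exponent q = p / 2; the outer root turns the constant into K^(1/p).\<close>

lemma Lp_norm_sqrt_le: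
  assumes p: "0 < p" and K: "0 < K"
    and le: "(\<integral>\<^sup>+x. ennreal_powr (F x) (p / 2) \<partial>M) \<le> ennreal K * (\<integral>\<^sup>+x. ennreal_powr (G x) (p / 2) \<partial>M)"
  shows "Lp_norm M p (\<lambda>x. ennreal_powr (F x) (1 / 2))
     \<le> ennreal (K powr (1 / p)) * Lp_norm M p (\<lambda>x. ennreal_powr (G x) (1 / 2))"
proof -
  have "Lp_norm M p (\<lambda>x. ennreal_powr (F x) (1 / 2))
    = ennreal_powr (\<integral>\<^sup>+x. ennreal_powr (F x) (p / 2) \<partial>M) (1 / p)" for F
    using p by (simp add: Lp_norm_def ennreal_powr_powr)
  moreover have "ennreal_powr (\<integral>\<^sup>+x. ennreal_powr (F x) (p / 2) \<partial>M) (1 / p)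
     \<le> ennreal_powr (ennreal K * (\<integral>\<^sup>+x. ennreal_powr (G x) (p / 2) \<partial>M)) (1 / p)"
    using p by (intro ennreal_powr_mono le) auto
  ultimately show ?thesis
    using p K by (simp add: ennreal_powr_mult ennreal_powr_ennreal)
qed

section \<open>Powers of a sum expanded scale by scale\<close>

lemma powr_diff_le:
  fixes x y q :: real
  assumes "0 \<le> x" "0 \<le> y" "1 \<le> q"
  shows "(x + y) powr q - x powr q \<le> q * y * (x + y) powr (q - 1)"
proof (cases "y = 0 \<or> x = 0")
  case True
  moreover have "y powr q = y * y powr (q - 1)" if "y \<noteq> 0"
    using that assms by (simp add: powr_diff)
  moreover have "y * y powr (q - 1) * 1 \<le> y * y powr (q - 1) * q"
    using assms by (intro mult_left_mono) auto
  ultimately show ?thesis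
    using assms by (cases "y = 0") (auto simp: mult.commute mult.left_commute)
next
  case False
  with assms have pos: "0 < x" "0 < y" by auto
  obtain z where z: "x < z" "z < x + y" "(x + y) powr q - x powr q = (x + y - x) * (q * z powr (q - 1))"
  proof (rule exE[OF MVT2[of x "x + y" "\<lambda>t. t powr q" "\<lambda>t. q * t powr (q - 1)"]])
    show "((\<lambda>t. t powr q) has_real_derivative q * t powr (q - 1)) (at t)" if "x \<le> t" "t \<le> x + y" for t
      using that pos by (intro has_real_derivative_powr) auto
  qed (use pos in auto)
  \<comment> \<open>For q \<ge> 1 the derivative increases, so its value at the intermediate point
    is at most that at the right end.\<close>
  have "z powr (q - 1) \<le> (x + y) powr (q - 1)"
    using z pos assms by (intro powr_mono2) auto
  then have "y * (q * z powr (q - 1)) \<le> y * (q * (x + y) powr (q - 1))"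
    using pos assms by (intro mult_left_mono) auto
  with z show ?thesis by (simp add: mult_ac)
qed

lemma powr_diff_ge:
  fixes x y q :: real
  assumes "0 \<le> x" "0 \<le> y" "0 < q" "q \<le> 1"
  shows "q * y * (x + y) powr (q - 1) \<le> (x + y) powr q - x powr q"
proof (cases "y = 0 \<or> x = 0")
  case True
  moreover have "y powr q = y * y powr (q - 1)" if "y \<noteq> 0"
    using that assms by (simp add: powr_diff)
  moreover have "y * y powr (q - 1) * q \<le> y * y powr (q - 1) * 1"
    using assms by (intro mult_left_mono) auto
  ultimately show ?thesis
    using assms by (cases "y = 0") (auto simp: mult.commute mult.left_commute)
next
  case False
  with assms have pos: "0 < x" "0 < y" by auto
  obtain z where z: "x < z" "z < x + y" "(x + y) powr q - x powr q = (x + y - x) * (q * z powr (q - 1))"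
  proof (rule exE[OF MVT2[of x "x + y" "\<lambda>t. t powr q" "\<lambda>t. q * t powr (q - 1)"]])
    show "((\<lambda>t. t powr q) has_real_derivative q * t powr (q - 1)) (at t)" if "x \<le> t" "t \<le> x + y" for t
      using that pos by (intro has_real_derivative_powr) auto
  qed (use pos in auto)
  \<comment> \<open>For q \<le> 1 the derivative decreases, so the value at the right end is now the
    smaller one.\<close>
  have "(x + y) powr (q - 1) \<le> z powr (q - 1)"
    using z pos assms by (intro powr_mono2') auto
  then have "y * (q * (x + y) powr (q - 1)) \<le> y * (q * z powr (q - 1))"
    using pos assms by (intro mult_left_mono) auto
  with z show ?thesis by (simp add: mult_ac)
qed

text \<open>Indices are added in order of increasing key: each new index has a maximal key, so its
  coarse part, ties included, is the whole set built so far. This makes the expansion of a q-th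
  power telescope.\<close>

lemma finite_key_max_induct [consumes 1, case_names empty insert]:
  fixes key :: "'i \<Rightarrow> int"
  assumes "finite J" "P {}"
    and step: "\<And>i J. finite J \<Longrightarrow> i \<notin> J \<Longrightarrow> (\<And>j. j \<in> J \<Longrightarrow> key j \<le> key i) \<Longrightarrow> P J \<Longrightarrow> P (insert i J)"
  shows "P J"
  using assms(1)
proof (induction J rule: finite_psubset_induct)
  case (psubset J)
  show ?case
  proof (cases "J = {}")
    case False
    have "Max (key ` J) \<in> key ` J"
      using psubset.hyps False by (intro Max_in) auto
    then obtain i where i: "i \<in> J" "key i = Max (key ` J)"
      by auto
    have "P (insert i (J - {i}))"
      using psubset i by (intro step) auto
    with i show ?thesis
      by (simp add: insert_absorb)
  qed (simp add: assms)
qed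

text \<open>A discrete form of the identity that F^q is q times the integral of F^(q-1) dF: adding
  an index i of maximal key raises F^q by at most q f(i) F^(q-1), where F already contains f(i).
  Coarse sums of older indices with the same key may grow in this step, which for q \<ge> 1 only
  enlarges the right-hand side.\<close>

lemma powr_sum_le_sum_key:
  fixes f :: "'i \<Rightarrow> real" and key :: "'i \<Rightarrow> int"
  assumes "finite J" "\<And>i. 0 \<le> f i" "1 \<le> q"
  shows "(\<Sum>i\<in>J. f i) powr q
    \<le> q * (\<Sum>i\<in>J. f i * (\<Sum>j\<in>{j\<in>J. key j \<le> key i}. f j) powr (q - 1))"
  using assms(1)
proof (induction J rule: finite_key_max_induct[of _ _ key])
  case (insert i J)
  let ?g = "\<lambda>J i. (\<Sum>j\<in>{j\<in>J. key j \<le> key i}. f j) powr (q - 1)"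
  have full: "{j\<in>insert i J. key j \<le> key i} = insert i J"
    using insert.hyps by auto
  have sum: "(\<Sum>j\<in>insert i J. f j) = (\<Sum>j\<in>J. f j) + f i"
    using insert.hyps by simp
  have split: "(\<Sum>j\<in>insert i J. f j * ?g (insert i J) j)
      = f i * ((\<Sum>j\<in>J. f j) + f i) powr (q - 1) + (\<Sum>j\<in>J. f j * ?g (insert i J) j)"
    using insert.hyps sum by (subst sum.insert) (simp_all only: full not_False_eq_True)
  have "(\<Sum>j\<in>insert i J. f j) powr q \<le> (\<Sum>j\<in>J. f j) powr q + q * f i * ((\<Sum>j\<in>J. f j) + f i) powr (q - 1)"
    using powr_diff_le[of "\<Sum>j\<in>J. f j" "f i" q] insert.hyps assms by (simp add: sum_nonneg add.commute)
  also have "(\<Sum>j\<in>J. f j) powr q \<le> q * (\<Sum>j\<in>J. f j * ?g J j)"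
    by (rule insert.IH)
  also have "q * (\<Sum>j\<in>J. f j * ?g J j) \<le> q * (\<Sum>j\<in>J. f j * ?g (insert i J) j)"
    using insert.hyps assms
    by (intro mult_left_mono sum_mono powr_mono2 sum_mono2) (auto intro: sum_nonneg)
  finally show ?case
    unfolding split by (simp add: distrib_left mult_ac add.commute)
qed simp

text \<open>The concave counterpart: increments are bounded below by the derivative at the right
  end, and coarse sums that grow because of equal keys acquire smaller powers, as q - 1 \<le>
  0.\<close>

lemma sum_key_le_powr_sum:
  fixes f :: "'i \<Rightarrow> real" and key :: "'i \<Rightarrow> int"
  assumes "finite J" "\<And>i. 0 \<le> f i" "0 < q" "q \<le> 1"
  shows "q * (\<Sum>i\<in>J. f i * (\<Sum>j\<in>{j\<in>J. key j \<le> key i}. f j) powr (q - 1))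
    \<le> (\<Sum>i\<in>J. f i) powr q"
  using assms(1)
proof (induction J rule: finite_key_max_induct[of _ _ key])
  case (insert i J)
  let ?g = "\<lambda>J i. (\<Sum>j\<in>{j\<in>J. key j \<le> key i}. f j) powr (q - 1)"
  have full: "{j\<in>insert i J. key j \<le> key i} = insert i J"
    using insert.hyps by auto
  have sum: "(\<Sum>j\<in>insert i J. f j) = (\<Sum>j\<in>J. f j) + f i"
    using insert.hyps by simp
  have split: "(\<Sum>j\<in>insert i J. f j * ?g (insert i J) j)
      = f i * ((\<Sum>j\<in>J. f j) + f i) powr (q - 1) + (\<Sum>j\<in>J. f j * ?g (insert i J) j)"
    using insert.hyps sum by (subst sum.insert) (simp_all only: full not_False_eq_True)
  \<comment> \<open>A negative power decreases only on positive numbers, and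
    \<open>0 powr (q - 1)\<close> is 0 by convention. If \<open>f j > 0\<close>, the coarse sum is
    positive because j belongs to its own coarse part; if \<open>f j = 0\<close>, both sides
    vanish.\<close>
  have mono: "f j * ?g (insert i J) j \<le> f j * ?g J j" if "j \<in> J" for j
  proof (cases "f j = 0")
    case False
    have "0 < f j"
      using False assms(2)[of j] by linarith
    also have "f j \<le> (\<Sum>l\<in>{l\<in>J. key l \<le> key j}. f l)"
      using that insert.hyps assms by (intro member_le_sum) auto
    finally have "0 < (\<Sum>l\<in>{l\<in>J. key l \<le> key j}. f l)" .
    then show ?thesis
      using insert.hyps assms by (intro mult_left_mono powr_mono2' sum_mono2) auto
  qed simp
  have "q * (\<Sum>j\<in>J. f j * ?g (insert i J) j) \<le> q * (\<Sum>j\<in>J. f j * ?g J j)"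
    using assms by (intro mult_left_mono sum_mono mono) auto
  also have "\<dots> \<le> (\<Sum>j\<in>J. f j) powr q"
    by (rule insert.IH)
  finally have *: "q * (\<Sum>j\<in>J. f j * ?g (insert i J) j) \<le> (\<Sum>j\<in>J. f j) powr q" .
  have "q * f i * ((\<Sum>j\<in>J. f j) + f i) powr (q - 1) \<le> ((\<Sum>j\<in>J. f j) + f i) powr q - (\<Sum>j\<in>J. f j) powr q"
    using powr_diff_ge[of "\<Sum>j\<in>J. f j" "f i" q] insert.hyps assms by (simp add: sum_nonneg)
  with * show ?case
    unfolding split sum by (simp add: distrib_left mult_ac add.commute)
qed simp

section \<open>Geometry of the dyadic cubes\<close>

text \<open>Comparable bases have comparable negative powers, at the cost of c^s. Together with
  \<open>\<rho>_triangle\<close> this moves decaying weights from one base point to another.\<close>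

lemma powr_neg_le_powr_neg:
  fixes a b c s :: real
  assumes "a \<le> c * b" "0 < a" "0 < c" "0 < b" "0 \<le> s"
  shows "b powr (- s) \<le> c powr s * a powr (- s)"
proof -
  have "(c * b) powr (- s) \<le> a powr (- s)"
    using assms by (intro powr_mono2') auto
  then have "c powr s * (c * b) powr (- s) \<le> c powr s * a powr (- s)"
    by (intro mult_left_mono) auto
  also have "c powr s * (c * b) powr (- s) = b powr (- s)"
    using assms by (simp add: powr_mult powr_minus field_simps)
  finally show ?thesis .
qed

lemma le_suminf_ennreal:
  fixes f :: "nat \<Rightarrow> ennreal"
  shows "f m \<le> suminf f"
  using sum_le_suminf[of f "{m}"] by simp

locale dyadic_space =
  fixes S :: "'a qm_space" and \<omega> \<delta> :: real and X :: "int \<Rightarrow> 'a set" and Q :: "int \<Rightarrow> 'a \<Rightarrow> 'a set"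
  assumes homogeneous: "homogeneous_type S"
    and ball_pos: "\<And>x r. r > 0 \<Longrightarrow> emeasure (qmeas S) (qball S x r) > 0"
    and upper_dim: "upper_dimension S \<omega>"
    and delta_pos: "0 < \<delta>" and delta_less: "\<delta> < 1"
    and cubes: "dyadic_cubes S \<delta> X Q"
begin

abbreviation d where "d \<equiv> qdist S"
abbreviation A where "A \<equiv> qconst S"
abbreviation M where "M \<equiv> qmeas S"

text \<open>Distance in units of the scale \<delta>^k, increased by 1. The shift makes it
  submultiplicative up to the factor A (\<open>\<rho>_triangle\<close>), so its powers factor
  through intermediate points.\<close>

definition \<rho> :: "int \<Rightarrow> 'a \<Rightarrow> 'a \<Rightarrow> real" where
  "\<rho> k x y = 1 + d x y / \<delta> powi k"

definition V :: "int \<Rightarrow> 'a \<Rightarrow> real" where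
  "V k x = vol S (\<delta> powi k) x"

abbreviation wt :: "real \<Rightarrow> int \<Rightarrow> 'a \<Rightarrow> 'a \<Rightarrow> ennreal" where
  "wt L k x y \<equiv> ennreal (\<rho> k x y powr (- L))"

text \<open>Weights of scale k are summed over points of generation k + n, with n = 1 for the
  wavelets and n = N for the small cubes. Distances are nevertheless measured in units of
  \<delta>^k, not of \<delta>^(k + n).\<close>

abbreviation pts :: "nat \<Rightarrow> int \<Rightarrow> 'a measure" where
  "pts n k \<equiv> count_space (X (k + int n))"

text \<open>The normalising factor of the cube attached to a wavelet, hence the generation k + 1; up
  to constants it is also the height of the wavelet.\<close>

abbreviation mass :: "int \<Rightarrow> 'a \<Rightarrow> real" where
  "mass k \<beta> \<equiv> measure M (Q (k + 1) \<beta>) powr (- 1 / 2)"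

lemma A_ge1: "1 \<le> A" and d_sym: "d x y = d y x" and d_nonneg [simp]: "0 \<le> d x y"
  and d_triangle: "d x y \<le> A * (d x z + d z y)" and d_refl [simp]: "d x x = 0"
  using homogeneous by (auto simp: homogeneous_type_def quasi_metric_def)

lemma A_pos [simp]: "0 < A" and A_nonzero [simp]: "A \<noteq> 0" and A_nonneg [simp]: "0 \<le> A"
  using A_ge1 by linarith+

lemma delta_nonzero [simp]: "\<delta> \<noteq> 0"
  using delta_pos by simp

lemma space_M [simp]: "space M = UNIV"
  and sets_qball [measurable]: "qball S x r \<in> sets M"
  using homogeneous by (auto simp: homogeneous_type_def)

lemma omega_pos: "0 < \<omega>"
  using upper_dim by (simp add: upper_dimension_def)

lemma scale_pos [simp]: "0 < \<delta> powi k"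
  using delta_pos by simp

lemma scale_nonneg [simp]: "0 \<le> \<delta> powi k" and scale_nonzero [simp]: "\<delta> powi k \<noteq> 0"
  using less_imp_le[OF scale_pos[of k]] less_imp_neq[OF scale_pos[of k]] by auto

lemma scale_antimono: "j \<le> k \<Longrightarrow> \<delta> powi k \<le> \<delta> powi j"
  using delta_pos delta_less by (intro power_int_decreasing) auto

lemma scale_add: "\<delta> powi (k + int n) = \<delta> powi k * \<delta> ^ n"
  using delta_pos by (simp add: power_int_add)

lemma emeasure_ball_finite: "0 < r \<Longrightarrow> emeasure M (qball S x r) < \<infinity>"
  using homogeneous unfolding homogeneous_type_def by blast

lemma emeasure_ball: "0 < r \<Longrightarrow> emeasure M (qball S x r) = ennreal (vol S r x)"
  unfolding vol_def using emeasure_ball_finite[of r x] by (intro emeasure_eq_ennreal_measure) auto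

lemma vol_pos: "0 < r \<Longrightarrow> 0 < vol S r x"
  using ball_pos[of r x] by (simp add: emeasure_ball)

lemma V_pos [simp]: "0 < V k x"
  by (simp add: V_def vol_pos)

lemma qball_mono: "r \<le> r' \<Longrightarrow> qball S x r \<subseteq> qball S x r'"
  by (auto simp: qball_def)

lemma vol_le_vol:
  assumes "qball S x r \<subseteq> qball S y r'" "0 < r" "0 < r'"
  shows "vol S r x \<le> vol S r' y"
proof -
  have "ennreal (vol S r x) \<le> ennreal (vol S r' y)"
    using assms emeasure_mono[OF assms(1), of M] by (simp add: emeasure_ball)
  then show ?thesis
    using vol_pos[of r' y] assms by simp
qed

lemma borel_measurable_d [measurable]: "d x \<in> borel_measurable M"
proof -
  have "{w \<in> space M. d x w < a} = qball S x a" for a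
    by (auto simp: qball_def)
  then show ?thesis
    by (simp add: borel_measurable_iff_less)
qed

lemma borel_measurable_d' [measurable]: "(\<lambda>y. d y x) \<in> borel_measurable M"
  by (subst d_sym) measurable

text \<open>One dilation constant for all centres and radii, taken at least 1 so that it may be
  inserted freely into upper bounds.\<close>

definition Cv :: real where
  "Cv = (SOME C. 1 \<le> C \<and> (\<forall>x t r. 1 \<le> t \<longrightarrow> 0 < r \<longrightarrow> vol S (t * r) x \<le> C * t powr \<omega> * vol S r x))"

lemma Cv_ge1: "1 \<le> Cv"
  and vol_dilate: "1 \<le> t \<Longrightarrow> 0 < r \<Longrightarrow> vol S (t * r) x \<le> Cv * t powr \<omega> * vol S r x"
proof -
  obtain C where C: "\<And>x t r. 1 \<le> t \<Longrightarrow> 0 < r \<Longrightarrow>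
      emeasure M (qball S x (t * r)) \<le> ennreal (C * t powr \<omega>) * emeasure M (qball S x r)"
    using upper_dim unfolding upper_dimension_def by blast
  have "vol S (t * r) x \<le> max C 1 * t powr \<omega> * vol S r x" if "1 \<le> t" "0 < r" for x t r
  proof -
    have "ennreal (vol S (t * r) x) \<le> ennreal (C * t powr \<omega>) * ennreal (vol S r x)"
      using C[OF that, of x] that by (simp add: emeasure_ball)
    also have "\<dots> \<le> ennreal (max C 1 * t powr \<omega>) * ennreal (vol S r x)"
      by (intro mult_right_mono ennreal_leI) auto
    also have "\<dots> = ennreal (max C 1 * t powr \<omega> * vol S r x)"
      using that by (simp add: ennreal_mult vol_pos less_imp_le)
    finally show ?thesis
      using that by (simp add: vol_pos less_imp_le ennreal_le_iff)
  qed
  then have "\<exists>C\<ge>1. \<forall>x t r. 1 \<le> t \<longrightarrow> 0 < r \<longrightarrow> vol S (t * r) x \<le> C * t powr \<omega> * vol S r x"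
    by (intro exI[of _ "max C 1"]) auto
  then have "1 \<le> Cv \<and> (\<forall>x t r. 1 \<le> t \<longrightarrow> 0 < r \<longrightarrow> vol S (t * r) x \<le> Cv * t powr \<omega> * vol S r x)"
    unfolding Cv_def by (rule someI_ex)
  then show "1 \<le> Cv" "1 \<le> t \<Longrightarrow> 0 < r \<Longrightarrow> vol S (t * r) x \<le> Cv * t powr \<omega> * vol S r x"
    by auto
qed

section \<open>The scaled distance\<close>

lemma \<rho>_ge1 [simp]: "1 \<le> \<rho> k x y"
  by (simp add: \<rho>_def)

lemma \<rho>_pos [simp]: "0 < \<rho> k x y" and \<rho>_nonneg [simp]: "0 \<le> \<rho> k x y"
  using \<rho>_ge1[of k x y] by linarith+

lemma \<rho>_nonzero [simp]: "\<rho> k x y \<noteq> 0"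
  using \<rho>_pos[of k x y] by linarith

lemma \<rho>_sym: "\<rho> k x y = \<rho> k y x"
  by (simp add: \<rho>_def d_sym)

lemma \<rho>_refl [simp]: "\<rho> k x x = 1"
  by (simp add: \<rho>_def)

lemma \<rho>_triangle: "\<rho> k x y \<le> A * \<rho> k x z * \<rho> k z y"
proof -
  let ?a = "d x z / \<delta> powi k" and ?b = "d z y / \<delta> powi k"
  have "d x y / \<delta> powi k \<le> A * (d x z + d z y) / \<delta> powi k"
    by (intro divide_right_mono d_triangle less_imp_le scale_pos)
  then have "\<rho> k x y \<le> 1 + A * (?a + ?b)"
    by (simp add: \<rho>_def distrib_left add_divide_distrib)
  \<comment> \<open>The constant 1 is at most A, and the nonnegative product of the two quotients is
    added; the resulting sum factors.\<close>
  also have "\<dots> \<le> A + A * (?a + ?b) + A * (?a * ?b)"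
    using A_ge1 by (intro add_mono add_increasing2 mult_nonneg_nonneg) (auto intro!: divide_nonneg_pos)
  also have "\<dots> = A * (1 + ?a) * (1 + ?b)"
    by (simp only: distrib_left distrib_right mult_1 mult_1_right mult_ac add_ac)
  also have "\<dots> = A * \<rho> k x z * \<rho> k z y"
    by (simp only: \<rho>_def)
  finally show ?thesis .
qed

text \<open>Coarser scales see smaller scaled distances; this is why partial sums over coarser
  scales vary little at the scale \<delta>^k.\<close>

lemma \<rho>_mono_scale: "j \<le> k \<Longrightarrow> \<rho> j x y \<le> \<rho> k x y"
  unfolding \<rho>_def by (intro add_left_mono divide_left_mono scale_antimono) auto

lemma borel_measurable_\<rho> [measurable]: "\<rho> k x \<in> borel_measurable M" "(\<lambda>y. \<rho> k y x) \<in> borel_measurable M"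
  by (simp_all add: \<rho>_def[abs_def])

lemma \<rho>_triangle_powr_neg:
  assumes "0 \<le> s"
  shows "\<rho> k x z powr (- s) \<le> (A * \<rho> k z y) powr s * \<rho> k x y powr (- s)"
  using \<rho>_triangle[of k x y z] assms by (intro powr_neg_le_powr_neg) (auto simp: mult_ac)

text \<open>The ball of radius \<delta>^k about x lies in the ball about y of radius A \<rho>(x, y)
  \<delta>^k, and the upper dimension turns this dilation into the loss \<rho>^\<omega>. An exponent
  \<omega> spent later on changing the centre of a volume at a fixed scale comes from here.\<close>

lemma V_change: "V k x \<le> Cv * (A * \<rho> k x y) powr \<omega> * V k y"
proof -
  have sub: "qball S x (\<delta> powi k) \<subseteq> qball S y (A * \<rho> k x y * \<delta> powi k)"
  proof
    fix z assume "z \<in> qball S x (\<delta> powi k)"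
    then have z: "d x z < \<delta> powi k" by (simp add: qball_def)
    have "d y z \<le> A * (d y x + d x z)" by (rule d_triangle)
    also have "\<dots> < A * (d y x + \<delta> powi k)"
      using z by (intro mult_strict_left_mono) auto
    also have "\<dots> = A * \<rho> k x y * \<delta> powi k"
      by (simp add: \<rho>_def d_sym[of y x] field_simps)
    finally show "z \<in> qball S y (A * \<rho> k x y * \<delta> powi k)"
      by (simp add: qball_def)
  qed
  have "1 * 1 \<le> A * \<rho> k x y"
    using A_ge1 by (intro mult_mono) auto
  then have ge1: "1 \<le> A * \<rho> k x y" by simp
  have "V k x \<le> vol S (A * \<rho> k x y * \<delta> powi k) y"
    unfolding V_def using ge1 by (intro vol_le_vol sub) auto
  also have "\<dots> \<le> Cv * (A * \<rho> k x y) powr \<omega> * V k y"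
    unfolding V_def using ge1 by (intro vol_dilate) auto
  finally show ?thesis .
qed

section \<open>Dyadic cubes as substitutes for balls\<close>

lemma sets_cube: "\<alpha> \<in> X k \<Longrightarrow> Q k \<alpha> \<in> sets M"
  and cube_cover: "\<exists>\<alpha>\<in>X k. x \<in> Q k \<alpha>"
  and cube_disjoint: "\<alpha> \<in> X k \<Longrightarrow> \<beta> \<in> X k \<Longrightarrow> \<alpha> \<noteq> \<beta> \<Longrightarrow> Q k \<alpha> \<inter> Q k \<beta> = {}"
  and cube_inner: "\<alpha> \<in> X k \<Longrightarrow> qball S \<alpha> (1 / (3 * A\<^sup>2) * \<delta> powi k) \<subseteq> Q k \<alpha>"
  and cube_outer: "\<alpha> \<in> X k \<Longrightarrow> Q k \<alpha> \<subseteq> qball S \<alpha> (4 * A\<^sup>2 * \<delta> powi k)"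
proof -
  have "\<forall>k. \<forall>\<alpha>\<in>X k. Q k \<alpha> \<in> sets M"
    and cover: "\<forall>k. (\<Union>\<alpha>\<in>X k. Q k \<alpha>) = UNIV"
    and "\<forall>k. \<forall>\<alpha>\<in>X k. \<forall>\<beta>\<in>X k. \<alpha> \<noteq> \<beta> \<longrightarrow> Q k \<alpha> \<inter> Q k \<beta> = {}"
    and "\<forall>k. \<forall>\<alpha>\<in>X k. qball S \<alpha> (1 / (3 * A\<^sup>2) * \<delta> powi k) \<subseteq> Q k \<alpha>
        \<and> Q k \<alpha> \<subseteq> qball S \<alpha> (4 * A\<^sup>2 * \<delta> powi k)"
    using cubes unfolding dyadic_cubes_def by simp_all
  then show "\<alpha> \<in> X k \<Longrightarrow> Q k \<alpha> \<in> sets M"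
    "\<alpha> \<in> X k \<Longrightarrow> \<beta> \<in> X k \<Longrightarrow> \<alpha> \<noteq> \<beta> \<Longrightarrow> Q k \<alpha> \<inter> Q k \<beta> = {}"
    "\<alpha> \<in> X k \<Longrightarrow> qball S \<alpha> (1 / (3 * A\<^sup>2) * \<delta> powi k) \<subseteq> Q k \<alpha>"
    "\<alpha> \<in> X k \<Longrightarrow> Q k \<alpha> \<subseteq> qball S \<alpha> (4 * A\<^sup>2 * \<delta> powi k)"
    by auto
  have "x \<in> (\<Union>\<alpha>\<in>X k. Q k \<alpha>)"
    using cover by simp
  then show "\<exists>\<alpha>\<in>X k. x \<in> Q k \<alpha>"
    by blast
qed

lemma cube_unique: "\<alpha> \<in> X k \<Longrightarrow> \<beta> \<in> X k \<Longrightarrow> x \<in> Q k \<alpha> \<Longrightarrow> x \<in> Q k \<beta> \<Longrightarrow> \<alpha> = \<beta>"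
  using cube_disjoint by blast

lemma cube_sum:
  assumes "\<alpha> \<in> X k" "x \<in> Q k \<alpha>"
  shows "(\<integral>\<^sup>+\<beta>. g \<beta> * indicator (Q k \<beta>) x \<partial>count_space (X k)) = g \<alpha>"
  using assms cube_unique
  by (subst nn_integral_count_space'[where A="{\<alpha>}"]) (auto split: split_indicator)

text \<open>However large n is, a cube of generation k + n lies within 4 A^2 \<delta>^k of its
  centre, and the added 1 is at most A^2. The bound is free of n, which keeps the constants of the
  oscillation estimate free of N.\<close>

lemma cube_\<rho>:
  assumes "\<alpha> \<in> X (k + int n)" "x \<in> Q (k + int n) \<alpha>"
  shows "\<rho> k x \<alpha> \<le> 5 * A\<^sup>2" "\<rho> k \<alpha> x \<le> 5 * A\<^sup>2"
proof -
  have "d \<alpha> x \<le> 4 * A\<^sup>2 * \<delta> powi (k + int n)"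
    using cube_outer[OF assms(1)] assms(2) by (auto simp: qball_def)
  also have "\<dots> \<le> 4 * A\<^sup>2 * \<delta> powi k"
    by (intro mult_left_mono scale_antimono) auto
  finally have "d \<alpha> x / \<delta> powi k \<le> 4 * A\<^sup>2"
    by (simp add: divide_le_eq)
  moreover have "1 \<le> A\<^sup>2"
    using A_ge1 by (simp add: one_le_power)
  ultimately show "\<rho> k \<alpha> x \<le> 5 * A\<^sup>2"
    by (simp add: \<rho>_def)
  then show "\<rho> k x \<alpha> \<le> 5 * A\<^sup>2"
    by (simp add: \<rho>_sym)
qed

lemma emeasure_cube:
  assumes "\<alpha> \<in> X k"
  shows "emeasure M (Q k \<alpha>) = ennreal (measure M (Q k \<alpha>))"
proof -
  have "emeasure M (Q k \<alpha>) \<le> emeasure M (qball S \<alpha> (4 * A\<^sup>2 * \<delta> powi k))"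
    using cube_outer[OF assms] by (intro emeasure_mono) auto
  also have "\<dots> < \<infinity>"
    by (intro emeasure_ball_finite mult_pos_pos) auto
  finally show ?thesis
    by (intro emeasure_eq_ennreal_measure) auto
qed

lemma cube_volume:
  obtains C where "1 \<le> C"
    "\<And>k \<alpha>. \<alpha> \<in> X (k + int n) \<Longrightarrow> V k \<alpha> \<le> C * measure M (Q (k + int n) \<alpha>)"
    "\<And>k \<alpha>. \<alpha> \<in> X (k + int n) \<Longrightarrow> measure M (Q (k + int n) \<alpha>) \<le> C * V k \<alpha>"
proof -
  \<comment> \<open>The ratio of \<delta>^k to the inner radius \<delta>^(k + n) / (3 A^2) of the
    cube; through it C depends on n.\<close>
  define t where "t = 3 * A\<^sup>2 / \<delta> ^ n"
  have A2: "1 \<le> A\<^sup>2"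
    using A_ge1 by (simp add: one_le_power)
  have dn: "0 < \<delta> ^ n" "\<delta> ^ n \<le> 1"
    using delta_pos delta_less by (auto intro: power_le_one)
  have t1: "1 \<le> t"
    using A2 dn by (simp add: t_def field_simps)
  define C where "C = max (Cv * t powr \<omega>) (max (Cv * (4 * A\<^sup>2) powr \<omega>) 1)"
  show thesis
  proof (rule that[of C])
    show "1 \<le> C" by (simp add: C_def)
    fix k \<alpha> assume \<alpha>: "\<alpha> \<in> X (k + int n)"
    let ?r = "1 / (3 * A\<^sup>2) * \<delta> powi (k + int n)"
    have r: "0 < ?r" by (intro mult_pos_pos) auto
    have "\<delta> powi k = t * ?r"
      using dn by (simp add: t_def scale_add)
    then have "V k \<alpha> \<le> Cv * t powr \<omega> * vol S ?r \<alpha>"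
      using vol_dilate[OF t1 r, of \<alpha>] by (simp only: V_def)
    also have "\<dots> \<le> C * vol S ?r \<alpha>"
      using vol_pos[OF r, of \<alpha>] by (intro mult_right_mono) (auto simp: C_def)
    also have "vol S ?r \<alpha> \<le> measure M (Q (k + int n) \<alpha>)"
    proof -
      have "ennreal (vol S ?r \<alpha>) \<le> ennreal (measure M (Q (k + int n) \<alpha>))"
        using emeasure_mono[OF cube_inner[OF \<alpha>] sets_cube[OF \<alpha>]] emeasure_ball[OF r, of \<alpha>]
        by (simp only: emeasure_cube[OF \<alpha>])
      then show ?thesis
        by (simp add: ennreal_le_iff)
    qed
    finally show "V k \<alpha> \<le> C * measure M (Q (k + int n) \<alpha>)"
      by (simp add: C_def mult_left_mono)
  next
    fix k \<alpha> assume \<alpha>: "\<alpha> \<in> X (k + int n)"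
    have "emeasure M (Q (k + int n) \<alpha>) \<le> emeasure M (qball S \<alpha> (4 * A\<^sup>2 * \<delta> powi k))"
      using cube_outer[OF \<alpha>] qball_mono[of "4 * A\<^sup>2 * \<delta> powi (k + int n)" "4 * A\<^sup>2 * \<delta> powi k" \<alpha>] scale_antimono[of k "k + int n"]
      by (intro emeasure_mono) auto
    then have "measure M (Q (k + int n) \<alpha>) \<le> vol S (4 * A\<^sup>2 * \<delta> powi k) \<alpha>"
      using emeasure_cube[OF \<alpha>] emeasure_ball[of "4 * A\<^sup>2 * \<delta> powi k" \<alpha>] vol_pos[of "4 * A\<^sup>2 * \<delta> powi k" \<alpha>]
      by (simp add: ennreal_le_iff less_imp_le)
    also have "\<dots> \<le> Cv * (4 * A\<^sup>2) powr \<omega> * V k \<alpha>"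
      unfolding V_def using A2 by (intro vol_dilate) auto
    also have "\<dots> \<le> C * V k \<alpha>"
      by (intro mult_right_mono) (auto simp: C_def less_imp_le)
    finally show "measure M (Q (k + int n) \<alpha>) \<le> C * V k \<alpha>" .
  qed
qed

lemma measure_cube_pos:
  assumes "\<alpha> \<in> X k"
  shows "0 < measure M (Q k \<alpha>)"
proof -
  obtain C where C: "1 \<le> C" "\<And>k \<alpha>. \<alpha> \<in> X (k + int 0) \<Longrightarrow> V k \<alpha> \<le> C * measure M (Q (k + int 0) \<alpha>)"
    using cube_volume[of 0] by metis
  have "0 < V k \<alpha>" by simp
  also have "V k \<alpha> \<le> C * measure M (Q k \<alpha>)"
    using C(2)[of \<alpha> k] assms by simp
  finally show ?thesis
    using C(1) by (simp add: zero_less_mult_iff)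
qed

lemma \<rho>_powr_le_annuli:
  assumes "0 \<le> L"
  shows "wt L k x y
    \<le> (\<Sum>m. ennreal (2 powr (- L * real m)) * indicator (qball S x (2 ^ (m + 1) * \<delta> powi k)) y)"
proof -
  \<comment> \<open>The dyadic index with 2^m \<le> \<rho> < 2^(m + 1). The single term of this
    index already dominates, with a full ball in place of the annulus.\<close>
  define m where "m = nat \<lfloor>log 2 (\<rho> k x y)\<rfloor>"
  have "0 \<le> log 2 (\<rho> k x y)" by simp
  then have m: "real m \<le> log 2 (\<rho> k x y)" "log 2 (\<rho> k x y) < real m + 1"
    unfolding m_def by linarith+
  have lower: "2 powr real m \<le> \<rho> k x y"
    using m(1) by (simp add: le_log_iff)
  have "\<rho> k x y < 2 powr (real m + 1)"
    using m(2) by (simp add: log_less_iff)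
  also have "\<dots> = 2 ^ (m + 1)"
    by (simp add: powr_add powr_realpow)
  finally have "d x y / \<delta> powi k < 2 ^ (m + 1)"
    by (simp add: \<rho>_def)
  then have "y \<in> qball S x (2 ^ (m + 1) * \<delta> powi k)"
    using pos_divide_less_eq[OF scale_pos[of k], of "d x y" "2 ^ (m + 1)"] by (simp add: qball_def)
  moreover have "\<rho> k x y powr (- L) \<le> 2 powr (- L * real m)"
    using powr_mono2'[of "- L", OF _ _ lower] assms by (simp add: powr_powr mult.commute)
  ultimately have "wt L k x y
      \<le> ennreal (2 powr (- L * real m)) * indicator (qball S x (2 ^ (m + 1) * \<delta> powi k)) y"
    by (simp add: ennreal_leI)
  also have "\<dots> \<le> (\<Sum>m. ennreal (2 powr (- L * real m)) * indicator (qball S x (2 ^ (m + 1) * \<delta> powi k)) y)"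
    by (rule le_suminf_ennreal[where f = "\<lambda>m. ennreal (2 powr (- L * real m)) * indicator (qball S x (2 ^ (m + 1) * \<delta> powi k)) y"])
  finally show ?thesis .
qed

lemma \<rho>_powr_antimono: "L \<le> L' \<Longrightarrow> \<rho> k x y powr (- L') \<le> \<rho> k x y powr (- L)"
  by (intro powr_mono) auto

text \<open>Over dyadic balls the weight contributes 2^(-(\<omega> + 1) m) and the volume at most a
  constant times 2^(\<omega> (m + 1)), so a geometric series of ratio 1/2 remains. Larger L only
  decreases the weight, so one constant serves all L.\<close>

lemma nn_integral_\<rho>:
  obtains C where "0 < C"
    "\<And>k x L. \<omega> + 1 \<le> L \<Longrightarrow> (\<integral>\<^sup>+z. wt L k x z \<partial>M) \<le> ennreal (C * V k x)"
proof (rule that[of "Cv * 2 powr \<omega> * 2"])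
  show "0 < Cv * 2 powr \<omega> * 2" using Cv_ge1 by simp
  fix k x and L :: real assume L: "\<omega> + 1 \<le> L"
  let ?B = "\<lambda>m. qball S x (2 ^ (m + 1) * \<delta> powi k)"
  have "(\<integral>\<^sup>+z. wt L k x z \<partial>M) \<le> (\<integral>\<^sup>+z. wt (\<omega> + 1) k x z \<partial>M)"
    by (intro nn_integral_mono ennreal_leI \<rho>_powr_antimono L)
  also have "\<dots> \<le> (\<integral>\<^sup>+z. (\<Sum>m. ennreal (2 powr (- (\<omega> + 1) * real m)) * indicator (?B m) z) \<partial>M)"
    using omega_pos by (intro nn_integral_mono \<rho>_powr_le_annuli) auto
  also have "\<dots> = (\<Sum>m. ennreal (2 powr (- (\<omega> + 1) * real m)) * emeasure M (?B m))"
    by (subst nn_integral_suminf) (auto simp: nn_integral_cmult_indicator)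
  also have "\<dots> \<le> (\<Sum>m. ennreal (Cv * 2 powr \<omega> * V k x * (1 / 2) ^ m))"
  proof (intro suminf_le summableI)
    fix m :: nat
    have "(2 :: real) ^ (m + 1) = 2 powr (real m + 1)"
      by (simp add: powr_add powr_realpow)
    moreover have "1 \<le> (2 :: real) ^ (m + 1)"
      by (rule one_le_power) simp
    ultimately have "vol S (2 ^ (m + 1) * \<delta> powi k) x \<le> Cv * 2 powr (\<omega> * (real m + 1)) * V k x"
      using vol_dilate[of "2 ^ (m + 1)" "\<delta> powi k" x] by (simp add: V_def powr_powr mult.commute)
    then have "2 powr (- (\<omega> + 1) * real m) * vol S (2 ^ (m + 1) * \<delta> powi k) x
      \<le> 2 powr (- (\<omega> + 1) * real m) * (Cv * 2 powr (\<omega> * (real m + 1)) * V k x)"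
      by (intro mult_left_mono) auto
    also have "\<dots> = Cv * (2 powr (- (\<omega> + 1) * real m) * 2 powr (\<omega> * (real m + 1))) * V k x"
      by simp
    also have "2 powr (- (\<omega> + 1) * real m) * 2 powr (\<omega> * (real m + 1)) = 2 powr (\<omega> - real m)"
      by (simp add: powr_add[symmetric] algebra_simps)
    also have "\<dots> = 2 powr \<omega> * (1 / 2) ^ m"
      by (simp add: powr_diff powr_realpow power_one_over)
    finally show "ennreal (2 powr (- (\<omega> + 1) * real m)) * emeasure M (?B m)
      \<le> ennreal (Cv * 2 powr \<omega> * V k x * (1 / 2) ^ m)"
      by (simp add: emeasure_ball ennreal_mult[symmetric] vol_pos less_imp_le ennreal_leI mult_ac del: power_Suc)
  qed
  also have "\<dots> = ennreal (Cv * 2 powr \<omega> * 2 * V k x)"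
  proof (subst suminf_ennreal2)
    show "0 \<le> Cv * 2 powr \<omega> * V k x * (1 / 2) ^ m" for m :: nat
      using Cv_ge1 by (simp add: less_imp_le)
    show "summable (\<lambda>m. Cv * 2 powr \<omega> * V k x * (1 / 2) ^ m :: real)"
      by (intro summable_mult summable_geometric) auto
    show "ennreal (\<Sum>m. Cv * 2 powr \<omega> * V k x * (1 / 2) ^ m) = ennreal (Cv * 2 powr \<omega> * 2 * V k x)"
      by (subst suminf_mult) (auto simp: suminf_geometric mult_ac)
  qed
  finally show "(\<integral>\<^sup>+z. wt L k x z \<partial>M) \<le> ennreal (Cv * 2 powr \<omega> * 2 * V k x)" .
qed

text \<open>Each weight is spread over its own cube, and the disjoint cubes are collected into one
  integral. Of the exponent 2 \<omega> + 1, the part \<omega> pays for comparing the volumes at x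
  and at \<alpha>, and \<omega> + 1 makes the integral converge. Finite sets are used because the
  countability of the points is deduced from this bound.\<close>

lemma sum_\<rho>_finite:
  obtains C where "0 < C"
    "\<And>k x F. finite F \<Longrightarrow> F \<subseteq> X (k + int n) \<Longrightarrow> (\<Sum>\<alpha>\<in>F. \<rho> k x \<alpha> powr (- (2 * \<omega> + 1))) \<le> C"
proof -
  obtain C1 where C1: "1 \<le> C1"
    "\<And>k \<alpha>. \<alpha> \<in> X (k + int n) \<Longrightarrow> V k \<alpha> \<le> C1 * measure M (Q (k + int n) \<alpha>)"
    using cube_volume[of n] by metis
  obtain C2 where C2: "0 < C2"
    "\<And>k x L. \<omega> + 1 \<le> L \<Longrightarrow> (\<integral>\<^sup>+z. wt L k x z \<partial>M) \<le> ennreal (C2 * V k x)"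
    using nn_integral_\<rho> by metis
  define K where "K = A * (5 * A\<^sup>2)"
  define C3 where "C3 = Cv * A powr \<omega> * C1 * K powr (\<omega> + 1)"
  have C3: "0 < C3" using Cv_ge1 C1
    unfolding C3_def K_def by (intro mult_pos_pos) auto
  show thesis
  proof (rule that[of "C3 * C2"])
    show "0 < C3 * C2" using C2 C3 by simp
    fix k x F assume F: "finite F" "F \<subseteq> X (k + int n)"
    have one: "ennreal (\<rho> k x \<alpha> powr (- (2 * \<omega> + 1)) * V k x)
      \<le> ennreal C3 * (\<integral>\<^sup>+z. wt (\<omega> + 1) k x z * indicator (Q (k + int n) \<alpha>) z \<partial>M)"
      if \<alpha>: "\<alpha> \<in> F" for \<alpha>
    proof -
      have \<alpha>X: "\<alpha> \<in> X (k + int n)" using \<alpha> F by auto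
      note [measurable] = sets_cube[OF \<alpha>X]
      have pt: "\<rho> k x \<alpha> powr (- (\<omega> + 1)) \<le> K powr (\<omega> + 1) * \<rho> k x z powr (- (\<omega> + 1))"
        if "z \<in> Q (k + int n) \<alpha>" for z
      proof (rule powr_neg_le_powr_neg)
        have "\<rho> k x z \<le> A * \<rho> k x \<alpha> * \<rho> k \<alpha> z" by (rule \<rho>_triangle)
        also have "\<dots> \<le> A * \<rho> k x \<alpha> * (5 * A\<^sup>2)"
          using cube_\<rho>(2)[OF \<alpha>X that] by (intro mult_left_mono) auto
        finally show "\<rho> k x z \<le> K * \<rho> k x \<alpha>" by (simp add: K_def mult_ac)
      qed (use omega_pos in \<open>auto simp: K_def\<close>)
      have "\<rho> k x \<alpha> powr (- (2 * \<omega> + 1)) * V k x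
        \<le> \<rho> k x \<alpha> powr (- (2 * \<omega> + 1)) * (Cv * (A * \<rho> k x \<alpha>) powr \<omega> * (C1 * measure M (Q (k + int n) \<alpha>)))"
        using C1(2)[OF \<alpha>X] Cv_ge1
        by (intro mult_left_mono order_trans[OF V_change[of k x \<alpha>]]) auto
      also have "\<dots> = Cv * A powr \<omega> * C1 * (\<rho> k x \<alpha> powr (- (2 * \<omega> + 1)) * \<rho> k x \<alpha> powr \<omega>) * measure M (Q (k + int n) \<alpha>)"
        by (simp add: powr_mult)
      also have "\<rho> k x \<alpha> powr (- (2 * \<omega> + 1)) * \<rho> k x \<alpha> powr \<omega> = \<rho> k x \<alpha> powr (- (\<omega> + 1))"
        by (simp add: powr_add[symmetric] algebra_simps)
      finally have "ennreal (\<rho> k x \<alpha> powr (- (2 * \<omega> + 1)) * V k x)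
         \<le> ennreal (Cv * A powr \<omega> * C1) * (wt (\<omega> + 1) k x \<alpha> * emeasure M (Q (k + int n) \<alpha>))"
        using Cv_ge1 C1 by (simp add: emeasure_cube[OF \<alpha>X] ennreal_mult[symmetric] ennreal_leI mult_ac)
      also have "wt (\<omega> + 1) k x \<alpha> * emeasure M (Q (k + int n) \<alpha>)
        = (\<integral>\<^sup>+z. wt (\<omega> + 1) k x \<alpha> * indicator (Q (k + int n) \<alpha>) z \<partial>M)"
        using sets_cube[OF \<alpha>X] by (simp add: nn_integral_cmult_indicator)
      also have "\<dots> \<le> (\<integral>\<^sup>+z. ennreal (K powr (\<omega> + 1)) * (wt (\<omega> + 1) k x z * indicator (Q (k + int n) \<alpha>) z) \<partial>M)"
        using pt by (intro nn_integral_mono) (auto simp: ennreal_mult[symmetric] intro!: ennreal_leI split: split_indicator)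
      also have "\<dots> = ennreal (K powr (\<omega> + 1)) * (\<integral>\<^sup>+z. wt (\<omega> + 1) k x z * indicator (Q (k + int n) \<alpha>) z \<partial>M)"
        by (intro nn_integral_cmult) measurable
      finally show ?thesis
        using Cv_ge1 C1 by (simp add: C3_def ennreal_mult' mult.assoc[symmetric] mult_left_mono)
    qed
    have "ennreal ((\<Sum>\<alpha>\<in>F. \<rho> k x \<alpha> powr (- (2 * \<omega> + 1))) * V k x)
      = (\<Sum>\<alpha>\<in>F. ennreal (\<rho> k x \<alpha> powr (- (2 * \<omega> + 1)) * V k x))"
      by (subst sum_ennreal) (auto simp: sum_distrib_right less_imp_le)
    also have "\<dots> \<le> (\<Sum>\<alpha>\<in>F. ennreal C3 * (\<integral>\<^sup>+z. wt (\<omega> + 1) k x z * indicator (Q (k + int n) \<alpha>) z \<partial>M))"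
      by (intro sum_mono one)
    also have "\<dots> = ennreal C3 * (\<integral>\<^sup>+z. (\<Sum>\<alpha>\<in>F. wt (\<omega> + 1) k x z * indicator (Q (k + int n) \<alpha>) z) \<partial>M)"
      using F sets_cube[of _ "k + int n"] by (subst nn_integral_sum) (auto simp: sum_distrib_left)
    also have "\<dots> \<le> ennreal C3 * (\<integral>\<^sup>+z. wt (\<omega> + 1) k x z \<partial>M)"
    proof (intro mult_left_mono nn_integral_mono)
      fix z
      have "disjoint_family_on (Q (k + int n)) F"
        using F cube_disjoint[of _ "k + int n"] by (auto simp: disjoint_family_on_def subset_iff)
      then have "(\<Sum>\<alpha>\<in>F. indicator (Q (k + int n) \<alpha>) z :: ennreal) = indicator (\<Union>\<alpha>\<in>F. Q (k + int n) \<alpha>) z"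
        using F by (subst indicator_UN_disjoint) auto
      then show "(\<Sum>\<alpha>\<in>F. wt (\<omega> + 1) k x z * indicator (Q (k + int n) \<alpha>) z) \<le> wt (\<omega> + 1) k x z"
        by (simp add: sum_distrib_left[symmetric] split: split_indicator)
    qed simp
    also have "\<dots> \<le> ennreal C3 * ennreal (C2 * V k x)"
      by (intro mult_left_mono C2) auto
    finally have "(\<Sum>\<alpha>\<in>F. \<rho> k x \<alpha> powr (- (2 * \<omega> + 1))) * V k x \<le> C3 * C2 * V k x"
      using C2 C3 by (simp add: ennreal_mult[symmetric] less_imp_le ennreal_le_iff mult.assoc)
    then show "(\<Sum>\<alpha>\<in>F. \<rho> k x \<alpha> powr (- (2 * \<omega> + 1))) \<le> C3 * C2"
      using V_pos[of k x] by (simp only: mult_le_cancel_right)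
  qed
qed

text \<open>A family of strictly positive numbers with bounded finite sums is countable.\<close>

lemma countable_X: "countable (X k)"
proof -
  obtain C where C: "0 < C"
    "\<And>k x F. finite F \<Longrightarrow> F \<subseteq> X (k + int 0) \<Longrightarrow> (\<Sum>\<alpha>\<in>F. \<rho> k x \<alpha> powr (- (2 * \<omega> + 1))) \<le> C"
    using sum_\<rho>_finite[of 0] by metis
  fix x
  have "(\<lambda>\<alpha>. \<rho> k x \<alpha> powr (- (2 * \<omega> + 1))) summable_on X k"
    using C(2)[of _ k x] by (intro nonneg_bdd_above_summable_on) (auto simp: bdd_above_def)
  then have "countable {\<alpha> \<in> X k. \<rho> k x \<alpha> powr (- (2 * \<omega> + 1)) \<noteq> 0}"
    by (rule summable_countable_real)
  moreover have "{\<alpha> \<in> X k. \<rho> k x \<alpha> powr (- (2 * \<omega> + 1)) \<noteq> 0} = X k"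
    using \<rho>_pos by (auto simp: less_imp_neq[symmetric])
  ultimately show ?thesis by simp
qed

lemma sum_\<rho>:
  obtains C where "0 < C"
    "\<And>k x L. 2 * \<omega> + 1 \<le> L \<Longrightarrow> (\<integral>\<^sup>+\<alpha>. wt L k x \<alpha> \<partial>pts n k) \<le> ennreal C"
proof -
  obtain C where C: "0 < C"
    "\<And>k x F. finite F \<Longrightarrow> F \<subseteq> X (k + int n) \<Longrightarrow> (\<Sum>\<alpha>\<in>F. \<rho> k x \<alpha> powr (- (2 * \<omega> + 1))) \<le> C"
    using sum_\<rho>_finite[of n] by metis
  show thesis
  proof (rule that[of C])
    fix k x and L :: real assume L: "2 * \<omega> + 1 \<le> L"
    have "(\<integral>\<^sup>+\<alpha>. wt L k x \<alpha> \<partial>pts n k)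
      \<le> (\<integral>\<^sup>+\<alpha>. wt (2 * \<omega> + 1) k x \<alpha> \<partial>pts n k)"
      by (intro nn_integral_mono ennreal_leI \<rho>_powr_antimono L)
    also have "\<dots> = (\<Sum>\<^sub>\<infinity>\<alpha>\<in>X (k + int n). wt (2 * \<omega> + 1) k x \<alpha>)"
      by (rule infsum_eq_nn_integral_count_space[OF countable_X, symmetric])
    also have "\<dots> \<le> ennreal C"
      using C(2)[of _ k x]
      by (subst nonneg_infsum_complete) (auto intro!: SUP_least simp: sum_ennreal ennreal_leI)
    finally show "(\<integral>\<^sup>+\<alpha>. wt L k x \<alpha> \<partial>pts n k) \<le> ennreal C" .
  qed (rule C(1))
qed

end

section \<open>The one-parameter inequality\<close>

text \<open>Subtracting half of R is legitimate because R is finite. The absorptions for the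
  apertures and for the weighted supremum both end here, and their a priori bounds serve to provide
  this finiteness.\<close>

lemma ennreal_absorb_half:
  fixes R a :: ennreal
  assumes "R \<le> a + ennreal (1 / 2) * R" "R < \<infinity>"
  shows "R \<le> 2 * a"
proof (cases a)
  case (real r)
  obtain t where t: "0 \<le> t" "R = ennreal t"
    using assms(2) by (cases R) auto
  have "ennreal t \<le> ennreal (r + 1 / 2 * t)"
    using assms(1) real t by (simp only: ennreal_mult'[symmetric] ennreal_plus)
  then have "t \<le> r + 1 / 2 * t"
    using real t by (subst (asm) ennreal_le_iff) auto
  then have "ennreal t \<le> ennreal (2 * r)"
    by (intro ennreal_leI) linarith
  with real t show ?thesis
    by (simp add: ennreal_mult)
qed (simp add: ennreal_mult_top)

lemma ennreal_affine_rescale: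
  fixes I R :: ennreal
  assumes "0 \<le> a" "0 \<le> b" "0 \<le> u" "0 \<le> v" "0 \<le> w"
  shows "ennreal a * (ennreal b * I + ennreal u * (R * ennreal v)) * ennreal w
    = ennreal (a * b * w) * I + ennreal (a * u * v * w) * R"
  using assms by (simp add: ennreal_mult distrib_left distrib_right mult_ac)

text \<open>Young's inequality by a threshold: for u \<le> s g the power of u is replaced by that of
  s g, otherwise the factor g is replaced by u / s. A large s makes the coefficient of u^q as small
  as desired.\<close>

lemma mult_powr_le_split:
  fixes g u s q :: real
  assumes "0 \<le> g" "0 \<le> u" "0 < s" "1 \<le> q"
  shows "g * u powr (q - 1) \<le> s powr (q - 1) * g powr q + u powr q / s"
proof (cases "u \<le> s * g")
  case True
  show ?thesis
  proof (cases "g = 0")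
    case False
    then have "g * u powr (q - 1) \<le> g * (s * g) powr (q - 1)"
      using True assms by (intro mult_left_mono powr_mono2) auto
    also have "\<dots> = s powr (q - 1) * g powr q"
      using assms False by (simp add: powr_mult powr_diff)
    finally show ?thesis
      using assms by (simp add: add_increasing2)
  qed (use assms in auto)
next
  case False
  then have "0 < u" "g \<le> u / s"
    using assms by (auto simp: field_simps intro: order.strict_trans1[of 0 "s * g" u])
  then have "g * u powr (q - 1) \<le> u / s * u powr (q - 1)"
    by (intro mult_right_mono) auto
  also have "\<dots> = u powr q / s"
    using \<open>0 < u\<close> by (simp add: powr_diff)
  finally show ?thesis
    using assms by (simp add: add_increasing)
qed

text \<open>The geometric weights replace the triangle inequality: every \<open>v m\<close> is at
  most the l^q size of the whole sequence, and the weights add up to 2.\<close>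

lemma ennreal_powr_suminf_le:
  fixes v :: "nat \<Rightarrow> ennreal"
  assumes q: "0 < q"
  shows "ennreal_powr (\<Sum>m. ennreal ((1 / 2) ^ m) * v m) q \<le> ennreal (2 powr q) * (\<Sum>m. ennreal_powr (v m) q)"
proof -
  let ?T = "ennreal_powr (\<Sum>m. ennreal_powr (v m) q) (1 / q)"
  have v: "v m \<le> ?T" for m
  proof -
    have "ennreal_powr (ennreal_powr (v m) q) (1 / q) \<le> ?T"
      using q by (intro ennreal_powr_mono le_suminf_ennreal) auto
    then show ?thesis
      using q by (simp add: ennreal_powr_powr)
  qed
  have "(\<Sum>m. ennreal ((1 / 2) ^ m) * v m) \<le> (\<Sum>m. ennreal ((1 / 2) ^ m) * ?T)"
    by (intro suminf_le mult_left_mono v) auto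
  also have "\<dots> = (\<Sum>m. ennreal ((1 / 2) ^ m)) * ?T"
    by simp
  also have "(\<Sum>m. ennreal ((1 / 2) ^ m)) = ennreal 2"
    by (subst suminf_ennreal2) (auto simp: summable_geometric suminf_geometric)
  finally have "ennreal_powr (\<Sum>m. ennreal ((1 / 2) ^ m) * v m) q \<le> ennreal_powr (ennreal 2 * ?T) q"
    using q by (intro ennreal_powr_mono) auto
  also have "\<dots> = ennreal (2 powr q) * (\<Sum>m. ennreal_powr (v m) q)"
    using q by (simp only: ennreal_powr_mult) (simp add: ennreal_powr_powr ennreal_powr_ennreal del: ennreal_numeral)
  finally show ?thesis .
qed

section \<open>Weighted sums over all scales\<close>

context dyadic_space
begin

definition cube_index :: "nat \<Rightarrow> (int \<times> 'a) set" where
  "cube_index n = (SIGMA k:UNIV. X (k + int n))"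

abbreviation icube :: "nat \<Rightarrow> int \<times> 'a \<Rightarrow> 'a set" where
  "icube n i \<equiv> Q (fst i + int n) (snd i)"

lemma cube_index_iff: "i \<in> cube_index n \<longleftrightarrow> snd i \<in> X (fst i + int n)"
  by (cases i) (auto simp: cube_index_def)

lemma sets_icube: "i \<in> cube_index n \<Longrightarrow> icube n i \<in> sets M"
  by (simp add: cube_index_iff sets_cube)

lemma countable_cube_index: "countable (cube_index n)"
  unfolding cube_index_def by (intro countable_SIGMA countable_X) auto

lemma infinite_cube_index: "infinite (cube_index n)"
proof
  assume "finite (cube_index n)"
  then have "finite (fst ` cube_index n)" by simp
  moreover have "fst ` cube_index n = UNIV"
    using cube_cover by (force simp: cube_index_def image_iff)
  ultimately show False by (simp add: infinite_UNIV_int)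
qed

text \<open>Averaging in y: the left-hand side does not depend on y, so it equals its mean over the
  cube. A bound with a free choice of y thus becomes an integral over the cube.\<close>

lemma le_nn_integral_cube:
  assumes \<alpha>: "\<alpha> \<in> X k" and [measurable]: "\<phi> \<in> borel_measurable M"
    and Z: "\<And>y. y \<in> Q k \<alpha> \<Longrightarrow> Z \<le> \<phi> y * ennreal (measure M (Q k \<alpha>))"
  shows "Z \<le> (\<integral>\<^sup>+y. \<phi> y * indicator (Q k \<alpha>) y \<partial>M)"
proof -
  let ?m = "measure M (Q k \<alpha>)"
  have m: "0 < ?m" using \<alpha> by (rule measure_cube_pos)
  have inv: "ennreal ?m * ennreal (1 / ?m) = 1"
    using m by (simp add: ennreal_mult[symmetric])
  have "Z = Z * ennreal (1 / ?m) * emeasure M (Q k \<alpha>)"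
    using inv by (simp add: emeasure_cube[OF \<alpha>] mult.assoc mult.commute[of "ennreal (1 / ?m)"])
  also have "\<dots> = (\<integral>\<^sup>+y. Z * ennreal (1 / ?m) * indicator (Q k \<alpha>) y \<partial>M)"
    using sets_cube[OF \<alpha>] by (simp add: nn_integral_cmult_indicator)
  also have "\<dots> \<le> (\<integral>\<^sup>+y. \<phi> y * indicator (Q k \<alpha>) y \<partial>M)"
  proof (intro nn_integral_mono)
    fix y
    have "Z * ennreal (1 / ?m) \<le> \<phi> y" if "y \<in> Q k \<alpha>"
    proof -
      have "Z * ennreal (1 / ?m) \<le> \<phi> y * ennreal ?m * ennreal (1 / ?m)"
        by (intro mult_right_mono Z that) auto
      then show ?thesis using inv by (simp add: mult.assoc)
    qed
    then show "Z * ennreal (1 / ?m) * indicator (Q k \<alpha>) y \<le> \<phi> y * indicator (Q k \<alpha>) y"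
      by (auto split: split_indicator)
  qed
  finally show ?thesis .
qed

text \<open>If \<open>y\<close> lies in the cube of \<open>i\<close>, then the coarse part of the weighted sum at \<open>x\<close> is at least a
  constant times \<open>\<rho>(x, i)^(-L) G(y)\<close>, where \<open>G\<close> is the coarse part of the sum of indicators. As
  \<open>q \<le> 1\<close>, this bounds \<open>h^(q - 1)\<close> from above, and the choice of \<open>L\<close> leaves an integrable weight.\<close>

lemma weighted_sum_le_finite_small:
  assumes q: "0 < q" "q \<le> 1"
  obtains C where "0 < C"
    "\<And>J a. finite J \<Longrightarrow> J \<subseteq> cube_index n \<Longrightarrow> (\<And>i. 0 \<le> a i) \<Longrightarrow>
      (\<integral>\<^sup>+x. ennreal ((\<Sum>i\<in>J. a i * \<rho> (fst i) x (snd i) powr (- ((\<omega> + 1) / q))) powr q) \<partial>M)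
      \<le> ennreal C * (\<integral>\<^sup>+x. ennreal ((\<Sum>i\<in>J. a i * indicator (icube n i) x) powr q) \<partial>M)"
proof -
  obtain C1 where C1: "1 \<le> C1"
    "\<And>k \<alpha>. \<alpha> \<in> X (k + int n) \<Longrightarrow> V k \<alpha> \<le> C1 * measure M (Q (k + int n) \<alpha>)"
    using cube_volume[of n] by metis
  obtain C2 where C2: "0 < C2"
    "\<And>k x L. \<omega> + 1 \<le> L \<Longrightarrow> (\<integral>\<^sup>+z. wt L k x z \<partial>M) \<le> ennreal (C2 * V k x)"
    using nn_integral_\<rho> by metis
  \<comment> \<open>Chosen so that the q-th power of the weight, which is what survives below, has
    the integrable exponent \<omega> + 1.\<close>
  define L where "L = (\<omega> + 1) / q"
  have L: "0 < L" using q omega_pos by (simp add: L_def)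
  \<comment> \<open>From x to the centre of j through y and the centre of i: two triangle
    inequalities and two cubes containing y.\<close>
  define K where "K = A\<^sup>2 * (5 * A\<^sup>2)\<^sup>2"
  have K: "0 < K" by (simp add: K_def)
  define D where "D = (K powr L) powr (1 - q) * C2 * C1"
  have D: "0 < D" using K C1 C2 by (simp add: D_def)
  show thesis
  proof (rule that[of "D / q"])
    show "0 < D / q" using D q by simp
    fix J and a :: "int \<times> 'a \<Rightarrow> real"
    assume J: "finite J" "J \<subseteq> cube_index n" and a: "\<And>i. 0 \<le> a i"
    define w where "w i x = \<rho> (fst i) x (snd i) powr (- L)" for i :: "int \<times> 'a" and x
    define h where "h x = (\<Sum>i\<in>J. a i * w i x)" for x
    define g where "g i x = a i * indicator (icube n i) x" for i x
    define G where "G i x = (\<Sum>j\<in>{j\<in>J. fst j \<le> fst i}. g j x)" for i :: "int \<times> 'a" and x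
    have w_pos: "0 < w i x" for i x by (simp add: w_def less_imp_neq[symmetric])
    have h_nonneg: "0 \<le> h x" for x using a w_pos by (simp add: h_def sum_nonneg less_imp_le)
    have g_nonneg: "0 \<le> g i x" for i x using a by (simp add: g_def)
    have G_nonneg: "0 \<le> G i x" for i x using g_nonneg by (simp add: G_def sum_nonneg)
    have [measurable]: "icube n i \<in> sets M" if "i \<in> J" for i
      using that J by (auto intro: sets_icube)
    have [measurable]: "w i \<in> borel_measurable M" for i
      by (simp add: w_def[abs_def])
    have [measurable]: "h \<in> borel_measurable M"
      by (simp add: h_def[abs_def])
    have [measurable]: "g i \<in> borel_measurable M" if "i \<in> J" for i
      using that by (simp add: g_def[abs_def])
    have [measurable]: "G i \<in> borel_measurable M" for i
      unfolding G_def[abs_def] by (intro borel_measurable_sum) auto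
    have transfer: "w i x * G i y \<le> K powr L * h x" if i: "i \<in> J" "y \<in> icube n i" for i x y
    proof -
      have le: "w i x * g j y \<le> K powr L * (a j * w j x)" if j: "j \<in> J" "fst j \<le> fst i" for j
      proof (cases "y \<in> icube n j")
        case True
        have "\<rho> (fst j) x (snd j) \<le> A * \<rho> (fst j) x y * \<rho> (fst j) y (snd j)"
          by (rule \<rho>_triangle)
        \<comment> \<open>Here \<open>fst j \<le> fst i\<close> is used: passing to the finer scale
          of i only enlarges the scaled distance.\<close>
        also have "\<dots> \<le> A * \<rho> (fst i) x y * (5 * A\<^sup>2)"
          using cube_\<rho>(1)[of "snd j" "fst j" n y] True j J \<rho>_mono_scale[OF j(2), of x y]
          by (intro mult_mono) (auto simp: cube_index_iff)
        also have "\<dots> \<le> A * (A * \<rho> (fst i) x (snd i) * \<rho> (fst i) (snd i) y) * (5 * A\<^sup>2)"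
          by (intro mult_mono \<rho>_triangle) auto
        also have "\<dots> \<le> A * (A * \<rho> (fst i) x (snd i) * (5 * A\<^sup>2)) * (5 * A\<^sup>2)"
          using cube_\<rho>(2)[of "snd i" "fst i" n y] i J by (intro mult_mono) (auto simp: cube_index_iff)
        finally have "\<rho> (fst j) x (snd j) \<le> K * \<rho> (fst i) x (snd i)"
          by (simp add: K_def power2_eq_square mult_ac)
        then have "w i x \<le> K powr L * w j x"
          unfolding w_def using K L by (intro powr_neg_le_powr_neg) auto
        then have "a j * w i x \<le> a j * (K powr L * w j x)"
          using a by (intro mult_left_mono)
        then show ?thesis
          using True by (simp add: g_def mult_ac)
      qed (use a w_pos[of j x] K in \<open>simp add: g_def\<close>)
      have "w i x * G i y = (\<Sum>j\<in>{j\<in>J. fst j \<le> fst i}. w i x * g j y)"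
        by (simp add: G_def sum_distrib_left)
      also have "\<dots> \<le> (\<Sum>j\<in>{j\<in>J. fst j \<le> fst i}. K powr L * (a j * w j x))"
        by (intro sum_mono le) auto
      also have "\<dots> \<le> (\<Sum>j\<in>J. K powr L * (a j * w j x))"
        using J by (intro sum_mono2) (auto intro!: mult_nonneg_nonneg less_imp_le[OF w_pos] a)
      also have "\<dots> = K powr L * h x"
        by (simp add: h_def sum_distrib_left)
      finally show ?thesis .
    qed
    have one: "(\<integral>\<^sup>+x. ennreal (a i * w i x * h x powr (q - 1)) \<partial>M)
        \<le> ennreal D * (\<integral>\<^sup>+y. ennreal (g i y * G i y powr (q - 1)) \<partial>M)" if i: "i \<in> J" for i
    proof (cases "a i = 0")
      case False
      then have ai: "0 < a i" using a[of i] by linarith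
      let ?k = "fst i" and ?\<alpha> = "snd i"
      have \<alpha>: "?\<alpha> \<in> X (?k + int n)" using i J by (auto simp: cube_index_iff)
      have Z: "(\<integral>\<^sup>+x. ennreal (a i * w i x * h x powr (q - 1)) \<partial>M)
         \<le> ennreal (D * a i * G i y powr (q - 1)) * ennreal (measure M (icube n i))"
        if y: "y \<in> icube n i" for y
      proof -
        \<comment> \<open>Since q - 1 may be negative, G must be positive at y; the term of i itself
          guarantees this.\<close>
        have "0 < g i y" using ai y by (simp add: g_def)
        also have "g i y \<le> G i y"
          unfolding G_def using i J g_nonneg by (intro member_le_sum) auto
        finally have Gy: "0 < G i y" .
        have pt: "a i * w i x * h x powr (q - 1)
            \<le> (K powr L) powr (1 - q) * a i * G i y powr (q - 1) * \<rho> ?k ?\<alpha> x powr (- (\<omega> + 1))" for x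
        proof -
 have pos: "0 < w i x * G i y"
            using Gy w_pos[of i x] by simp
          have "0 < K powr L * h x"
            using pos transfer[OF i y, of x] by linarith
          then have hx: "0 < h x"
            using h_nonneg[of x] by (simp add: zero_less_mult_iff)
          have "h x powr (- (1 - q)) \<le> (K powr L) powr (1 - q) * (w i x * G i y) powr (- (1 - q))"
            using transfer[OF i y, of x] pos hx K q by (intro powr_neg_le_powr_neg) auto
          then have "a i * w i x * h x powr (q - 1)
            \<le> a i * w i x * ((K powr L) powr (1 - q) * (w i x * G i y) powr (q - 1))"
            using ai w_pos[of i x] by (intro mult_left_mono) auto
          also have "\<dots> = (K powr L) powr (1 - q) * a i * G i y powr (q - 1) * (w i x * w i x powr (q - 1))"
            using Gy w_pos[of i x] by (simp add: powr_mult mult_ac)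
          also have "w i x * w i x powr (q - 1) = w i x powr q"
            using w_pos[of i x] by (simp add: powr_diff)
          also have "w i x powr q = \<rho> ?k ?\<alpha> x powr (- (\<omega> + 1))"
            using q by (simp add: w_def powr_powr L_def \<rho>_sym)
          finally show ?thesis .
        qed
        have "(\<integral>\<^sup>+x. ennreal (a i * w i x * h x powr (q - 1)) \<partial>M)
          \<le> (\<integral>\<^sup>+x. ennreal ((K powr L) powr (1 - q) * a i * G i y powr (q - 1)) * wt (\<omega> + 1) ?k ?\<alpha> x \<partial>M)"
          using pt a by (intro nn_integral_mono) (auto simp: ennreal_mult[symmetric] intro!: ennreal_leI)
        also have "\<dots> = ennreal ((K powr L) powr (1 - q) * a i * G i y powr (q - 1)) * (\<integral>\<^sup>+x. wt (\<omega> + 1) ?k ?\<alpha> x \<partial>M)"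
          by (intro nn_integral_cmult) measurable
        also have "\<dots> \<le> ennreal ((K powr L) powr (1 - q) * a i * G i y powr (q - 1)) * ennreal (C2 * (C1 * measure M (icube n i)))"
          using C2(1) C1(2)[OF \<alpha>] by (intro mult_left_mono order_trans[OF C2(2)] ennreal_leI) auto
        also have "\<dots> = ennreal (D * a i * G i y powr (q - 1)) * ennreal (measure M (icube n i))"
          using a C1 C2 by (simp add: D_def ennreal_mult[symmetric] mult_ac)
        finally show ?thesis .
      qed
      have "(\<integral>\<^sup>+x. ennreal (a i * w i x * h x powr (q - 1)) \<partial>M)
        \<le> (\<integral>\<^sup>+y. ennreal (D * a i * G i y powr (q - 1)) * indicator (icube n i) y \<partial>M)"
        by (intro le_nn_integral_cube \<alpha> Z) measurable
      also have "\<dots> = (\<integral>\<^sup>+y. ennreal D * ennreal (g i y * G i y powr (q - 1)) \<partial>M)"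
        using a D by (intro nn_integral_cong) (auto simp: g_def ennreal_mult[symmetric] mult_ac split: split_indicator)
      also have "\<dots> = ennreal D * (\<integral>\<^sup>+y. ennreal (g i y * G i y powr (q - 1)) \<partial>M)"
        using i by (intro nn_integral_cmult) measurable
      finally show ?thesis .
    qed simp
    \<comment> \<open>The power q - 1 here is that of the full sum h. Coarse parts appear only on
      the side of the indicators, where \<open>sum_key_le_powr_sum\<close> reassembles them.\<close>
    have "(\<integral>\<^sup>+x. ennreal (h x powr q) \<partial>M) = (\<integral>\<^sup>+x. (\<Sum>i\<in>J. ennreal (a i * w i x * h x powr (q - 1))) \<partial>M)"
    proof (intro nn_integral_cong)
      fix x
      have "h x powr q = h x * h x powr (q - 1)"
        using h_nonneg[of x] by (cases "h x = 0") (auto simp: powr_diff)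
      also have "\<dots> = (\<Sum>i\<in>J. a i * w i x * h x powr (q - 1))"
        by (simp add: h_def sum_distrib_right)
      finally show "ennreal (h x powr q) = (\<Sum>i\<in>J. ennreal (a i * w i x * h x powr (q - 1)))"
        using a w_pos by (simp add: sum_ennreal less_imp_le)
    qed
    also have "\<dots> = (\<Sum>i\<in>J. \<integral>\<^sup>+x. ennreal (a i * w i x * h x powr (q - 1)) \<partial>M)"
      by (intro nn_integral_sum) measurable
    also have "\<dots> \<le> (\<Sum>i\<in>J. ennreal D * (\<integral>\<^sup>+y. ennreal (g i y * G i y powr (q - 1)) \<partial>M))"
      by (intro sum_mono one)
    also have "\<dots> = ennreal D * (\<integral>\<^sup>+y. (\<Sum>i\<in>J. ennreal (g i y * G i y powr (q - 1))) \<partial>M)"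
      by (subst nn_integral_sum) (auto simp: sum_distrib_left)
    also have "\<dots> \<le> ennreal D * (\<integral>\<^sup>+y. ennreal (1 / q) * ennreal ((\<Sum>i\<in>J. g i y) powr q) \<partial>M)"
    proof (intro mult_left_mono nn_integral_mono)
      fix y
      have "q * (\<Sum>i\<in>J. g i y * G i y powr (q - 1)) \<le> (\<Sum>i\<in>J. g i y) powr q"
        unfolding G_def using J g_nonneg q by (intro sum_key_le_powr_sum) auto
      then have "(\<Sum>i\<in>J. g i y * G i y powr (q - 1)) \<le> 1 / q * (\<Sum>i\<in>J. g i y) powr q"
        using q by (simp add: field_simps)
      then show "(\<Sum>i\<in>J. ennreal (g i y * G i y powr (q - 1))) \<le> ennreal (1 / q) * ennreal ((\<Sum>i\<in>J. g i y) powr q)"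
        using g_nonneg q by (simp add: sum_ennreal ennreal_mult[symmetric] ennreal_leI)
    qed simp
    also have "\<dots> = ennreal (D / q) * (\<integral>\<^sup>+y. ennreal ((\<Sum>i\<in>J. g i y) powr q) \<partial>M)"
      using D q by (subst nn_integral_cmult) (auto simp: ennreal_mult[symmetric] mult.assoc[symmetric])
    finally show "(\<integral>\<^sup>+x. ennreal ((\<Sum>i\<in>J. a i * \<rho> (fst i) x (snd i) powr (- ((\<omega> + 1) / q))) powr q) \<partial>M)
      \<le> ennreal (D / q) * (\<integral>\<^sup>+x. ennreal ((\<Sum>i\<in>J. a i * indicator (icube n i) x) powr q) \<partial>M)"
      by (simp add: h_def w_def g_def L_def)
  qed
qed

text \<open>Moving the coarse part of the sum with aperture \<open>t\<close> to a point of the cube enlarges the aperture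
  by a fixed factor \<open>c\<close>, so the integral \<open>P(t)\<close> is only controlled by \<open>P(c t)\<close>. Since \<open>P(t)\<close> grows at most
  like \<open>t^(\<omega> q)\<close> for a finite sum, the supremum of \<open>P(t) t^(-\<omega> q)\<close> is finite and can be absorbed.\<close>

lemma aperture_sum_le_finite:
  assumes q: "1 \<le> q"
  obtains C where "0 < C"
    "\<And>J a t. finite J \<Longrightarrow> J \<subseteq> cube_index n \<Longrightarrow> (\<And>i. 0 \<le> a i) \<Longrightarrow> 1 \<le> t \<Longrightarrow>
      (\<integral>\<^sup>+x. ennreal ((\<Sum>i\<in>J. a i * indicator (qball S (snd i) (t * \<delta> powi fst i)) x) powr q) \<partial>M)
      \<le> ennreal (C * t powr (\<omega> * q)) * (\<integral>\<^sup>+x. ennreal ((\<Sum>i\<in>J. a i * indicator (icube n i) x) powr q) \<partial>M)"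
proof -
  obtain C1 where C1: "1 \<le> C1"
    "\<And>k \<alpha>. \<alpha> \<in> X (k + int n) \<Longrightarrow> V k \<alpha> \<le> C1 * measure M (Q (k + int n) \<alpha>)"
    using cube_volume[of n] by metis
  \<comment> \<open>For x in the balls of i and of a coarser j, and y in the cube of i: the distance
    from y to x is at most A (4 A^2 + 1) t \<delta>^k with k the scale of j, and one more triangle
    inequality leads to the centre of j.\<close>
  define c where "c = A * (A * (4 * A\<^sup>2 + 1) + 1)"
  have A2: "1 \<le> A\<^sup>2" using A_ge1 by (simp add: one_le_power)
  have "1 * 1 \<le> c"
    unfolding c_def using A_ge1 A2 by (intro mult_mono) (auto intro: add_increasing)
  then have c: "1 \<le> c" by simp
  define D where "D = q * Cv * C1"
  have D: "0 < D" using q Cv_ge1 C1 by (simp add: D_def)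
  \<comment> \<open>Fixed so that the coefficient of R below, D c^(\<omega> q) / s0, equals 1 /
    2.\<close>
  define s0 where "s0 = 2 * D * c powr (\<omega> * q)"
  have s0: "0 < s0" using D c by (simp add: s0_def)
  define E where "E = D * s0 powr (q - 1)"
  have E: "0 < E" using D s0 by (simp add: E_def)
  show thesis
  proof (rule that[of "2 * E"])
    show "0 < 2 * E" using E by simp
    fix J and a :: "int \<times> 'a \<Rightarrow> real" and t0 :: real
    assume J: "finite J" "J \<subseteq> cube_index n" and a: "\<And>i. 0 \<le> a i" and t0: "1 \<le> t0"
    define B where "B t i = qball S (snd i) (t * \<delta> powi fst i)" for t and i :: "int \<times> 'a"
    define f where "f t i x = a i * indicator (B t i) x" for t i x
    define h where "h t x = (\<Sum>i\<in>J. f t i x)" for t x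
    define g where "g i x = a i * indicator (icube n i) x" for i x
    define G where "G x = (\<Sum>i\<in>J. g i x)" for x
    define P where "P t = (\<integral>\<^sup>+x. ennreal (h t x powr q) \<partial>M)" for t
    define I where "I = (\<integral>\<^sup>+x. ennreal (G x powr q) \<partial>M)"
    have f_nonneg: "0 \<le> f t i x" and g_nonneg: "0 \<le> g i x" for t i x
      using a by (simp_all add: f_def g_def)
    have h_nonneg: "0 \<le> h t x" and G_nonneg: "0 \<le> G x" for t x
      using f_nonneg g_nonneg by (simp_all add: h_def G_def sum_nonneg)
    have [measurable]: "B t i \<in> sets M" for t i by (simp add: B_def)
    have [measurable]: "icube n i \<in> sets M" if "i \<in> J" for i
      using that J by (auto intro: sets_icube)
    have [measurable]: "f t i \<in> borel_measurable M" for t i by (simp add: f_def[abs_def])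
    have [measurable]: "h t \<in> borel_measurable M" for t by (simp add: h_def[abs_def])
    have [measurable]: "g i \<in> borel_measurable M" if "i \<in> J" for i
      using that by (simp add: g_def[abs_def])
    have [measurable]: "G \<in> borel_measurable M"
      unfolding G_def[abs_def] by (intro borel_measurable_sum) auto
    have emeasure_B: "emeasure M (B t i) \<le> ennreal (Cv * t powr \<omega> * V (fst i) (snd i))" if "1 \<le> t" for t i
      unfolding B_def V_def using that vol_dilate[of t "\<delta> powi fst i" "snd i"]
      by (subst emeasure_ball) (auto intro!: ennreal_leI mult_pos_pos)
    have transfer: "(\<Sum>j\<in>{j\<in>J. fst j \<le> fst i}. f t j x) \<le> h (c * t) y"
      if i: "i \<in> J" "x \<in> B t i" "y \<in> icube n i" and t: "1 \<le> t" for i x y t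
    proof -
      have \<alpha>: "snd i \<in> X (fst i + int n)" using i J by (auto simp: cube_index_iff)
      have le: "f t j x \<le> f (c * t) j y" if j: "j \<in> J" "fst j \<le> fst i" for j
      proof (cases "x \<in> B t j")
        case True
        have "d (snd i) y \<le> 4 * A\<^sup>2 * \<delta> powi (fst i + int n)"
          using cube_outer[OF \<alpha>] i by (auto simp: qball_def)
        also have "\<dots> \<le> 4 * A\<^sup>2 * \<delta> powi fst i"
          by (intro mult_left_mono scale_antimono) auto
        also have "\<dots> \<le> 4 * A\<^sup>2 * (t * \<delta> powi fst i)"
          using mult_right_mono[OF t, of "\<delta> powi fst i"] by (intro mult_left_mono) auto
        finally have yi: "d y (snd i) \<le> 4 * A\<^sup>2 * (t * \<delta> powi fst i)"
          by (subst d_sym)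
        have "d y x \<le> A * (d y (snd i) + d (snd i) x)" by (rule d_triangle)
        also have "\<dots> \<le> A * (4 * A\<^sup>2 * (t * \<delta> powi fst i) + t * \<delta> powi fst i)"
          using yi i by (intro mult_left_mono add_mono) (auto simp: B_def qball_def)
        also have "\<dots> = A * (4 * A\<^sup>2 + 1) * t * \<delta> powi fst i"
          by (simp add: algebra_simps)
        also have "\<dots> \<le> A * (4 * A\<^sup>2 + 1) * t * \<delta> powi fst j"
          using t by (intro mult_left_mono scale_antimono j) auto
        finally have yx: "d y x \<le> A * (4 * A\<^sup>2 + 1) * t * \<delta> powi fst j" .
        have "d (snd j) y \<le> A * (d y x + d x (snd j))" by (subst d_sym) (rule d_triangle)
        also have "\<dots> < A * (A * (4 * A\<^sup>2 + 1) * t * \<delta> powi fst j + t * \<delta> powi fst j)"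
          using yx True by (intro mult_strict_left_mono add_le_less_mono) (auto simp: B_def qball_def d_sym)
        also have "\<dots> = c * t * \<delta> powi fst j"
          by (simp add: c_def algebra_simps)
        finally have "y \<in> B (c * t) j" by (simp add: B_def qball_def)
        with True show ?thesis by (simp add: f_def)
      qed (use a in \<open>simp add: f_def\<close>)
      have "(\<Sum>j\<in>{j\<in>J. fst j \<le> fst i}. f t j x) \<le> (\<Sum>j\<in>{j\<in>J. fst j \<le> fst i}. f (c * t) j y)"
        by (intro sum_mono le) auto
      also have "\<dots> \<le> h (c * t) y"
        unfolding h_def using J f_nonneg by (intro sum_mono2) auto
      finally show ?thesis .
    qed
    have step: "P t \<le> ennreal (D * t powr \<omega>) * (\<integral>\<^sup>+y. ennreal (G y * h (c * t) y powr (q - 1)) \<partial>M)" if t: "1 \<le> t" for t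
    proof -
      have one: "(\<integral>\<^sup>+x. ennreal (f t i x * (\<Sum>j\<in>{j\<in>J. fst j \<le> fst i}. f t j x) powr (q - 1)) \<partial>M)
         \<le> ennreal (Cv * C1 * t powr \<omega>) * (\<integral>\<^sup>+y. ennreal (g i y * h (c * t) y powr (q - 1)) \<partial>M)" (is "?Z \<le> _")
        if i: "i \<in> J" for i
      proof -
        have \<alpha>: "snd i \<in> X (fst i + int n)" using i J by (auto simp: cube_index_iff)
        have Z: "?Z \<le> ennreal (Cv * C1 * t powr \<omega>) * ennreal (a i * h (c * t) y powr (q - 1)) * ennreal (measure M (icube n i))"
          if y: "y \<in> icube n i" for y
        proof -
          have "?Z \<le> (\<integral>\<^sup>+x. ennreal (a i * h (c * t) y powr (q - 1)) * indicator (B t i) x \<partial>M)"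
          proof (intro nn_integral_mono)
            fix x
            have "f t i x * (\<Sum>j\<in>{j\<in>J. fst j \<le> fst i}. f t j x) powr (q - 1) \<le> a i * h (c * t) y powr (q - 1)" if "x \<in> B t i"
            proof -
              have fi: "f t i x = a i" using that by (simp add: f_def)
              show ?thesis
                unfolding fi using q
                by (intro mult_left_mono powr_mono2 sum_nonneg f_nonneg a transfer[OF i that y t]) auto
            qed
            then show "ennreal (f t i x * (\<Sum>j\<in>{j\<in>J. fst j \<le> fst i}. f t j x) powr (q - 1))
               \<le> ennreal (a i * h (c * t) y powr (q - 1)) * indicator (B t i) x"
              by (cases "x \<in> B t i") (auto simp: f_def intro!: ennreal_leI)
          qed
          also have "\<dots> = ennreal (a i * h (c * t) y powr (q - 1)) * emeasure M (B t i)"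
            by (simp add: nn_integral_cmult_indicator)
          also have "\<dots> \<le> ennreal (a i * h (c * t) y powr (q - 1)) * ennreal (Cv * t powr \<omega> * (C1 * measure M (icube n i)))"
            using C1(2)[OF \<alpha>] Cv_ge1
            by (intro mult_left_mono order_trans[OF emeasure_B[OF t]] ennreal_leI) auto
          also have "\<dots> = ennreal (Cv * C1 * t powr \<omega>) * ennreal (a i * h (c * t) y powr (q - 1)) * ennreal (measure M (icube n i))"
            using a Cv_ge1 C1 by (simp add: ennreal_mult[symmetric] mult_ac)
          finally show ?thesis .
        qed
        have "?Z \<le> (\<integral>\<^sup>+y. ennreal (Cv * C1 * t powr \<omega>) * ennreal (a i * h (c * t) y powr (q - 1)) * indicator (icube n i) y \<partial>M)"
          by (intro le_nn_integral_cube \<alpha> Z) measurable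
        also have "\<dots> = (\<integral>\<^sup>+y. ennreal (Cv * C1 * t powr \<omega>) * ennreal (g i y * h (c * t) y powr (q - 1)) \<partial>M)"
          by (intro nn_integral_cong) (auto simp: g_def split: split_indicator)
        also have "\<dots> = ennreal (Cv * C1 * t powr \<omega>) * (\<integral>\<^sup>+y. ennreal (g i y * h (c * t) y powr (q - 1)) \<partial>M)"
          using i by (intro nn_integral_cmult) measurable
        finally show ?thesis .
      qed
      have "P t \<le> (\<integral>\<^sup>+x. ennreal q * (\<Sum>i\<in>J. ennreal (f t i x * (\<Sum>j\<in>{j\<in>J. fst j \<le> fst i}. f t j x) powr (q - 1))) \<partial>M)"
        unfolding P_def
      proof (intro nn_integral_mono)
        fix x
        have "h t x powr q \<le> q * (\<Sum>i\<in>J. f t i x * (\<Sum>j\<in>{j\<in>J. fst j \<le> fst i}. f t j x) powr (q - 1))"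
          unfolding h_def using J f_nonneg q by (intro powr_sum_le_sum_key) auto
        then show "ennreal (h t x powr q) \<le> ennreal q * (\<Sum>i\<in>J. ennreal (f t i x * (\<Sum>j\<in>{j\<in>J. fst j \<le> fst i}. f t j x) powr (q - 1)))"
          using q f_nonneg by (simp add: sum_ennreal sum_nonneg ennreal_mult[symmetric] ennreal_leI)
      qed
      also have "\<dots> = ennreal q * (\<Sum>i\<in>J. \<integral>\<^sup>+x. ennreal (f t i x * (\<Sum>j\<in>{j\<in>J. fst j \<le> fst i}. f t j x) powr (q - 1)) \<partial>M)"
        by (subst nn_integral_cmult) (auto simp: nn_integral_sum)
      also have "\<dots> \<le> ennreal q * (\<Sum>i\<in>J. ennreal (Cv * C1 * t powr \<omega>) * (\<integral>\<^sup>+y. ennreal (g i y * h (c * t) y powr (q - 1)) \<partial>M))"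
        by (intro mult_left_mono sum_mono one) auto
      also have "\<dots> = ennreal q * (ennreal (Cv * C1 * t powr \<omega>) * (\<integral>\<^sup>+y. (\<Sum>i\<in>J. ennreal (g i y * h (c * t) y powr (q - 1))) \<partial>M))"
        by (subst nn_integral_sum) (auto simp: sum_distrib_left)
      also have "(\<integral>\<^sup>+y. (\<Sum>i\<in>J. ennreal (g i y * h (c * t) y powr (q - 1))) \<partial>M) = (\<integral>\<^sup>+y. ennreal (G y * h (c * t) y powr (q - 1)) \<partial>M)"
        using g_nonneg by (intro nn_integral_cong) (simp add: sum_ennreal G_def sum_distrib_right)
      finally show ?thesis
        using q Cv_ge1 C1 by (simp add: D_def ennreal_mult[symmetric] mult.assoc[symmetric])
    qed
    \<comment> \<open>Crude bound: the sum never exceeds the total of the coefficients and lives on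
      the union of the balls, whose measure grows at most like t^\<omega>. The constant depends on J
      and a, which is harmless because only finiteness of R is drawn from it.\<close>
    have apriori: "\<exists>K\<ge>0. \<forall>t\<ge>1. P t \<le> ennreal (K * t powr (\<omega> * q))"
    proof (intro exI conjI allI impI)
      let ?s = "(\<Sum>i\<in>J. a i) powr q" and ?v = "\<Sum>i\<in>J. Cv * V (fst i) (snd i)"
      show "0 \<le> ?s * ?v" using Cv_ge1 by (auto intro!: mult_nonneg_nonneg sum_nonneg simp: less_imp_le)
      fix t :: real assume t: "1 \<le> t"
      have "P t \<le> (\<integral>\<^sup>+x. (\<Sum>i\<in>J. ennreal ?s * indicator (B t i) x) \<partial>M)"
        unfolding P_def
      proof (intro nn_integral_mono)
        fix x
        show "ennreal (h t x powr q) \<le> (\<Sum>i\<in>J. ennreal ?s * indicator (B t i) x)"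
        proof (cases "\<exists>i\<in>J. x \<in> B t i")
          case True
          then obtain i where i: "i \<in> J" "x \<in> B t i" by auto
          have "h t x \<le> (\<Sum>i\<in>J. a i)"
            unfolding h_def f_def using a by (intro sum_mono) (auto split: split_indicator)
          then have "ennreal (h t x powr q) \<le> ennreal ?s * indicator (B t i) x"
            using i h_nonneg q by (auto intro!: ennreal_leI powr_mono2)
          also have "\<dots> \<le> (\<Sum>i\<in>J. ennreal ?s * indicator (B t i) x)"
            using i J by (intro member_le_sum) auto
          finally show ?thesis .
        next
          case False
          then have "h t x = 0" by (simp add: h_def f_def)
          then show ?thesis by simp
        qed
      qed
      also have "\<dots> = (\<Sum>i\<in>J. ennreal ?s * emeasure M (B t i))"
        by (subst nn_integral_sum) (auto simp: nn_integral_cmult_indicator)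
      also have "\<dots> \<le> (\<Sum>i\<in>J. ennreal ?s * ennreal (Cv * t powr \<omega> * V (fst i) (snd i)))"
        by (intro sum_mono mult_left_mono emeasure_B t) auto
      also have "\<dots> = ennreal (?s * ?v * t powr \<omega>)"
        using Cv_ge1
        by (simp add: sum_ennreal ennreal_mult[symmetric] less_imp_le sum_distrib_left sum_distrib_right mult_ac)
      also have "\<dots> \<le> ennreal (?s * ?v * t powr (\<omega> * q))"
        using Cv_ge1 t q omega_pos
        by (intro ennreal_leI mult_left_mono powr_mono mult_nonneg_nonneg sum_nonneg) (auto simp: less_imp_le)
      finally show "P t \<le> ennreal (?s * ?v * t powr (\<omega> * q))" .
    qed
    define R where "R = (SUP t\<in>{1..}. P t * ennreal (t powr (- (\<omega> * q))))"
    have P_le_R: "P t \<le> R * ennreal (t powr (\<omega> * q))" if "1 \<le> t" for t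
    proof -
      have "P t * ennreal (t powr (- (\<omega> * q))) * ennreal (t powr (\<omega> * q)) \<le> R * ennreal (t powr (\<omega> * q))"
        unfolding R_def using that by (intro mult_right_mono SUP_upper) auto
      moreover have "ennreal (t powr (- (\<omega> * q))) * ennreal (t powr (\<omega> * q)) = 1"
        using that by (simp add: ennreal_mult[symmetric] powr_minus)
      ultimately show ?thesis by (simp add: mult.assoc)
    qed
    have R_finite: "R < \<infinity>"
    proof -
      obtain K where K: "0 \<le> K" "\<And>t. 1 \<le> t \<Longrightarrow> P t \<le> ennreal (K * t powr (\<omega> * q))"
        using apriori by auto
      have "R \<le> ennreal K"
        unfolding R_def
      proof (intro SUP_least)
        fix t :: real assume "t \<in> {1..}"
        then have t: "1 \<le> t" by simp
        have "P t * ennreal (t powr (- (\<omega> * q))) \<le> ennreal (K * t powr (\<omega> * q)) * ennreal (t powr (- (\<omega> * q)))"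
          by (intro mult_right_mono K t) auto
        also have "\<dots> = ennreal K"
          using t K by (simp add: ennreal_mult[symmetric] powr_minus)
        finally show "P t * ennreal (t powr (- (\<omega> * q))) \<le> ennreal K" .
      qed
      then show ?thesis by (rule order.strict_trans1) simp
    qed
    have "R \<le> ennreal E * I + ennreal (1 / 2) * R"
      unfolding R_def
    proof (intro SUP_least, fold R_def)
      fix t :: real assume "t \<in> {1..}"
      then have t: "1 \<le> t" by simp
      \<comment> \<open>The factor t^\<omega> in s compensates the volume growth of the balls, so
        both coefficients below become free of t.\<close>
      define s where "s = s0 * t powr \<omega>"
      have s: "0 < s" using s0 t by (simp add: s_def)
      have ct: "1 \<le> c * t" using mult_mono[OF c t] c by simp
      have "(\<integral>\<^sup>+y. ennreal (G y * h (c * t) y powr (q - 1)) \<partial>M)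
        \<le> (\<integral>\<^sup>+y. ennreal (s powr (q - 1)) * ennreal (G y powr q) + ennreal (1 / s) * ennreal (h (c * t) y powr q) \<partial>M)"
      proof (intro nn_integral_mono)
        fix y
        have "ennreal (G y * h (c * t) y powr (q - 1)) \<le> ennreal (s powr (q - 1) * G y powr q + 1 / s * h (c * t) y powr q)"
          using mult_powr_le_split[OF G_nonneg h_nonneg s q, of y "c * t" y] by (intro ennreal_leI) simp
        also have "\<dots> = ennreal (s powr (q - 1)) * ennreal (G y powr q) + ennreal (1 / s) * ennreal (h (c * t) y powr q)"
          using s by (subst ennreal_plus) (auto simp: ennreal_mult'[symmetric])
        finally show "ennreal (G y * h (c * t) y powr (q - 1)) \<le> \<dots>" .
      qed
      also have "\<dots> = ennreal (s powr (q - 1)) * I + ennreal (1 / s) * P (c * t)"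
        unfolding I_def P_def by (subst nn_integral_add) (auto simp: nn_integral_cmult)
      also have "\<dots> \<le> ennreal (s powr (q - 1)) * I + ennreal (1 / s) * (R * ennreal ((c * t) powr (\<omega> * q)))"
        by (intro add_left_mono mult_left_mono P_le_R ct) auto
      finally have "P t \<le> ennreal (D * t powr \<omega>) * (ennreal (s powr (q - 1)) * I + ennreal (1 / s) * (R * ennreal ((c * t) powr (\<omega> * q))))"
        using step[OF t] by (meson mult_left_mono order_trans zero_le)
      then have "P t * ennreal (t powr (- (\<omega> * q))) \<le>
         ennreal (D * t powr \<omega>) * (ennreal (s powr (q - 1)) * I + ennreal (1 / s) * (R * ennreal ((c * t) powr (\<omega> * q)))) * ennreal (t powr (- (\<omega> * q)))"
        by (intro mult_right_mono) auto
      also have "\<dots> = ennreal (D * t powr \<omega> * s powr (q - 1) * t powr (- (\<omega> * q))) * I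
         + ennreal (D * t powr \<omega> * (1 / s) * (c * t) powr (\<omega> * q) * t powr (- (\<omega> * q))) * R"
        using D s by (intro ennreal_affine_rescale) auto
      also have "D * t powr \<omega> * s powr (q - 1) * t powr (- (\<omega> * q)) = E"
      proof -
        have "s powr (q - 1) = s0 powr (q - 1) * t powr (\<omega> * (q - 1))"
          using t s0 by (simp add: s_def powr_mult powr_powr)
        then have "D * t powr \<omega> * s powr (q - 1) * t powr (- (\<omega> * q))
          = E * (t powr \<omega> * t powr (\<omega> * (q - 1)) * t powr (- (\<omega> * q)))"
          by (simp add: E_def)
        also have "t powr \<omega> * t powr (\<omega> * (q - 1)) * t powr (- (\<omega> * q)) = 1"
          using t by (simp add: powr_add[symmetric] algebra_simps)
        finally show ?thesis by simp
      qed
      also have "D * t powr \<omega> * (1 / s) * (c * t) powr (\<omega> * q) * t powr (- (\<omega> * q)) = 1 / 2"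
        using t c D by (simp add: s_def s0_def powr_mult powr_minus field_simps)
      finally show "P t * ennreal (t powr (- (\<omega> * q))) \<le> ennreal E * I + ennreal (1 / 2) * R" .
    qed
    then have "R \<le> 2 * (ennreal E * I)"
      by (rule ennreal_absorb_half) (rule R_finite)
    then have "P t0 \<le> 2 * (ennreal E * I) * ennreal (t0 powr (\<omega> * q))"
      by (intro order_trans[OF P_le_R[OF t0]] mult_right_mono) auto
    also have "\<dots> = ennreal (2 * E * t0 powr (\<omega> * q)) * I"
      using E by (simp add: ennreal_mult mult_ac)
    finally show "(\<integral>\<^sup>+x. ennreal ((\<Sum>i\<in>J. a i * indicator (qball S (snd i) (t0 * \<delta> powi fst i)) x) powr q) \<partial>M)
      \<le> ennreal (2 * E * t0 powr (\<omega> * q)) * (\<integral>\<^sup>+x. ennreal ((\<Sum>i\<in>J. a i * indicator (icube n i) x) powr q) \<partial>M)"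
      by (simp add: P_def I_def h_def f_def G_def g_def B_def)
  qed
qed

text \<open>The weight is split over dyadic balls of aperture 2^(m + 1). Of the exponent \<omega> +
  2, the part \<omega> pays for the aperture, one unit supplies the geometric weights of
  \<open>ennreal_powr_suminf_le\<close>, and the last unit makes the sum over m converge.\<close>

lemma weighted_sum_le_finite_large:
  assumes q: "1 \<le> q"
  obtains C where "0 < C"
    "\<And>J a. finite J \<Longrightarrow> J \<subseteq> cube_index n \<Longrightarrow> (\<And>i. 0 \<le> a i) \<Longrightarrow>
      (\<integral>\<^sup>+x. ennreal ((\<Sum>i\<in>J. a i * \<rho> (fst i) x (snd i) powr (- (\<omega> + 2))) powr q) \<partial>M)
      \<le> ennreal C * (\<integral>\<^sup>+x. ennreal ((\<Sum>i\<in>J. a i * indicator (icube n i) x) powr q) \<partial>M)"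
proof -
  obtain C where C: "0 < C"
    "\<And>J a t. finite J \<Longrightarrow> J \<subseteq> cube_index n \<Longrightarrow> (\<And>i. 0 \<le> a i) \<Longrightarrow> 1 \<le> t \<Longrightarrow>
      (\<integral>\<^sup>+x. ennreal ((\<Sum>i\<in>J. a i * indicator (qball S (snd i) (t * \<delta> powi fst i)) x) powr q) \<partial>M)
      \<le> ennreal (C * t powr (\<omega> * q)) * (\<integral>\<^sup>+x. ennreal ((\<Sum>i\<in>J. a i * indicator (icube n i) x) powr q) \<partial>M)"
  proof -
    show ?thesis by (rule aperture_sum_le_finite[OF q, of n]) (fact that)
  qed
  define D where "D = 2 powr q * (C * 2 powr (\<omega> * q)) * 2"
  show thesis
  proof (rule that[of D])
    show "0 < D" using C by (simp add: D_def)
    fix J and a :: "int \<times> 'a \<Rightarrow> real"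
    assume J: "finite J" "J \<subseteq> cube_index n" and a: "\<And>i. 0 \<le> a i"
    define B where "B m i = qball S (snd i) (2 ^ (m + 1) * \<delta> powi fst i)" for m and i :: "int \<times> 'a"
    define h where "h m x = (\<Sum>i\<in>J. a i * indicator (B m i) x)" for m x
    define I where "I = (\<integral>\<^sup>+x. ennreal ((\<Sum>i\<in>J. a i * indicator (icube n i) x) powr q) \<partial>M)"
    define v where "v m x = ennreal (2 powr (- (\<omega> + 1) * real m) * h m x)" for m x
    have h_nonneg: "0 \<le> h m x" for m x
      using a by (simp add: h_def sum_nonneg)
    have [measurable]: "h m \<in> borel_measurable M" for m
      by (simp add: h_def[abs_def] B_def)
    have [measurable]: "v m \<in> borel_measurable M" for m
      by (simp add: v_def[abs_def])
    have pt: "ennreal (\<Sum>i\<in>J. a i * \<rho> (fst i) x (snd i) powr (- (\<omega> + 2))) \<le> (\<Sum>m. ennreal ((1 / 2) ^ m) * v m x)" for x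
    proof -
      have "ennreal (\<Sum>i\<in>J. a i * \<rho> (fst i) x (snd i) powr (- (\<omega> + 2)))
        = (\<Sum>i\<in>J. ennreal (a i) * ennreal (\<rho> (fst i) (snd i) x powr (- (\<omega> + 2))))"
        using a by (simp add: sum_ennreal ennreal_mult'[symmetric] \<rho>_sym)
      also have "\<dots> \<le> (\<Sum>i\<in>J. ennreal (a i) * (\<Sum>m. ennreal (2 powr (- (\<omega> + 2) * real m)) * indicator (B m i) x))"
        unfolding B_def using omega_pos by (intro sum_mono mult_left_mono \<rho>_powr_le_annuli) auto
      also have "\<dots> = (\<Sum>i\<in>J. \<Sum>m. ennreal (a i) * (ennreal (2 powr (- (\<omega> + 2) * real m)) * indicator (B m i) x))"
        by simp
      also have "\<dots> = (\<Sum>m. \<Sum>i\<in>J. ennreal (a i) * (ennreal (2 powr (- (\<omega> + 2) * real m)) * indicator (B m i) x))"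
        by (rule suminf_sum[symmetric]) simp
      also have "\<dots> = (\<Sum>m. ennreal ((1 / 2) ^ m) * v m x)"
      proof (intro suminf_cong)
        fix m
        have pw: "2 powr (- (\<omega> + 2) * real m) = (1 / 2) ^ m * 2 powr (- (\<omega> + 1) * real m)"
        proof -
          have "(1 / 2) ^ m = 2 powr (- real m)"
            by (simp add: powr_minus powr_realpow power_one_over divide_simps)
          moreover have "- (\<omega> + 2) * real m = - real m + - (\<omega> + 1) * real m"
            by (simp add: algebra_simps)
          ultimately show ?thesis by (simp only: powr_add)
        qed
        have "(\<Sum>i\<in>J. ennreal (a i) * (ennreal (2 powr (- (\<omega> + 2) * real m)) * indicator (B m i) x))
          = (\<Sum>i\<in>J. ennreal (2 powr (- (\<omega> + 2) * real m) * (a i * indicator (B m i) x)))"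
          using a by (intro sum.cong) (auto simp: ennreal_mult mult_ac split: split_indicator)
        also have "\<dots> = ennreal (2 powr (- (\<omega> + 2) * real m) * h m x)"
          using a by (subst sum_ennreal) (auto simp: h_def sum_distrib_left)
        also have "\<dots> = ennreal ((1 / 2) ^ m) * v m x"
          unfolding pw v_def using h_nonneg[of m x] by (subst ennreal_mult[symmetric]) (auto simp: mult.assoc)
        finally show "(\<Sum>i\<in>J. ennreal (a i) * (ennreal (2 powr (- (\<omega> + 2) * real m)) * indicator (B m i) x))
          = ennreal ((1 / 2) ^ m) * v m x" .
      qed
      finally show ?thesis .
    qed
    have "(\<integral>\<^sup>+x. ennreal ((\<Sum>i\<in>J. a i * \<rho> (fst i) x (snd i) powr (- (\<omega> + 2))) powr q) \<partial>M)
      \<le> (\<integral>\<^sup>+x. ennreal (2 powr q) * (\<Sum>m. ennreal_powr (v m x) q) \<partial>M)"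
    proof (intro nn_integral_mono)
      fix x
      have "ennreal ((\<Sum>i\<in>J. a i * \<rho> (fst i) x (snd i) powr (- (\<omega> + 2))) powr q)
        = ennreal_powr (ennreal (\<Sum>i\<in>J. a i * \<rho> (fst i) x (snd i) powr (- (\<omega> + 2)))) q"
        using a by (simp add: ennreal_powr_ennreal sum_nonneg)
      also have "\<dots> \<le> ennreal_powr (\<Sum>m. ennreal ((1 / 2) ^ m) * v m x) q"
        using q by (intro ennreal_powr_mono pt) auto
      also have "\<dots> \<le> ennreal (2 powr q) * (\<Sum>m. ennreal_powr (v m x) q)"
        using q by (intro ennreal_powr_suminf_le) auto
      finally show "ennreal ((\<Sum>i\<in>J. a i * \<rho> (fst i) x (snd i) powr (- (\<omega> + 2))) powr q) \<le> \<dots>" .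
    qed
    also have "\<dots> = ennreal (2 powr q) * (\<Sum>m. \<integral>\<^sup>+x. ennreal_powr (v m x) q \<partial>M)"
      by (subst nn_integral_cmult, measurable, subst nn_integral_suminf) simp_all
    also have "(\<Sum>m. \<integral>\<^sup>+x. ennreal_powr (v m x) q \<partial>M) \<le> (\<Sum>m. ennreal (C * 2 powr (\<omega> * q) * (1 / 2) ^ m) * I)"
    proof (intro suminf_le summableI)
      fix m :: nat
      have t: "(1 :: real) \<le> 2 ^ (m + 1)" by (rule one_le_power) simp
      have "(\<integral>\<^sup>+x. ennreal_powr (v m x) q \<partial>M)
        = (\<integral>\<^sup>+x. ennreal (2 powr (- (\<omega> + 1) * real m * q)) * ennreal (h m x powr q) \<partial>M)"
        using h_nonneg q
        by (intro nn_integral_cong) (simp add: v_def ennreal_mult ennreal_powr_mult ennreal_powr_ennreal powr_powr)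
      also have "\<dots> = ennreal (2 powr (- (\<omega> + 1) * real m * q)) * (\<integral>\<^sup>+x. ennreal (h m x powr q) \<partial>M)"
        by (intro nn_integral_cmult) measurable
      also have "\<dots> \<le> ennreal (2 powr (- (\<omega> + 1) * real m * q)) * (ennreal (C * (2 ^ (m + 1)) powr (\<omega> * q)) * I)"
        unfolding h_def B_def I_def by (intro mult_left_mono C(2) J a t) auto
      also have "\<dots> = ennreal (2 powr (- (\<omega> + 1) * real m * q) * (C * (2 ^ (m + 1)) powr (\<omega> * q))) * I"
        using C by (simp add: ennreal_mult[symmetric] mult.assoc[symmetric])
      also have "2 powr (- (\<omega> + 1) * real m * q) * (C * (2 ^ (m + 1)) powr (\<omega> * q)) \<le> C * 2 powr (\<omega> * q) * (1 / 2) ^ m"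
      proof -
        have eq: "(2 :: real) ^ (m + 1) = 2 powr (real m + 1)"
          by (simp add: powr_add powr_realpow)
        have "2 powr (- (\<omega> + 1) * real m * q) * (2 ^ (m + 1)) powr (\<omega> * q) = 2 powr (\<omega> * q - q * real m)"
          unfolding eq by (simp add: powr_powr powr_add[symmetric] algebra_simps)
        \<comment> \<open>By q \<ge> 1 the remaining decay 2^(-q m) is at least as good as
          2^(-m).\<close>
        also have "\<dots> \<le> 2 powr (\<omega> * q - real m)"
          using q by (intro powr_mono) (auto simp: mult_le_cancel_right1)
        also have "\<dots> = 2 powr (\<omega> * q) * (1 / 2) ^ m"
          by (simp add: powr_diff powr_realpow power_one_over)
        finally show ?thesis
          using C(1) by (simp add: mult_left_mono mult.left_commute mult.assoc)
      qed
      then have "ennreal (2 powr (- (\<omega> + 1) * real m * q) * (C * (2 ^ (m + 1)) powr (\<omega> * q))) * I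
          \<le> ennreal (C * 2 powr (\<omega> * q) * (1 / 2) ^ m) * I"
        by (intro mult_right_mono ennreal_leI) auto
      finally show "(\<integral>\<^sup>+x. ennreal_powr (v m x) q \<partial>M) \<le> ennreal (C * 2 powr (\<omega> * q) * (1 / 2) ^ m) * I" .
    qed
    also have "(\<Sum>m. ennreal (C * 2 powr (\<omega> * q) * (1 / 2) ^ m) * I) = (\<Sum>m. ennreal (C * 2 powr (\<omega> * q) * (1 / 2) ^ m)) * I"
      by simp
    also have "(\<Sum>m. ennreal (C * 2 powr (\<omega> * q) * (1 / 2) ^ m)) = ennreal (C * 2 powr (\<omega> * q) * 2)"
    proof (subst suminf_ennreal2)
      show "ennreal (\<Sum>m. C * 2 powr (\<omega> * q) * (1 / 2) ^ m) = ennreal (C * 2 powr (\<omega> * q) * 2)"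
        by (subst suminf_mult) (auto simp: suminf_geometric)
    qed (use C in \<open>auto intro!: summable_mult summable_geometric\<close>)
    finally show "(\<integral>\<^sup>+x. ennreal ((\<Sum>i\<in>J. a i * \<rho> (fst i) x (snd i) powr (- (\<omega> + 2))) powr q) \<partial>M)
      \<le> ennreal D * (\<integral>\<^sup>+x. ennreal ((\<Sum>i\<in>J. a i * indicator (icube n i) x) powr q) \<partial>M)"
      using C by (simp add: D_def I_def ennreal_mult[symmetric] mult.assoc[symmetric] mult_left_mono)
  qed
qed

text \<open>The sum of the exponents for q \<le> 1 and for q \<ge> 1, so that one quantity dominates
  both.\<close>

definition decay_exponent :: "real \<Rightarrow> real" where
  "decay_exponent q = (\<omega> + 1) / q + (\<omega> + 2)"

theorem weighted_sum_le:
  fixes q :: real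
  assumes q: "0 < q"
  obtains C where "0 < C"
    "\<And>(a :: int \<times> 'a \<Rightarrow> ennreal) L. decay_exponent q \<le> L \<Longrightarrow>
      (\<integral>\<^sup>+x. ennreal_powr (\<integral>\<^sup>+i. a i * wt L (fst i) x (snd i) \<partial>count_space (cube_index n)) q \<partial>M)
      \<le> ennreal C * (\<integral>\<^sup>+x. ennreal_powr (\<integral>\<^sup>+i. a i * indicator (icube n i) x \<partial>count_space (cube_index n)) q \<partial>M)"
proof -
  have "\<exists>L0 C. L0 \<le> decay_exponent q \<and> 0 < C \<and> (\<forall>J a. finite J \<longrightarrow> J \<subseteq> cube_index n \<longrightarrow> (\<forall>i. 0 \<le> a i) \<longrightarrow>
      (\<integral>\<^sup>+x. ennreal ((\<Sum>i\<in>J. a i * \<rho> (fst i) x (snd i) powr (- L0)) powr q) \<partial>M)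
      \<le> ennreal C * (\<integral>\<^sup>+x. ennreal ((\<Sum>i\<in>J. a i * indicator (icube n i) x) powr q) \<partial>M))"
  proof (cases "q \<le> 1")
    case True
    show ?thesis
    proof (rule weighted_sum_le_finite_small[OF q True, of n])
      fix C :: real
      assume "0 < C"
        and "\<And>J a. finite J \<Longrightarrow> J \<subseteq> cube_index n \<Longrightarrow> (\<And>i. 0 \<le> a i) \<Longrightarrow>
          (\<integral>\<^sup>+x. ennreal ((\<Sum>i\<in>J. a i * \<rho> (fst i) x (snd i) powr (- ((\<omega> + 1) / q))) powr q) \<partial>M)
          \<le> ennreal C * (\<integral>\<^sup>+x. ennreal ((\<Sum>i\<in>J. a i * indicator (icube n i) x) powr q) \<partial>M)"
      then show ?thesis
        using q omega_pos
        by (intro exI[of _ "((\<omega> + 1) / q)"] exI[of _ C] conjI allI impI) (auto simp: decay_exponent_def)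
    qed
  next
    case False
    then have "1 \<le> q" by simp
    show ?thesis
    proof (rule weighted_sum_le_finite_large[OF \<open>1 \<le> q\<close>, of n])
      fix C :: real
      assume "0 < C"
        and "\<And>J a. finite J \<Longrightarrow> J \<subseteq> cube_index n \<Longrightarrow> (\<And>i. 0 \<le> a i) \<Longrightarrow>
          (\<integral>\<^sup>+x. ennreal ((\<Sum>i\<in>J. a i * \<rho> (fst i) x (snd i) powr (- (\<omega> + 2))) powr q) \<partial>M)
          \<le> ennreal C * (\<integral>\<^sup>+x. ennreal ((\<Sum>i\<in>J. a i * indicator (icube n i) x) powr q) \<partial>M)"
      then show ?thesis
        using q omega_pos
        by (intro exI[of _ "(\<omega> + 2)"] exI[of _ C] conjI allI impI) (auto simp: decay_exponent_def)
    qed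
  qed
  then obtain L0 C where L0: "L0 \<le> decay_exponent q" and C: "0 < C" and fin: "\<And>J a. finite J \<Longrightarrow> J \<subseteq> cube_index n \<Longrightarrow> (\<And>i. 0 \<le> a i) \<Longrightarrow>
      (\<integral>\<^sup>+x. ennreal ((\<Sum>i\<in>J. a i * \<rho> (fst i) x (snd i) powr (- L0)) powr q) \<partial>M)
      \<le> ennreal C * (\<integral>\<^sup>+x. ennreal ((\<Sum>i\<in>J. a i * indicator (icube n i) x) powr q) \<partial>M)"
    by blast
  show thesis
  proof (rule that[of C])
    show "0 < C" by (rule C)
    fix a :: "int \<times> 'a \<Rightarrow> ennreal" and L :: real assume "decay_exponent q \<le> L"
    with L0 have L: "L0 \<le> L" by linarith
    let ?I = "cube_index n"
    define F where "F x = (\<integral>\<^sup>+i. a i * indicator (icube n i) x \<partial>count_space ?I)" for x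
    define H where "H x = (\<integral>\<^sup>+i. a i * wt L0 (fst i) x (snd i) \<partial>count_space ?I)" for x
    define e where "e = from_nat_into ?I"
    have bij: "bij_betw e UNIV ?I"
      unfolding e_def by (intro bij_betw_from_nat_into countable_cube_index infinite_cube_index)
    then have e: "e m \<in> ?I" and inj: "inj_on e A" for m A
      by (auto simp: bij_betw_def inj_on_def)
    have sum: "(\<integral>\<^sup>+i. f i \<partial>count_space ?I) = (SUP N. \<Sum>i\<in>e ` {..<N}. f i)" for f :: "int \<times> 'a \<Rightarrow> ennreal"
      by (simp add: nn_integral_bij_count_space[OF bij, symmetric] nn_integral_count_space_nat
          suminf_eq_SUP sum.reindex[OF inj])
    have main: "(\<integral>\<^sup>+x. ennreal_powr (H x) q \<partial>M) \<le> ennreal C * (\<integral>\<^sup>+x. ennreal_powr (F x) q \<partial>M)"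
    proof (cases "\<exists>i\<in>?I. a i = \<infinity>")
      case True
      \<comment> \<open>An infinite coefficient makes the right-hand side infinite, since its cube
        has positive measure.\<close>
      then obtain i where i: "i \<in> ?I" "a i = \<infinity>" by auto
      then have \<alpha>: "snd i \<in> X (fst i + int n)" by (simp add: cube_index_iff)
      have "(\<integral>\<^sup>+x. \<infinity> * indicator (icube n i) x \<partial>M) \<le> (\<integral>\<^sup>+x. ennreal_powr (F x) q \<partial>M)"
      proof (intro nn_integral_mono)
        fix x
        show "\<infinity> * indicator (icube n i) x \<le> ennreal_powr (F x) q"
        proof (cases "x \<in> icube n i")
          case True
          then have "\<infinity> = a i * indicator (icube n i) x" using i by simp
          also have "\<dots> \<le> F x"
            unfolding F_def using i by (intro nn_integral_ge_point)
          finally show ?thesis by (simp add: top_unique)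
        qed simp
      qed
      also have "(\<integral>\<^sup>+x. \<infinity> * indicator (icube n i) x \<partial>M) = \<infinity>"
        using sets_icube[OF i(1)] measure_cube_pos[OF \<alpha>] emeasure_cube[OF \<alpha>]
        by (subst nn_integral_cmult_indicator) (auto simp: ennreal_top_mult)
      finally show ?thesis using C by (simp add: top_unique ennreal_mult_top)
    next
      case False
      define b where "b i = enn2real (a i)" for i
      have b: "0 \<le> b i" for i by (simp add: b_def)
      have ab: "a i = ennreal (b i)" if "i \<in> ?I" for i
        using False that by (auto simp: b_def less_top)
      define HN where "HN N x = (\<Sum>i\<in>e ` {..<N}. a i * wt L0 (fst i) x (snd i))" for N x
      have [measurable]: "HN N \<in> borel_measurable M" for N
        unfolding HN_def by measurable
      have mono: "incseq (\<lambda>N. HN N x)" for x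
        unfolding HN_def incseq_def by (auto intro!: sum_mono2)
      have "(\<integral>\<^sup>+x. ennreal_powr (H x) q \<partial>M) = (\<integral>\<^sup>+x. (SUP N. ennreal_powr (HN N x) q) \<partial>M)"
        using ennreal_powr_SUP[OF q mono] by (simp add: H_def sum HN_def)
      also have "\<dots> = (SUP N. \<integral>\<^sup>+x. ennreal_powr (HN N x) q \<partial>M)"
        using mono q
        by (intro nn_integral_monotone_convergence_SUP) (auto simp: incseq_def le_fun_def intro!: ennreal_powr_mono)
      also have "\<dots> \<le> ennreal C * (\<integral>\<^sup>+x. ennreal_powr (F x) q \<partial>M)"
      proof (intro SUP_least)
        fix N
        let ?J = "e ` {..<N}"
        have J: "finite ?J" "?J \<subseteq> ?I" using e by auto
        have "(\<integral>\<^sup>+x. ennreal_powr (HN N x) q \<partial>M)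
          = (\<integral>\<^sup>+x. ennreal ((\<Sum>i\<in>?J. b i * \<rho> (fst i) x (snd i) powr (- L0)) powr q) \<partial>M)"
        proof (intro nn_integral_cong)
          fix x
          have "HN N x = (\<Sum>i\<in>?J. ennreal (b i * \<rho> (fst i) x (snd i) powr (- L0)))"
            unfolding HN_def
          proof (intro sum.cong refl)
            fix i assume "i \<in> ?J"
            with J have "i \<in> ?I" by blast
            then show "a i * wt L0 (fst i) x (snd i) = ennreal (b i * \<rho> (fst i) x (snd i) powr (- L0))"
              using b[of i] by (simp add: ab ennreal_mult)
          qed
          then have "HN N x = ennreal (\<Sum>i\<in>?J. b i * \<rho> (fst i) x (snd i) powr (- L0))"
            using b by (subst (asm) sum_ennreal) auto
          then show "ennreal_powr (HN N x) q = ennreal ((\<Sum>i\<in>?J. b i * \<rho> (fst i) x (snd i) powr (- L0)) powr q)"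
            using b by (simp add: ennreal_powr_ennreal sum_nonneg)
        qed
        also have "\<dots> \<le> ennreal C * (\<integral>\<^sup>+x. ennreal ((\<Sum>i\<in>?J. b i * indicator (icube n i) x) powr q) \<partial>M)"
          by (intro fin J b)
        also have "\<dots> \<le> ennreal C * (\<integral>\<^sup>+x. ennreal_powr (F x) q \<partial>M)"
        proof (intro mult_left_mono nn_integral_mono)
          fix x
          have "ennreal (\<Sum>i\<in>?J. b i * indicator (icube n i) x) = (\<Sum>i\<in>?J. a i * indicator (icube n i) x)"
          proof (subst sum_ennreal[symmetric])
            show "(\<Sum>i\<in>?J. ennreal (b i * indicator (icube n i) x)) = (\<Sum>i\<in>?J. a i * indicator (icube n i) x)"
            proof (intro sum.cong refl)
              fix i assume "i \<in> ?J"
              with J have "i \<in> ?I" by blast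
              then show "ennreal (b i * indicator (icube n i) x) = a i * indicator (icube n i) x"
                by (simp add: ab split: split_indicator)
            qed
          qed (use b in auto)
          also have "\<dots> \<le> F x"
            unfolding F_def sum by (rule SUP_upper) simp
          finally have "ennreal_powr (ennreal (\<Sum>i\<in>?J. b i * indicator (icube n i) x)) q \<le> ennreal_powr (F x) q"
            using q by (intro ennreal_powr_mono) auto
          then show "ennreal ((\<Sum>i\<in>?J. b i * indicator (icube n i) x) powr q) \<le> ennreal_powr (F x) q"
            using b by (simp add: ennreal_powr_ennreal sum_nonneg)
        qed simp
        finally show "(\<integral>\<^sup>+x. ennreal_powr (HN N x) q \<partial>M) \<le> ennreal C * (\<integral>\<^sup>+x. ennreal_powr (F x) q \<partial>M)" .
      qed
      finally show ?thesis .
    qed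
    have "(\<integral>\<^sup>+x. ennreal_powr (\<integral>\<^sup>+i. a i * wt L (fst i) x (snd i) \<partial>count_space ?I) q \<partial>M)
      \<le> (\<integral>\<^sup>+x. ennreal_powr (H x) q \<partial>M)"
      unfolding H_def using q L
      by (intro nn_integral_mono ennreal_powr_mono mult_left_mono ennreal_leI \<rho>_powr_antimono) auto
    from order_trans[OF this main] show "(\<integral>\<^sup>+x. ennreal_powr (\<integral>\<^sup>+i. a i * wt L (fst i) x (snd i) \<partial>count_space ?I) q \<partial>M)
      \<le> ennreal C * (\<integral>\<^sup>+x. ennreal_powr (\<integral>\<^sup>+i. a i * indicator (icube n i) x \<partial>count_space ?I) q \<partial>M)"
      by (simp only: F_def)
  qed
qed

end

section \<open>Iteration in the two variables\<close>

definition double_sum ::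
  "'i set \<Rightarrow> 'j set \<Rightarrow> ('i \<Rightarrow> 'j \<Rightarrow> ennreal) \<Rightarrow> ('i \<Rightarrow> 'a \<Rightarrow> ennreal) \<Rightarrow> ('j \<Rightarrow> 'b \<Rightarrow> ennreal) \<Rightarrow>
   'a \<Rightarrow> 'b \<Rightarrow> ennreal" where
  "double_sum I J b u v x y = (\<integral>\<^sup>+i. \<integral>\<^sup>+j. b i j * u i x * v j y \<partial>count_space J \<partial>count_space I)"

text \<open>With y frozen, the inner sum is a mere coefficient for the one-parameter inequality in
  x.\<close>

lemma double_sum_left: "double_sum I J b u v x y = (\<integral>\<^sup>+i. (\<integral>\<^sup>+j. b i j * v j y \<partial>count_space J) * u i x \<partial>count_space I)"
  unfolding double_sum_def
  by (intro nn_integral_cong, subst nn_integral_multc[symmetric]) (auto simp: mult_ac)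

lemma double_sum_right:
  assumes "countable J"
  shows "double_sum I J b u v x y = (\<integral>\<^sup>+j. (\<integral>\<^sup>+i. b i j * u i x \<partial>count_space I) * v j y \<partial>count_space J)"
  unfolding double_sum_def
  by (subst nn_integral_count_space_swap[OF assms, symmetric])
     (intro nn_integral_cong, subst nn_integral_multc[symmetric], auto simp: mult_ac)

lemma borel_measurable_double_sum:
  assumes I: "countable I" and J: "countable J"
    and [measurable]: "\<And>i. i \<in> I \<Longrightarrow> u i \<in> borel_measurable M" "\<And>j. j \<in> J \<Longrightarrow> v j \<in> borel_measurable N"
  shows "(\<lambda>z. double_sum I J b u v (fst z) (snd z)) \<in> borel_measurable (M \<Otimes>\<^sub>M N)"
  unfolding double_sum_def by (intro borel_measurable_nn_integral_count_space I J) measurable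

context dyadic_space
begin

lemma sigma_finite_M: "sigma_finite_measure M"
proof
  fix x
  let ?B = "\<lambda>n :: nat. qball S x (real n + 1)"
  have "y \<in> (\<Union>n. ?B n)" for y
  proof -
    obtain n :: nat where "d x y < real n"
      using reals_Archimedean2 by blast
    then show ?thesis by (auto simp: qball_def intro!: exI[of _ n])
  qed
  then show "\<exists>A. countable A \<and> A \<subseteq> sets M \<and> \<Union> A = space M \<and> (\<forall>a\<in>A. emeasure M a \<noteq> \<infinity>)"
    using emeasure_ball_finite[of "real n + 1" x for n]
    by (intro exI[of _ "range ?B"]) (force simp: less_top[symmetric])
qed

lemma nn_integral_cube_index:
  "(\<integral>\<^sup>+i. f (fst i) (snd i) \<partial>count_space (cube_index n))
    = (\<integral>\<^sup>+k. \<integral>\<^sup>+\<alpha>. f k \<alpha> \<partial>pts n k \<partial>count_space UNIV)"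
  unfolding cube_index_def by (rule nn_integral_count_space_Sigma[symmetric])

end

locale dyadic_pair =
  one: dyadic_space S1 \<omega>1 \<delta>1 X1 Q1 + two: dyadic_space S2 \<omega>2 \<delta>2 X2 Q2
  for S1 :: "'a qm_space" and \<omega>1 \<delta>1 :: real and X1 Q1
    and S2 :: "'b qm_space" and \<omega>2 \<delta>2 :: real and X2 Q2
begin

lemma product_weighted_sum_le:
  fixes q :: real
  assumes q: "0 < q"
  obtains C where "0 < C"
    "\<And>b L. max (one.decay_exponent q) (two.decay_exponent q) \<le> L \<Longrightarrow>
      (\<integral>\<^sup>+z. ennreal_powr (double_sum (one.cube_index n1) (two.cube_index n2) b
          (\<lambda>i x. one.wt L (fst i) x (snd i))
          (\<lambda>j y. two.wt L (fst j) y (snd j)) (fst z) (snd z)) q \<partial>(one.M \<Otimes>\<^sub>M two.M))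
      \<le> ennreal C * (\<integral>\<^sup>+z. ennreal_powr (double_sum (one.cube_index n1) (two.cube_index n2) b
          (\<lambda>i. indicator (one.icube n1 i)) (\<lambda>j. indicator (two.icube n2 j)) (fst z) (snd z)) q \<partial>(one.M \<Otimes>\<^sub>M two.M))"
proof (rule one.weighted_sum_le[OF q, of n1], rule two.weighted_sum_le[OF q, of n2])
  fix C1 C2 :: real
  let ?I = "one.cube_index n1" and ?J = "two.cube_index n2"
  assume C1: "0 < C1" and C2: "0 < C2"
    and key1: "\<And>(a :: int \<times> 'a \<Rightarrow> ennreal) L. one.decay_exponent q \<le> L \<Longrightarrow>
      (\<integral>\<^sup>+x. ennreal_powr (\<integral>\<^sup>+i. a i * one.wt L (fst i) x (snd i) \<partial>count_space ?I) q \<partial>one.M)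
      \<le> ennreal C1 * (\<integral>\<^sup>+x. ennreal_powr (\<integral>\<^sup>+i. a i * indicator (one.icube n1 i) x \<partial>count_space ?I) q \<partial>one.M)"
    and key2: "\<And>(a :: int \<times> 'b \<Rightarrow> ennreal) L. two.decay_exponent q \<le> L \<Longrightarrow>
      (\<integral>\<^sup>+x. ennreal_powr (\<integral>\<^sup>+i. a i * two.wt L (fst i) x (snd i) \<partial>count_space ?J) q \<partial>two.M)
      \<le> ennreal C2 * (\<integral>\<^sup>+x. ennreal_powr (\<integral>\<^sup>+i. a i * indicator (two.icube n2 i) x \<partial>count_space ?J) q \<partial>two.M)"
  interpret M1: sigma_finite_measure one.M by (rule one.sigma_finite_M)
  interpret M2: sigma_finite_measure two.M by (rule two.sigma_finite_M)
  interpret pair_sigma_finite one.M two.M ..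
  show thesis
  proof (rule that[of "C2 * C1"])
    show "0 < C2 * C1" using C1 C2 by simp
    fix b and L :: real assume L: "max (one.decay_exponent q) (two.decay_exponent q) \<le> L"
    define w1 where "w1 i x = one.wt L (fst i) x (snd i)" for i :: "int \<times> 'a" and x
    define w2 where "w2 j y = two.wt L (fst j) y (snd j)" for j :: "int \<times> 'b" and y
    define c1 where "c1 i = (indicator (one.icube n1 i) :: 'a \<Rightarrow> ennreal)" for i
    define c2 where "c2 j = (indicator (two.icube n2 j) :: 'b \<Rightarrow> ennreal)" for j
    have [measurable]: "w1 i \<in> borel_measurable one.M" "w2 j \<in> borel_measurable two.M" for i j
      by (simp_all add: w1_def[abs_def] w2_def[abs_def])
    have [measurable]: "i \<in> ?I \<Longrightarrow> c1 i \<in> borel_measurable one.M" "j \<in> ?J \<Longrightarrow> c2 j \<in> borel_measurable two.M" for i j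
      by (auto simp: c1_def c2_def intro!: borel_measurable_indicator one.sets_icube two.sets_icube)
    note I = one.countable_cube_index[of n1] and J = two.countable_cube_index[of n2]
    have [measurable]: "(\<lambda>z. double_sum ?I ?J b w1 w2 (fst z) (snd z)) \<in> borel_measurable (one.M \<Otimes>\<^sub>M two.M)"
      "(\<lambda>z. double_sum ?I ?J b w1 c2 (fst z) (snd z)) \<in> borel_measurable (one.M \<Otimes>\<^sub>M two.M)"
      "(\<lambda>z. double_sum ?I ?J b c1 c2 (fst z) (snd z)) \<in> borel_measurable (one.M \<Otimes>\<^sub>M two.M)"
      by (intro borel_measurable_double_sum I J; measurable)+
    have "(\<integral>\<^sup>+z. ennreal_powr (double_sum ?I ?J b w1 w2 (fst z) (snd z)) q \<partial>(one.M \<Otimes>\<^sub>M two.M))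
      = (\<integral>\<^sup>+x. \<integral>\<^sup>+y. ennreal_powr (double_sum ?I ?J b w1 w2 x y) q \<partial>two.M \<partial>one.M)"
      by (subst M2.nn_integral_fst[symmetric]) auto
    \<comment> \<open>For frozen x the coefficient of j is the sum over i of
      \<open>b i j * w1 i x\<close>, which may be infinite.\<close>
    also have "\<dots> \<le> (\<integral>\<^sup>+x. ennreal C2 * (\<integral>\<^sup>+y. ennreal_powr (double_sum ?I ?J b w1 c2 x y) q \<partial>two.M) \<partial>one.M)"
      unfolding double_sum_right[OF J] w2_def c2_def using L by (intro nn_integral_mono key2) auto
    also have "\<dots> = ennreal C2 * (\<integral>\<^sup>+x. \<integral>\<^sup>+y. ennreal_powr (double_sum ?I ?J b w1 c2 x y) q \<partial>two.M \<partial>one.M)"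
      using M2.borel_measurable_nn_integral_fst[of "\<lambda>z. ennreal_powr (double_sum ?I ?J b w1 c2 (fst z) (snd z)) q" one.M]
      by (intro nn_integral_cmult) simp
    \<comment> \<open>Fubini exchanges the roles: y is now frozen, with the indicators in y already
      in place.\<close>
    also have "(\<integral>\<^sup>+x. \<integral>\<^sup>+y. ennreal_powr (double_sum ?I ?J b w1 c2 x y) q \<partial>two.M \<partial>one.M)
      = (\<integral>\<^sup>+y. \<integral>\<^sup>+x. ennreal_powr (double_sum ?I ?J b w1 c2 x y) q \<partial>one.M \<partial>two.M)"
      using Fubini[of "\<lambda>z. ennreal_powr (double_sum ?I ?J b w1 c2 (fst z) (snd z)) q"] by simp
    also have "\<dots> \<le> (\<integral>\<^sup>+y. ennreal C1 * (\<integral>\<^sup>+x. ennreal_powr (double_sum ?I ?J b c1 c2 x y) q \<partial>one.M) \<partial>two.M)"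
      unfolding double_sum_left w1_def c1_def using L by (intro nn_integral_mono key1) auto
    also have "\<dots> = ennreal C1 * (\<integral>\<^sup>+y. \<integral>\<^sup>+x. ennreal_powr (double_sum ?I ?J b c1 c2 x y) q \<partial>one.M \<partial>two.M)"
      using M1.borel_measurable_nn_integral_fst[OF measurable_pair_swap[of "\<lambda>z. ennreal_powr (double_sum ?I ?J b c1 c2 (fst z) (snd z)) q" one.M two.M borel]]
      by (intro nn_integral_cmult) (simp add: case_prod_beta)
    also have "(\<integral>\<^sup>+y. \<integral>\<^sup>+x. ennreal_powr (double_sum ?I ?J b c1 c2 x y) q \<partial>one.M \<partial>two.M)
      = (\<integral>\<^sup>+z. ennreal_powr (double_sum ?I ?J b c1 c2 (fst z) (snd z)) q \<partial>(one.M \<Otimes>\<^sub>M two.M))"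
      using nn_integral_snd[of "\<lambda>z. ennreal_powr (double_sum ?I ?J b c1 c2 (fst z) (snd z)) q"] by simp
    finally show "(\<integral>\<^sup>+z. ennreal_powr (double_sum ?I ?J b (\<lambda>i x. one.wt L (fst i) x (snd i))
          (\<lambda>j y. two.wt L (fst j) y (snd j)) (fst z) (snd z)) q \<partial>(one.M \<Otimes>\<^sub>M two.M))
      \<le> ennreal (C2 * C1) * (\<integral>\<^sup>+z. ennreal_powr (double_sum ?I ?J b
          (\<lambda>i. indicator (one.icube n1 i)) (\<lambda>j. indicator (two.icube n2 j)) (fst z) (snd z)) q \<partial>(one.M \<Otimes>\<^sub>M two.M))"
      using C1 C2 by (simp add: w1_def[abs_def] w2_def[abs_def] c1_def[abs_def] c2_def[abs_def]
          ennreal_mult[symmetric] mult.assoc[symmetric] mult_left_mono)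
  qed
qed

text \<open>The common shape of all the square functions before the root is taken: coefficients H
  that are constant on products of cubes.\<close>

definition cube_series :: "nat \<Rightarrow> nat \<Rightarrow> (int \<Rightarrow> 'a \<Rightarrow> int \<Rightarrow> 'b \<Rightarrow> ennreal) \<Rightarrow> 'a \<Rightarrow> 'b \<Rightarrow> ennreal" where
  "cube_series n1 n2 H x y = (\<Sum>\<^sub>\<infinity>k1. \<Sum>\<^sub>\<infinity>\<alpha>1\<in>X1 (k1 + int n1). \<Sum>\<^sub>\<infinity>k2. \<Sum>\<^sub>\<infinity>\<alpha>2\<in>X2 (k2 + int n2).
     H k1 \<alpha>1 k2 \<alpha>2 * indicator (Q1 (k1 + int n1) \<alpha>1) x * indicator (Q2 (k2 + int n2) \<alpha>2) y)"

lemma cube_series_nn_integral: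
  "cube_series n1 n2 H x y = (\<integral>\<^sup>+k1. \<integral>\<^sup>+\<alpha>1. \<integral>\<^sup>+k2. \<integral>\<^sup>+\<alpha>2.
     H k1 \<alpha>1 k2 \<alpha>2 * indicator (Q1 (k1 + int n1) \<alpha>1) x * indicator (Q2 (k2 + int n2) \<alpha>2) y
     \<partial>two.pts n2 k2 \<partial>count_space UNIV \<partial>one.pts n1 k1 \<partial>count_space UNIV)"
  unfolding cube_series_def
  by (simp add: infsum_eq_nn_integral_count_space one.countable_X two.countable_X)

lemma cube_series_double_sum:
  "cube_series n1 n2 H x y = double_sum (one.cube_index n1) (two.cube_index n2)
     (\<lambda>i j. H (fst i) (snd i) (fst j) (snd j))
     (\<lambda>i. indicator (one.icube n1 i)) (\<lambda>j. indicator (two.icube n2 j)) x y"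
  unfolding cube_series_nn_integral double_sum_def
  by (subst one.nn_integral_cube_index, subst two.nn_integral_cube_index) (rule refl)

text \<open>The same pair of scales stands on both sides, and the bound is required at every point
  of the cube of H. The generations of the cubes carrying H and b may differ.\<close>

definition cube_dominated ::
  "nat \<Rightarrow> nat \<Rightarrow> nat \<Rightarrow> nat \<Rightarrow> real \<Rightarrow> real \<Rightarrow> (int \<Rightarrow> 'a \<Rightarrow> int \<Rightarrow> 'b \<Rightarrow> ennreal) \<Rightarrow>
   (int \<Rightarrow> 'a \<Rightarrow> int \<Rightarrow> 'b \<Rightarrow> ennreal) \<Rightarrow> bool" where
  "cube_dominated n1 n2 m1 m2 L C H b \<longleftrightarrow> (\<forall>k1 k2. \<forall>\<alpha>1\<in>X1 (k1 + int n1). \<forall>\<alpha>2\<in>X2 (k2 + int n2).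
     \<forall>x\<in>Q1 (k1 + int n1) \<alpha>1. \<forall>y\<in>Q2 (k2 + int n2) \<alpha>2.
       H k1 \<alpha>1 k2 \<alpha>2 \<le> ennreal C * (\<integral>\<^sup>+\<beta>1. \<integral>\<^sup>+\<beta>2. b k1 \<beta>1 k2 \<beta>2
         * one.wt L k1 x \<beta>1 * two.wt L k2 y \<beta>2
         \<partial>two.pts m2 k2 \<partial>one.pts m1 k1))"

text \<open>K serves all H, b and L at once, which is what later makes the constants uniform in the
  distribution.\<close>

lemma cube_series_le:
  fixes q :: real
  assumes q: "0 < q"
  obtains K where "0 < K"
    "\<And>H b C L. max (one.decay_exponent q) (two.decay_exponent q) \<le> L \<Longrightarrow> 0 < C \<Longrightarrow>
      cube_dominated n1 n2 m1 m2 L C H b \<Longrightarrow>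
      (\<integral>\<^sup>+z. ennreal_powr (cube_series n1 n2 H (fst z) (snd z)) q \<partial>(one.M \<Otimes>\<^sub>M two.M))
      \<le> ennreal (C powr q * K) * (\<integral>\<^sup>+z. ennreal_powr (cube_series m1 m2 b (fst z) (snd z)) q \<partial>(one.M \<Otimes>\<^sub>M two.M))"
proof (rule product_weighted_sum_le[OF q, of m1 m2])
  fix K :: real
  let ?I = "one.cube_index m1" and ?J = "two.cube_index m2"
  assume K: "0 < K" and key: "\<And>b L. max (one.decay_exponent q) (two.decay_exponent q) \<le> L \<Longrightarrow>
      (\<integral>\<^sup>+z. ennreal_powr (double_sum ?I ?J b
          (\<lambda>i x. one.wt L (fst i) x (snd i))
          (\<lambda>j y. two.wt L (fst j) y (snd j)) (fst z) (snd z)) q \<partial>(one.M \<Otimes>\<^sub>M two.M))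
      \<le> ennreal K * (\<integral>\<^sup>+z. ennreal_powr (double_sum ?I ?J b
          (\<lambda>i. indicator (one.icube m1 i)) (\<lambda>j. indicator (two.icube m2 j)) (fst z) (snd z)) q \<partial>(one.M \<Otimes>\<^sub>M two.M))"
  show thesis
  proof (rule that[of K])
    show "0 < K" by (rule K)
    fix H b C and L :: real
    assume L: "max (one.decay_exponent q) (two.decay_exponent q) \<le> L" and C: "0 < C"
      and H: "cube_dominated n1 n2 m1 m2 L C H b"
    define E where "E k1 k2 x y = (\<integral>\<^sup>+\<beta>1. \<integral>\<^sup>+\<beta>2. b k1 \<beta>1 k2 \<beta>2
           * one.wt L k1 x \<beta>1 * two.wt L k2 y \<beta>2
           \<partial>two.pts m2 k2 \<partial>one.pts m1 k1)" for k1 k2 x y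
    have pt: "cube_series n1 n2 H x y \<le> ennreal C * double_sum ?I ?J (\<lambda>i j. b (fst i) (snd i) (fst j) (snd j))
          (\<lambda>i x. one.wt L (fst i) x (snd i))
          (\<lambda>j y. two.wt L (fst j) y (snd j)) x y" for x y
    proof -
      have "cube_series n1 n2 H x y \<le> (\<integral>\<^sup>+k1. \<integral>\<^sup>+\<alpha>1. \<integral>\<^sup>+k2. \<integral>\<^sup>+\<alpha>2.
         (ennreal C * E k1 k2 x y) * indicator (Q1 (k1 + int n1) \<alpha>1) x * indicator (Q2 (k2 + int n2) \<alpha>2) y
         \<partial>two.pts n2 k2 \<partial>count_space UNIV \<partial>one.pts n1 k1 \<partial>count_space UNIV)"
        unfolding cube_series_nn_integral E_def
        using H by (intro nn_integral_mono) (auto simp: cube_dominated_def split: split_indicator)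
      \<comment> \<open>In each generation exactly one cube contains the given point, so both sums
        over cubes collapse to a term that no longer depends on the cube.\<close>
      also have "\<dots> = (\<integral>\<^sup>+k1. \<integral>\<^sup>+k2. ennreal C * E k1 k2 x y \<partial>count_space UNIV \<partial>count_space UNIV)"
      proof (intro nn_integral_cong)
        fix k1
        obtain \<alpha> where \<alpha>: "\<alpha> \<in> X1 (k1 + int n1)" "x \<in> Q1 (k1 + int n1) \<alpha>"
          using one.cube_cover by blast
        have "(\<integral>\<^sup>+\<alpha>2. (ennreal C * E k1 k2 x y) * indicator (Q1 (k1 + int n1) \<alpha>1) x * indicator (Q2 (k2 + int n2) \<alpha>2) y
           \<partial>two.pts n2 k2) = ennreal C * E k1 k2 x y * indicator (Q1 (k1 + int n1) \<alpha>1) x" for k2 \<alpha>1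
        proof -
          obtain \<beta> where "\<beta> \<in> X2 (k2 + int n2)" "y \<in> Q2 (k2 + int n2) \<beta>"
            using two.cube_cover by blast
          then show ?thesis by (rule two.cube_sum)
        qed
        then show "(\<integral>\<^sup>+\<alpha>1. \<integral>\<^sup>+k2. \<integral>\<^sup>+\<alpha>2. (ennreal C * E k1 k2 x y) * indicator (Q1 (k1 + int n1) \<alpha>1) x
            * indicator (Q2 (k2 + int n2) \<alpha>2) y \<partial>two.pts n2 k2 \<partial>count_space UNIV \<partial>one.pts n1 k1)
          = (\<integral>\<^sup>+k2. ennreal C * E k1 k2 x y \<partial>count_space UNIV)"
          by (simp add: nn_integral_multc one.cube_sum[OF \<alpha>])
      qed
      also have "\<dots> = ennreal C * (\<integral>\<^sup>+k1. \<integral>\<^sup>+k2. E k1 k2 x y \<partial>count_space UNIV \<partial>count_space UNIV)"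
        by (simp add: nn_integral_cmult)
      also have "(\<integral>\<^sup>+k1. \<integral>\<^sup>+k2. E k1 k2 x y \<partial>count_space UNIV \<partial>count_space UNIV)
        = double_sum ?I ?J (\<lambda>i j. b (fst i) (snd i) (fst j) (snd j))
          (\<lambda>i x. one.wt L (fst i) x (snd i))
          (\<lambda>j y. two.wt L (fst j) y (snd j)) x y"
        unfolding double_sum_def E_def
        by (subst one.nn_integral_cube_index, subst two.nn_integral_cube_index,
            intro nn_integral_cong nn_integral_count_space_swap one.countable_X two.countable_X) simp
      finally show ?thesis .
    qed
    have "(\<integral>\<^sup>+z. ennreal_powr (cube_series n1 n2 H (fst z) (snd z)) q \<partial>(one.M \<Otimes>\<^sub>M two.M))
      \<le> (\<integral>\<^sup>+z. ennreal (C powr q) * ennreal_powr (double_sum ?I ?J (\<lambda>i j. b (fst i) (snd i) (fst j) (snd j))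
          (\<lambda>i x. one.wt L (fst i) x (snd i))
          (\<lambda>j y. two.wt L (fst j) y (snd j)) (fst z) (snd z)) q \<partial>(one.M \<Otimes>\<^sub>M two.M))"
      using q C
      by (intro nn_integral_mono order_trans[OF ennreal_powr_mono[OF pt]])
         (auto simp: ennreal_powr_mult ennreal_powr_ennreal)
    also have "\<dots> = ennreal (C powr q) * (\<integral>\<^sup>+z. ennreal_powr (double_sum ?I ?J (\<lambda>i j. b (fst i) (snd i) (fst j) (snd j))
          (\<lambda>i x. one.wt L (fst i) x (snd i))
          (\<lambda>j y. two.wt L (fst j) y (snd j)) (fst z) (snd z)) q \<partial>(one.M \<Otimes>\<^sub>M two.M))"
      by (intro nn_integral_cmult borel_measurable_ennreal_powr borel_measurable_double_sum
          one.countable_cube_index two.countable_cube_index) measurable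
    also have "\<dots> \<le> ennreal (C powr q) * (ennreal K * (\<integral>\<^sup>+z. ennreal_powr (cube_series m1 m2 b (fst z) (snd z)) q \<partial>(one.M \<Otimes>\<^sub>M two.M)))"
      unfolding cube_series_double_sum by (intro mult_left_mono key L) auto
    finally show "(\<integral>\<^sup>+z. ennreal_powr (cube_series n1 n2 H (fst z) (snd z)) q \<partial>(one.M \<Otimes>\<^sub>M two.M))
      \<le> ennreal (C powr q * K) * (\<integral>\<^sup>+z. ennreal_powr (cube_series m1 m2 b (fst z) (snd z)) q \<partial>(one.M \<Otimes>\<^sub>M two.M))"
      using K by (simp add: ennreal_mult mult.assoc)
  qed
qed

end

section \<open>Wavelets and test functions\<close>

lemma exp_powr_decay:
  fixes a \<nu> L :: real
  assumes a: "0 < a" and \<nu>: "0 < \<nu>" and L: "0 \<le> L"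
  obtains C where "0 < C" "\<And>t. 0 \<le> t \<Longrightarrow> exp (- \<nu> * t powr a) \<le> C * (1 + t) powr (- L)"
proof -
  \<comment> \<open>An integer with a m \<ge> L, so that (t^a)^m controls t^L for t \<ge> 1.\<close>
  define m where "m = Suc (nat \<lceil>L / a\<rceil>)"
  have m: "0 < m" "L \<le> a * real m"
    using a by (auto simp: m_def field_simps) (smt (verit) divide_le_eq mult.commute of_nat_ceiling)
  define C where "C = 2 powr L * max 1 ((real m / \<nu>) ^ m)"
  show thesis
  proof (rule that[of C])
    show "0 < C" by (simp add: C_def)
    fix t :: real assume t: "0 \<le> t"
    have "exp (- \<nu> * t powr a) * (1 + t) powr L \<le> C"
    proof (cases "t \<le> 1")
      case True
      have "exp (- \<nu> * t powr a) * (1 + t) powr L \<le> 1 * 2 powr L"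
        using True t \<nu> L by (intro mult_mono powr_mono2) auto
      also have "\<dots> \<le> C" by (simp add: C_def)
      finally show ?thesis .
    next
      case False
      let ?u = "\<nu> * t powr a"
      have u: "0 < ?u" using \<nu> False by simp
      \<comment> \<open>The exponential dominates its argument; applied to u / m and raised to the
        power m, this bounds u^m by m^m times exp u.\<close>
      have "(?u / real m) ^ m \<le> (exp (?u / real m)) ^ m"
      proof (rule power_mono)
        show "?u / real m \<le> exp (?u / real m)"
          using exp_ge_add_one_self[of "?u / real m"] by linarith
      qed (use u m in simp)
      also have "\<dots> = exp ?u"
        using m by (simp add: exp_of_nat_mult[symmetric])
      finally have "(t powr a) ^ m \<le> (real m / \<nu>) ^ m * exp ?u"
        using \<nu> m by (simp add: power_divide power_mult_distrib field_simps)
      moreover have "(1 + t) powr L \<le> 2 powr L * (t powr a) ^ m"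
      proof -
        have "(1 + t) powr L \<le> (2 * t) powr L"
          using False L by (intro powr_mono2) auto
        also have "\<dots> = 2 powr L * t powr L"
          using False by (simp add: powr_mult)
        also have "t powr L \<le> t powr (a * real m)"
          using False m by (intro powr_mono) auto
        also have "\<dots> = (t powr a) ^ m"
          using False by (simp add: powr_powr[symmetric] powr_realpow)
        finally show ?thesis by simp
      qed
      ultimately have "(1 + t) powr L \<le> 2 powr L * ((real m / \<nu>) ^ m * exp ?u)"
        by (smt (verit) mult_left_mono powr_ge_zero)
      also have "\<dots> \<le> C * exp ?u"
        by (simp add: C_def)
      finally show ?thesis
        by (simp add: exp_minus field_simps)
    qed
    then show "exp (- \<nu> * t powr a) \<le> C * (1 + t) powr (- L)"
      using t by (simp add: powr_minus field_simps)
  qed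
qed

text \<open>A real-valued estimate that feeds every clause of the product norm. The denominators
  with V(x, x0) and with V(x0, x) are both kept because the one-parameter and the product regularity
  conditions use different ones, and y ranges over the closed set of the product condition.\<close>

definition test_estimate :: "'a qm_space \<Rightarrow> 'a \<Rightarrow> real \<Rightarrow> real \<Rightarrow> ('a \<Rightarrow> real) \<Rightarrow> real \<Rightarrow> bool" where
  "test_estimate S x0 b \<gamma> f T \<longleftrightarrow> 0 < T \<and>
    (\<forall>x. \<bar>f x\<bar> \<le> T * (1 / (vol S 1 x0 + vol2 S x x0)) * (1 / (1 + qdist S x x0)) powr \<gamma>) \<and>
    (\<forall>x y. qdist S x y \<le> 1 / (2 * qconst S) * (1 + qdist S x x0) \<longrightarrow>
       \<bar>f x - f y\<bar> \<le> T * (qdist S x y / (1 + qdist S x x0)) powr b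
         * (1 / (vol S 1 x0 + vol2 S x x0)) * (1 / (1 + qdist S x x0)) powr \<gamma> \<and>
       \<bar>f x - f y\<bar> \<le> T * (qdist S x y / (1 + qdist S x x0)) powr b
         * (1 / (vol S 1 x0 + vol2 S x0 x)) * (1 / (1 + qdist S x x0)) powr \<gamma>)"

locale wavelet_space = dyadic_space S \<omega> \<delta> X Q
  for S :: "'a qm_space" and \<omega> \<delta> :: real and X :: "int \<Rightarrow> 'a set" and Q +
  fixes \<eta> :: real and \<psi> :: "int \<Rightarrow> 'a \<Rightarrow> 'a \<Rightarrow> real"
  assumes wavelets: "wavelet_basis S \<delta> X \<eta> \<psi>"
begin

lemma eta_pos: "0 < \<eta>"
  using wavelets by (simp_all add: wavelet_basis_def)

lemma new_points_subset: "new_points X k \<subseteq> X (k + int 1)"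
  by (auto simp: new_points_def)

lemma countable_new_points: "countable (new_points X k)"
  using new_points_subset countable_X countable_subset by blast

lemma integrable_wavelet: "\<beta> \<in> new_points X k \<Longrightarrow> integrable M (\<psi> k \<beta>)"
  and integral_wavelet: "\<beta> \<in> new_points X k \<Longrightarrow> (\<integral>x. \<psi> k \<beta> x \<partial>M) = 0"
  using wavelets by (simp_all add: wavelet_basis_def)

lemma borel_measurable_wavelet: "\<beta> \<in> new_points X k \<Longrightarrow> \<psi> k \<beta> \<in> borel_measurable M"
  using integrable_wavelet by auto

lemma orthonormal_wavelet:
  assumes "\<alpha> \<in> new_points X k" "\<beta> \<in> new_points X k"
  shows "(\<integral>x. \<psi> k \<alpha> x * \<psi> k \<beta> x \<partial>M) = (if \<alpha> = \<beta> then 1 else 0)"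
proof -
  have on: "\<forall>i\<in>(SIGMA k:UNIV. new_points X k). \<forall>j\<in>(SIGMA k:UNIV. new_points X k).
      (\<integral>x. (case i of (k, \<alpha>) \<Rightarrow> \<psi> k \<alpha>) x * (case j of (k, \<alpha>) \<Rightarrow> \<psi> k \<alpha>) x \<partial>M) = (if i = j then 1 else 0)"
  proof -
    have "orthonormal_basis_L2 M (SIGMA k:UNIV. new_points X k) (\<lambda>(k, \<alpha>). \<psi> k \<alpha>)"
      using wavelets by (simp add: wavelet_basis_def)
    from conjunct1[OF conjunct2[OF this[unfolded orthonormal_basis_L2_def]]] show ?thesis .
  qed
  have "(\<integral>x. (case (k, \<alpha>) of (k, \<alpha>) \<Rightarrow> \<psi> k \<alpha>) x * (case (k, \<beta>) of (k, \<alpha>) \<Rightarrow> \<psi> k \<alpha>) x \<partial>M)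
    = (if (k, \<alpha>) = (k, \<beta>) then 1 else 0)"
    using assms by (intro on[rule_format]) auto
  then show ?thesis by simp
qed

text \<open>The exponential decay beats every power of \<rho>, so L remains at the disposal of the
  later arguments; the volume of the ball is exchanged for that of the cube of the wavelet.\<close>

lemma wavelet_estimates:
  assumes L: "0 \<le> L"
  obtains C where "0 < C"
    "\<And>k \<beta> x. \<beta> \<in> new_points X k \<Longrightarrow>
      \<bar>\<psi> k \<beta> x\<bar> \<le> C * mass k \<beta> * \<rho> k x \<beta> powr (- L)"
    "\<And>k \<beta> x y. \<beta> \<in> new_points X k \<Longrightarrow> d x y \<le> \<delta> powi k \<Longrightarrow>
      \<bar>\<psi> k \<beta> x - \<psi> k \<beta> y\<bar> \<le> C * mass k \<beta> * (d x y / \<delta> powi k) powr \<eta> * \<rho> k x \<beta> powr (- L)"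
proof -
  define a where "a = 1 / (1 + 2 * log 2 A)"
  have "0 \<le> log 2 A" using A_ge1 by simp
  then have a: "0 < a" by (simp add: a_def add_pos_nonneg)
  obtain C \<nu> where C: "0 < C" and \<nu>: "0 < \<nu>"
    and size: "\<And>k \<alpha> x. \<alpha> \<in> new_points X k \<Longrightarrow>
       \<bar>\<psi> k \<alpha> x\<bar> \<le> C * vol S (\<delta> powi k) \<alpha> powr (- 1 / 2) * exp (- \<nu> * (d \<alpha> x / \<delta> powi k) powr a)"
    and holder: "\<And>k \<alpha> x y. \<alpha> \<in> new_points X k \<Longrightarrow> d x y \<le> \<delta> powi k \<Longrightarrow>
       \<bar>\<psi> k \<alpha> x - \<psi> k \<alpha> y\<bar> \<le> C * vol S (\<delta> powi k) \<alpha> powr (- 1 / 2)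
         * (d x y / \<delta> powi k) powr \<eta> * exp (- \<nu> * (d \<alpha> x / \<delta> powi k) powr a)"
    using wavelets unfolding wavelet_basis_def a_def by blast
  obtain CL where CL: "0 < CL" "\<And>t. 0 \<le> t \<Longrightarrow> exp (- \<nu> * t powr a) \<le> CL * (1 + t) powr (- L)"
    using exp_powr_decay[OF a \<nu> L] by blast
  obtain C1 where C1: "1 \<le> C1"
    "\<And>k \<alpha>. \<alpha> \<in> X (k + int 1) \<Longrightarrow> measure M (Q (k + int 1) \<alpha>) \<le> C1 * V k \<alpha>"
    using cube_volume[of 1] by metis
  define D where "D = C * C1 powr (1 / 2) * CL"
  have vol: "vol S (\<delta> powi k) \<beta> powr (- 1 / 2) \<le> C1 powr (1 / 2) * mass k \<beta>"
    if \<beta>: "\<beta> \<in> new_points X k" for k \<beta>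
  proof -
    have \<beta>': "\<beta> \<in> X (k + int 1)" using \<beta> new_points_subset by auto
    have "V k \<beta> powr (- (1 / 2)) \<le> C1 powr (1 / 2) * measure M (Q (k + int 1) \<beta>) powr (- (1 / 2))"
      using C1(1) C1(2)[OF \<beta>'] measure_cube_pos[OF \<beta>'] by (intro powr_neg_le_powr_neg) auto
    then show ?thesis by (simp add: V_def)
  qed
  have decay: "exp (- \<nu> * (d \<beta> x / \<delta> powi k) powr a) \<le> CL * \<rho> k x \<beta> powr (- L)" for k \<beta> x
    using CL(2)[of "d \<beta> x / \<delta> powi k"] by (simp add: \<rho>_def d_sym)
  show thesis
  proof (rule that[of D])
    show "0 < D" using C C1 CL by (simp add: D_def)
    fix k \<beta> x assume \<beta>: "\<beta> \<in> new_points X k"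
    have "\<bar>\<psi> k \<beta> x\<bar> \<le> C * (C1 powr (1 / 2) * mass k \<beta>) * (CL * \<rho> k x \<beta> powr (- L))"
      using C CL by (intro order_trans[OF size[OF \<beta>]] mult_mono vol[OF \<beta>] decay mult_nonneg_nonneg) auto
    then show "\<bar>\<psi> k \<beta> x\<bar> \<le> D * mass k \<beta> * \<rho> k x \<beta> powr (- L)"
      by (simp add: D_def mult_ac)
    fix y assume xy: "d x y \<le> \<delta> powi k"
    have "\<bar>\<psi> k \<beta> x - \<psi> k \<beta> y\<bar> \<le> C * (C1 powr (1 / 2) * mass k \<beta>)
        * (d x y / \<delta> powi k) powr \<eta> * (CL * \<rho> k x \<beta> powr (- L))"
      using C CL by (intro order_trans[OF holder[OF \<beta> xy]] mult_mono vol[OF \<beta>] decay mult_nonneg_nonneg) auto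
    then show "\<bar>\<psi> k \<beta> x - \<psi> k \<beta> y\<bar> \<le> D * mass k \<beta> * (d x y / \<delta> powi k) powr \<eta> * \<rho> k x \<beta> powr (- L)"
      by (simp add: D_def mult_ac)
  qed
qed

text \<open>Two points of a cube of generation k + N are within A (4 A^2 + 4 A^2) \<delta>^(k + N)
  of each other, whence 8 A^3. The small factor is kept explicit and C is independent of N.\<close>

lemma wavelet_cube_oscillation:
  assumes L: "0 \<le> L"
  obtains C where "0 < C"
    "\<And>k \<beta> N \<alpha> x y. \<beta> \<in> new_points X k \<Longrightarrow> 8 * A ^ 3 * \<delta> ^ N \<le> 1 \<Longrightarrow> \<alpha> \<in> X (k + int N) \<Longrightarrow>
      x \<in> Q (k + int N) \<alpha> \<Longrightarrow> y \<in> Q (k + int N) \<alpha> \<Longrightarrow>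
      \<bar>\<psi> k \<beta> x - \<psi> k \<beta> y\<bar> \<le> C * (\<delta> ^ N) powr \<eta> * mass k \<beta> * \<rho> k x \<beta> powr (- L)"
proof -
  obtain C where C: "0 < C"
    "\<And>k \<beta> x y. \<beta> \<in> new_points X k \<Longrightarrow> d x y \<le> \<delta> powi k \<Longrightarrow>
      \<bar>\<psi> k \<beta> x - \<psi> k \<beta> y\<bar> \<le> C * mass k \<beta> * (d x y / \<delta> powi k) powr \<eta> * \<rho> k x \<beta> powr (- L)"
    using wavelet_estimates[OF L] by metis
  show thesis
  proof (rule that[of "C * (8 * A ^ 3) powr \<eta>"])
    show "0 < C * (8 * A ^ 3) powr \<eta>" using C by simp
    fix k \<beta> N \<alpha> x y
    assume \<beta>: "\<beta> \<in> new_points X k" and N: "8 * A ^ 3 * \<delta> ^ N \<le> 1"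
      and \<alpha>: "\<alpha> \<in> X (k + int N)" and xy: "x \<in> Q (k + int N) \<alpha>" "y \<in> Q (k + int N) \<alpha>"
    have "d x \<alpha> \<le> 4 * A\<^sup>2 * \<delta> powi (k + int N)" "d \<alpha> y \<le> 4 * A\<^sup>2 * \<delta> powi (k + int N)"
      using cube_outer[OF \<alpha>] xy by (auto simp: qball_def d_sym[of x])
    then have "d x y \<le> A * (4 * A\<^sup>2 * \<delta> powi (k + int N) + 4 * A\<^sup>2 * \<delta> powi (k + int N))"
      by (intro order_trans[OF d_triangle[of x y \<alpha>]] mult_left_mono add_mono) auto
    also have "\<dots> = 8 * A ^ 3 * \<delta> ^ N * \<delta> powi k"
      by (simp add: scale_add power2_eq_square power3_eq_cube)
    finally have d: "d x y \<le> 8 * A ^ 3 * \<delta> ^ N * \<delta> powi k" .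
    also have "\<dots> \<le> 1 * \<delta> powi k"
      by (intro mult_right_mono N) auto
    finally have small: "d x y \<le> \<delta> powi k" by simp
    have "(d x y / \<delta> powi k) powr \<eta> \<le> (8 * A ^ 3 * \<delta> ^ N) powr \<eta>"
      using d eta_pos by (intro powr_mono2) (auto simp: divide_le_eq)
    also have "\<dots> = (8 * A ^ 3) powr \<eta> * (\<delta> ^ N) powr \<eta>"
      using delta_pos by (simp add: powr_mult)
    finally have "C * mass k \<beta> * (d x y / \<delta> powi k) powr \<eta> * \<rho> k x \<beta> powr (- L)
       \<le> C * mass k \<beta> * ((8 * A ^ 3) powr \<eta> * (\<delta> ^ N) powr \<eta>) * \<rho> k x \<beta> powr (- L)"
      using C by (intro mult_right_mono mult_left_mono) auto
    with C(2)[OF \<beta> small] show "\<bar>\<psi> k \<beta> x - \<psi> k \<beta> y\<bar>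
        \<le> C * (8 * A ^ 3) powr \<eta> * (\<delta> ^ N) powr \<eta> * mass k \<beta> * \<rho> k x \<beta> powr (- L)"
      by (simp add: mult_ac)
  qed
qed

text \<open>Both balls occurring in the denominators lie in the ball of radius 2 A \<rho> about x0,
  whose volume is at most a constant times \<rho>^\<omega>. A decay \<rho>^(-\<omega>) therefore
  supplies the volume factor of a test function. The scale is 0 because the test functions have r =
  1.\<close>

lemma volume_denominator:
  fixes x0 :: 'a
  obtains C where "0 < C"
    "\<And>x. \<rho> 0 x x0 powr (- \<omega>) \<le> C * (1 / (vol S 1 x0 + vol2 S x x0))"
    "\<And>x. \<rho> 0 x x0 powr (- \<omega>) \<le> C * (1 / (vol S 1 x0 + vol2 S x0 x))"
proof -
  define C where "C = 2 * (Cv * (2 * A) powr \<omega> * vol S 1 x0)"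
  have v1: "0 < vol S 1 x0" by (rule vol_pos) simp
  have bound: "\<rho> 0 x x0 powr (- \<omega>) \<le> C * (1 / (vol S 1 x0 + v))"
    if v: "v = measure M B" and B: "B \<subseteq> qball S x0 (2 * A * \<rho> 0 x x0)" for B v x
  proof -
    let ?r = "2 * A * \<rho> 0 x x0"
    have "1 * 1 \<le> ?r" using A_ge1 by (intro mult_mono) auto
    then have r: "1 \<le> ?r" by simp
    have fin: "emeasure M (qball S x0 ?r) < \<infinity>"
      using r by (intro emeasure_ball_finite) auto
    have dil: "vol S ?r x0 \<le> Cv * ?r powr \<omega> * vol S 1 x0"
      using vol_dilate[OF r, of 1 x0] by simp
    have "v \<le> vol S ?r x0"
      unfolding v vol_def
    proof (cases "B \<in> sets M")
      case True
      then show "measure M B \<le> measure M (qball S x0 ?r)"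
        using fin B by (intro measure_mono_fmeasurable) (auto simp: fmeasurable_def)
    next
      case False
      then show "measure M B \<le> measure M (qball S x0 ?r)"
        by (simp add: measure_notin_sets)
    qed
    moreover have "vol S 1 x0 \<le> vol S ?r x0"
      using r by (intro vol_le_vol qball_mono) auto
    ultimately have le: "vol S 1 x0 + v \<le> 2 * (Cv * ?r powr \<omega> * vol S 1 x0)"
      using dil by linarith
    also have "\<dots> = C * \<rho> 0 x x0 powr \<omega>"
      by (simp add: C_def powr_mult)
    finally have "vol S 1 x0 + v \<le> C * \<rho> 0 x x0 powr \<omega>" .
    moreover have "0 < vol S 1 x0 + v" using v1 v by (simp add: add_pos_nonneg)
    moreover have "0 < \<rho> 0 x x0 powr \<omega>" using less_imp_neq[OF \<rho>_pos[of 0 x x0]] by simp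
    ultimately show ?thesis
      by (simp add: powr_minus field_simps)
  qed
  show thesis
  proof (rule that[of C])
    show "0 < C" using Cv_ge1 v1 by (simp add: C_def)
    fix x
    have d\<rho>: "d x x0 \<le> \<rho> 0 x x0" by (simp add: \<rho>_def)
    show "\<rho> 0 x x0 powr (- \<omega>) \<le> C * (1 / (vol S 1 x0 + vol2 S x x0))"
    proof (rule bound)
      show "qball S x (d x x0) \<subseteq> qball S x0 (2 * A * \<rho> 0 x x0)"
      proof
        fix z assume "z \<in> qball S x (d x x0)"
        then have "d x z < d x x0" by (simp add: qball_def)
        have "d x0 z \<le> A * (d x0 x + d x z)" by (rule d_triangle)
        also have "\<dots> < A * (\<rho> 0 x x0 + \<rho> 0 x x0)"
          using \<open>d x z < d x x0\<close> d\<rho> by (intro mult_strict_left_mono add_le_less_mono) (auto simp: d_sym[of x0 x])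
        finally show "z \<in> qball S x0 (2 * A * \<rho> 0 x x0)" by (simp add: qball_def)
      qed
    qed (simp add: vol2_def)
    show "\<rho> 0 x x0 powr (- \<omega>) \<le> C * (1 / (vol S 1 x0 + vol2 S x0 x))"
    proof (rule bound)
      have "1 * \<rho> 0 x x0 \<le> 2 * A * \<rho> 0 x x0" using A_ge1 by (intro mult_right_mono) auto
      then have "d x0 x \<le> 2 * A * \<rho> 0 x x0"
        using d\<rho> by (subst d_sym) linarith
      then show "qball S x0 (d x0 x) \<subseteq> qball S x0 (2 * A * \<rho> 0 x x0)"
        by (rule qball_mono)
    qed (simp add: vol2_def)
  qed
qed

text \<open>The exponent \<open>D\<close> does not depend on the scale, while the constant may.\<close>

lemma wavelet_test_estimate:
  fixes x0 :: 'a
  assumes \<gamma>: "0 < \<gamma>"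
  obtains D where "0 \<le> D"
    "\<And>k. \<exists>K>0. \<forall>\<beta>\<in>new_points X k. \<forall>b. 0 < b \<longrightarrow> b \<le> \<eta> \<longrightarrow>
       test_estimate S x0 b \<gamma> (\<psi> k \<beta>) (K * \<rho> k \<beta> x0 powr D)
       \<and> mass k \<beta> \<le> K * \<rho> k \<beta> x0 powr D"
proof -
  \<comment> \<open>\<omega> produces the volume factor, \<gamma> the decay of the test function,
    and \<eta> pays for the denominator in the regularity condition, where b \<le> \<eta>.\<close>
  define L where "L = \<omega> + \<gamma> + \<eta>"
  have L: "0 \<le> L" using omega_pos \<gamma> eta_pos by (simp add: L_def)
  obtain C where C: "0 < C"
    "\<And>k \<beta> x. \<beta> \<in> new_points X k \<Longrightarrow>
      \<bar>\<psi> k \<beta> x\<bar> \<le> C * mass k \<beta> * \<rho> k x \<beta> powr (- L)"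
    "\<And>k \<beta> x y. \<beta> \<in> new_points X k \<Longrightarrow> d x y \<le> \<delta> powi k \<Longrightarrow>
      \<bar>\<psi> k \<beta> x - \<psi> k \<beta> y\<bar> \<le> C * mass k \<beta> * (d x y / \<delta> powi k) powr \<eta> * \<rho> k x \<beta> powr (- L)"
    using wavelet_estimates[OF L] by metis
  obtain C1 where C1: "1 \<le> C1"
    "\<And>k \<alpha>. \<alpha> \<in> X (k + int 1) \<Longrightarrow> V k \<alpha> \<le> C1 * measure M (Q (k + int 1) \<alpha>)"
    using cube_volume[of 1] by metis
  obtain C2 where C2: "0 < C2"
    "\<And>x. \<rho> 0 x x0 powr (- \<omega>) \<le> C2 * (1 / (vol S 1 x0 + vol2 S x x0))"
    "\<And>x. \<rho> 0 x x0 powr (- \<omega>) \<le> C2 * (1 / (vol S 1 x0 + vol2 S x0 x))"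
    using volume_denominator[of x0] by metis
  \<comment> \<open>L is lost when the weight is moved from \<beta> to x0, and \<omega> is lost in
    the bound of \<open>mass\<close>.\<close>
  define D where "D = L + \<omega>"
  show thesis
  proof (rule that[of D])
    show "0 \<le> D" using L omega_pos by (simp add: D_def)
    fix k
    \<comment> \<open>Compares the scale \<delta>^k with the scale 1 of the test functions, one
      source of the dependence of K on k.\<close>
    define m where "m = max 1 (\<delta> powi k)"
    have m: "1 \<le> m" "0 < m" by (auto simp: m_def)
    define K0 where "K0 = (C1 * Cv * A powr \<omega> * (1 / V k x0)) powr (1 / 2)"
    define K1 where "K1 = C * K0 * (A powr L * m powr L)"
    define K where "K = max K0 (max 1 ((\<delta> powi k) powr (- \<eta>)) * (2 * K1 * (2 * A) powr L) * C2)"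
    have K0: "0 < K0" using C1 Cv_ge1 by (simp add: K0_def less_imp_neq[symmetric])
    have K1: "0 < K1" using C K0 m by (simp add: K1_def)
    have K: "0 < K" using K0 by (simp add: K_def less_max_iff_disj)
    have \<rho>0: "\<rho> 0 x y \<le> m * \<rho> k x y" for x y
    proof -
      have "d x y \<le> m * (d x y / \<delta> powi k)"
        using mult_right_mono[of "\<delta> powi k" m "d x y"] by (simp add: m_def field_simps)
      then show ?thesis using m by (simp add: \<rho>_def distrib_left)
    qed
    have mq: "mass k \<beta> \<le> K0 * \<rho> k \<beta> x0 powr \<omega>" if \<beta>: "\<beta> \<in> new_points X k" for \<beta>
    proof -
      have \<beta>': "\<beta> \<in> X (k + int 1)" using \<beta> new_points_subset by auto
      let ?mu = "measure M (Q (k + 1) \<beta>)"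
      have mu: "0 < ?mu" using measure_cube_pos[OF \<beta>'] by simp
      have "V k x0 \<le> Cv * (A * \<rho> k x0 \<beta>) powr \<omega> * V k \<beta>" by (rule V_change)
      also have "\<dots> \<le> Cv * (A * \<rho> k x0 \<beta>) powr \<omega> * (C1 * ?mu)"
        using C1(2)[OF \<beta>'] Cv_ge1 by (intro mult_left_mono) auto
      finally have "V k x0 \<le> (C1 * Cv * (A * \<rho> k \<beta> x0) powr \<omega>) * ?mu"
        by (simp add: \<rho>_sym mult_ac)
      then have "?mu powr (- (1 / 2)) \<le> (C1 * Cv * (A * \<rho> k \<beta> x0) powr \<omega>) powr (1 / 2) * V k x0 powr (- (1 / 2))"
        using C1 Cv_ge1 mu by (intro powr_neg_le_powr_neg mult_pos_pos) auto
      also have "\<dots> = K0 * (\<rho> k \<beta> x0 powr \<omega>) powr (1 / 2)"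
        using C1 Cv_ge1 by (simp add: K0_def powr_mult powr_minus powr_divide divide_simps)
      also have "(\<rho> k \<beta> x0 powr \<omega>) powr (1 / 2) \<le> \<rho> k \<beta> x0 powr \<omega>"
        using omega_pos by (simp add: powr_powr powr_mono)
      finally show ?thesis using K0 by (simp add: mult_left_mono)
    qed
    have main: "\<bar>\<psi> k \<beta> x\<bar> \<le> K1 * \<rho> k \<beta> x0 powr D * \<rho> 0 x x0 powr (- L)" (is ?size)
      "d x y \<le> \<delta> powi k \<Longrightarrow> \<bar>\<psi> k \<beta> x - \<psi> k \<beta> y\<bar> \<le> K1 * \<rho> k \<beta> x0 powr D * (d x y / \<delta> powi k) powr \<eta> * \<rho> 0 x x0 powr (- L)"
      if \<beta>: "\<beta> \<in> new_points X k" for \<beta> x y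
    proof -
      have "\<rho> k x \<beta> powr (- L) \<le> (A * \<rho> k \<beta> x0) powr L * \<rho> k x x0 powr (- L)"
        using L by (rule \<rho>_triangle_powr_neg)
      also have "\<rho> k x x0 powr (- L) \<le> m powr L * \<rho> 0 x x0 powr (- L)"
        using m L \<rho>0 by (intro powr_neg_le_powr_neg) auto
      finally have w: "\<rho> k x \<beta> powr (- L) \<le> (A * \<rho> k \<beta> x0) powr L * (m powr L * \<rho> 0 x x0 powr (- L))"
        by (simp add: mult_left_mono)
      have "C * mass k \<beta> * \<rho> k x \<beta> powr (- L)
        \<le> C * (K0 * \<rho> k \<beta> x0 powr \<omega>) * ((A * \<rho> k \<beta> x0) powr L * (m powr L * \<rho> 0 x x0 powr (- L)))"
        using C K0 by (intro mult_mono w mq[OF \<beta>] mult_nonneg_nonneg) auto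
      also have "\<dots> = K1 * (\<rho> k \<beta> x0 powr \<omega> * \<rho> k \<beta> x0 powr L) * \<rho> 0 x x0 powr (- L)"
        by (simp add: K1_def powr_mult mult_ac)
      also have "\<rho> k \<beta> x0 powr \<omega> * \<rho> k \<beta> x0 powr L = \<rho> k \<beta> x0 powr D"
        by (simp add: D_def powr_add[symmetric] add.commute)
      finally have *: "C * mass k \<beta> * \<rho> k x \<beta> powr (- L)
        \<le> K1 * \<rho> k \<beta> x0 powr D * \<rho> 0 x x0 powr (- L)" .
      show ?size by (rule order_trans[OF C(2)[OF \<beta>] *])
      assume "d x y \<le> \<delta> powi k"
      from C(3)[OF \<beta> this] mult_right_mono[OF *, of "(d x y / \<delta> powi k) powr \<eta>"]
      show "\<bar>\<psi> k \<beta> x - \<psi> k \<beta> y\<bar> \<le> K1 * \<rho> k \<beta> x0 powr D * (d x y / \<delta> powi k) powr \<eta> * \<rho> 0 x x0 powr (- L)"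
        by (simp add: mult_ac)
    qed
    show "\<exists>K>0. \<forall>\<beta>\<in>new_points X k. \<forall>b. 0 < b \<longrightarrow> b \<le> \<eta> \<longrightarrow>
       test_estimate S x0 b \<gamma> (\<psi> k \<beta>) (K * \<rho> k \<beta> x0 powr D)
       \<and> mass k \<beta> \<le> K * \<rho> k \<beta> x0 powr D"
    proof (intro exI[of _ K] conjI ballI allI impI K)
      fix \<beta> and b :: real assume \<beta>: "\<beta> \<in> new_points X k" and b: "0 < b" "b \<le> \<eta>"
      have "\<rho> k \<beta> x0 powr \<omega> \<le> \<rho> k \<beta> x0 powr D"
        using L by (intro powr_mono) (auto simp: D_def)
      then have "K0 * \<rho> k \<beta> x0 powr \<omega> \<le> K * \<rho> k \<beta> x0 powr D"
        using K0 K by (intro mult_mono) (auto simp: K_def)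
      then show "mass k \<beta> \<le> K * \<rho> k \<beta> x0 powr D"
        using mq[OF \<beta>] by linarith
      let ?P = "\<rho> k \<beta> x0 powr D" and ?n = "max 1 ((\<delta> powi k) powr (- \<eta>))" and ?B = "2 * K1 * (2 * A) powr L"
      have P: "0 < ?P" by (simp add: less_imp_neq[symmetric])
      have B: "0 < ?B" using K1 by simp
      have A2L: "1 \<le> (2 * A) powr L" using A_ge1 L by (intro ge_one_powr_ge_zero) auto
      have K1B: "K1 \<le> ?B" using K1 A2L mult_mono[of 1 2 1 "(2 * A) powr L"] by simp
      have \<rho>0_eq: "1 + d x x0 = \<rho> 0 x x0" for x by (simp add: \<rho>_def)
      have \<rho>_inv: "(1 / \<rho> 0 x x0) powr \<gamma> = \<rho> 0 x x0 powr (- \<gamma>)" for x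
        by (simp add: powr_divide powr_minus_divide)
      have fin: "?n * ?B * ?P * u * \<rho> 0 x x0 powr (- (\<omega> + \<gamma>)) \<le> K * ?P * u * (1 / v) * (1 / (1 + d x x0)) powr \<gamma>"
        if v: "\<rho> 0 x x0 powr (- \<omega>) \<le> C2 * (1 / v)" "0 \<le> v" and u: "0 \<le> u" for x u v
      proof -
        have "\<rho> 0 x x0 powr (- (\<omega> + \<gamma>)) = \<rho> 0 x x0 powr (- \<omega>) * \<rho> 0 x x0 powr (- \<gamma>)"
          by (simp add: powr_add[symmetric])
        also have "\<dots> \<le> (C2 * (1 / v)) * \<rho> 0 x x0 powr (- \<gamma>)"
          by (intro mult_right_mono v) auto
        finally have "?n * ?B * ?P * u * \<rho> 0 x x0 powr (- (\<omega> + \<gamma>)) \<le> ?n * ?B * ?P * u * ((C2 * (1 / v)) * \<rho> 0 x x0 powr (- \<gamma>))"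
          using B P u by (intro mult_left_mono) auto
        also have "\<dots> = (?n * ?B * C2) * (?P * u * (1 / v) * \<rho> 0 x x0 powr (- \<gamma>))"
          by (simp add: mult_ac)
        also have "\<dots> \<le> K * (?P * u * (1 / v) * \<rho> 0 x x0 powr (- \<gamma>))"
          using P u v by (intro mult_right_mono) (auto simp: K_def)
        finally show ?thesis by (simp add: \<rho>0_eq \<rho>_inv mult_ac)
      qed
      have vv: "0 \<le> vol S 1 x0 + vol2 S x y" for x y
        by (simp add: vol_def vol2_def)
      have sz: "\<bar>\<psi> k \<beta> x\<bar> \<le> ?n * ?B * ?P * 1 * \<rho> 0 x x0 powr (- (\<omega> + \<gamma>))" for x
      proof -
        have s1: "1 * K1 \<le> ?n * ?B" by (rule mult_mono[OF _ K1B]) (use K1 in simp_all)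
        have s2: "\<rho> 0 x x0 powr (- L) \<le> \<rho> 0 x x0 powr (- (\<omega> + \<gamma>))"
          using eta_pos by (intro powr_mono) (auto simp: L_def)
        have "1 * K1 * ?P * \<rho> 0 x x0 powr (- L) \<le> ?n * ?B * ?P * \<rho> 0 x x0 powr (- (\<omega> + \<gamma>))"
          by (rule mult_mono[OF mult_right_mono[OF s1] s2]) (use K1 in simp_all)
        then show ?thesis using main(1)[OF \<beta>, of x] by simp
      qed
      have hd: "\<bar>\<psi> k \<beta> x - \<psi> k \<beta> y\<bar> \<le> ?n * ?B * ?P * (d x y / \<rho> 0 x x0) powr b * \<rho> 0 x x0 powr (- (\<omega> + \<gamma>))"
        if xy: "d x y \<le> 1 / (2 * A) * \<rho> 0 x x0" for x y
      proof -
        have split: "\<rho> 0 x x0 powr (- L) * \<rho> 0 x x0 powr b \<le> \<rho> 0 x x0 powr (- (\<omega> + \<gamma>))"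
          using b by (simp add: powr_add[symmetric] L_def powr_mono)
        have db: "(d x y / \<rho> 0 x x0) powr b * \<rho> 0 x x0 powr b = d x y powr b"
          by (simp add: powr_mult[symmetric])
        \<comment> \<open>One constant for all b between 0 and \<eta>: for \<delta>^k \<le> 1 the
          worst case is b = \<eta>, otherwise it is b = 0.\<close>
        have nb: "(\<delta> powi k) powr (- b) \<le> ?n"
        proof (cases "\<delta> powi k \<le> 1")
          case True
          then have "(\<delta> powi k) powr (- b) \<le> (\<delta> powi k) powr (- \<eta>)"
            using b by (intro powr_mono') auto
          then show ?thesis by simp
        next
          case False
          then have "(\<delta> powi k) powr (- b) \<le> (\<delta> powi k) powr 0"
            using b by (intro powr_mono) auto
          then show ?thesis by simp
        qed
        \<comment> \<open>For points within \<delta>^k the Hoelder bound is weakened from \<eta> to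
          b, the quotient being at most 1. Farther apart the difference is bounded by the two sizes,
          and the quotient, now at least 1, may be inserted as a factor.\<close>
        have core: "\<bar>\<psi> k \<beta> x - \<psi> k \<beta> y\<bar> \<le> ?B * ?P * (d x y / \<delta> powi k) powr b * \<rho> 0 x x0 powr (- L)"
        proof (cases "d x y \<le> \<delta> powi k")
          case True
          have "(d x y / \<delta> powi k) powr \<eta> \<le> (d x y / \<delta> powi k) powr b"
            using True b by (intro powr_mono') (auto simp: divide_le_eq)
          then have "K1 * ?P * (d x y / \<delta> powi k) powr \<eta> * \<rho> 0 x x0 powr (- L)
             \<le> ?B * ?P * (d x y / \<delta> powi k) powr b * \<rho> 0 x x0 powr (- L)"
            using K1 K1B P by (intro mult_mono mult_nonneg_nonneg) auto
          with main(2)[OF \<beta> True] show ?thesis by linarith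
        next
          case False
          have "\<rho> 0 x x0 \<le> 1 + A * (d x y + d y x0)"
            using d_triangle[of x x0 y] by (simp add: \<rho>_def)
          also have "\<dots> \<le> 1 + (1 / 2 * \<rho> 0 x x0 + A * d y x0)"
            using mult_left_mono[OF xy A_nonneg] by (simp add: distrib_left)
          \<comment> \<open>The restriction on d(x, y) lets half of \<rho> be absorbed on the left,
            so that the scaled distance from x to x0 is controlled by that from y.\<close>
          finally have "1 / 2 * \<rho> 0 x x0 \<le> 1 + A * d y x0" by linarith
          also have "\<dots> \<le> A * \<rho> 0 y x0"
            using A_ge1 by (simp add: \<rho>_def distrib_left)
          finally have "\<rho> 0 x x0 \<le> (2 * A) * \<rho> 0 y x0" by simp
          then have \<rho>y: "\<rho> 0 y x0 powr (- L) \<le> (2 * A) powr L * \<rho> 0 x x0 powr (- L)"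
            using L by (intro powr_neg_le_powr_neg) auto
          have "\<bar>\<psi> k \<beta> x - \<psi> k \<beta> y\<bar> \<le> \<bar>\<psi> k \<beta> x\<bar> + \<bar>\<psi> k \<beta> y\<bar>" by linarith
          also have "\<dots> \<le> K1 * ?P * \<rho> 0 x x0 powr (- L) + K1 * ?P * \<rho> 0 y x0 powr (- L)"
            by (intro add_mono main(1) \<beta>)
          also have "\<dots> \<le> K1 * ?P * ((2 * A) powr L * \<rho> 0 x x0 powr (- L)) + K1 * ?P * ((2 * A) powr L * \<rho> 0 x x0 powr (- L))"
            using K1 P A2L \<rho>y by (intro add_mono mult_left_mono) (auto simp: mult_le_cancel_right1)
          also have "\<dots> = ?B * ?P * 1 * \<rho> 0 x x0 powr (- L)" by simp
          also have "\<dots> \<le> ?B * ?P * (d x y / \<delta> powi k) powr b * \<rho> 0 x x0 powr (- L)"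
            using False b B P by (intro mult_right_mono mult_left_mono ge_one_powr_ge_zero) auto
          finally show ?thesis .
        qed
        also have "?B * ?P * (d x y / \<delta> powi k) powr b * \<rho> 0 x x0 powr (- L)
          = ?B * ?P * ((\<delta> powi k) powr (- b)) * (d x y / \<rho> 0 x x0) powr b * (\<rho> 0 x x0 powr (- L) * \<rho> 0 x x0 powr b)"
          unfolding powr_divide[of "d x y" "\<delta> powi k"] by (simp add: db[symmetric] powr_minus_divide)
        also have "\<dots> \<le> ?B * ?P * ?n * (d x y / \<rho> 0 x x0) powr b * \<rho> 0 x x0 powr (- (\<omega> + \<gamma>))"
          by (rule mult_mono[OF mult_right_mono[OF mult_left_mono[OF nb]] split]) (use K1 in simp_all)
        finally show ?thesis by (simp add: mult_ac)
      qed
      show "test_estimate S x0 b \<gamma> (\<psi> k \<beta>) (K * ?P)"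
        unfolding test_estimate_def
      proof (intro conjI allI impI)
        show "0 < K * ?P" using K P by simp
        show "\<bar>\<psi> k \<beta> x\<bar> \<le> K * ?P * (1 / (vol S 1 x0 + vol2 S x x0)) * (1 / (1 + d x x0)) powr \<gamma>" for x
          using order_trans[OF sz fin[OF C2(2) vv, of 1 x]] by simp
        fix x y assume "d x y \<le> 1 / (2 * A) * (1 + d x x0)"
        then have xy: "d x y \<le> 1 / (2 * A) * \<rho> 0 x x0" by (simp only: \<rho>0_eq)
        show "\<bar>\<psi> k \<beta> x - \<psi> k \<beta> y\<bar> \<le> K * ?P * (d x y / (1 + d x x0)) powr b * (1 / (vol S 1 x0 + vol2 S x x0)) * (1 / (1 + d x x0)) powr \<gamma>"
          using order_trans[OF hd[OF xy] fin[OF C2(2) vv]] by (simp only: \<rho>0_eq powr_ge_zero simp_thms)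
        show "\<bar>\<psi> k \<beta> x - \<psi> k \<beta> y\<bar> \<le> K * ?P * (d x y / (1 + d x x0)) powr b * (1 / (vol S 1 x0 + vol2 S x0 x)) * (1 / (1 + d x x0)) powr \<gamma>"
          using order_trans[OF hd[OF xy] fin[OF C2(3) vv]] by (simp only: \<rho>0_eq powr_ge_zero simp_thms)
      qed
    qed
  qed
qed

end

lemma integral_count_space_swap:
  fixes g :: "'i \<Rightarrow> 'a \<Rightarrow> complex"
  assumes M: "sigma_finite_measure M" and I: "countable I"
    and [measurable]: "\<And>i. i \<in> I \<Longrightarrow> g i \<in> borel_measurable M"
    and fin: "(\<integral>\<^sup>+i. \<integral>\<^sup>+x. ennreal (norm (g i x)) \<partial>M \<partial>count_space I) < \<infinity>"
  shows "(\<integral>x. (\<integral>i. g i x \<partial>count_space I) \<partial>M) = (\<integral>i. (\<integral>x. g i x \<partial>M) \<partial>count_space I)"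
proof -
  interpret M: sigma_finite_measure M by fact
  interpret I: sigma_finite_measure "count_space I"
    by (rule sigma_finite_measure_count_space_countable[OF I])
  interpret pair_sigma_finite "count_space I" M ..
  have meas: "case_prod g \<in> borel_measurable (count_space I \<Otimes>\<^sub>M M)"
    by (rule measurable_pair_measure_countable1[OF I]) simp
  then have meas': "(\<lambda>z. norm (g (fst z) (snd z))) \<in> borel_measurable (count_space I \<Otimes>\<^sub>M M)"
    by (simp add: case_prod_beta)
  have "integrable (count_space I \<Otimes>\<^sub>M M) (case_prod g)"
  proof (rule integrableI_bounded[OF meas])
    have "(\<integral>\<^sup>+z. ennreal (norm (case_prod g z)) \<partial>(count_space I \<Otimes>\<^sub>M M))
      = (\<integral>\<^sup>+i. \<integral>\<^sup>+x. ennreal (norm (g i x)) \<partial>M \<partial>count_space I)"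
      using M.nn_integral_fst[of "\<lambda>z. ennreal (norm (g (fst z) (snd z)))" "count_space I"] meas'
      by (simp add: case_prod_beta)
    with fin show "(\<integral>\<^sup>+z. ennreal (norm (case_prod g z)) \<partial>(count_space I \<Otimes>\<^sub>M M)) < \<infinity>" by simp
  qed
  from Fubini_integral[OF this] show ?thesis by simp
qed

section \<open>Wavelet series of one scale and their coefficients\<close>

context wavelet_space
begin

text \<open>The decay exceeds the growth D by 2 \<omega> + 1: the part D moves the growth from
  \<beta> to z, and the rest makes the sum over the points converge. The constant is the same for
  all scales and coefficients.\<close>

lemma wavelet_series_growth:
  fixes x0 :: 'a
  assumes D: "0 \<le> D"
  obtains C where "0 < C"
    "\<And>k K e z. 0 \<le> K \<Longrightarrow> (\<And>\<beta>. 0 \<le> e \<beta>) \<Longrightarrow>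
      (\<And>\<beta>. \<beta> \<in> new_points X k \<Longrightarrow> e \<beta> * mass k \<beta> \<le> K * \<rho> k \<beta> x0 powr D) \<Longrightarrow>
      (\<integral>\<^sup>+\<beta>. ennreal (e \<beta> * \<bar>\<psi> k \<beta> z\<bar>) \<partial>count_space (new_points X k)) \<le> ennreal (C * K * \<rho> k z x0 powr D)"
proof -
  define L where "L = D + (2 * \<omega> + 1)"
  have L: "0 \<le> L" using D omega_pos by (simp add: L_def)
  obtain C where C: "0 < C"
    "\<And>k \<beta> x. \<beta> \<in> new_points X k \<Longrightarrow>
      \<bar>\<psi> k \<beta> x\<bar> \<le> C * mass k \<beta> * \<rho> k x \<beta> powr (- L)"
    using wavelet_estimates[OF L] by metis
  obtain C2 where C2: "0 < C2"
    "\<And>k x L. 2 * \<omega> + 1 \<le> L \<Longrightarrow> (\<integral>\<^sup>+\<alpha>. wt L k x \<alpha> \<partial>pts 1 k) \<le> ennreal C2"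
    using sum_\<rho>[of 1] by metis
  show thesis
  proof (rule that[of "C * A powr D * C2"])
    show "0 < C * A powr D * C2" using C C2 by simp
    fix k K e z
    assume K: "0 \<le> K" and e: "\<And>\<beta>. 0 \<le> e \<beta>"
      and growth: "\<And>\<beta>. \<beta> \<in> new_points X k \<Longrightarrow> e \<beta> * mass k \<beta> \<le> K * \<rho> k \<beta> x0 powr D"
    let ?c = "C * K * (A * \<rho> k z x0) powr D"
    have "(\<integral>\<^sup>+\<beta>. ennreal (e \<beta> * \<bar>\<psi> k \<beta> z\<bar>) \<partial>count_space (new_points X k))
      \<le> (\<integral>\<^sup>+\<beta>. ennreal ?c * wt (2 * \<omega> + 1) k z \<beta> \<partial>count_space (new_points X k))"
    proof (intro nn_integral_mono)
      fix \<beta> assume "\<beta> \<in> space (count_space (new_points X k))"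
      then have \<beta>: "\<beta> \<in> new_points X k" by simp
      have "\<rho> k \<beta> x0 \<le> A * \<rho> k \<beta> z * \<rho> k z x0" by (rule \<rho>_triangle)
      then have "\<rho> k \<beta> x0 powr D \<le> (\<rho> k z \<beta> * (A * \<rho> k z x0)) powr D"
        using D by (intro powr_mono2) (auto simp: \<rho>_sym mult_ac)
      then have tri: "\<rho> k \<beta> x0 powr D \<le> \<rho> k z \<beta> powr D * (A * \<rho> k z x0) powr D"
        by (simp add: powr_mult)
      have "e \<beta> * \<bar>\<psi> k \<beta> z\<bar> \<le> e \<beta> * (C * mass k \<beta> * \<rho> k z \<beta> powr (- L))"
        by (intro mult_left_mono C(2) \<beta> e)
      also have "\<dots> = C * (e \<beta> * mass k \<beta>) * \<rho> k z \<beta> powr (- L)"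
        by simp
      also have "\<dots> \<le> C * (K * (\<rho> k z \<beta> powr D * (A * \<rho> k z x0) powr D)) * \<rho> k z \<beta> powr (- L)"
        using C K by (intro mult_right_mono mult_left_mono order_trans[OF growth[OF \<beta>]] tri) auto
      also have "\<dots> = ?c * (\<rho> k z \<beta> powr D * \<rho> k z \<beta> powr (- L))"
        by simp
      also have "\<rho> k z \<beta> powr D * \<rho> k z \<beta> powr (- L) = \<rho> k z \<beta> powr (- (2 * \<omega> + 1))"
        by (simp add: powr_add[symmetric] L_def)
      finally show "ennreal (e \<beta> * \<bar>\<psi> k \<beta> z\<bar>) \<le> ennreal ?c * wt (2 * \<omega> + 1) k z \<beta>"
        using C K by (simp add: ennreal_mult[symmetric] ennreal_leI)
    qed
    also have "\<dots> = ennreal ?c * (\<integral>\<^sup>+\<beta>. wt (2 * \<omega> + 1) k z \<beta> \<partial>count_space (new_points X k))"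
      by (simp add: nn_integral_cmult)
    also have "\<dots> \<le> ennreal ?c * (\<integral>\<^sup>+\<beta>. wt (2 * \<omega> + 1) k z \<beta> \<partial>pts 1 k)"
      using new_points_subset[of k]
      by (intro mult_left_mono, subst (1 2) nn_integral_count_space_indicator)
         (auto intro!: nn_integral_mono split: split_indicator)
    also have "\<dots> \<le> ennreal ?c * ennreal C2"
      by (intro mult_left_mono C2) auto
    also have "\<dots> = ennreal (C * A powr D * C2 * K * \<rho> k z x0 powr D)"
      using C K C2 by (simp add: ennreal_mult[symmetric] powr_mult mult_ac)
    finally show "(\<integral>\<^sup>+\<beta>. ennreal (e \<beta> * \<bar>\<psi> k \<beta> z\<bar>) \<partial>count_space (new_points X k))
      \<le> ennreal (C * A powr D * C2 * K * \<rho> k z x0 powr D)" .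
  qed
qed

text \<open>This integrability of the growing majorant justifies the exchange of sum and integral in
  \<open>wavelet_series_coefficient\<close>.\<close>

lemma nn_integral_\<rho>_wavelet_finite:
  fixes x0 :: 'a
  assumes D: "0 \<le> D" and \<alpha>: "\<alpha> \<in> new_points X k"
  shows "(\<integral>\<^sup>+z. ennreal (\<rho> k z x0 powr D * \<bar>\<psi> k \<alpha> z\<bar>) \<partial>M) < \<infinity>"
proof -
  define L where "L = D + (\<omega> + 1)"
  have L: "0 \<le> L" using D omega_pos by (simp add: L_def)
  obtain C where C: "0 < C"
    "\<And>k \<beta> x. \<beta> \<in> new_points X k \<Longrightarrow>
      \<bar>\<psi> k \<beta> x\<bar> \<le> C * mass k \<beta> * \<rho> k x \<beta> powr (- L)"
    using wavelet_estimates[OF L] by metis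
  obtain C2 where C2: "0 < C2"
    "\<And>k x L. \<omega> + 1 \<le> L \<Longrightarrow> (\<integral>\<^sup>+z. wt L k x z \<partial>M) \<le> ennreal (C2 * V k x)"
    using nn_integral_\<rho> by metis
  let ?c = "(A * \<rho> k \<alpha> x0) powr D * (C * mass k \<alpha>)"
  have "(\<integral>\<^sup>+z. ennreal (\<rho> k z x0 powr D * \<bar>\<psi> k \<alpha> z\<bar>) \<partial>M)
    \<le> (\<integral>\<^sup>+z. ennreal ?c * wt (\<omega> + 1) k \<alpha> z \<partial>M)"
  proof (intro nn_integral_mono)
    fix z
    have "\<rho> k z x0 powr D \<le> (\<rho> k z \<alpha> * (A * \<rho> k \<alpha> x0)) powr D"
      using \<rho>_triangle[of k z x0 \<alpha>] D by (intro powr_mono2) (auto simp: mult_ac)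
    then have "\<rho> k z x0 powr D * \<bar>\<psi> k \<alpha> z\<bar>
      \<le> (\<rho> k z \<alpha> powr D * (A * \<rho> k \<alpha> x0) powr D) * (C * mass k \<alpha> * \<rho> k z \<alpha> powr (- L))"
      using C(1) by (intro mult_mono C(2) \<alpha>) (auto simp: powr_mult)
    also have "\<dots> = ?c * (\<rho> k z \<alpha> powr D * \<rho> k z \<alpha> powr (- L))"
      by simp
    also have "\<rho> k z \<alpha> powr D * \<rho> k z \<alpha> powr (- L) = \<rho> k \<alpha> z powr (- (\<omega> + 1))"
      by (simp add: powr_add[symmetric] L_def \<rho>_sym)
    finally show "ennreal (\<rho> k z x0 powr D * \<bar>\<psi> k \<alpha> z\<bar>) \<le> ennreal ?c * wt (\<omega> + 1) k \<alpha> z"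
      using C by (simp add: ennreal_mult[symmetric] ennreal_leI)
  qed
  also have "\<dots> = ennreal ?c * (\<integral>\<^sup>+z. wt (\<omega> + 1) k \<alpha> z \<partial>M)"
    by (intro nn_integral_cmult) measurable
  also have "\<dots> \<le> ennreal ?c * ennreal (C2 * V k \<alpha>)"
    by (intro mult_left_mono C2) auto
  also have "\<dots> < \<infinity>" by (simp add: ennreal_mult_less_top)
  finally show ?thesis .
qed

text \<open>The series need not lie in L^2, so its coefficients cannot be read off from the basis
  expansion. Polynomial growth gives absolute convergence against the wavelet, sum and integral are
  exchanged, and orthonormality within the single scale k leaves one term.\<close>

lemma wavelet_series_coefficient:
  fixes e :: "'a \<Rightarrow> complex" and x0 :: 'a
  assumes D: "0 \<le> D" and K: "0 \<le> K" and \<alpha>: "\<alpha> \<in> new_points X k"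
    and growth: "\<And>\<beta>. \<beta> \<in> new_points X k \<Longrightarrow>
      cmod (e \<beta>) * mass k \<beta> \<le> K * \<rho> k \<beta> x0 powr D"
  shows "(\<integral>z. (\<Sum>\<^sub>\<infinity>\<beta>\<in>new_points X k. e \<beta> * complex_of_real (\<psi> k \<beta> z)) * complex_of_real (\<psi> k \<alpha> z) \<partial>M) = e \<alpha>"
proof -
  let ?Y = "new_points X k"
  obtain C where C: "0 < C"
    "\<And>k K e z. 0 \<le> K \<Longrightarrow> (\<And>\<beta>. 0 \<le> e \<beta>) \<Longrightarrow>
      (\<And>\<beta>. \<beta> \<in> new_points X k \<Longrightarrow> e \<beta> * mass k \<beta> \<le> K * \<rho> k \<beta> x0 powr D) \<Longrightarrow>
      (\<integral>\<^sup>+\<beta>. ennreal (e \<beta> * \<bar>\<psi> k \<beta> z\<bar>) \<partial>count_space (new_points X k)) \<le> ennreal (C * K * \<rho> k z x0 powr D)"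
  proof -
    show ?thesis by (rule wavelet_series_growth[OF D, of x0]) (fact that)
  qed
  have bound: "(\<integral>\<^sup>+\<beta>. ennreal (cmod (e \<beta>) * \<bar>\<psi> k \<beta> z\<bar>) \<partial>count_space ?Y) \<le> ennreal (C * K * \<rho> k z x0 powr D)" for z
    using K growth by (intro C) auto
  note [measurable] = borel_measurable_wavelet
  have series: "(\<Sum>\<^sub>\<infinity>\<beta>\<in>?Y. e \<beta> * complex_of_real (\<psi> k \<beta> z)) = (\<integral>\<beta>. e \<beta> * complex_of_real (\<psi> k \<beta> z) \<partial>count_space ?Y)"
    and int: "integrable (count_space ?Y) (\<lambda>\<beta>. e \<beta> * complex_of_real (\<psi> k \<beta> z))" for z
  proof -
    have "(\<integral>\<^sup>+\<beta>. ennreal (norm (e \<beta> * complex_of_real (\<psi> k \<beta> z))) \<partial>count_space ?Y) < \<infinity>"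
      using bound[of z] by (simp add: norm_mult order.strict_trans1)
    from summable_on_if_nn_integral_finite[OF this]
    show "(\<Sum>\<^sub>\<infinity>\<beta>\<in>?Y. e \<beta> * complex_of_real (\<psi> k \<beta> z)) = (\<integral>\<beta>. e \<beta> * complex_of_real (\<psi> k \<beta> z) \<partial>count_space ?Y)"
      "integrable (count_space ?Y) (\<lambda>\<beta>. e \<beta> * complex_of_real (\<psi> k \<beta> z))" by auto
  qed
  have "(\<integral>z. (\<Sum>\<^sub>\<infinity>\<beta>\<in>?Y. e \<beta> * complex_of_real (\<psi> k \<beta> z)) * complex_of_real (\<psi> k \<alpha> z) \<partial>M)
    = (\<integral>z. (\<integral>\<beta>. e \<beta> * complex_of_real (\<psi> k \<beta> z) * complex_of_real (\<psi> k \<alpha> z) \<partial>count_space ?Y) \<partial>M)"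
    unfolding series using int by (intro Bochner_Integration.integral_cong refl) simp
  also have "\<dots> = (\<integral>\<beta>. (\<integral>z. e \<beta> * complex_of_real (\<psi> k \<beta> z) * complex_of_real (\<psi> k \<alpha> z) \<partial>M) \<partial>count_space ?Y)"
  proof (rule integral_count_space_swap[OF sigma_finite_M countable_new_points])
    show "(\<lambda>z. e \<beta> * complex_of_real (\<psi> k \<beta> z) * complex_of_real (\<psi> k \<alpha> z)) \<in> borel_measurable M" if "\<beta> \<in> ?Y" for \<beta>
      using that \<alpha> by measurable
    have "(\<integral>\<^sup>+\<beta>. \<integral>\<^sup>+z. ennreal (norm (e \<beta> * complex_of_real (\<psi> k \<beta> z) * complex_of_real (\<psi> k \<alpha> z))) \<partial>M \<partial>count_space ?Y)
      = (\<integral>\<^sup>+z. \<integral>\<^sup>+\<beta>. ennreal (norm (e \<beta> * complex_of_real (\<psi> k \<beta> z) * complex_of_real (\<psi> k \<alpha> z))) \<partial>count_space ?Y \<partial>M)"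
      using \<alpha> by (intro nn_integral_count_space_nn_integral[symmetric] countable_new_points) measurable
    also have "\<dots> = (\<integral>\<^sup>+z. (\<integral>\<^sup>+\<beta>. ennreal (cmod (e \<beta>) * \<bar>\<psi> k \<beta> z\<bar>) \<partial>count_space ?Y) * ennreal \<bar>\<psi> k \<alpha> z\<bar> \<partial>M)"
      by (intro nn_integral_cong, subst nn_integral_multc[symmetric]) (auto simp: norm_mult ennreal_mult)
    also have "\<dots> \<le> (\<integral>\<^sup>+z. ennreal (C * K * \<rho> k z x0 powr D) * ennreal \<bar>\<psi> k \<alpha> z\<bar> \<partial>M)"
      by (intro nn_integral_mono mult_right_mono bound) auto
    also have "\<dots> = ennreal (C * K) * (\<integral>\<^sup>+z. ennreal (\<rho> k z x0 powr D * \<bar>\<psi> k \<alpha> z\<bar>) \<partial>M)"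
      using C K \<alpha> by (subst nn_integral_cmult[symmetric]) (auto simp: ennreal_mult mult.assoc)
    also have "\<dots> < \<infinity>"
      using nn_integral_\<rho>_wavelet_finite[OF D \<alpha>, of x0] by (simp add: ennreal_mult_less_top)
    finally show "(\<integral>\<^sup>+\<beta>. \<integral>\<^sup>+z. ennreal (norm (e \<beta> * complex_of_real (\<psi> k \<beta> z) * complex_of_real (\<psi> k \<alpha> z))) \<partial>M \<partial>count_space ?Y) < \<infinity>" .
  qed
  also have "\<dots> = (\<integral>\<beta>. (if \<beta> = \<alpha> then e \<alpha> else 0) \<partial>count_space ?Y)"
  proof (intro Bochner_Integration.integral_cong refl)
    fix \<beta> assume "\<beta> \<in> space (count_space ?Y)"
    then have \<beta>: "\<beta> \<in> ?Y" by simp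
    have "(\<integral>z. e \<beta> * complex_of_real (\<psi> k \<beta> z) * complex_of_real (\<psi> k \<alpha> z) \<partial>M)
      = (\<integral>z. e \<beta> * complex_of_real (\<psi> k \<beta> z * \<psi> k \<alpha> z) \<partial>M)"
      by (simp add: mult.assoc)
    also have "\<dots> = e \<beta> * complex_of_real (\<integral>z. \<psi> k \<beta> z * \<psi> k \<alpha> z \<partial>M)"
      by (simp only: integral_mult_right_zero integral_complex_of_real)
    also have "\<dots> = (if \<beta> = \<alpha> then e \<alpha> else 0)"
      using orthonormal_wavelet[OF \<beta> \<alpha>] by simp
    finally show "(\<integral>z. e \<beta> * complex_of_real (\<psi> k \<beta> z) * complex_of_real (\<psi> k \<alpha> z) \<partial>M) = (if \<beta> = \<alpha> then e \<alpha> else 0)" .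
  qed
  also have "\<dots> = e \<alpha>"
    using \<alpha> by (subst lebesgue_integral_count_space_finite_support) (auto simp: if_distrib[of "\<lambda>x. x = 0"] cong: if_cong)
  finally show ?thesis .
qed

end

section \<open>Tensor wavelets as test functions\<close>

lemma test_norm_le: "test_bound S x0 r b \<gamma> f C \<Longrightarrow> test_norm S x0 r b \<gamma> f \<le> C"
  unfolding test_norm_def by (rule cInf_lower) (auto simp: test_bound_def intro!: bdd_belowI[of _ 0])

lemma product_test_norm_le:
  "product_test_bound S1 S2 x0 y0 r1 r2 b1 b2 \<gamma>1 \<gamma>2 f C \<Longrightarrow> product_test_norm S1 S2 x0 y0 r1 r2 b1 b2 \<gamma>1 \<gamma>2 f \<le> C"
  unfolding product_test_norm_def
  by (rule cInf_lower) (auto simp: product_test_bound_def intro!: bdd_belowI[of _ 0])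

lemma vol_nonneg [simp]: "0 \<le> vol S r x" and vol2_nonneg [simp]: "0 \<le> vol2 S x y"
  by (simp_all add: vol_def vol2_def)

lemma test_bound_zero: "0 < C \<Longrightarrow> test_bound S x0 r b \<gamma> (\<lambda>x. 0) C"
  by (simp add: test_bound_def)

text \<open>Every positive constant is admissible for the zero function but 0 itself is not, so the
  bound arises as a limit.\<close>

lemma test_norm_zero_le: "test_norm S x0 r b \<gamma> (\<lambda>x. 0) \<le> 0"
  by (rule field_le_epsilon) (simp add: test_norm_le test_bound_zero)

text \<open>The scalar must not vanish because the constants in \<open>test_bound\<close> are
  strictly positive; a vanishing scalar is covered by \<open>test_norm_zero_le\<close>.\<close>

lemma test_estimate_bound:
  assumes f: "test_estimate S x0 b \<gamma> f T" and c: "c \<noteq> 0"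
  shows "test_bound S x0 1 b \<gamma> (\<lambda>x. complex_of_real (f x) * c) (T * cmod c)"
  unfolding test_bound_def
proof (intro conjI allI impI)
  show "0 < T * cmod c" using f c by (simp add: test_estimate_def)
  show "cmod (complex_of_real (f x) * c) \<le> T * cmod c * (1 / (vol S 1 x0 + vol2 S x x0)) * (1 / (1 + qdist S x x0)) powr \<gamma>" for x
  proof -
    have "\<bar>f x\<bar> \<le> T * (1 / (vol S 1 x0 + vol2 S x x0)) * (1 / (1 + qdist S x x0)) powr \<gamma>"
      using f by (simp only: test_estimate_def)
    from mult_right_mono[OF this, of "cmod c"] show ?thesis by (simp add: norm_mult mult_ac)
  qed
  fix x y assume "qdist S x y < 1 / (2 * qconst S) * (1 + qdist S x x0)"
  then have "qdist S x y \<le> 1 / (2 * qconst S) * (1 + qdist S x x0)" by simp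
  then have le: "\<bar>f x - f y\<bar> \<le> T * (qdist S x y / (1 + qdist S x x0)) powr b
         * (1 / (vol S 1 x0 + vol2 S x x0)) * (1 / (1 + qdist S x x0)) powr \<gamma>"
    using f by (simp only: test_estimate_def)
  have eq: "cmod (complex_of_real (f x) * c - complex_of_real (f y) * c) = \<bar>f x - f y\<bar> * cmod c"
    by (metis left_diff_distrib norm_mult norm_of_real of_real_diff)
  show "cmod (complex_of_real (f x) * c - complex_of_real (f y) * c)
     \<le> T * cmod c * (qdist S x y / (1 + qdist S x x0)) powr b * (1 / (vol S 1 x0 + vol2 S x x0)) * (1 / (1 + qdist S x x0)) powr \<gamma>"
    unfolding eq using mult_right_mono[OF le, of "cmod c"] by (simp add: mult_ac)
qed

lemma test_estimate_norm:
  assumes f: "test_estimate S x0 b \<gamma> f T"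
  shows "test_norm S x0 1 b \<gamma> (\<lambda>x. complex_of_real (f x) * c) \<le> T * cmod c"
  using test_norm_le[OF test_estimate_bound[OF f], of c] test_norm_zero_le[of S x0 1 b \<gamma>]
  by (cases "c = 0") auto

text \<open>The factor in y, or its difference, is a scalar for the norm in x, so the estimates of
  the two variables multiply.\<close>

lemma test_estimate_half_product:
  assumes f: "test_estimate S1 x0 b1 \<gamma>1 f T1" and g: "test_estimate S2 y0 b2 \<gamma>2 g T2"
  shows "half_product_bound S1 S2 x0 y0 1 1 b1 b2 \<gamma>1 \<gamma>2 (\<lambda>(x, y). complex_of_real (f x * g y)) (T1 * T2)"
  unfolding half_product_bound_def
proof (intro conjI allI impI)
  have T1: "0 \<le> T1" using f by (simp add: test_estimate_def)
  fix y
  have "test_norm S1 x0 1 b1 \<gamma>1 (\<lambda>x. complex_of_real (f x) * complex_of_real (g y)) \<le> T1 * \<bar>g y\<bar>"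
    using test_estimate_norm[OF f, of "complex_of_real (g y)"] by simp
  also have "\<dots> \<le> T1 * (T2 * (1 / (vol S2 1 y0 + vol2 S2 y y0)) * (1 / (1 + qdist S2 y y0)) powr \<gamma>2)"
    using g T1 by (intro mult_left_mono) (simp_all only: test_estimate_def)
  finally show "test_norm S1 x0 1 b1 \<gamma>1 (\<lambda>x. case (x, y) of (x, y) \<Rightarrow> complex_of_real (f x * g y))
     \<le> T1 * T2 * (1 / (vol S2 1 y0 + vol2 S2 y y0)) * (1 / (1 + qdist S2 y y0)) powr \<gamma>2"
    by (simp add: mult.assoc)
  fix y' assume y': "qdist S2 y y' \<le> 1 / (2 * qconst S2) * (1 + qdist S2 y y0)"
  have "test_norm S1 x0 1 b1 \<gamma>1 (\<lambda>x. complex_of_real (f x) * complex_of_real (g y - g y')) \<le> T1 * \<bar>g y - g y'\<bar>"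
    using test_estimate_norm[OF f, of "complex_of_real (g y - g y')"] by (simp only: norm_of_real)
  also have "\<dots> \<le> T1 * (T2 * (qdist S2 y y' / (1 + qdist S2 y y0)) powr b2
         * (1 / (vol S2 1 y0 + vol2 S2 y0 y)) * (1 / (1 + qdist S2 y y0)) powr \<gamma>2)"
    using g T1 y' by (intro mult_left_mono) (simp_all only: test_estimate_def)
  finally show "test_norm S1 x0 1 b1 \<gamma>1 (\<lambda>x. (case (x, y) of (x, y) \<Rightarrow> complex_of_real (f x * g y))
        - (case (x, y') of (x, y) \<Rightarrow> complex_of_real (f x * g y)))
     \<le> T1 * T2 * (qdist S2 y y' / (1 + qdist S2 y y0)) powr b2 * (1 / (vol S2 1 y0 + vol2 S2 y0 y)) * (1 / (1 + qdist S2 y y0)) powr \<gamma>2"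
    by (simp add: mult.assoc right_diff_distrib)
qed

lemma test_estimate_product_bound:
  assumes f: "test_estimate S1 x0 b1 \<gamma>1 f T1" and g: "test_estimate S2 y0 b2 \<gamma>2 g T2"
  shows "product_test_bound S1 S2 x0 y0 1 1 b1 b2 \<gamma>1 \<gamma>2 (\<lambda>(x, y). complex_of_real (f x * g y)) (T1 * T2)"
proof -
  have "0 < T1 * T2" using f g by (simp add: test_estimate_def)
  then show ?thesis
    using test_estimate_half_product[OF f g] test_estimate_half_product[OF g f]
    by (simp add: product_test_bound_def mult.commute case_prod_beta' split_beta)
qed

lemma test_estimate_test_space:
  assumes f: "test_estimate S x0 b \<gamma> f T" and int: "integrable (qmeas S) f" "(\<integral>x. f x \<partial>qmeas S) = 0"
  shows "(\<lambda>x. complex_of_real (f x) * c) \<in> test_space S x0 1 b \<gamma>"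
proof -
  have "\<exists>C. test_bound S x0 1 b \<gamma> (\<lambda>x. complex_of_real (f x) * c) C"
  proof (cases "c = 0")
    case True
    then show ?thesis using test_bound_zero[of 1 S x0 1 b \<gamma>] by auto
  next
    case False
    then show ?thesis using test_estimate_bound[OF f] by blast
  qed
  then show ?thesis
    using int by (simp add: test_space_def)
qed

lemma test_estimate_product_space:
  assumes f: "test_estimate S1 x0 b1 \<gamma>1 f T1" and g: "test_estimate S2 y0 b2 \<gamma>2 g T2"
    and "integrable (qmeas S1) f" "(\<integral>x. f x \<partial>qmeas S1) = 0"
    and "integrable (qmeas S2) g" "(\<integral>x. g x \<partial>qmeas S2) = 0"
  shows "(\<lambda>(x, y). complex_of_real (f x * g y)) \<in> product_test_space S1 S2 x0 y0 1 1 b1 b2 \<gamma>1 \<gamma>2"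
proof -
  have "(\<lambda>x. complex_of_real (f x * g y)) \<in> test_space S1 x0 1 b1 \<gamma>1" for y
    using test_estimate_test_space[OF f assms(3,4), of "complex_of_real (g y)"] by simp
  moreover have "(\<lambda>y. complex_of_real (f x * g y)) \<in> test_space S2 y0 1 b2 \<gamma>2" for x
    using test_estimate_test_space[OF g assms(5,6), of "complex_of_real (f x)"] by (simp add: mult.commute)
  ultimately show ?thesis
    using test_estimate_product_bound[OF f g]
    by (auto simp: product_test_space_def test_space_def)
qed

lemma product_test_norm_zero: "product_test_norm S1 S2 x0 y0 1 1 b1 b2 \<gamma>1 \<gamma>2 (\<lambda>z. 0) = 0"
proof -
  have bound: "product_test_bound S1 S2 x0 y0 1 1 b1 b2 \<gamma>1 \<gamma>2 (\<lambda>z. 0) C" if "0 < C" for C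
    using that test_norm_zero_le[of S1 x0 1 b1 \<gamma>1] test_norm_zero_le[of S2 y0 1 b2 \<gamma>2]
    by (auto simp: product_test_bound_def half_product_bound_def case_prod_beta'
        intro: order_trans)
  then have "{C. product_test_bound S1 S2 x0 y0 1 1 b1 b2 \<gamma>1 \<gamma>2 (\<lambda>z. 0) C} = {0<..}"
    by (auto simp: product_test_bound_def)
  then show ?thesis
    by (simp add: product_test_norm_def)
qed

text \<open>The function already lies in the space of exponents (\<eta>1, \<eta>2), so a constant
  sequence approximates it. This puts tensor wavelets into the domain on which distributions are
  bounded.\<close>

lemma test_estimate_completed_space:
  assumes f: "test_estimate S1 x0 b1 \<gamma>1 f T1" "test_estimate S1 x0 \<eta>1 \<gamma>1 f T1"
    and g: "test_estimate S2 y0 b2 \<gamma>2 g T2" "test_estimate S2 y0 \<eta>2 \<gamma>2 g T2"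
    and int: "integrable (qmeas S1) f" "(\<integral>x. f x \<partial>qmeas S1) = 0"
      "integrable (qmeas S2) g" "(\<integral>x. g x \<partial>qmeas S2) = 0"
  shows "(\<lambda>(x, y). complex_of_real (f x * g y)) \<in> completed_test_space S1 S2 x0 y0 \<eta>1 \<eta>2 b1 b2 \<gamma>1 \<gamma>2"
proof -
  let ?F = "\<lambda>(x, y). complex_of_real (f x * g y)"
  have "(\<lambda>z. ?F z - ?F z) = (\<lambda>z. 0)" by simp
  then show ?thesis
    using test_estimate_product_space[OF f(1) g(1) int] test_estimate_product_space[OF f(2) g(2) int]
    unfolding completed_test_space_def
    by (intro CollectI conjI exI[of _ "\<lambda>_. ?F"] allI) (simp_all only: product_test_norm_zero tendsto_const)
qed

section \<open>Moving weights and kernels between base points\<close>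

context dyadic_space
begin

text \<open>From x to \<beta> through \<alpha> and z: two factors A and two factors 5 A^2. No trace
  of n remains in 25 A^6.\<close>

lemma \<rho>_cube_transfer:
  assumes L: "0 \<le> L" and \<alpha>: "\<alpha> \<in> X (k + int n)" and xz: "x \<in> Q (k + int n) \<alpha>" "z \<in> Q (k + int n) \<alpha>"
  shows "\<rho> k z \<beta> powr (- L) \<le> (25 * A ^ 6) powr L * \<rho> k x \<beta> powr (- L)"
proof (rule powr_neg_le_powr_neg)
  have "\<rho> k x \<beta> \<le> A * \<rho> k x z * \<rho> k z \<beta>" by (rule \<rho>_triangle)
  also have "\<dots> \<le> A * (A * \<rho> k x \<alpha> * \<rho> k \<alpha> z) * \<rho> k z \<beta>"
    by (intro mult_right_mono mult_left_mono \<rho>_triangle) auto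
  also have "\<dots> \<le> A * (A * (5 * A\<^sup>2) * (5 * A\<^sup>2)) * \<rho> k z \<beta>"
    using cube_\<rho>(1)[OF \<alpha> xz(1)] cube_\<rho>(2)[OF \<alpha> xz(2)]
    by (intro mult_right_mono mult_left_mono mult_mono) auto
  also have "\<dots> = 25 * A ^ 6 * \<rho> k z \<beta>"
    by algebra
  finally show "\<rho> k x \<beta> \<le> 25 * A ^ 6 * \<rho> k z \<beta>" .
qed (use L in auto)

lemma \<rho>_powr_triangle:
  assumes "0 \<le> s"
  shows "\<rho> k x z powr s \<le> A powr s * \<rho> k x y powr s * \<rho> k y z powr s"
proof -
  have "\<rho> k x z powr s \<le> (A * \<rho> k x y * \<rho> k y z) powr s"
    using assms by (intro powr_mono2 \<rho>_triangle) auto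
  then show ?thesis by (simp add: powr_mult)
qed

lemma \<rho>_powr_growth_le:
  assumes D: "0 \<le> D" "D \<le> M'"
  shows "\<rho> k \<beta> x0 powr D * \<rho> k x \<beta> powr (- M') \<le> (A * \<rho> k x x0) powr D"
proof -
  have "\<rho> k \<beta> x0 powr D * \<rho> k x \<beta> powr (- M')
    \<le> (A powr D * \<rho> k \<beta> x powr D * \<rho> k x x0 powr D) * \<rho> k x \<beta> powr (- D)"
    by (intro mult_mono \<rho>_powr_triangle D \<rho>_powr_antimono) auto
  also have "\<dots> = (A * \<rho> k x x0) powr D * (\<rho> k x \<beta> powr D * \<rho> k x \<beta> powr (- D))"
    by (simp add: powr_mult \<rho>_sym[of k \<beta> x])
  finally show ?thesis by (simp add: powr_add[symmetric])
qed

text \<open>The growth about x is moved to z at the expense of the part s of the decay; the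
  remaining 2 \<omega> + 1 makes the sum converge.\<close>

lemma sum_\<rho>_growth:
  assumes s: "0 \<le> s"
  obtains C where "0 < C"
    "\<And>k x z L. s + (2 * \<omega> + 1) \<le> L \<Longrightarrow>
      (\<integral>\<^sup>+\<beta>. ennreal (\<rho> k x \<beta> powr s * \<rho> k z \<beta> powr (- L)) \<partial>pts n k) \<le> ennreal (C * \<rho> k x z powr s)"
proof -
  obtain C where C: "0 < C"
    "\<And>k x L. 2 * \<omega> + 1 \<le> L \<Longrightarrow> (\<integral>\<^sup>+\<alpha>. wt L k x \<alpha> \<partial>pts n k) \<le> ennreal C"
    using sum_\<rho>[of n] by metis
  show thesis
  proof (rule that[of "A powr s * C"])
    show "0 < A powr s * C" using C by simp
    fix k x z and L :: real assume L: "s + (2 * \<omega> + 1) \<le> L"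
    have "(\<integral>\<^sup>+\<beta>. ennreal (\<rho> k x \<beta> powr s * \<rho> k z \<beta> powr (- L)) \<partial>pts n k)
      \<le> (\<integral>\<^sup>+\<beta>. ennreal (A powr s * \<rho> k x z powr s) * wt (L - s) k z \<beta> \<partial>pts n k)"
    proof (intro nn_integral_mono)
      fix \<beta>
      have "\<rho> k x \<beta> powr s * \<rho> k z \<beta> powr (- L) \<le> (A powr s * \<rho> k x z powr s * \<rho> k z \<beta> powr s) * \<rho> k z \<beta> powr (- L)"
        using s by (intro mult_right_mono \<rho>_powr_triangle) auto
      also have "\<dots> = A powr s * \<rho> k x z powr s * (\<rho> k z \<beta> powr s * \<rho> k z \<beta> powr (- L))"
        by simp
      also have "\<rho> k z \<beta> powr s * \<rho> k z \<beta> powr (- L) = \<rho> k z \<beta> powr (- (L - s))"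
        by (simp add: powr_add[symmetric])
      finally show "ennreal (\<rho> k x \<beta> powr s * \<rho> k z \<beta> powr (- L))
        \<le> ennreal (A powr s * \<rho> k x z powr s) * wt (L - s) k z \<beta>"
        by (simp add: ennreal_mult[symmetric] ennreal_leI)
    qed
    also have "\<dots> = ennreal (A powr s * \<rho> k x z powr s) * (\<integral>\<^sup>+\<beta>. wt (L - s) k z \<beta> \<partial>pts n k)"
      by (simp add: nn_integral_cmult)
    also have "\<dots> \<le> ennreal (A powr s * \<rho> k x z powr s) * ennreal C"
      using L by (intro mult_left_mono C) auto
    finally show "(\<integral>\<^sup>+\<beta>. ennreal (\<rho> k x \<beta> powr s * \<rho> k z \<beta> powr (- L)) \<partial>pts n k)
      \<le> ennreal (A powr s * C * \<rho> k x z powr s)"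
      using C by (simp add: ennreal_mult[symmetric] mult_ac)
  qed
qed

text \<open>The size of a wavelet times its own normalising factor: a bump about \<beta> normalised
  in L^1.\<close>

definition kernel :: "real \<Rightarrow> int \<Rightarrow> 'a \<Rightarrow> 'a \<Rightarrow> real" where
  "kernel L k \<beta> z = measure M (Q (k + 1) \<beta>) powr (- 1) * \<rho> k z \<beta> powr (- L)"

lemma kernel_nonneg [simp]: "0 \<le> kernel L k \<beta> z"
  by (simp add: kernel_def)

lemma borel_measurable_kernel [measurable]: "kernel L k \<beta> \<in> borel_measurable M"
  by (simp add: kernel_def[abs_def])

lemma nn_integral_kernel_scaled:
  assumes P: "0 \<le> P" and [measurable]: "\<phi> \<in> borel_measurable M"
    and le: "(\<integral>\<^sup>+z. \<phi> z * ennreal (kernel L k \<beta> z) \<partial>M) * r \<le> ennreal G"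
  shows "(\<integral>\<^sup>+z. \<phi> z * (ennreal (P * kernel L k \<beta> z) * r) \<partial>M) \<le> ennreal (P * G)"
proof -
  have "(\<integral>\<^sup>+z. \<phi> z * (ennreal (P * kernel L k \<beta> z) * r) \<partial>M)
    = (\<integral>\<^sup>+z. (ennreal P * r) * (\<phi> z * ennreal (kernel L k \<beta> z)) \<partial>M)"
    using P by (simp add: ennreal_mult mult_ac)
  also have "\<dots> = ennreal P * ((\<integral>\<^sup>+z. \<phi> z * ennreal (kernel L k \<beta> z) \<partial>M) * r)"
    by (subst nn_integral_cmult) (auto simp: mult_ac)
  also have "\<dots> \<le> ennreal P * ennreal G"
    by (intro mult_left_mono le) simp
  finally show ?thesis using P by (simp add: ennreal_mult')
qed

text \<open>For the error term: growth about x survives integration against the bump, with its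
  argument moved to \<beta>. The only cubes involved are those of the wavelets, of generation k + 1,
  so the constant is free of N.\<close>

lemma kernel_growth:
  assumes s: "0 \<le> s" and L: "s + (\<omega> + 1) \<le> L"
  obtains C where "0 < C"
    "\<And>k x \<beta>. \<beta> \<in> X (k + int 1) \<Longrightarrow>
      (\<integral>\<^sup>+z. ennreal (\<rho> k x z powr s * kernel L k \<beta> z) \<partial>M) \<le> ennreal (C * \<rho> k x \<beta> powr s)"
proof -
  obtain C1 where C1: "1 \<le> C1"
    "\<And>k \<alpha>. \<alpha> \<in> X (k + int 1) \<Longrightarrow> V k \<alpha> \<le> C1 * measure M (Q (k + int 1) \<alpha>)"
    using cube_volume[of 1] by metis
  obtain C2 where C2: "0 < C2"
    "\<And>k x L. \<omega> + 1 \<le> L \<Longrightarrow> (\<integral>\<^sup>+z. wt L k x z \<partial>M) \<le> ennreal (C2 * V k x)"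
    using nn_integral_\<rho> by metis
  show thesis
  proof (rule that[of "A powr s * C2 * C1"])
    show "0 < A powr s * C2 * C1" using C1 C2 by simp
    fix k x \<beta> assume \<beta>: "\<beta> \<in> X (k + int 1)"
    let ?mu = "measure M (Q (k + 1) \<beta>)"
    have mu: "0 < ?mu" using measure_cube_pos[OF \<beta>] by simp
    let ?c = "?mu powr (- 1) * (A powr s * \<rho> k x \<beta> powr s)"
    have "(\<integral>\<^sup>+z. ennreal (\<rho> k x z powr s * kernel L k \<beta> z) \<partial>M)
      \<le> (\<integral>\<^sup>+z. ennreal ?c * wt (L - s) k \<beta> z \<partial>M)"
    proof (intro nn_integral_mono)
      fix z
      have "\<rho> k x z powr s * kernel L k \<beta> z \<le> (A powr s * \<rho> k x \<beta> powr s * \<rho> k \<beta> z powr s) * (?mu powr (- 1) * \<rho> k z \<beta> powr (- L))"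
        unfolding kernel_def using s by (intro mult_right_mono \<rho>_powr_triangle) auto
      also have "\<dots> = ?c * (\<rho> k \<beta> z powr s * \<rho> k \<beta> z powr (- L))"
        by (simp add: \<rho>_sym)
      also have "\<rho> k \<beta> z powr s * \<rho> k \<beta> z powr (- L) = \<rho> k \<beta> z powr (- (L - s))"
        by (simp add: powr_add[symmetric])
      finally show "ennreal (\<rho> k x z powr s * kernel L k \<beta> z) \<le> ennreal ?c * wt (L - s) k \<beta> z"
        by (simp add: ennreal_mult[symmetric] ennreal_leI)
    qed
    also have "\<dots> = ennreal ?c * (\<integral>\<^sup>+z. wt (L - s) k \<beta> z \<partial>M)"
      by (intro nn_integral_cmult) measurable
    also have "\<dots> \<le> ennreal ?c * ennreal (C2 * (C1 * ?mu))"
      using L C1(2)[OF \<beta>] C2(1)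
      by (intro mult_left_mono order_trans[OF C2(2)] ennreal_leI) auto
    also have "\<dots> = ennreal (A powr s * C2 * C1 * \<rho> k x \<beta> powr s)"
      using C1 C2 mu by (simp add: ennreal_mult[symmetric] powr_minus mult_ac)
    finally show "(\<integral>\<^sup>+z. ennreal (\<rho> k x z powr s * kernel L k \<beta> z) \<partial>M) \<le> ennreal (A powr s * C2 * C1 * \<rho> k x \<beta> powr s)" .
  qed
qed

text \<open>For the main term: the decay of the kernel from z to \<beta> and the weight from x to
  \<beta> multiply to a decay from x to z, hence to \<alpha>. Of the extra 2 \<omega>, one \<omega>
  exchanges the measure of the cube of \<beta> for the volume at x, the other does so for the cube
  of \<alpha>. This constant may depend on n.\<close>

lemma kernel_cube_decay:
  assumes s: "0 \<le> s" and L: "s + \<omega> \<le> L"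
  obtains C where "0 < C"
    "\<And>k x \<beta> \<alpha>. \<beta> \<in> X (k + int 1) \<Longrightarrow> \<alpha> \<in> X (k + int n) \<Longrightarrow>
      (\<integral>\<^sup>+z. indicator (Q (k + int n) \<alpha>) z * ennreal (kernel L k \<beta> z) \<partial>M) * wt (s + 2 * \<omega>) k x \<beta>
      \<le> ennreal (C * \<rho> k x \<alpha> powr (- s))"
proof -
  obtain C1 where C1: "1 \<le> C1"
    "\<And>k \<alpha>. \<alpha> \<in> X (k + int 1) \<Longrightarrow> V k \<alpha> \<le> C1 * measure M (Q (k + int 1) \<alpha>)"
    using cube_volume[of 1] by metis
  obtain C2 where C2: "1 \<le> C2"
    "\<And>k \<alpha>. \<alpha> \<in> X (k + int n) \<Longrightarrow> measure M (Q (k + int n) \<alpha>) \<le> C2 * V k \<alpha>"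
    using cube_volume[of n] by metis
  define K where "K = A * (5 * A\<^sup>2)"
  have K: "0 < K" by (simp add: K_def)
  define C where "C = C1 * (Cv * A powr \<omega>) * A powr (s + \<omega>) * K powr (s + \<omega>) * C2 * (Cv * A powr \<omega>)"
  show thesis
  proof (rule that[of C])
    show "0 < C" using C1 C2 Cv_ge1 K by (simp add: C_def)
    fix k x \<beta> \<alpha>
    assume \<beta>: "\<beta> \<in> X (k + int 1)" and \<alpha>: "\<alpha> \<in> X (k + int n)"
    let ?mu = "measure M (Q (k + 1) \<beta>)" and ?Q = "Q (k + int n) \<alpha>"
    have mu: "0 < ?mu" using measure_cube_pos[OF \<beta>] by simp
    note [measurable] = sets_cube[OF \<alpha>]
    have "V k x \<le> Cv * (A * \<rho> k x \<beta>) powr \<omega> * (C1 * ?mu)"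
      using C1(2)[OF \<beta>] Cv_ge1 by (intro order_trans[OF V_change[of k x \<beta>]] mult_left_mono) auto
    then have mu_inv: "?mu powr (- 1) \<le> C1 * (Cv * A powr \<omega>) * \<rho> k x \<beta> powr \<omega> / V k x"
      using mu V_pos[of k x] by (simp add: powr_minus powr_mult divide_simps mult_ac)
    let ?c = "C1 * (Cv * A powr \<omega>) * A powr (s + \<omega>) * K powr (s + \<omega>) * \<rho> k x \<alpha> powr (- (s + \<omega>)) / V k x"
    have pt: "kernel L k \<beta> z * \<rho> k x \<beta> powr (- (s + 2 * \<omega>)) \<le> ?c" if z: "z \<in> ?Q" for z
    proof -
      have "kernel L k \<beta> z * \<rho> k x \<beta> powr (- (s + 2 * \<omega>))
        \<le> (C1 * (Cv * A powr \<omega>) * \<rho> k x \<beta> powr \<omega> / V k x) * \<rho> k z \<beta> powr (- (s + \<omega>)) * \<rho> k x \<beta> powr (- (s + 2 * \<omega>))"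
        unfolding kernel_def using L C1 Cv_ge1
        by (intro mult_right_mono mult_mono mu_inv \<rho>_powr_antimono divide_nonneg_pos mult_nonneg_nonneg) auto
      also have "\<dots> = C1 * (Cv * A powr \<omega>) / V k x * (\<rho> k z \<beta> powr (- (s + \<omega>)) * (\<rho> k x \<beta> powr \<omega> * \<rho> k x \<beta> powr (- (s + 2 * \<omega>))))"
        by simp
      also have "\<rho> k x \<beta> powr \<omega> * \<rho> k x \<beta> powr (- (s + 2 * \<omega>)) = \<rho> k x \<beta> powr (- (s + \<omega>))"
        by (simp add: powr_add[symmetric] algebra_simps)
      also have "\<rho> k z \<beta> powr (- (s + \<omega>)) * \<rho> k x \<beta> powr (- (s + \<omega>)) = (\<rho> k x \<beta> * \<rho> k \<beta> z) powr (- (s + \<omega>))"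
        by (simp add: powr_mult \<rho>_sym mult.commute)
      also have "\<dots> \<le> A powr (s + \<omega>) * \<rho> k x z powr (- (s + \<omega>))"
        using \<rho>_triangle[of k x z \<beta>] s omega_pos by (intro powr_neg_le_powr_neg) (auto simp: mult.assoc)
      also have "\<rho> k x z powr (- (s + \<omega>)) \<le> K powr (s + \<omega>) * \<rho> k x \<alpha> powr (- (s + \<omega>))"
      proof (rule powr_neg_le_powr_neg)
        have "\<rho> k x \<alpha> \<le> A * \<rho> k x z * \<rho> k z \<alpha>" by (rule \<rho>_triangle)
        also have "\<dots> \<le> A * \<rho> k x z * (5 * A\<^sup>2)"
          using cube_\<rho>(1)[OF \<alpha> z] by (intro mult_left_mono) auto
        finally show "\<rho> k x \<alpha> \<le> K * \<rho> k x z" by (simp add: K_def mult_ac)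
      qed (use K s omega_pos in auto)
      finally show ?thesis
        using C1 Cv_ge1 by (simp add: mult_left_mono divide_right_mono less_imp_le mult_ac)
    qed
    have "(\<integral>\<^sup>+z. indicator ?Q z * ennreal (kernel L k \<beta> z) \<partial>M) * wt (s + 2 * \<omega>) k x \<beta>
      = (\<integral>\<^sup>+z. indicator ?Q z * ennreal (kernel L k \<beta> z) * wt (s + 2 * \<omega>) k x \<beta> \<partial>M)"
      by (intro nn_integral_multc[symmetric]) measurable
    also have "\<dots> \<le> (\<integral>\<^sup>+z. ennreal ?c * indicator ?Q z \<partial>M)"
      using pt by (intro nn_integral_mono) (auto simp: ennreal_mult[symmetric] intro!: ennreal_leI split: split_indicator)
    also have "\<dots> = ennreal ?c * ennreal (measure M ?Q)"
      by (simp add: nn_integral_cmult_indicator emeasure_cube[OF \<alpha>])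
    also have "\<dots> \<le> ennreal ?c * ennreal (C2 * (Cv * (A * \<rho> k x \<alpha>) powr \<omega> * V k x))"
      using C2 V_change[of k \<alpha> x]
      by (intro mult_left_mono ennreal_leI order_trans[OF C2(2)[OF \<alpha>]]) (auto simp: \<rho>_sym)
    also have "\<dots> = ennreal (C * (\<rho> k x \<alpha> powr (- (s + \<omega>)) * \<rho> k x \<alpha> powr \<omega>))"
      using C1 C2 Cv_ge1 less_imp_neq[OF V_pos[of k x]] by (simp add: ennreal_mult[symmetric] less_imp_le C_def powr_mult)
    also have "\<rho> k x \<alpha> powr (- (s + \<omega>)) * \<rho> k x \<alpha> powr \<omega> = \<rho> k x \<alpha> powr (- s)"
      by (simp add: powr_add[symmetric])
    finally show "(\<integral>\<^sup>+z. indicator ?Q z * ennreal (kernel L k \<beta> z) \<partial>M) * wt (s + 2 * \<omega>) k x \<beta>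
      \<le> ennreal (C * \<rho> k x \<alpha> powr (- s))" .
  qed
qed

end

context wavelet_space
begin

lemma wavelet_kernel:
  assumes L: "0 \<le> L"
  obtains C where "0 < C"
    "\<And>k \<beta> x. \<beta> \<in> new_points X k \<Longrightarrow>
      mass k \<beta> * \<bar>\<psi> k \<beta> x\<bar> \<le> C * kernel L k \<beta> x"
proof -
  obtain C where C: "0 < C"
    "\<And>k \<beta> x. \<beta> \<in> new_points X k \<Longrightarrow>
      \<bar>\<psi> k \<beta> x\<bar> \<le> C * mass k \<beta> * \<rho> k x \<beta> powr (- L)"
    using wavelet_estimates[OF L] by metis
  show thesis
  proof (rule that[OF C(1)])
    fix k \<beta> x assume \<beta>: "\<beta> \<in> new_points X k"
    have "mass k \<beta> * \<bar>\<psi> k \<beta> x\<bar>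
      \<le> mass k \<beta> * (C * mass k \<beta> * \<rho> k x \<beta> powr (- L))"
      by (intro mult_left_mono C(2) \<beta>) auto
    also have "\<dots> = C * ((mass k \<beta> * mass k \<beta>) * \<rho> k x \<beta> powr (- L))"
      by simp
    also have "mass k \<beta> * mass k \<beta> = measure M (Q (k + 1) \<beta>) powr (- 1)"
      by (simp add: powr_add[symmetric])
    finally show "mass k \<beta> * \<bar>\<psi> k \<beta> x\<bar> \<le> C * kernel L k \<beta> x"
      by (simp add: kernel_def)
  qed
qed

end

section \<open>The estimate of the supremum\<close>

lemma nn_integral_count_space_subset:
  fixes f :: "'a \<Rightarrow> ennreal"
  assumes "A \<subseteq> B"
  shows "(\<integral>\<^sup>+x. f x \<partial>count_space A) = (\<integral>\<^sup>+x. f x * indicator A x \<partial>count_space B)"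
proof -
  have "indicator A x * indicator B x = (indicator A x :: ennreal)" for x
    using assms by (auto split: split_indicator)
  then show ?thesis
    by (subst nn_integral_count_space_indicator, simp, subst nn_integral_count_space_indicator)
       (simp_all add: mult.assoc)
qed

lemma ennreal_norm_integral_le:
  fixes f :: "'a \<Rightarrow> complex"
  shows "ennreal (norm (\<integral>x. f x \<partial>M)) \<le> (\<integral>\<^sup>+x. ennreal (norm (f x)) \<partial>M)"
  by (cases "integrable M f") (simp_all add: integral_norm_bound_ennreal not_integrable_integral_eq)

lemma ennreal_norm_double_infsum_le:
  fixes F :: "'a \<Rightarrow> 'b \<Rightarrow> complex"
  shows "ennreal (norm (\<Sum>\<^sub>\<infinity>x\<in>A. \<Sum>\<^sub>\<infinity>y\<in>B. F x y))
    \<le> (\<integral>\<^sup>+x. \<integral>\<^sup>+y. ennreal (norm (F x y)) \<partial>count_space B \<partial>count_space A)"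
  by (rule order_trans[OF norm_infsum_le_nn_integral]) (intro nn_integral_mono norm_infsum_le_nn_integral)

text \<open>Subtraction requires genuine summability of the inner and outer sums, since a divergent
  \<open>infsum\<close> is 0 and would destroy linearity; this is where the finiteness of both
  absolute sums is used.\<close>

lemma ennreal_norm_double_infsum_diff_le:
  fixes F G :: "'a \<Rightarrow> 'b \<Rightarrow> complex"
  assumes F: "(\<integral>\<^sup>+x. \<integral>\<^sup>+y. ennreal (norm (F x y)) \<partial>count_space B \<partial>count_space A) < \<infinity>"
    and G: "(\<integral>\<^sup>+x. \<integral>\<^sup>+y. ennreal (norm (G x y)) \<partial>count_space B \<partial>count_space A) < \<infinity>"
  shows "ennreal (norm ((\<Sum>\<^sub>\<infinity>x\<in>A. \<Sum>\<^sub>\<infinity>y\<in>B. F x y) - (\<Sum>\<^sub>\<infinity>x\<in>A. \<Sum>\<^sub>\<infinity>y\<in>B. G x y)))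
    \<le> (\<integral>\<^sup>+x. \<integral>\<^sup>+y. ennreal (norm (F x y - G x y)) \<partial>count_space B \<partial>count_space A)"
proof -
  have inner: "H x summable_on B"
    if "(\<integral>\<^sup>+x. \<integral>\<^sup>+y. ennreal (norm (H x y)) \<partial>count_space B \<partial>count_space A) < \<infinity>" "x \<in> A" for H :: "'a \<Rightarrow> 'b \<Rightarrow> complex" and x
    using order.strict_trans1[OF nn_integral_ge_point[of x A "\<lambda>x. \<integral>\<^sup>+y. ennreal (norm (H x y)) \<partial>count_space B"] that(1)] that(2)
    by (intro summable_on_if_nn_integral_finite(1)) auto
  have outer: "(\<lambda>x. \<Sum>\<^sub>\<infinity>y\<in>B. H x y) summable_on A"
    if "(\<integral>\<^sup>+x. \<integral>\<^sup>+y. ennreal (norm (H x y)) \<partial>count_space B \<partial>count_space A) < \<infinity>" for H :: "'a \<Rightarrow> 'b \<Rightarrow> complex"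
    by (intro summable_on_if_nn_integral_finite(1) order.strict_trans1[OF _ that])
       (intro nn_integral_mono norm_infsum_le_nn_integral)
  have diff: "infsum f I - infsum g I = (\<Sum>\<^sub>\<infinity>i\<in>I. f i - g i)" if "f summable_on I" "g summable_on I" for f g :: "'c \<Rightarrow> complex" and I
  proof -
    have "(\<lambda>i. - g i) summable_on I" using that(2) by (simp add: summable_on_uminus)
    from infsum_add[OF that(1) this] show ?thesis by (simp add: infsum_uminus)
  qed
  have "(\<Sum>\<^sub>\<infinity>x\<in>A. \<Sum>\<^sub>\<infinity>y\<in>B. F x y) - (\<Sum>\<^sub>\<infinity>x\<in>A. \<Sum>\<^sub>\<infinity>y\<in>B. G x y)
    = (\<Sum>\<^sub>\<infinity>x\<in>A. (\<Sum>\<^sub>\<infinity>y\<in>B. F x y) - (\<Sum>\<^sub>\<infinity>y\<in>B. G x y))"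
    by (rule diff[OF outer[OF F] outer[OF G]])
  also have "\<dots> = (\<Sum>\<^sub>\<infinity>x\<in>A. \<Sum>\<^sub>\<infinity>y\<in>B. F x y - G x y)"
    by (intro infsum_cong diff inner F G)
  finally show ?thesis
    using ennreal_norm_double_infsum_le[of "\<lambda>x y. F x y - G x y" B A] by simp
qed

text \<open>Cauchy-Schwarz in j for every fixed i with the weight v, then in i with the weight
  u.\<close>

lemma double_sum_Cauchy_Schwarz:
  assumes u: "\<And>i. 0 \<le> u i" "(\<integral>\<^sup>+i. ennreal (u i) \<partial>count_space I) \<le> ennreal a" "0 \<le> a"
    and v: "\<And>j. 0 \<le> v j" "(\<integral>\<^sup>+j. ennreal (v j) \<partial>count_space J) \<le> ennreal b" "0 \<le> b"
  shows "(\<integral>\<^sup>+i. \<integral>\<^sup>+j. s i j * ennreal (u i) * ennreal (v j) \<partial>count_space J \<partial>count_space I)\<^sup>2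
    \<le> ennreal (a * b) * (\<integral>\<^sup>+i. \<integral>\<^sup>+j. (s i j)\<^sup>2 * ennreal (u i) * ennreal (v j) \<partial>count_space J \<partial>count_space I)"
proof -
  let ?t = "\<lambda>i. \<integral>\<^sup>+j. s i j * ennreal (v j) \<partial>count_space J"
  have "(\<integral>\<^sup>+i. \<integral>\<^sup>+j. s i j * ennreal (u i) * ennreal (v j) \<partial>count_space J \<partial>count_space I)\<^sup>2
    = (\<integral>\<^sup>+i. ?t i * ennreal (u i) \<partial>count_space I)\<^sup>2"
    by (intro arg_cong[where f="\<lambda>x. x\<^sup>2"] nn_integral_cong, subst nn_integral_multc[symmetric]) (auto simp: mult_ac)
  also have "\<dots> \<le> (\<integral>\<^sup>+i. ennreal (u i) \<partial>count_space I) * (\<integral>\<^sup>+i. (?t i)\<^sup>2 * ennreal (u i) \<partial>count_space I)"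
    by (rule Cauchy_Schwarz_weighted_nn_integral) (auto simp: u)
  also have "\<dots> \<le> ennreal a * (\<integral>\<^sup>+i. (ennreal b * (\<integral>\<^sup>+j. (s i j)\<^sup>2 * ennreal (v j) \<partial>count_space J)) * ennreal (u i) \<partial>count_space I)"
  proof (intro mult_mono u(2) nn_integral_mono mult_right_mono)
    fix i
    have "(?t i)\<^sup>2 \<le> (\<integral>\<^sup>+j. ennreal (v j) \<partial>count_space J) * (\<integral>\<^sup>+j. (s i j)\<^sup>2 * ennreal (v j) \<partial>count_space J)"
      by (rule Cauchy_Schwarz_weighted_nn_integral) (auto simp: v)
    also have "\<dots> \<le> ennreal b * (\<integral>\<^sup>+j. (s i j)\<^sup>2 * ennreal (v j) \<partial>count_space J)"
      by (intro mult_right_mono v) auto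
    finally show "(?t i)\<^sup>2 \<le> ennreal b * (\<integral>\<^sup>+j. (s i j)\<^sup>2 * ennreal (v j) \<partial>count_space J)" .
  qed auto
  also have "\<dots> = ennreal (a * b) * (\<integral>\<^sup>+i. \<integral>\<^sup>+j. (s i j)\<^sup>2 * ennreal (u i) * ennreal (v j) \<partial>count_space J \<partial>count_space I)"
    using u(3) v(3) by (simp add: nn_integral_cmult[symmetric] nn_integral_multc[symmetric] ennreal_mult mult_ac)
  finally show ?thesis .
qed

text \<open>Integration turns each \<open>u i\<close> into a constant, and \<open>x0\<close> is
  merely the argument at which this constant function is evaluated.\<close>

lemma nn_integral_double_sum:
  assumes I: "countable I" and J: "countable J" and u: "\<And>i. i \<in> I \<Longrightarrow> u i \<in> borel_measurable M"
  shows "(\<integral>\<^sup>+x. double_sum I J t u v x y \<partial>M) = double_sum I J t (\<lambda>i x. \<integral>\<^sup>+x. u i x \<partial>M) v x0 y"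
proof -
  note [measurable] = u
  have "(\<integral>\<^sup>+x. double_sum I J t u v x y \<partial>M)
    = (\<integral>\<^sup>+i. \<integral>\<^sup>+x. (\<integral>\<^sup>+j. t i j * v j y \<partial>count_space J) * u i x \<partial>M \<partial>count_space I)"
    unfolding double_sum_left by (intro nn_integral_count_space_nn_integral I) measurable
  also have "\<dots> = double_sum I J t (\<lambda>i x. \<integral>\<^sup>+x. u i x \<partial>M) v x0 y"
    unfolding double_sum_left by (intro nn_integral_cong nn_integral_cmult) simp
  finally show ?thesis .
qed

lemma double_sum_flip:
  assumes "countable J"
  shows "double_sum I J t u v x y = double_sum J I (\<lambda>j i. t i j) v u y x"
  unfolding double_sum_right[OF assms] double_sum_left[of J] by simp

lemma nn_integral_nn_integral_double_sum:
  assumes I: "countable I" and J: "countable J"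
    and u: "\<And>i. i \<in> I \<Longrightarrow> u i \<in> borel_measurable M" and v: "\<And>j. j \<in> J \<Longrightarrow> v j \<in> borel_measurable N"
  shows "(\<integral>\<^sup>+y. \<integral>\<^sup>+x. double_sum I J t u v x y \<partial>M \<partial>N)
    = (\<integral>\<^sup>+i. \<integral>\<^sup>+j. t i j * (\<integral>\<^sup>+x. u i x \<partial>M) * (\<integral>\<^sup>+y. v j y \<partial>N) \<partial>count_space J \<partial>count_space I)"
proof -
  fix x0 :: 'a and y0 :: 'b
  have "(\<integral>\<^sup>+x. double_sum I J t u v x y \<partial>M) = double_sum J I (\<lambda>j i. t i j) v (\<lambda>i x. \<integral>\<^sup>+x. u i x \<partial>M) y x0" for y
    by (rule trans[OF nn_integral_double_sum[OF I J u] double_sum_flip[OF J]])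
  then have "(\<integral>\<^sup>+y. \<integral>\<^sup>+x. double_sum I J t u v x y \<partial>M \<partial>N)
    = (\<integral>\<^sup>+y. double_sum J I (\<lambda>j i. t i j) v (\<lambda>i x. \<integral>\<^sup>+x. u i x \<partial>M) y x0 \<partial>N)"
    by simp
  also have "\<dots> = double_sum J I (\<lambda>j i. t i j) (\<lambda>j y. \<integral>\<^sup>+y. v j y \<partial>N) (\<lambda>i x. \<integral>\<^sup>+x. u i x \<partial>M) y0 x0"
    by (rule nn_integral_double_sum[OF J I v])
  also have "\<dots> = double_sum I J t (\<lambda>i x. \<integral>\<^sup>+x. u i x \<partial>M) (\<lambda>j y. \<integral>\<^sup>+y. v j y \<partial>N) x0 y0"
    by (rule double_sum_flip[OF J, symmetric])
  finally show ?thesis by (simp add: double_sum_def)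
qed

lemma nn_integral_double_sum_add_le:
  assumes I: "countable I" and J: "countable J"
    and u: "\<And>i. i \<in> I \<Longrightarrow> u i \<in> borel_measurable M" and v: "\<And>j. j \<in> J \<Longrightarrow> v j \<in> borel_measurable N"
    and g: "g \<in> borel_measurable M" and h: "h \<in> borel_measurable N"
  shows "(\<integral>\<^sup>+y. \<integral>\<^sup>+x. double_sum I J t u v x y + E * g x * h y \<partial>M \<partial>N)
    = (\<integral>\<^sup>+i. \<integral>\<^sup>+j. t i j * (\<integral>\<^sup>+x. u i x \<partial>M) * (\<integral>\<^sup>+y. v j y \<partial>N) \<partial>count_space J \<partial>count_space I)
      + E * (\<integral>\<^sup>+x. g x \<partial>M) * (\<integral>\<^sup>+y. h y \<partial>N)"
proof -
  note [measurable] = u v g h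
  have [measurable]: "(\<lambda>x. double_sum I J t u v x y) \<in> borel_measurable M" for y
    unfolding double_sum_left by (intro borel_measurable_nn_integral_count_space I) measurable
  \<comment> \<open>The inner integral is measurable in y because it is again a countable double
    sum, with the integrals of \<open>u i\<close> as constants.\<close>
  have [measurable]: "(\<lambda>y. \<integral>\<^sup>+x. double_sum I J t u v x y \<partial>M) \<in> borel_measurable N"
  proof -
    have "(\<lambda>y. \<integral>\<^sup>+x. double_sum I J t u v x y \<partial>M) = (\<lambda>y. double_sum I J t (\<lambda>i x. \<integral>\<^sup>+x. u i x \<partial>M) v undefined y)"
      by (rule ext) (rule nn_integral_double_sum[OF I J u])
    then show ?thesis
      unfolding double_sum_right[OF J]
      by (auto intro!: borel_measurable_nn_integral_count_space J borel_measurable_times v)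
  qed
  have "(\<integral>\<^sup>+y. \<integral>\<^sup>+x. double_sum I J t u v x y + E * g x * h y \<partial>M \<partial>N)
    = (\<integral>\<^sup>+y. (\<integral>\<^sup>+x. double_sum I J t u v x y \<partial>M) + E * (\<integral>\<^sup>+x. g x \<partial>M) * h y \<partial>N)"
    by (intro nn_integral_cong) (simp add: nn_integral_add nn_integral_cmult nn_integral_multc)
  also have "\<dots> = (\<integral>\<^sup>+y. \<integral>\<^sup>+x. double_sum I J t u v x y \<partial>M \<partial>N) + E * (\<integral>\<^sup>+x. g x \<partial>M) * (\<integral>\<^sup>+y. h y \<partial>N)"
    by (simp add: nn_integral_add nn_integral_cmult)
  finally show ?thesis
    by (simp add: nn_integral_nn_integral_double_sum[OF I J u v])
qed

section \<open>Coefficients and series at a pair of scales\<close>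

locale wavelet_pair =
  dyadic_pair S1 \<omega>1 \<delta>1 X1 Q1 S2 \<omega>2 \<delta>2 X2 Q2 +
  one: wavelet_space S1 \<omega>1 \<delta>1 X1 Q1 \<eta>1 \<psi>1 + two: wavelet_space S2 \<omega>2 \<delta>2 X2 Q2 \<eta>2 \<psi>2
  for S1 :: "'a qm_space" and \<omega>1 \<delta>1 :: real and X1 Q1 \<eta>1 \<psi>1
    and S2 :: "'b qm_space" and \<omega>2 \<delta>2 :: real and X2 Q2 \<eta>2 \<psi>2
begin

text \<open>The coefficients are normalised by the square roots of the measures of the cubes and extended by
  zero from the new points to all points of the next generation.\<close>

definition ncoef :: "('a \<Rightarrow> 'b \<Rightarrow> complex) \<Rightarrow> int \<Rightarrow> int \<Rightarrow> 'a \<Rightarrow> 'b \<Rightarrow> ennreal" where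
  "ncoef c k1 k2 \<beta>1 \<beta>2 = ennreal (cmod (c \<beta>1 \<beta>2) * one.mass k1 \<beta>1 * two.mass k2 \<beta>2)
     * indicator (new_points X1 k1) \<beta>1 * indicator (new_points X2 k2) \<beta>2"

definition series :: "('a \<Rightarrow> 'b \<Rightarrow> complex) \<Rightarrow> int \<Rightarrow> int \<Rightarrow> 'a \<Rightarrow> 'b \<Rightarrow> complex" where
  "series c k1 k2 x y = (\<Sum>\<^sub>\<infinity>\<beta>1\<in>new_points X1 k1. \<Sum>\<^sub>\<infinity>\<beta>2\<in>new_points X2 k2.
     c \<beta>1 \<beta>2 * complex_of_real (\<psi>1 k1 \<beta>1 x) * complex_of_real (\<psi>2 k2 \<beta>2 y))"

text \<open>Dominates the series with all cancellation discarded. The sum runs over whole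
  generations k + 1, where the sums of weights are under control.\<close>

definition majorant :: "('a \<Rightarrow> 'b \<Rightarrow> complex) \<Rightarrow> int \<Rightarrow> int \<Rightarrow> real \<Rightarrow> real \<Rightarrow> 'a \<Rightarrow> 'b \<Rightarrow> ennreal" where
  "majorant c k1 k2 L1 L2 x y = (\<integral>\<^sup>+\<beta>1. \<integral>\<^sup>+\<beta>2. ncoef c k1 k2 \<beta>1 \<beta>2
     * one.wt L1 k1 x \<beta>1 * two.wt L2 k2 y \<beta>2
     \<partial>two.pts 1 k2 \<partial>one.pts 1 k1)"

text \<open>P and R stand for sizes of wavelets or for their oscillations on a small cube, so one
  bound covers the series and its differences.\<close>

lemma le_majorant:
  assumes C: "0 \<le> C1" "0 \<le> C2"
    and P: "\<And>\<beta>. \<beta> \<in> new_points X1 k1 \<Longrightarrow> 0 \<le> P \<beta> \<and> P \<beta> \<le> C1 * one.mass k1 \<beta> * one.\<rho> k1 x \<beta> powr (- L1)"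
    and R: "\<And>\<beta>. \<beta> \<in> new_points X2 k2 \<Longrightarrow> 0 \<le> R \<beta> \<and> R \<beta> \<le> C2 * two.mass k2 \<beta> * two.\<rho> k2 y \<beta> powr (- L2)"
  shows "(\<integral>\<^sup>+\<beta>1. \<integral>\<^sup>+\<beta>2. ennreal (cmod (c \<beta>1 \<beta>2) * P \<beta>1 * R \<beta>2)
      \<partial>count_space (new_points X2 k2) \<partial>count_space (new_points X1 k1))
    \<le> ennreal (C1 * C2) * majorant c k1 k2 L1 L2 x y"
proof -
  let ?w = "\<lambda>\<beta>1 \<beta>2. one.wt L1 k1 x \<beta>1 * two.wt L2 k2 y \<beta>2"
  have "(\<integral>\<^sup>+\<beta>1. \<integral>\<^sup>+\<beta>2. ennreal (cmod (c \<beta>1 \<beta>2) * P \<beta>1 * R \<beta>2)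
      \<partial>count_space (new_points X2 k2) \<partial>count_space (new_points X1 k1))
    = (\<integral>\<^sup>+\<beta>1. \<integral>\<^sup>+\<beta>2. ennreal (cmod (c \<beta>1 \<beta>2) * P \<beta>1 * R \<beta>2)
      * indicator (new_points X1 k1) \<beta>1 * indicator (new_points X2 k2) \<beta>2
      \<partial>two.pts 1 k2 \<partial>one.pts 1 k1)"
    by (subst nn_integral_count_space_subset[OF one.new_points_subset],
        subst nn_integral_count_space_subset[OF two.new_points_subset])
       (intro nn_integral_cong, subst nn_integral_multc[symmetric], auto intro!: nn_integral_cong simp: mult_ac)
  also have "\<dots> \<le> (\<integral>\<^sup>+\<beta>1. \<integral>\<^sup>+\<beta>2. ennreal (C1 * C2) * (ncoef c k1 k2 \<beta>1 \<beta>2 * ?w \<beta>1 \<beta>2)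
      \<partial>two.pts 1 k2 \<partial>one.pts 1 k1)"
  proof (intro nn_integral_mono)
    fix \<beta>1 \<beta>2
    show "ennreal (cmod (c \<beta>1 \<beta>2) * P \<beta>1 * R \<beta>2) * indicator (new_points X1 k1) \<beta>1 * indicator (new_points X2 k2) \<beta>2
       \<le> ennreal (C1 * C2) * (ncoef c k1 k2 \<beta>1 \<beta>2 * ?w \<beta>1 \<beta>2)"
    proof (cases "\<beta>1 \<in> new_points X1 k1 \<and> \<beta>2 \<in> new_points X2 k2")
      case True
      then have "cmod (c \<beta>1 \<beta>2) * P \<beta>1 * R \<beta>2
         \<le> cmod (c \<beta>1 \<beta>2) * (C1 * one.mass k1 \<beta>1 * one.\<rho> k1 x \<beta>1 powr (- L1)) * (C2 * two.mass k2 \<beta>2 * two.\<rho> k2 y \<beta>2 powr (- L2))"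
        using P R C by (intro mult_mono) auto
      also have "\<dots> = C1 * C2 * (cmod (c \<beta>1 \<beta>2) * one.mass k1 \<beta>1 * two.mass k2 \<beta>2)
          * (one.\<rho> k1 x \<beta>1 powr (- L1) * two.\<rho> k2 y \<beta>2 powr (- L2))"
        by simp
      finally show ?thesis
        using True C by (simp add: ncoef_def ennreal_mult[symmetric] ennreal_leI mult_ac)
    qed (auto simp: ncoef_def)
  qed
  also have "\<dots> = ennreal (C1 * C2) * majorant c k1 k2 L1 L2 x y"
    by (simp add: majorant_def nn_integral_cmult mult.assoc)
  finally show ?thesis .
qed

lemma series_le_majorant:
  assumes L: "0 \<le> L1" "0 \<le> L2"
  obtains C where "0 < C"
    "\<And>c k1 k2 x y. ennreal (cmod (series c k1 k2 x y)) \<le> ennreal C * majorant c k1 k2 L1 L2 x y"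
proof -
  obtain C1 where C1: "0 < C1"
    "\<And>k \<beta> x. \<beta> \<in> new_points X1 k \<Longrightarrow> \<bar>\<psi>1 k \<beta> x\<bar> \<le> C1 * one.mass k \<beta> * one.\<rho> k x \<beta> powr (- L1)"
    using one.wavelet_estimates[OF L(1)] by metis
  obtain C2 where C2: "0 < C2"
    "\<And>k \<beta> x. \<beta> \<in> new_points X2 k \<Longrightarrow> \<bar>\<psi>2 k \<beta> x\<bar> \<le> C2 * two.mass k \<beta> * two.\<rho> k x \<beta> powr (- L2)"
    using two.wavelet_estimates[OF L(2)] by metis
  show thesis
  proof (rule that[of "C1 * C2"])
    show "0 < C1 * C2" using C1 C2 by simp
    fix c k1 k2 x y
    have "ennreal (cmod (series c k1 k2 x y))
      \<le> (\<integral>\<^sup>+\<beta>1. \<integral>\<^sup>+\<beta>2. ennreal (cmod (c \<beta>1 \<beta>2) * \<bar>\<psi>1 k1 \<beta>1 x\<bar> * \<bar>\<psi>2 k2 \<beta>2 y\<bar>)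
      \<partial>count_space (new_points X2 k2) \<partial>count_space (new_points X1 k1))"
      unfolding series_def by (rule order_trans[OF ennreal_norm_double_infsum_le]) (simp add: norm_mult)
    also have "\<dots> \<le> ennreal (C1 * C2) * majorant c k1 k2 L1 L2 x y"
      using C1 C2 by (intro le_majorant) auto
    finally show "ennreal (cmod (series c k1 k2 x y)) \<le> ennreal (C1 * C2) * majorant c k1 k2 L1 L2 x y" .
  qed
qed

lemma majorant_cube_transfer:
  assumes L: "0 \<le> L1" "0 \<le> L2"
    and \<alpha>1: "\<alpha>1 \<in> X1 (k1 + int N1)" and x: "x \<in> Q1 (k1 + int N1) \<alpha>1" "x' \<in> Q1 (k1 + int N1) \<alpha>1"
    and \<alpha>2: "\<alpha>2 \<in> X2 (k2 + int N2)" and y: "y \<in> Q2 (k2 + int N2) \<alpha>2" "y' \<in> Q2 (k2 + int N2) \<alpha>2"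
  shows "majorant c k1 k2 L1 L2 x' y'
    \<le> ennreal ((25 * one.A ^ 6) powr L1 * (25 * two.A ^ 6) powr L2) * majorant c k1 k2 L1 L2 x y"
proof -
  let ?K1 = "(25 * one.A ^ 6) powr L1" and ?K2 = "(25 * two.A ^ 6) powr L2"
  have "majorant c k1 k2 L1 L2 x' y' \<le> (\<integral>\<^sup>+\<beta>1. \<integral>\<^sup>+\<beta>2. ncoef c k1 k2 \<beta>1 \<beta>2
     * ennreal (?K1 * one.\<rho> k1 x \<beta>1 powr (- L1)) * ennreal (?K2 * two.\<rho> k2 y \<beta>2 powr (- L2))
     \<partial>two.pts 1 k2 \<partial>one.pts 1 k1)"
    unfolding majorant_def
    by (intro nn_integral_mono mult_mono ennreal_leI one.\<rho>_cube_transfer[OF L(1) \<alpha>1 x] two.\<rho>_cube_transfer[OF L(2) \<alpha>2 y]) auto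
  also have "\<dots> = ennreal (?K1 * ?K2) * majorant c k1 k2 L1 L2 x y"
    unfolding majorant_def
    by (simp add: nn_integral_cmult[symmetric] ennreal_mult mult_ac)
  finally show ?thesis .
qed

definition sq_coef :: "(('a \<times> 'b \<Rightarrow> complex) \<Rightarrow> complex) \<Rightarrow> int \<Rightarrow> 'a \<Rightarrow> int \<Rightarrow> 'b \<Rightarrow> ennreal" where
  "sq_coef f k1 \<beta>1 k2 \<beta>2 = (ncoef (\<lambda>\<beta>1 \<beta>2. wavelet_coeff \<psi>1 \<psi>2 f k1 \<beta>1 k2 \<beta>2) k1 k2 \<beta>1 \<beta>2)\<^sup>2"

lemma DD_series:
  "DD X1 X2 \<psi>1 \<psi>2 k1 k2 f (x, y) = series (\<lambda>\<beta>1 \<beta>2. wavelet_coeff \<psi>1 \<psi>2 f k1 \<beta>1 k2 \<beta>2) k1 k2 x y"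
  by (simp add: DD_def series_def)

text \<open>The sums over new points extend by zero to the whole generation k + 1, and the squared
  normalising factors are absorbed into \<open>sq_coef\<close>.\<close>

lemma coeff_square_function_eq:
  "coeff_square_function S1 S2 X1 X2 Q1 Q2 \<psi>1 \<psi>2 f
    = (\<lambda>z. ennreal_powr (cube_series 1 1 (sq_coef f) (fst z) (snd z)) (1 / 2))"
proof -
  have "(\<Sum>\<^sub>\<infinity>k1. \<Sum>\<^sub>\<infinity>\<alpha>1\<in>new_points X1 k1. \<Sum>\<^sub>\<infinity>k2. \<Sum>\<^sub>\<infinity>\<alpha>2\<in>new_points X2 k2.
        ennreal ((cmod (wavelet_coeff \<psi>1 \<psi>2 f k1 \<alpha>1 k2 \<alpha>2)
          * normalized_indicator one.M (Q1 (k1 + 1) \<alpha>1) x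
          * normalized_indicator two.M (Q2 (k2 + 1) \<alpha>2) y)\<^sup>2)) = cube_series 1 1 (sq_coef f) x y" for x y
    unfolding cube_series_def
  proof (intro infsum_cong infsum_cong_neutral)
    fix k1 k2 \<alpha>1 \<alpha>2
    assume "\<alpha>1 \<in> new_points X1 k1 \<inter> X1 (k1 + int 1)" "\<alpha>2 \<in> new_points X2 k2 \<inter> X2 (k2 + int 1)"
    then show "ennreal ((cmod (wavelet_coeff \<psi>1 \<psi>2 f k1 \<alpha>1 k2 \<alpha>2)
          * normalized_indicator one.M (Q1 (k1 + 1) \<alpha>1) x
          * normalized_indicator two.M (Q2 (k2 + 1) \<alpha>2) y)\<^sup>2)
        = sq_coef f k1 \<alpha>1 k2 \<alpha>2 * indicator (Q1 (k1 + int 1) \<alpha>1) x * indicator (Q2 (k2 + int 1) \<alpha>2) y"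
      by (auto simp: sq_coef_def ncoef_def normalized_indicator_def ennreal_power mult_ac split: split_indicator)
  next
    fix k1 k2 \<alpha>1 \<alpha>2
    assume "\<alpha>2 \<in> X2 (k2 + int 1) - new_points X2 k2"
    then show "sq_coef f k1 \<alpha>1 k2 \<alpha>2 * indicator (Q1 (k1 + int 1) \<alpha>1) x * indicator (Q2 (k2 + int 1) \<alpha>2) y = 0"
      by (simp add: sq_coef_def ncoef_def)
  next
    fix k1 \<alpha>1
    assume "\<alpha>1 \<in> X1 (k1 + int 1) - new_points X1 k1"
    then show "(\<Sum>\<^sub>\<infinity>k2. \<Sum>\<^sub>\<infinity>\<alpha>2\<in>X2 (k2 + int 1). sq_coef f k1 \<alpha>1 k2 \<alpha>2
        * indicator (Q1 (k1 + int 1) \<alpha>1) x * indicator (Q2 (k2 + int 1) \<alpha>2) y) = 0"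
      by (simp add: sq_coef_def ncoef_def)
  qed (use one.new_points_subset two.new_points_subset in auto)
  then show ?thesis
    by (simp add: coeff_square_function_def case_prod_beta')
qed

lemma sup_square_function_eq:
  "sup_square_function X1 X2 Q1 Q2 \<psi>1 \<psi>2 N1 N2 f = (\<lambda>z. ennreal_powr (cube_series N1 N2
     (\<lambda>k1 \<alpha>1 k2 \<alpha>2. SUP z\<in>Q1 (k1 + int N1) \<alpha>1 \<times> Q2 (k2 + int N2) \<alpha>2.
        ennreal ((cmod (DD X1 X2 \<psi>1 \<psi>2 k1 k2 f z))\<^sup>2)) (fst z) (snd z)) (1 / 2))"
  by (simp add: sup_square_function_def cube_series_def case_prod_beta')

lemma inf_square_function_eq:
  "inf_square_function X1 X2 Q1 Q2 \<psi>1 \<psi>2 N1 N2 f = (\<lambda>z. ennreal_powr (cube_series N1 N2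
     (\<lambda>k1 \<alpha>1 k2 \<alpha>2. INF z\<in>Q1 (k1 + int N1) \<alpha>1 \<times> Q2 (k2 + int N2) \<alpha>2.
        ennreal ((cmod (DD X1 X2 \<psi>1 \<psi>2 k1 k2 f z))\<^sup>2)) (fst z) (snd z)) (1 / 2))"
  by (simp add: inf_square_function_def cube_series_def case_prod_beta')

lemma majorant_power2_le:
  assumes L: "2 * \<omega>1 + 1 \<le> L1" "2 * \<omega>2 + 1 \<le> L2"
  obtains C where "0 < C"
    "\<And>c k1 k2 x y. (majorant c k1 k2 L1 L2 x y)\<^sup>2 \<le> ennreal C *
      (\<integral>\<^sup>+\<beta>1. \<integral>\<^sup>+\<beta>2. (ncoef c k1 k2 \<beta>1 \<beta>2)\<^sup>2
     * one.wt L1 k1 x \<beta>1 * two.wt L2 k2 y \<beta>2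
     \<partial>two.pts 1 k2 \<partial>one.pts 1 k1)"
proof -
  obtain C1 where C1: "0 < C1"
    "\<And>k x L. 2 * \<omega>1 + 1 \<le> L \<Longrightarrow> (\<integral>\<^sup>+\<alpha>. one.wt L k x \<alpha> \<partial>one.pts 1 k) \<le> ennreal C1"
    using one.sum_\<rho>[of 1] by metis
  obtain C2 where C2: "0 < C2"
    "\<And>k x L. 2 * \<omega>2 + 1 \<le> L \<Longrightarrow> (\<integral>\<^sup>+\<alpha>. two.wt L k x \<alpha> \<partial>two.pts 1 k) \<le> ennreal C2"
    using two.sum_\<rho>[of 1] by metis
  show thesis
  proof (rule that[of "C1 * C2"])
    show "0 < C1 * C2" using C1 C2 by simp
    fix c k1 k2 x y
    show "(majorant c k1 k2 L1 L2 x y)\<^sup>2 \<le> ennreal (C1 * C2) *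
      (\<integral>\<^sup>+\<beta>1. \<integral>\<^sup>+\<beta>2. (ncoef c k1 k2 \<beta>1 \<beta>2)\<^sup>2
     * one.wt L1 k1 x \<beta>1 * two.wt L2 k2 y \<beta>2
     \<partial>two.pts 1 k2 \<partial>one.pts 1 k1)"
      unfolding majorant_def using C1 C2 L
      by (intro double_sum_Cauchy_Schwarz C1(2) C2(2)) auto
  qed
qed

text \<open>The double series is dominated termwise, a divergent one counting as 0, and its
  majorants at two points of the same small cube are comparable. Hence the supremum costs only a
  constant, and Cauchy-Schwarz passes to squares of coefficients.\<close>

theorem sup_square_function_le:
  fixes p :: real
  assumes p: "0 < p"
  shows "\<exists>C::real. C > 0 \<and> (\<forall>f.
    Lp_norm (one.M \<Otimes>\<^sub>M two.M) p (sup_square_function X1 X2 Q1 Q2 \<psi>1 \<psi>2 N1 N2 f)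
    \<le> ennreal C * Lp_norm (one.M \<Otimes>\<^sub>M two.M) p (coeff_square_function S1 S2 X1 X2 Q1 Q2 \<psi>1 \<psi>2 f))"
proof (rule cube_series_le[of "p / 2" N1 N2 1 1])
  show "0 < p / 2" using p by simp
  let ?L0 = "max (one.decay_exponent (p / 2)) (two.decay_exponent (p / 2))"
  fix K :: real
  assume K: "0 < K" and key: "\<And>H b C L. ?L0 \<le> L \<Longrightarrow> 0 < C \<Longrightarrow>
      cube_dominated N1 N2 1 1 L C H b \<Longrightarrow>
      (\<integral>\<^sup>+z. ennreal_powr (cube_series N1 N2 H (fst z) (snd z)) (p / 2) \<partial>(one.M \<Otimes>\<^sub>M two.M))
      \<le> ennreal (C powr (p / 2) * K) * (\<integral>\<^sup>+z. ennreal_powr (cube_series 1 1 b (fst z) (snd z)) (p / 2) \<partial>(one.M \<Otimes>\<^sub>M two.M))"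
  \<comment> \<open>Large enough for the one-parameter inequality at p / 2 and for summable weights
    in Cauchy-Schwarz.\<close>
  define L where "L = max ?L0 (max (2 * \<omega>1 + 1) (2 * \<omega>2 + 1))"
  have L: "?L0 \<le> L" "2 * \<omega>1 + 1 \<le> L" "2 * \<omega>2 + 1 \<le> L" by (auto simp: L_def)
  have L0: "0 \<le> L" using L(2) one.omega_pos by linarith
  obtain C1 where C1: "0 < C1"
    "\<And>c k1 k2 x y. ennreal (cmod (series c k1 k2 x y)) \<le> ennreal C1 * majorant c k1 k2 L L x y"
    using series_le_majorant[OF L0 L0] by metis
  obtain C2 where C2: "0 < C2"
    "\<And>c k1 k2 x y. (majorant c k1 k2 L L x y)\<^sup>2 \<le> ennreal C2 *
      (\<integral>\<^sup>+\<beta>1. \<integral>\<^sup>+\<beta>2. (ncoef c k1 k2 \<beta>1 \<beta>2)\<^sup>2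
     * one.wt L k1 x \<beta>1 * two.wt L k2 y \<beta>2
     \<partial>two.pts 1 k2 \<partial>one.pts 1 k1)"
  proof -
    show ?thesis by (rule majorant_power2_le[OF L(2,3)]) (fact that)
  qed
  define K1 where "K1 = (25 * one.A ^ 6) powr L * (25 * two.A ^ 6) powr L"
  have K1: "0 < K1" by (simp add: K1_def)
  define C where "C = (C1 * K1)\<^sup>2 * C2"
  have C: "0 < C" using C1 C2 K1 by (simp add: C_def)
  show ?thesis
  proof (intro exI conjI allI)
    show "0 < (C powr (p / 2) * K) powr (1 / p)" using C K by simp
    fix f
    let ?c = "\<lambda>k1 k2 \<beta>1 \<beta>2. wavelet_coeff \<psi>1 \<psi>2 f k1 \<beta>1 k2 \<beta>2"
    show "Lp_norm (one.M \<Otimes>\<^sub>M two.M) p (sup_square_function X1 X2 Q1 Q2 \<psi>1 \<psi>2 N1 N2 f)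
      \<le> ennreal ((C powr (p / 2) * K) powr (1 / p)) * Lp_norm (one.M \<Otimes>\<^sub>M two.M) p (coeff_square_function S1 S2 X1 X2 Q1 Q2 \<psi>1 \<psi>2 f)"
      unfolding sup_square_function_eq coeff_square_function_eq
    proof (rule Lp_norm_sqrt_le[OF p _ key[OF L(1) C]])
      show "0 < C powr (p / 2) * K" using C K by simp
      show "cube_dominated N1 N2 1 1 L C (\<lambda>k1 \<alpha>1 k2 \<alpha>2. SUP z\<in>Q1 (k1 + int N1) \<alpha>1 \<times> Q2 (k2 + int N2) \<alpha>2.
        ennreal ((cmod (DD X1 X2 \<psi>1 \<psi>2 k1 k2 f z))\<^sup>2)) (sq_coef f)"
        unfolding cube_dominated_def
      proof (intro allI ballI)
        fix k1 \<alpha>1 k2 \<alpha>2 x y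
        assume \<alpha>: "\<alpha>1 \<in> X1 (k1 + int N1)" "\<alpha>2 \<in> X2 (k2 + int N2)" and xy: "x \<in> Q1 (k1 + int N1) \<alpha>1" "y \<in> Q2 (k2 + int N2) \<alpha>2"
        show "(SUP z\<in>Q1 (k1 + int N1) \<alpha>1 \<times> Q2 (k2 + int N2) \<alpha>2. ennreal ((cmod (DD X1 X2 \<psi>1 \<psi>2 k1 k2 f z))\<^sup>2))
          \<le> ennreal C * (\<integral>\<^sup>+\<beta>1. \<integral>\<^sup>+\<beta>2. sq_coef f k1 \<beta>1 k2 \<beta>2
             * one.wt L k1 x \<beta>1 * two.wt L k2 y \<beta>2
             \<partial>two.pts 1 k2 \<partial>one.pts 1 k1)"
        proof (rule SUP_least)
          fix z assume z: "z \<in> Q1 (k1 + int N1) \<alpha>1 \<times> Q2 (k2 + int N2) \<alpha>2"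
          obtain x' y' where z': "z = (x', y')" by (cases z)
          have "ennreal (cmod (DD X1 X2 \<psi>1 \<psi>2 k1 k2 f z)) \<le> ennreal C1 * majorant (?c k1 k2) k1 k2 L L x' y'"
            unfolding z' DD_series by (rule C1(2))
          also have "\<dots> \<le> ennreal C1 * (ennreal K1 * majorant (?c k1 k2) k1 k2 L L x y)"
            unfolding K1_def using z z' xy
            by (intro mult_left_mono majorant_cube_transfer[OF L0 L0 \<alpha>(1) _ _ \<alpha>(2)]) auto
          also have "\<dots> = ennreal (C1 * K1) * majorant (?c k1 k2) k1 k2 L L x y"
            using C1 K1 by (simp add: ennreal_mult mult.assoc)
          finally have "(ennreal (cmod (DD X1 X2 \<psi>1 \<psi>2 k1 k2 f z)))\<^sup>2 \<le> (ennreal (C1 * K1) * majorant (?c k1 k2) k1 k2 L L x y)\<^sup>2"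
            by (rule power_mono) simp
          also have "\<dots> = ennreal ((C1 * K1)\<^sup>2) * (majorant (?c k1 k2) k1 k2 L L x y)\<^sup>2"
            using C1 K1 by (simp add: power_mult_distrib ennreal_power)
          also have "\<dots> \<le> ennreal ((C1 * K1)\<^sup>2) * (ennreal C2 * (\<integral>\<^sup>+\<beta>1. \<integral>\<^sup>+\<beta>2. sq_coef f k1 \<beta>1 k2 \<beta>2
             * one.wt L k1 x \<beta>1 * two.wt L k2 y \<beta>2
             \<partial>two.pts 1 k2 \<partial>one.pts 1 k1))"
            unfolding sq_coef_def by (intro mult_left_mono C2(2)) auto
          finally show "ennreal ((cmod (DD X1 X2 \<psi>1 \<psi>2 k1 k2 f z))\<^sup>2) \<le> ennreal C * (\<integral>\<^sup>+\<beta>1. \<integral>\<^sup>+\<beta>2. sq_coef f k1 \<beta>1 k2 \<beta>2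
             * one.wt L k1 x \<beta>1 * two.wt L k2 y \<beta>2
             \<partial>two.pts 1 k2 \<partial>one.pts 1 k1)"
            using C2 by (simp add: C_def ennreal_power ennreal_mult mult.assoc)
        qed
      qed
    qed
  qed
qed

end

section \<open>The estimate by the infimum\<close>

lemma ennreal_le_add:
  assumes "a \<le> b + c" "0 \<le> b" "0 \<le> c"
  shows "ennreal a \<le> ennreal b + ennreal c"
  using ennreal_leI[OF assms(1)] assms(2,3) by (simp add: ennreal_plus)

text \<open>Simple functions below f give this direction for arbitrary f. It is applied to the
  modulus of the wavelet series as a function on the space, for which no measurability is
  established.\<close>

lemma nn_integral_multc_le: "(\<integral>\<^sup>+x. f x \<partial>M) * c \<le> (\<integral>\<^sup>+x. f x * c \<partial>M)"
proof -
  have "(\<integral>\<^sup>+x. f x \<partial>M) * c = (SUP g\<in>{g. simple_function M g \<and> g \<le> f}. integral\<^sup>S M g * c)"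
    unfolding nn_integral_def by (rule SUP_mult_right_ennreal)
  also have "\<dots> \<le> (\<integral>\<^sup>+x. f x * c \<partial>M)"
  proof (rule SUP_least)
    fix g assume "g \<in> {g. simple_function M g \<and> g \<le> f}"
    then have g: "simple_function M g" "g \<le> f" by auto
    have "integral\<^sup>S M g * c = (\<integral>\<^sup>+x. g x * c \<partial>M)"
      using g by (simp add: nn_integral_eq_simple_integral[symmetric] nn_integral_multc borel_measurable_simple_function)
    also have "\<dots> \<le> (\<integral>\<^sup>+x. f x * c \<partial>M)"
      using g(2) by (intro nn_integral_mono mult_right_mono) (auto simp: le_fun_def)
    finally show "integral\<^sup>S M g * c \<le> (\<integral>\<^sup>+x. f x * c \<partial>M)" .
  qed
  finally show ?thesis .
qed

lemma eventually_cube_small: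
  fixes \<delta> \<eta> \<epsilon> A :: real
  assumes "0 < \<delta>" "\<delta> < 1" "0 < \<eta>" "0 < \<epsilon>"
  shows "\<forall>\<^sub>F N in sequentially. A * \<delta> ^ N \<le> 1 \<and> (\<delta> ^ N) powr \<eta> \<le> \<epsilon>"
proof (rule eventually_conj)
  have "(\<lambda>N. A * \<delta> ^ N) \<longlonglongrightarrow> A * 0"
    using assms by (intro tendsto_mult tendsto_const LIMSEQ_power_zero) auto
  then have "\<forall>\<^sub>F N in sequentially. A * \<delta> ^ N < 1"
    by (rule order_tendstoD) simp
  then show "\<forall>\<^sub>F N in sequentially. A * \<delta> ^ N \<le> 1"
    by (rule eventually_mono) simp
  have "\<delta> powr \<eta> < 1" using assms powr_less_mono2[of \<eta> \<delta> 1] by simp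
  then have "(\<lambda>N. (\<delta> powr \<eta>) ^ N) \<longlonglongrightarrow> 0"
    by (intro LIMSEQ_power_zero) auto
  then have "\<forall>\<^sub>F N in sequentially. (\<delta> powr \<eta>) ^ N < \<epsilon>"
    using assms by (intro order_tendstoD(2))
  moreover have "(\<delta> ^ N) powr \<eta> = (\<delta> powr \<eta>) ^ N" for N
    using assms by (simp add: powr_realpow[symmetric] powr_powr mult.commute)
  ultimately show "\<forall>\<^sub>F N in sequentially. (\<delta> ^ N) powr \<eta> \<le> \<epsilon>"
    by (simp add: eventually_mono less_imp_le)
qed

lemma distributions_bound:
  assumes "f \<in> distributions S1 S2 x0 y0 \<eta>1 \<eta>2 b1 b2 \<gamma>1 \<gamma>2"
  obtains B where "0 \<le> B"
    "\<And>g C. g \<in> completed_test_space S1 S2 x0 y0 \<eta>1 \<eta>2 b1 b2 \<gamma>1 \<gamma>2 \<Longrightarrow>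
       product_test_bound S1 S2 x0 y0 1 1 b1 b2 \<gamma>1 \<gamma>2 g C \<Longrightarrow> cmod (f g) \<le> B * C"
proof -
  obtain B where B: "\<And>g. g \<in> completed_test_space S1 S2 x0 y0 \<eta>1 \<eta>2 b1 b2 \<gamma>1 \<gamma>2 \<Longrightarrow>
      cmod (f g) \<le> B * product_test_norm S1 S2 x0 y0 1 1 b1 b2 \<gamma>1 \<gamma>2 g"
    using assms unfolding distributions_def Let_def by blast
  \<comment> \<open>Nothing forces B to be nonnegative, but monotonicity in the norm asks for a
    nonnegative factor.\<close>
  show thesis
  proof (rule that[of "max B 0"])
    fix g C
    assume g: "g \<in> completed_test_space S1 S2 x0 y0 \<eta>1 \<eta>2 b1 b2 \<gamma>1 \<gamma>2"
      and C: "product_test_bound S1 S2 x0 y0 1 1 b1 b2 \<gamma>1 \<gamma>2 g C"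
    let ?N = "product_test_norm S1 S2 x0 y0 1 1 b1 b2 \<gamma>1 \<gamma>2 g"
    have "0 \<le> ?N"
      unfolding product_test_norm_def using C
      by (intro cInf_greatest) (auto simp: product_test_bound_def)
    moreover have "?N \<le> C" using C by (rule product_test_norm_le)
    ultimately have "B * ?N \<le> max B 0 * C"
      by (meson max.cobounded1 max.cobounded2 mult_mono)
    with B[OF g] show "cmod (f g) \<le> max B 0 * C" by linarith
  qed simp
qed

section \<open>Polynomial growth and reproduction of the coefficients\<close>

context wavelet_pair
begin

text \<open>The exponents D1 and D2 will be common to all scales and distributions, while K may vary
  with them: it only certifies finiteness.\<close>

definition growth :: "'a \<Rightarrow> 'b \<Rightarrow> real \<Rightarrow> real \<Rightarrow> real \<Rightarrow> ('a \<Rightarrow> 'b \<Rightarrow> complex) \<Rightarrow> int \<Rightarrow> int \<Rightarrow> bool" where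
  "growth x0 y0 D1 D2 K c k1 k2 \<longleftrightarrow> 0 \<le> K \<and> (\<forall>\<beta>1\<in>new_points X1 k1. \<forall>\<beta>2\<in>new_points X2 k2.
     cmod (c \<beta>1 \<beta>2) * one.mass k1 \<beta>1 * two.mass k2 \<beta>2 \<le> K * one.\<rho> k1 \<beta>1 x0 powr D1 * two.\<rho> k2 \<beta>2 y0 powr D2)"

text \<open>A coefficient is bounded by the norm of its tensor wavelet, of order \<rho>^D in each
  variable, and the normalising factor of each variable contributes another \<rho>^D; hence the
  doubled exponents.\<close>

lemma distributions_growth:
  assumes \<beta>: "0 < b1" "b1 < \<eta>1" "0 < b2" "b2 < \<eta>2" and \<gamma>: "0 < \<gamma>1" "0 < \<gamma>2"
  obtains D1 D2 where "0 \<le> D1" "0 \<le> D2"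
    "\<And>f k1 k2. f \<in> distributions S1 S2 x0 y0 \<eta>1 \<eta>2 b1 b2 \<gamma>1 \<gamma>2 \<Longrightarrow>
      \<exists>K. growth x0 y0 D1 D2 K (\<lambda>\<beta>1 \<beta>2. wavelet_coeff \<psi>1 \<psi>2 f k1 \<beta>1 k2 \<beta>2) k1 k2"
proof -
  obtain D1 where D1: "0 \<le> D1" "\<And>k. \<exists>K>0. \<forall>\<beta>\<in>new_points X1 k. \<forall>b. 0 < b \<longrightarrow> b \<le> \<eta>1 \<longrightarrow>
       test_estimate S1 x0 b \<gamma>1 (\<psi>1 k \<beta>) (K * one.\<rho> k \<beta> x0 powr D1) \<and> one.mass k \<beta> \<le> K * one.\<rho> k \<beta> x0 powr D1"
    using one.wavelet_test_estimate[OF \<gamma>(1), of x0] by blast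
  obtain D2 where D2: "0 \<le> D2" "\<And>k. \<exists>K>0. \<forall>\<beta>\<in>new_points X2 k. \<forall>b. 0 < b \<longrightarrow> b \<le> \<eta>2 \<longrightarrow>
       test_estimate S2 y0 b \<gamma>2 (\<psi>2 k \<beta>) (K * two.\<rho> k \<beta> y0 powr D2) \<and> two.mass k \<beta> \<le> K * two.\<rho> k \<beta> y0 powr D2"
    using two.wavelet_test_estimate[OF \<gamma>(2), of y0] by blast
  show thesis
  proof (rule that[of "2 * D1" "2 * D2"])
    show "0 \<le> 2 * D1" "0 \<le> 2 * D2" using D1 D2 by auto
    fix f k1 k2
    assume f: "f \<in> distributions S1 S2 x0 y0 \<eta>1 \<eta>2 b1 b2 \<gamma>1 \<gamma>2"
    obtain B where B: "0 \<le> B"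
      "\<And>g C. g \<in> completed_test_space S1 S2 x0 y0 \<eta>1 \<eta>2 b1 b2 \<gamma>1 \<gamma>2 \<Longrightarrow>
       product_test_bound S1 S2 x0 y0 1 1 b1 b2 \<gamma>1 \<gamma>2 g C \<Longrightarrow> cmod (f g) \<le> B * C"
      using distributions_bound[OF f] by blast
    obtain K1 where K1: "0 < K1" "\<And>\<beta> b. \<beta>\<in>new_points X1 k1 \<Longrightarrow> 0 < b \<Longrightarrow> b \<le> \<eta>1 \<Longrightarrow>
       test_estimate S1 x0 b \<gamma>1 (\<psi>1 k1 \<beta>) (K1 * one.\<rho> k1 \<beta> x0 powr D1) \<and> one.mass k1 \<beta> \<le> K1 * one.\<rho> k1 \<beta> x0 powr D1"
      using D1(2)[of k1] by blast
    obtain K2 where K2: "0 < K2" "\<And>\<beta> b. \<beta>\<in>new_points X2 k2 \<Longrightarrow> 0 < b \<Longrightarrow> b \<le> \<eta>2 \<Longrightarrow>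
       test_estimate S2 y0 b \<gamma>2 (\<psi>2 k2 \<beta>) (K2 * two.\<rho> k2 \<beta> y0 powr D2) \<and> two.mass k2 \<beta> \<le> K2 * two.\<rho> k2 \<beta> y0 powr D2"
      using D2(2)[of k2] by blast
    show "\<exists>K. growth x0 y0 (2 * D1) (2 * D2) K (\<lambda>\<beta>1 \<beta>2. wavelet_coeff \<psi>1 \<psi>2 f k1 \<beta>1 k2 \<beta>2) k1 k2"
      unfolding growth_def
    proof (intro exI[of _ "B * K1\<^sup>2 * K2\<^sup>2"] conjI ballI)
      show "0 \<le> B * K1\<^sup>2 * K2\<^sup>2" using B by simp
      fix \<beta>1 \<beta>2 assume new: "\<beta>1 \<in> new_points X1 k1" "\<beta>2 \<in> new_points X2 k2"
      let ?T1 = "K1 * one.\<rho> k1 \<beta>1 x0 powr D1" and ?T2 = "K2 * two.\<rho> k2 \<beta>2 y0 powr D2"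
      have e1: "test_estimate S1 x0 b1 \<gamma>1 (\<psi>1 k1 \<beta>1) ?T1" "test_estimate S1 x0 \<eta>1 \<gamma>1 (\<psi>1 k1 \<beta>1) ?T1" "one.mass k1 \<beta>1 \<le> ?T1"
        using K1(2)[OF new(1), of b1] K1(2)[OF new(1), of \<eta>1] \<beta> one.eta_pos by auto
      have e2: "test_estimate S2 y0 b2 \<gamma>2 (\<psi>2 k2 \<beta>2) ?T2" "test_estimate S2 y0 \<eta>2 \<gamma>2 (\<psi>2 k2 \<beta>2) ?T2" "two.mass k2 \<beta>2 \<le> ?T2"
        using K2(2)[OF new(2), of b2] K2(2)[OF new(2), of \<eta>2] \<beta> two.eta_pos by auto
      have "cmod (wavelet_coeff \<psi>1 \<psi>2 f k1 \<beta>1 k2 \<beta>2) \<le> B * (?T1 * ?T2)"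
        unfolding wavelet_coeff_def
        by (rule B(2)[OF test_estimate_completed_space[OF e1(1,2) e2(1,2)] test_estimate_product_bound[OF e1(1) e2(1)]])
           (simp_all add: one.integrable_wavelet two.integrable_wavelet one.integral_wavelet two.integral_wavelet new)
      then have "cmod (wavelet_coeff \<psi>1 \<psi>2 f k1 \<beta>1 k2 \<beta>2) * one.mass k1 \<beta>1 * two.mass k2 \<beta>2 \<le> B * (?T1 * ?T2) * ?T1 * ?T2"
        using B K1 K2 by (intro mult_mono e1(3) e2(3)) auto
      also have "\<dots> = B * K1\<^sup>2 * K2\<^sup>2 * (one.\<rho> k1 \<beta>1 x0 powr D1 * one.\<rho> k1 \<beta>1 x0 powr D1) * (two.\<rho> k2 \<beta>2 y0 powr D2 * two.\<rho> k2 \<beta>2 y0 powr D2)"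
        by (simp add: power2_eq_square mult_ac)
      also have "\<dots> = B * K1\<^sup>2 * K2\<^sup>2 * one.\<rho> k1 \<beta>1 x0 powr (2 * D1) * two.\<rho> k2 \<beta>2 y0 powr (2 * D2)"
        by (simp add: powr_add[symmetric])
      finally show "cmod (wavelet_coeff \<psi>1 \<psi>2 f k1 \<beta>1 k2 \<beta>2) * one.mass k1 \<beta>1 * two.mass k2 \<beta>2
        \<le> B * K1\<^sup>2 * K2\<^sup>2 * one.\<rho> k1 \<beta>1 x0 powr (2 * D1) * two.\<rho> k2 \<beta>2 y0 powr (2 * D2)" .
    qed
  qed
qed

lemma mass1_pos: "\<beta> \<in> new_points X1 k \<Longrightarrow> 0 < one.mass k \<beta>"
  using one.new_points_subset[of k] one.measure_cube_pos[of \<beta> "k + 1"] by fastforce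

text \<open>For one row of the coefficient array and fixed y, the sum over \<beta>2 still grows
  polynomially in \<beta>1, so the one-variable lemmas can be applied a second time.\<close>

lemma growth_row:
  assumes D: "0 \<le> D1" "0 \<le> D2" and growth: "growth x0 y0 D1 D2 K c k1 k2"
  obtains K' where "0 \<le> K'"
    "\<And>\<beta>1. \<beta>1 \<in> new_points X1 k1 \<Longrightarrow>
      (\<integral>\<^sup>+\<beta>2. ennreal (cmod (c \<beta>1 \<beta>2) * \<bar>\<psi>2 k2 \<beta>2 y\<bar>) \<partial>count_space (new_points X2 k2))
      \<le> ennreal (K' * one.\<rho> k1 \<beta>1 x0 powr D1 / one.mass k1 \<beta>1)"
proof -
  obtain C where C: "0 < C"
    "\<And>k K e z. 0 \<le> K \<Longrightarrow> (\<And>\<beta>. 0 \<le> e \<beta>) \<Longrightarrow>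
      (\<And>\<beta>. \<beta> \<in> new_points X2 k \<Longrightarrow> e \<beta> * two.mass k \<beta> \<le> K * two.\<rho> k \<beta> y0 powr D2) \<Longrightarrow>
      (\<integral>\<^sup>+\<beta>. ennreal (e \<beta> * \<bar>\<psi>2 k \<beta> z\<bar>) \<partial>count_space (new_points X2 k)) \<le> ennreal (C * K * two.\<rho> k z y0 powr D2)"
  proof -
    show ?thesis by (rule two.wavelet_series_growth[OF D(2), of y0]) (fact that)
  qed
  have K: "0 \<le> K" using growth by (simp add: growth_def)
  show thesis
  proof (rule that[of "C * K * two.\<rho> k2 y y0 powr D2"])
    show "0 \<le> C * K * two.\<rho> k2 y y0 powr D2" using C K by simp
    fix \<beta>1 assume \<beta>1: "\<beta>1 \<in> new_points X1 k1"
    have m: "0 < one.mass k1 \<beta>1" using \<beta>1 by (rule mass1_pos)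
    have "(\<integral>\<^sup>+\<beta>2. ennreal (cmod (c \<beta>1 \<beta>2) * \<bar>\<psi>2 k2 \<beta>2 y\<bar>) \<partial>count_space (new_points X2 k2))
      \<le> ennreal (C * (K * one.\<rho> k1 \<beta>1 x0 powr D1 / one.mass k1 \<beta>1) * two.\<rho> k2 y y0 powr D2)"
    proof (rule C(2))
      show "0 \<le> K * one.\<rho> k1 \<beta>1 x0 powr D1 / one.mass k1 \<beta>1" using K m by simp
      fix \<beta>2 assume "\<beta>2 \<in> new_points X2 k2"
      then have "cmod (c \<beta>1 \<beta>2) * one.mass k1 \<beta>1 * two.mass k2 \<beta>2 \<le> K * one.\<rho> k1 \<beta>1 x0 powr D1 * two.\<rho> k2 \<beta>2 y0 powr D2"
        using growth \<beta>1 by (simp add: growth_def)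
      then show "cmod (c \<beta>1 \<beta>2) * two.mass k2 \<beta>2 \<le> K * one.\<rho> k1 \<beta>1 x0 powr D1 / one.mass k1 \<beta>1 * two.\<rho> k2 \<beta>2 y0 powr D2"
        using m by (simp add: field_simps)
    qed simp
    then show "(\<integral>\<^sup>+\<beta>2. ennreal (cmod (c \<beta>1 \<beta>2) * \<bar>\<psi>2 k2 \<beta>2 y\<bar>) \<partial>count_space (new_points X2 k2))
      \<le> ennreal (C * K * two.\<rho> k2 y y0 powr D2 * one.\<rho> k1 \<beta>1 x0 powr D1 / one.mass k1 \<beta>1)"
      by (simp add: mult_ac)
  qed
qed

lemma growth_series_finite:
  assumes D: "0 \<le> D1" "0 \<le> D2" and growth: "growth x0 y0 D1 D2 K c k1 k2"
  shows "(\<integral>\<^sup>+\<beta>1. \<integral>\<^sup>+\<beta>2. ennreal (cmod (c \<beta>1 \<beta>2) * \<bar>\<psi>1 k1 \<beta>1 x\<bar> * \<bar>\<psi>2 k2 \<beta>2 y\<bar>)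
    \<partial>count_space (new_points X2 k2) \<partial>count_space (new_points X1 k1)) < \<infinity>"
proof -
  obtain K' where K': "0 \<le> K'"
    "\<And>\<beta>1. \<beta>1 \<in> new_points X1 k1 \<Longrightarrow>
      (\<integral>\<^sup>+\<beta>2. ennreal (cmod (c \<beta>1 \<beta>2) * \<bar>\<psi>2 k2 \<beta>2 y\<bar>) \<partial>count_space (new_points X2 k2))
      \<le> ennreal (K' * one.\<rho> k1 \<beta>1 x0 powr D1 / one.mass k1 \<beta>1)"
    using growth_row[OF D growth, of y] by blast
  obtain C where C: "0 < C"
    "\<And>k K e z. 0 \<le> K \<Longrightarrow> (\<And>\<beta>. 0 \<le> e \<beta>) \<Longrightarrow>
      (\<And>\<beta>. \<beta> \<in> new_points X1 k \<Longrightarrow> e \<beta> * one.mass k \<beta> \<le> K * one.\<rho> k \<beta> x0 powr D1) \<Longrightarrow>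
      (\<integral>\<^sup>+\<beta>. ennreal (e \<beta> * \<bar>\<psi>1 k \<beta> z\<bar>) \<partial>count_space (new_points X1 k)) \<le> ennreal (C * K * one.\<rho> k z x0 powr D1)"
  proof -
    show ?thesis by (rule one.wavelet_series_growth[OF D(1), of x0]) (fact that)
  qed
  let ?e = "\<lambda>\<beta>1. K' * one.\<rho> k1 \<beta>1 x0 powr D1 / one.mass k1 \<beta>1"
  have "(\<integral>\<^sup>+\<beta>1. \<integral>\<^sup>+\<beta>2. ennreal (cmod (c \<beta>1 \<beta>2) * \<bar>\<psi>1 k1 \<beta>1 x\<bar> * \<bar>\<psi>2 k2 \<beta>2 y\<bar>)
    \<partial>count_space (new_points X2 k2) \<partial>count_space (new_points X1 k1))
    \<le> (\<integral>\<^sup>+\<beta>1. ennreal (?e \<beta>1 * \<bar>\<psi>1 k1 \<beta>1 x\<bar>) \<partial>count_space (new_points X1 k1))"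
  proof (intro nn_integral_mono)
    fix \<beta>1 assume "\<beta>1 \<in> space (count_space (new_points X1 k1))"
    then have \<beta>1: "\<beta>1 \<in> new_points X1 k1" by simp
    have "(\<integral>\<^sup>+\<beta>2. ennreal (cmod (c \<beta>1 \<beta>2) * \<bar>\<psi>1 k1 \<beta>1 x\<bar> * \<bar>\<psi>2 k2 \<beta>2 y\<bar>) \<partial>count_space (new_points X2 k2))
      = (\<integral>\<^sup>+\<beta>2. ennreal (cmod (c \<beta>1 \<beta>2) * \<bar>\<psi>2 k2 \<beta>2 y\<bar>) \<partial>count_space (new_points X2 k2)) * ennreal \<bar>\<psi>1 k1 \<beta>1 x\<bar>"
      by (subst nn_integral_multc[symmetric]) (auto intro!: nn_integral_cong simp: ennreal_mult mult_ac)
    also have "\<dots> \<le> ennreal (?e \<beta>1) * ennreal \<bar>\<psi>1 k1 \<beta>1 x\<bar>"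
      by (intro mult_right_mono K'(2) \<beta>1) auto
    also have "\<dots> = ennreal (?e \<beta>1 * \<bar>\<psi>1 k1 \<beta>1 x\<bar>)"
      using K'(1) by (subst ennreal_mult) auto
    finally show "(\<integral>\<^sup>+\<beta>2. ennreal (cmod (c \<beta>1 \<beta>2) * \<bar>\<psi>1 k1 \<beta>1 x\<bar> * \<bar>\<psi>2 k2 \<beta>2 y\<bar>) \<partial>count_space (new_points X2 k2))
      \<le> ennreal (?e \<beta>1 * \<bar>\<psi>1 k1 \<beta>1 x\<bar>)" .
  qed
  also have "\<dots> \<le> ennreal (C * K' * one.\<rho> k1 x x0 powr D1)"
  proof (rule C(2)[OF K'(1)])
    show "?e \<beta> * one.mass k1 \<beta> \<le> K' * one.\<rho> k1 \<beta> x0 powr D1" if "\<beta> \<in> new_points X1 k1" for \<beta>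
      using mass1_pos[OF that] by simp
  qed (use K' in simp)
  also have "\<dots> < \<infinity>" by simp
  finally show ?thesis .
qed

text \<open>One-variable reproduction is applied twice. For fixed y the series is one in x with
  coefficients \<open>E \<beta>1 y\<close>; integration in x returns \<open>E \<alpha>1 y\<close>,
  itself a series in y with coefficients \<open>c \<alpha>1\<close>.\<close>

lemma coefficient_le_integral:
  assumes D: "0 \<le> D1" "0 \<le> D2" and growth: "growth x0 y0 D1 D2 K c k1 k2"
    and \<alpha>: "\<alpha>1 \<in> new_points X1 k1" "\<alpha>2 \<in> new_points X2 k2"
  shows "ennreal (cmod (c \<alpha>1 \<alpha>2))
    \<le> (\<integral>\<^sup>+y. \<integral>\<^sup>+x. ennreal (cmod (series c k1 k2 x y)) * ennreal \<bar>\<psi>1 k1 \<alpha>1 x\<bar> * ennreal \<bar>\<psi>2 k2 \<alpha>2 y\<bar> \<partial>one.M \<partial>two.M)"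
proof -
  have K: "0 \<le> K" using growth by (simp add: growth_def)
  define E where "E \<beta>1 y = (\<Sum>\<^sub>\<infinity>\<beta>2\<in>new_points X2 k2. c \<beta>1 \<beta>2 * complex_of_real (\<psi>2 k2 \<beta>2 y))" for \<beta>1 y
  note [measurable] = one.borel_measurable_wavelet[OF \<alpha>(1)]
  have series: "series c k1 k2 x y = (\<Sum>\<^sub>\<infinity>\<beta>1\<in>new_points X1 k1. E \<beta>1 y * complex_of_real (\<psi>1 k1 \<beta>1 x))" for x y
    unfolding series_def E_def
    by (intro infsum_cong, subst infsum_cmult_left'[symmetric]) (simp add: mult_ac)
  have inner: "(\<integral>x. series c k1 k2 x y * complex_of_real (\<psi>1 k1 \<alpha>1 x) \<partial>one.M) = E \<alpha>1 y" for y
  proof -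
    obtain K' where K': "0 \<le> K'"
      "\<And>\<beta>1. \<beta>1 \<in> new_points X1 k1 \<Longrightarrow>
        (\<integral>\<^sup>+\<beta>2. ennreal (cmod (c \<beta>1 \<beta>2) * \<bar>\<psi>2 k2 \<beta>2 y\<bar>) \<partial>count_space (new_points X2 k2))
        \<le> ennreal (K' * one.\<rho> k1 \<beta>1 x0 powr D1 / one.mass k1 \<beta>1)"
      using growth_row[OF D growth, of y] by blast
    show ?thesis
      unfolding series
    proof (rule one.wavelet_series_coefficient[OF D(1) K'(1) \<alpha>(1)])
      fix \<beta> assume \<beta>: "\<beta> \<in> new_points X1 k1"
      have "ennreal (cmod (E \<beta> y)) \<le> (\<integral>\<^sup>+\<beta>2. ennreal (cmod (c \<beta> \<beta>2) * \<bar>\<psi>2 k2 \<beta>2 y\<bar>) \<partial>count_space (new_points X2 k2))"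
        unfolding E_def by (rule order_trans[OF norm_infsum_le_nn_integral]) (simp add: norm_mult)
      also have "\<dots> \<le> ennreal (K' * one.\<rho> k1 \<beta> x0 powr D1 / one.mass k1 \<beta>)"
        by (rule K'(2)[OF \<beta>])
      finally have "cmod (E \<beta> y) \<le> K' * one.\<rho> k1 \<beta> x0 powr D1 / one.mass k1 \<beta>"
        using K'(1) by (simp add: ennreal_le_iff)
      then show "cmod (E \<beta> y) * one.mass k1 \<beta> \<le> K' * one.\<rho> k1 \<beta> x0 powr D1"
        using mass1_pos[OF \<beta>] by (simp add: field_simps)
    qed
  qed
  have m: "0 < one.mass k1 \<alpha>1" by (rule mass1_pos[OF \<alpha>(1)])
  have outer: "(\<integral>y. E \<alpha>1 y * complex_of_real (\<psi>2 k2 \<alpha>2 y) \<partial>two.M) = c \<alpha>1 \<alpha>2"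
    unfolding E_def
  proof (rule two.wavelet_series_coefficient[OF D(2) _ \<alpha>(2)])
    show "0 \<le> K * one.\<rho> k1 \<alpha>1 x0 powr D1 / one.mass k1 \<alpha>1" using K m by simp
    fix \<beta> assume "\<beta> \<in> new_points X2 k2"
    then have "cmod (c \<alpha>1 \<beta>) * one.mass k1 \<alpha>1 * two.mass k2 \<beta> \<le> K * one.\<rho> k1 \<alpha>1 x0 powr D1 * two.\<rho> k2 \<beta> y0 powr D2"
      using growth \<alpha> by (simp add: growth_def)
    then show "cmod (c \<alpha>1 \<beta>) * two.mass k2 \<beta> \<le> K * one.\<rho> k1 \<alpha>1 x0 powr D1 / one.mass k1 \<alpha>1 * two.\<rho> k2 \<beta> y0 powr D2"
      using m by (simp add: field_simps)
  qed
  have "ennreal (cmod (c \<alpha>1 \<alpha>2)) \<le> (\<integral>\<^sup>+y. ennreal (cmod (E \<alpha>1 y)) * ennreal \<bar>\<psi>2 k2 \<alpha>2 y\<bar> \<partial>two.M)"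
    unfolding outer[symmetric]
    by (rule order_trans[OF ennreal_norm_integral_le]) (simp add: norm_mult ennreal_mult)
  also have "\<dots> \<le> (\<integral>\<^sup>+y. (\<integral>\<^sup>+x. ennreal (cmod (series c k1 k2 x y)) * ennreal \<bar>\<psi>1 k1 \<alpha>1 x\<bar> \<partial>one.M) * ennreal \<bar>\<psi>2 k2 \<alpha>2 y\<bar> \<partial>two.M)"
    unfolding inner[symmetric]
    by (intro nn_integral_mono mult_right_mono order_trans[OF ennreal_norm_integral_le]) (auto simp: norm_mult ennreal_mult)
  also have "\<dots> \<le> (\<integral>\<^sup>+y. \<integral>\<^sup>+x. ennreal (cmod (series c k1 k2 x y)) * ennreal \<bar>\<psi>1 k1 \<alpha>1 x\<bar> * ennreal \<bar>\<psi>2 k2 \<alpha>2 y\<bar> \<partial>one.M \<partial>two.M)"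
    by (intro nn_integral_mono nn_integral_multc_le)
  finally show ?thesis .
qed

text \<open>The difference of products splits as (a - a') b + a' (b - b'), and the Hoelder bound
  makes one factor of each summand small. C does not depend on N1 and N2; their whole influence is
  in the displayed powers.\<close>

lemma series_oscillation:
  assumes D: "0 \<le> D1" "0 \<le> D2" and L: "0 \<le> L1" "0 \<le> L2"
  obtains C where "0 < C"
    "\<And>K c k1 k2 N1 N2 \<alpha>1 \<alpha>2 x x' y y'. growth x0 y0 D1 D2 K c k1 k2 \<Longrightarrow>
      8 * one.A ^ 3 * \<delta>1 ^ N1 \<le> 1 \<Longrightarrow> 8 * two.A ^ 3 * \<delta>2 ^ N2 \<le> 1 \<Longrightarrow>
      \<alpha>1 \<in> X1 (k1 + int N1) \<Longrightarrow> x \<in> Q1 (k1 + int N1) \<alpha>1 \<Longrightarrow> x' \<in> Q1 (k1 + int N1) \<alpha>1 \<Longrightarrow>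
      \<alpha>2 \<in> X2 (k2 + int N2) \<Longrightarrow> y \<in> Q2 (k2 + int N2) \<alpha>2 \<Longrightarrow> y' \<in> Q2 (k2 + int N2) \<alpha>2 \<Longrightarrow>
      ennreal (cmod (series c k1 k2 x y - series c k1 k2 x' y'))
      \<le> ennreal (C * ((\<delta>1 ^ N1) powr \<eta>1 + (\<delta>2 ^ N2) powr \<eta>2)) * majorant c k1 k2 L1 L2 x y"
proof -
  obtain C1 where C1: "0 < C1"
    "\<And>k \<beta> x. \<beta> \<in> new_points X1 k \<Longrightarrow> \<bar>\<psi>1 k \<beta> x\<bar> \<le> C1 * one.mass k \<beta> * one.\<rho> k x \<beta> powr (- L1)"
    using one.wavelet_estimates[OF L(1)] by metis
  obtain C2 where C2: "0 < C2"
    "\<And>k \<beta> x. \<beta> \<in> new_points X2 k \<Longrightarrow> \<bar>\<psi>2 k \<beta> x\<bar> \<le> C2 * two.mass k \<beta> * two.\<rho> k x \<beta> powr (- L2)"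
    using two.wavelet_estimates[OF L(2)] by metis
  obtain O1 where O1: "0 < O1"
    "\<And>k \<beta> N \<alpha> x y. \<beta> \<in> new_points X1 k \<Longrightarrow> 8 * one.A ^ 3 * \<delta>1 ^ N \<le> 1 \<Longrightarrow> \<alpha> \<in> X1 (k + int N) \<Longrightarrow>
      x \<in> Q1 (k + int N) \<alpha> \<Longrightarrow> y \<in> Q1 (k + int N) \<alpha> \<Longrightarrow>
      \<bar>\<psi>1 k \<beta> x - \<psi>1 k \<beta> y\<bar> \<le> O1 * (\<delta>1 ^ N) powr \<eta>1 * one.mass k \<beta> * one.\<rho> k x \<beta> powr (- L1)"
    using one.wavelet_cube_oscillation[OF L(1)] by blast
  obtain O2 where O2: "0 < O2"
    "\<And>k \<beta> N \<alpha> x y. \<beta> \<in> new_points X2 k \<Longrightarrow> 8 * two.A ^ 3 * \<delta>2 ^ N \<le> 1 \<Longrightarrow> \<alpha> \<in> X2 (k + int N) \<Longrightarrow>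
      x \<in> Q2 (k + int N) \<alpha> \<Longrightarrow> y \<in> Q2 (k + int N) \<alpha> \<Longrightarrow>
      \<bar>\<psi>2 k \<beta> x - \<psi>2 k \<beta> y\<bar> \<le> O2 * (\<delta>2 ^ N) powr \<eta>2 * two.mass k \<beta> * two.\<rho> k x \<beta> powr (- L2)"
    using two.wavelet_cube_oscillation[OF L(2)] by blast
  define G where "G = (25 * one.A ^ 6) powr L1"
  have G: "0 < G" by (simp add: G_def)
  define C where "C = max (O1 * C2) (C1 * G * O2)"
  show thesis
  proof (rule that[of C])
    show "0 < C" using O1 C2 by (simp add: C_def less_max_iff_disj)
    fix K c k1 k2 N1 N2 \<alpha>1 \<alpha>2 x x' y y'
    assume growth: "growth x0 y0 D1 D2 K c k1 k2"
      and N: "8 * one.A ^ 3 * \<delta>1 ^ N1 \<le> 1" "8 * two.A ^ 3 * \<delta>2 ^ N2 \<le> 1"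
      and x: "\<alpha>1 \<in> X1 (k1 + int N1)" "x \<in> Q1 (k1 + int N1) \<alpha>1" "x' \<in> Q1 (k1 + int N1) \<alpha>1"
      and y: "\<alpha>2 \<in> X2 (k2 + int N2)" "y \<in> Q2 (k2 + int N2) \<alpha>2" "y' \<in> Q2 (k2 + int N2) \<alpha>2"
    let ?e1 = "(\<delta>1 ^ N1) powr \<eta>1" and ?e2 = "(\<delta>2 ^ N2) powr \<eta>2"
    let ?Y1 = "count_space (new_points X1 k1)" and ?Y2 = "count_space (new_points X2 k2)"
    \<comment> \<open>Growth enters here to make both series absolutely convergent, so that they may
      be subtracted term by term.\<close>
    have fin: "(\<integral>\<^sup>+\<beta>1. \<integral>\<^sup>+\<beta>2. ennreal (norm (c \<beta>1 \<beta>2 * complex_of_real (\<psi>1 k1 \<beta>1 x) * complex_of_real (\<psi>2 k2 \<beta>2 y))) \<partial>?Y2 \<partial>?Y1) < \<infinity>" for x y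
      using growth_series_finite[OF D growth, of x y] by (simp add: norm_mult)
    have "ennreal (cmod (series c k1 k2 x y - series c k1 k2 x' y'))
      \<le> (\<integral>\<^sup>+\<beta>1. \<integral>\<^sup>+\<beta>2. ennreal (norm (c \<beta>1 \<beta>2 * complex_of_real (\<psi>1 k1 \<beta>1 x) * complex_of_real (\<psi>2 k2 \<beta>2 y)
          - c \<beta>1 \<beta>2 * complex_of_real (\<psi>1 k1 \<beta>1 x') * complex_of_real (\<psi>2 k2 \<beta>2 y'))) \<partial>?Y2 \<partial>?Y1)"
      unfolding series_def by (rule ennreal_norm_double_infsum_diff_le[OF fin fin])
    also have "\<dots> \<le> (\<integral>\<^sup>+\<beta>1. \<integral>\<^sup>+\<beta>2. ennreal (cmod (c \<beta>1 \<beta>2) * \<bar>\<psi>1 k1 \<beta>1 x - \<psi>1 k1 \<beta>1 x'\<bar> * \<bar>\<psi>2 k2 \<beta>2 y\<bar>)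
        + ennreal (cmod (c \<beta>1 \<beta>2) * \<bar>\<psi>1 k1 \<beta>1 x'\<bar> * \<bar>\<psi>2 k2 \<beta>2 y - \<psi>2 k2 \<beta>2 y'\<bar>) \<partial>?Y2 \<partial>?Y1)"
    proof (intro nn_integral_mono)
      fix \<beta>1 \<beta>2
      let ?a = "\<psi>1 k1 \<beta>1 x" and ?a' = "\<psi>1 k1 \<beta>1 x'" and ?b = "\<psi>2 k2 \<beta>2 y" and ?b' = "\<psi>2 k2 \<beta>2 y'"
      have "c \<beta>1 \<beta>2 * complex_of_real ?a * complex_of_real ?b - c \<beta>1 \<beta>2 * complex_of_real ?a' * complex_of_real ?b'
        = c \<beta>1 \<beta>2 * complex_of_real ((?a - ?a') * ?b) + c \<beta>1 \<beta>2 * complex_of_real (?a' * (?b - ?b'))"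
        by (simp add: algebra_simps)
      then have "norm (c \<beta>1 \<beta>2 * complex_of_real ?a * complex_of_real ?b - c \<beta>1 \<beta>2 * complex_of_real ?a' * complex_of_real ?b')
        \<le> norm (c \<beta>1 \<beta>2 * complex_of_real ((?a - ?a') * ?b)) + norm (c \<beta>1 \<beta>2 * complex_of_real (?a' * (?b - ?b')))"
        by (simp only: norm_triangle_ineq)
      also have "\<dots> = cmod (c \<beta>1 \<beta>2) * \<bar>?a - ?a'\<bar> * \<bar>?b\<bar> + cmod (c \<beta>1 \<beta>2) * \<bar>?a'\<bar> * \<bar>?b - ?b'\<bar>"
        by (simp only: norm_mult norm_of_real abs_mult mult.assoc)
      finally show "ennreal (norm (c \<beta>1 \<beta>2 * complex_of_real ?a * complex_of_real ?b - c \<beta>1 \<beta>2 * complex_of_real ?a' * complex_of_real ?b'))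
        \<le> ennreal (cmod (c \<beta>1 \<beta>2) * \<bar>?a - ?a'\<bar> * \<bar>?b\<bar>) + ennreal (cmod (c \<beta>1 \<beta>2) * \<bar>?a'\<bar> * \<bar>?b - ?b'\<bar>)"
        by (rule ennreal_le_add) simp_all
    qed
    also have "\<dots> = (\<integral>\<^sup>+\<beta>1. \<integral>\<^sup>+\<beta>2. ennreal (cmod (c \<beta>1 \<beta>2) * \<bar>\<psi>1 k1 \<beta>1 x - \<psi>1 k1 \<beta>1 x'\<bar> * \<bar>\<psi>2 k2 \<beta>2 y\<bar>) \<partial>?Y2 \<partial>?Y1)
        + (\<integral>\<^sup>+\<beta>1. \<integral>\<^sup>+\<beta>2. ennreal (cmod (c \<beta>1 \<beta>2) * \<bar>\<psi>1 k1 \<beta>1 x'\<bar> * \<bar>\<psi>2 k2 \<beta>2 y - \<psi>2 k2 \<beta>2 y'\<bar>) \<partial>?Y2 \<partial>?Y1)"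
      by (simp add: nn_integral_add)
    also have "\<dots> \<le> ennreal ((O1 * ?e1) * C2) * majorant c k1 k2 L1 L2 x y + ennreal ((C1 * G) * (O2 * ?e2)) * majorant c k1 k2 L1 L2 x y"
    proof (intro add_mono le_majorant)
      show "0 \<le> \<bar>\<psi>1 k1 \<beta> x - \<psi>1 k1 \<beta> x'\<bar> \<and> \<bar>\<psi>1 k1 \<beta> x - \<psi>1 k1 \<beta> x'\<bar> \<le> O1 * ?e1 * one.mass k1 \<beta> * one.\<rho> k1 x \<beta> powr (- L1)"
        if "\<beta> \<in> new_points X1 k1" for \<beta>
        using O1(2)[OF that N(1) x] by simp
      show "0 \<le> \<bar>\<psi>2 k2 \<beta> y\<bar> \<and> \<bar>\<psi>2 k2 \<beta> y\<bar> \<le> C2 * two.mass k2 \<beta> * two.\<rho> k2 y \<beta> powr (- L2)"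
        if "\<beta> \<in> new_points X2 k2" for \<beta>
        using C2(2)[OF that] by simp
      show "0 \<le> \<bar>\<psi>2 k2 \<beta> y - \<psi>2 k2 \<beta> y'\<bar> \<and> \<bar>\<psi>2 k2 \<beta> y - \<psi>2 k2 \<beta> y'\<bar> \<le> O2 * ?e2 * two.mass k2 \<beta> * two.\<rho> k2 y \<beta> powr (- L2)"
        if "\<beta> \<in> new_points X2 k2" for \<beta>
        using O2(2)[OF that N(2) y] by simp
      \<comment> \<open>This size factor sits at x' and is moved to x, which costs G.\<close>
      show "0 \<le> \<bar>\<psi>1 k1 \<beta> x'\<bar> \<and> \<bar>\<psi>1 k1 \<beta> x'\<bar> \<le> C1 * G * one.mass k1 \<beta> * one.\<rho> k1 x \<beta> powr (- L1)"
        if "\<beta> \<in> new_points X1 k1" for \<beta>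
      proof -
        have "C1 * one.mass k1 \<beta> * one.\<rho> k1 x' \<beta> powr (- L1) \<le> C1 * one.mass k1 \<beta> * (G * one.\<rho> k1 x \<beta> powr (- L1))"
          unfolding G_def using C1(1) by (intro mult_left_mono one.\<rho>_cube_transfer[OF L(1) x]) auto
        with C1(2)[OF that, of x'] show ?thesis by (simp add: mult_ac)
      qed
    qed (use O1 O2 C1 C2 G in auto)
    also have "\<dots> = ennreal (O1 * ?e1 * C2 + C1 * G * (O2 * ?e2)) * majorant c k1 k2 L1 L2 x y"
      using O1 O2 C1 C2 G by (simp add: distrib_right[symmetric] ennreal_plus[symmetric] del: ennreal_plus)
    also have "\<dots> \<le> ennreal (C * (?e1 + ?e2)) * majorant c k1 k2 L1 L2 x y"
    proof (intro mult_right_mono ennreal_leI)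
      have "(O1 * C2) * ?e1 + (C1 * G * O2) * ?e2 \<le> C * ?e1 + C * ?e2"
        by (intro add_mono mult_right_mono) (auto simp: C_def)
      then show "O1 * ?e1 * C2 + C1 * G * (O2 * ?e2) \<le> C * (?e1 + ?e2)"
        by (simp add: algebra_simps)
    qed simp
    finally show "ennreal (cmod (series c k1 k2 x y - series c k1 k2 x' y')) \<le> ennreal (C * (?e1 + ?e2)) * majorant c k1 k2 L1 L2 x y" .
  qed
qed

text \<open>The infimum of the modulus, written as the root of the infimum of the squares so that
  squaring it returns the coefficient of \<open>inf_square_function\<close>.\<close>

definition inf_series :: "('a \<Rightarrow> 'b \<Rightarrow> complex) \<Rightarrow> int \<Rightarrow> int \<Rightarrow> nat \<Rightarrow> nat \<Rightarrow> 'a \<Rightarrow> 'b \<Rightarrow> ennreal" where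
  "inf_series c k1 k2 N1 N2 \<alpha>1 \<alpha>2 = ennreal_powr (INF z\<in>Q1 (k1 + int N1) \<alpha>1 \<times> Q2 (k2 + int N2) \<alpha>2.
     ennreal ((cmod (series c k1 k2 (fst z) (snd z)))\<^sup>2)) (1 / 2)"

lemma series_le_inf_series:
  assumes osc: "\<And>x' y'. x' \<in> Q1 (k1 + int N1) \<alpha>1 \<Longrightarrow> y' \<in> Q2 (k2 + int N2) \<alpha>2 \<Longrightarrow>
      ennreal (cmod (series c k1 k2 x y - series c k1 k2 x' y')) \<le> R"
  shows "ennreal (cmod (series c k1 k2 x y)) \<le> inf_series c k1 k2 N1 N2 \<alpha>1 \<alpha>2 + R"
proof -
  let ?a = "ennreal (cmod (series c k1 k2 x y))"
  let ?I = "INF z\<in>Q1 (k1 + int N1) \<alpha>1 \<times> Q2 (k2 + int N2) \<alpha>2. ennreal ((cmod (series c k1 k2 (fst z) (snd z)))\<^sup>2)"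
  \<comment> \<open>Truncated subtraction lets the error pass to the left before squares and infimum
    are taken; an infinite R causes no harm.\<close>
  have "(?a - R)\<^sup>2 \<le> ?I"
  proof (rule INF_greatest)
    fix z assume z: "z \<in> Q1 (k1 + int N1) \<alpha>1 \<times> Q2 (k2 + int N2) \<alpha>2"
    let ?b = "ennreal (cmod (series c k1 k2 (fst z) (snd z)))"
    have "cmod (series c k1 k2 x y) \<le> cmod (series c k1 k2 (fst z) (snd z)) + cmod (series c k1 k2 x y - series c k1 k2 (fst z) (snd z))"
      by (rule norm_triangle_sub)
    then have "?a \<le> ?b + ennreal (cmod (series c k1 k2 x y - series c k1 k2 (fst z) (snd z)))"
      by (rule ennreal_le_add) simp_all
    also have "\<dots> \<le> ?b + R"
      using z by (intro add_left_mono osc) auto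
    finally have "?a - R \<le> ?b"
      by (simp add: ennreal_minus_le_iff add.commute)
    then have "(?a - R)\<^sup>2 \<le> ?b\<^sup>2"
      by (rule power_mono) simp
    then show "(?a - R)\<^sup>2 \<le> ennreal ((cmod (series c k1 k2 (fst z) (snd z)))\<^sup>2)"
      by (simp add: ennreal_power)
  qed
  then have "ennreal_powr ((?a - R)\<^sup>2) (1 / 2) \<le> inf_series c k1 k2 N1 N2 \<alpha>1 \<alpha>2"
    unfolding inf_series_def by (rule ennreal_powr_mono) simp
  moreover have "ennreal_powr ((?a - R)\<^sup>2) (1 / 2) = ?a - R"
    using ennreal_powr_half_square[of "?a - R"] by (simp add: power2_eq_square ennreal_powr_mult)
  ultimately have "?a - R \<le> inf_series c k1 k2 N1 N2 \<alpha>1 \<alpha>2" by simp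
  then show ?thesis
    by (simp add: ennreal_minus_le_iff add.commute)
qed

text \<open>A maximal function of Peetre type over the points of one pair of scales; changing its
  base point costs a power of \<rho> in each variable.\<close>

definition weighted_sup :: "('a \<Rightarrow> 'b \<Rightarrow> complex) \<Rightarrow> int \<Rightarrow> int \<Rightarrow> real \<Rightarrow> real \<Rightarrow> 'a \<Rightarrow> 'b \<Rightarrow> ennreal" where
  "weighted_sup c k1 k2 M1 M2 x y = (SUP \<beta>\<in>new_points X1 k1 \<times> new_points X2 k2.
     ncoef c k1 k2 (fst \<beta>) (snd \<beta>) * one.wt M1 k1 x (fst \<beta>) * two.wt M2 k2 y (snd \<beta>))"

lemma ncoef_le_weighted_sup:
  "ncoef c k1 k2 \<beta>1 \<beta>2 \<le> weighted_sup c k1 k2 M1 M2 x y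
    * ennreal (one.\<rho> k1 x \<beta>1 powr M1) * ennreal (two.\<rho> k2 y \<beta>2 powr M2)"
proof (cases "\<beta>1 \<in> new_points X1 k1 \<and> \<beta>2 \<in> new_points X2 k2")
  case True
  have inv: "one.wt M1 k1 x \<beta>1 * ennreal (one.\<rho> k1 x \<beta>1 powr M1) = 1"
    "two.wt M2 k2 y \<beta>2 * ennreal (two.\<rho> k2 y \<beta>2 powr M2) = 1"
    by (simp_all add: ennreal_mult[symmetric] powr_minus)
  have "ncoef c k1 k2 \<beta>1 \<beta>2 * one.wt M1 k1 x \<beta>1 * two.wt M2 k2 y \<beta>2 \<le> weighted_sup c k1 k2 M1 M2 x y"
    unfolding weighted_sup_def using True by (intro SUP_upper2[of "(\<beta>1, \<beta>2)"]) auto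
  then have "ncoef c k1 k2 \<beta>1 \<beta>2 * one.wt M1 k1 x \<beta>1 * two.wt M2 k2 y \<beta>2
      * (ennreal (one.\<rho> k1 x \<beta>1 powr M1) * ennreal (two.\<rho> k2 y \<beta>2 powr M2))
    \<le> weighted_sup c k1 k2 M1 M2 x y * (ennreal (one.\<rho> k1 x \<beta>1 powr M1) * ennreal (two.\<rho> k2 y \<beta>2 powr M2))"
    by (rule mult_right_mono) simp
  moreover have "ncoef c k1 k2 \<beta>1 \<beta>2 * one.wt M1 k1 x \<beta>1 * two.wt M2 k2 y \<beta>2
      * (ennreal (one.\<rho> k1 x \<beta>1 powr M1) * ennreal (two.\<rho> k2 y \<beta>2 powr M2))
    = ncoef c k1 k2 \<beta>1 \<beta>2 * ((one.wt M1 k1 x \<beta>1 * ennreal (one.\<rho> k1 x \<beta>1 powr M1))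
      * (two.wt M2 k2 y \<beta>2 * ennreal (two.\<rho> k2 y \<beta>2 powr M2)))"
    by (simp only: mult_ac)
  ultimately show ?thesis by (simp add: inv mult.assoc)
qed (auto simp: ncoef_def)

text \<open>The weights decay at least as fast as the coefficients may grow. The bound is not
  uniform in c, and absorption only asks for a finite value.\<close>

lemma weighted_sup_finite:
  assumes D: "0 \<le> D1" "0 \<le> D2" and M: "D1 \<le> M1" "D2 \<le> M2" and growth: "growth x0 y0 D1 D2 K c k1 k2"
  shows "weighted_sup c k1 k2 M1 M2 x y < \<infinity>"
proof -
  have K: "0 \<le> K" using growth by (simp add: growth_def)
  let ?B = "K * (one.A * one.\<rho> k1 x x0) powr D1 * (two.A * two.\<rho> k2 y y0) powr D2"
  have "weighted_sup c k1 k2 M1 M2 x y \<le> ennreal ?B"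
    unfolding weighted_sup_def
  proof (rule SUP_least)
    fix \<beta> assume "\<beta> \<in> new_points X1 k1 \<times> new_points X2 k2"
    then obtain \<beta>1 \<beta>2 where \<beta>: "\<beta> = (\<beta>1, \<beta>2)" "\<beta>1 \<in> new_points X1 k1" "\<beta>2 \<in> new_points X2 k2" by auto
    let ?r1 = "one.\<rho> k1 x \<beta>1 powr (- M1)" and ?r2 = "two.\<rho> k2 y \<beta>2 powr (- M2)"
    have "cmod (c \<beta>1 \<beta>2) * one.mass k1 \<beta>1 * two.mass k2 \<beta>2 \<le> K * one.\<rho> k1 \<beta>1 x0 powr D1 * two.\<rho> k2 \<beta>2 y0 powr D2"
      using growth \<beta> by (simp add: growth_def)
    then have "cmod (c \<beta>1 \<beta>2) * one.mass k1 \<beta>1 * two.mass k2 \<beta>2 * (?r1 * ?r2)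
      \<le> K * one.\<rho> k1 \<beta>1 x0 powr D1 * two.\<rho> k2 \<beta>2 y0 powr D2 * (?r1 * ?r2)"
      by (intro mult_right_mono) auto
    also have "\<dots> = K * (one.\<rho> k1 \<beta>1 x0 powr D1 * ?r1) * (two.\<rho> k2 \<beta>2 y0 powr D2 * ?r2)"
      by simp
    also have "\<dots> \<le> ?B"
      using K D M by (intro mult_mono mult_left_mono one.\<rho>_powr_growth_le two.\<rho>_powr_growth_le) auto
    finally show "ncoef c k1 k2 (fst \<beta>) (snd \<beta>) * one.wt M1 k1 x (fst \<beta>) * two.wt M2 k2 y (snd \<beta>) \<le> ennreal ?B"
      using \<beta> by (simp add: ncoef_def ennreal_mult[symmetric] ennreal_leI mult.assoc)
  qed
  then show ?thesis by (rule order.strict_trans1) simp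
qed

text \<open>Every coefficient is at most the supremum based at (x, y) times growing factors, and the
  surplus decay 2 \<omega> + 1 about (x', y') sums these.\<close>

lemma majorant_le_weighted_sup:
  assumes M: "0 \<le> M1" "0 \<le> M2" and L: "M1 + (2 * \<omega>1 + 1) \<le> L1" "M2 + (2 * \<omega>2 + 1) \<le> L2"
  obtains C where "0 < C"
    "\<And>c k1 k2 x y x' y'. majorant c k1 k2 L1 L2 x' y'
      \<le> ennreal C * weighted_sup c k1 k2 M1 M2 x y * ennreal (one.\<rho> k1 x x' powr M1) * ennreal (two.\<rho> k2 y y' powr M2)"
proof -
  obtain C1 where C1: "0 < C1" "\<And>k x z L. M1 + (2 * \<omega>1 + 1) \<le> L \<Longrightarrow>
      (\<integral>\<^sup>+\<beta>. ennreal (one.\<rho> k x \<beta> powr M1 * one.\<rho> k z \<beta> powr (- L)) \<partial>one.pts 1 k) \<le> ennreal (C1 * one.\<rho> k x z powr M1)"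
  proof -
    show ?thesis by (rule one.sum_\<rho>_growth[OF M(1), of 1]) (fact that)
  qed
  obtain C2 where C2: "0 < C2" "\<And>k x z L. M2 + (2 * \<omega>2 + 1) \<le> L \<Longrightarrow>
      (\<integral>\<^sup>+\<beta>. ennreal (two.\<rho> k x \<beta> powr M2 * two.\<rho> k z \<beta> powr (- L)) \<partial>two.pts 1 k) \<le> ennreal (C2 * two.\<rho> k x z powr M2)"
  proof -
    show ?thesis by (rule two.sum_\<rho>_growth[OF M(2), of 1]) (fact that)
  qed
  show thesis
  proof (rule that[of "C1 * C2"])
    show "0 < C1 * C2" using C1 C2 by simp
    fix c k1 k2 x y x' y'
    let ?S = "weighted_sup c k1 k2 M1 M2 x y"
    let ?u = "\<lambda>\<beta>1. ennreal (one.\<rho> k1 x \<beta>1 powr M1 * one.\<rho> k1 x' \<beta>1 powr (- L1))"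
    let ?v = "\<lambda>\<beta>2. ennreal (two.\<rho> k2 y \<beta>2 powr M2 * two.\<rho> k2 y' \<beta>2 powr (- L2))"
    have "majorant c k1 k2 L1 L2 x' y' \<le> (\<integral>\<^sup>+\<beta>1. \<integral>\<^sup>+\<beta>2. ?S * ?u \<beta>1 * ?v \<beta>2 \<partial>two.pts 1 k2 \<partial>one.pts 1 k1)"
      unfolding majorant_def
    proof (intro nn_integral_mono)
      fix \<beta>1 \<beta>2
      have "ncoef c k1 k2 \<beta>1 \<beta>2 * one.wt L1 k1 x' \<beta>1 * two.wt L2 k2 y' \<beta>2
        \<le> (?S * ennreal (one.\<rho> k1 x \<beta>1 powr M1) * ennreal (two.\<rho> k2 y \<beta>2 powr M2))
          * one.wt L1 k1 x' \<beta>1 * two.wt L2 k2 y' \<beta>2"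
        by (intro mult_right_mono ncoef_le_weighted_sup) auto
      then show "ncoef c k1 k2 \<beta>1 \<beta>2 * one.wt L1 k1 x' \<beta>1 * two.wt L2 k2 y' \<beta>2 \<le> ?S * ?u \<beta>1 * ?v \<beta>2"
        by (simp add: ennreal_mult mult_ac)
    qed
    also have "\<dots> = ?S * (\<integral>\<^sup>+\<beta>1. ?u \<beta>1 \<partial>one.pts 1 k1) * (\<integral>\<^sup>+\<beta>2. ?v \<beta>2 \<partial>two.pts 1 k2)"
      by (simp add: nn_integral_cmult nn_integral_multc)
    also have "\<dots> \<le> ?S * ennreal (C1 * one.\<rho> k1 x x' powr M1) * ennreal (C2 * two.\<rho> k2 y y' powr M2)"
      using C1(2)[OF L(1)] C2(2)[OF L(2)] by (intro mult_mono) auto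
    also have "\<dots> = ennreal (C1 * C2) * ?S * ennreal (one.\<rho> k1 x x' powr M1) * ennreal (two.\<rho> k2 y y' powr M2)"
      using C1 C2 by (simp add: ennreal_mult mult_ac)
    finally show "majorant c k1 k2 L1 L2 x' y' \<le> ennreal (C1 * C2) * ?S * ennreal (one.\<rho> k1 x x' powr M1) * ennreal (two.\<rho> k2 y y' powr M2)" .
  qed
qed

text \<open>N0 and C are uniform over all coefficient families with growth exponents D1 and D2: the
  constants K of the growth condition do not enter them, serving for absolute convergence and for
  the finiteness of the absorbed supremum.\<close>

theorem ncoef_le_inf_series:
  assumes D: "0 \<le> D1" "0 \<le> D2" and s: "0 \<le> s" "D1 \<le> s + 2 * \<omega>1" "D2 \<le> s + 2 * \<omega>2"
  shows "\<exists>N0. \<forall>N1\<ge>N0. \<forall>N2\<ge>N0. \<exists>C>0. \<forall>c. (\<forall>k1 k2. \<exists>K. growth x0 y0 D1 D2 K (c k1 k2) k1 k2) \<longrightarrow>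
    cube_dominated 1 1 N1 N2 s C (\<lambda>k1 \<beta>1 k2 \<beta>2. ncoef (c k1 k2) k1 k2 \<beta>1 \<beta>2)
      (\<lambda>k1 \<alpha>1 k2 \<alpha>2. inf_series (c k1 k2) k1 k2 N1 N2 \<alpha>1 \<alpha>2)"
proof -
  \<comment> \<open>Besides dominating the growth, the weight of the supremum must leave decay s
    after \<open>kernel_cube_decay\<close>, whose volume comparisons use up 2 \<omega>.\<close>
  define M1 where "M1 = s + 2 * \<omega>1"
  define M2 where "M2 = s + 2 * \<omega>2"
  \<comment> \<open>Enough decay to sum over the points after a growth of exponent M1 has been
    moved; the demands of the kernel lemmas are weaker.\<close>
  define L1 where "L1 = M1 + (2 * \<omega>1 + 1)"
  define L2 where "L2 = M2 + (2 * \<omega>2 + 1)"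
  have \<omega>: "0 < \<omega>1" "0 < \<omega>2" by (rule one.omega_pos two.omega_pos)+
  have M: "0 \<le> M1" "0 \<le> M2" "D1 \<le> M1" "D2 \<le> M2" using s \<omega> by (auto simp: M1_def M2_def)
  have L: "0 \<le> L1" "0 \<le> L2" "M1 + (2 * \<omega>1 + 1) \<le> L1" "M2 + (2 * \<omega>2 + 1) \<le> L2"
    "M1 + (\<omega>1 + 1) \<le> L1" "M2 + (\<omega>2 + 1) \<le> L2" "s + \<omega>1 \<le> L1" "s + \<omega>2 \<le> L2"
    using M s \<omega> by (auto simp: L1_def L2_def M1_def M2_def)
  obtain Co where Co: "0 < Co" and osc: "\<And>K c k1 k2 N1 N2 \<alpha>1 \<alpha>2 x x' y y'. growth x0 y0 D1 D2 K c k1 k2 \<Longrightarrow>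
      8 * one.A ^ 3 * \<delta>1 ^ N1 \<le> 1 \<Longrightarrow> 8 * two.A ^ 3 * \<delta>2 ^ N2 \<le> 1 \<Longrightarrow>
      \<alpha>1 \<in> X1 (k1 + int N1) \<Longrightarrow> x \<in> Q1 (k1 + int N1) \<alpha>1 \<Longrightarrow> x' \<in> Q1 (k1 + int N1) \<alpha>1 \<Longrightarrow>
      \<alpha>2 \<in> X2 (k2 + int N2) \<Longrightarrow> y \<in> Q2 (k2 + int N2) \<alpha>2 \<Longrightarrow> y' \<in> Q2 (k2 + int N2) \<alpha>2 \<Longrightarrow>
      ennreal (cmod (series c k1 k2 x y - series c k1 k2 x' y'))
      \<le> ennreal (Co * ((\<delta>1 ^ N1) powr \<eta>1 + (\<delta>2 ^ N2) powr \<eta>2)) * majorant c k1 k2 L1 L2 x y"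
  proof -
    show ?thesis by (rule series_oscillation[OF D L(1,2), of x0 y0]) (fact that)
  qed
  obtain Ca where Ca: "0 < Ca" and maj: "\<And>c k1 k2 x y x' y'. majorant c k1 k2 L1 L2 x' y'
      \<le> ennreal Ca * weighted_sup c k1 k2 M1 M2 x y * ennreal (one.\<rho> k1 x x' powr M1) * ennreal (two.\<rho> k2 y y' powr M2)"
  proof -
    show ?thesis by (rule majorant_le_weighted_sup[OF M(1,2) L(3,4)]) (fact that)
  qed
  obtain P1 where P1: "0 < P1" and ker1: "\<And>k \<beta> x. \<beta> \<in> new_points X1 k \<Longrightarrow> one.mass k \<beta> * \<bar>\<psi>1 k \<beta> x\<bar> \<le> P1 * one.kernel L1 k \<beta> x"
    using one.wavelet_kernel[OF L(1)] by blast
  obtain P2 where P2: "0 < P2" and ker2: "\<And>k \<beta> x. \<beta> \<in> new_points X2 k \<Longrightarrow> two.mass k \<beta> * \<bar>\<psi>2 k \<beta> x\<bar> \<le> P2 * two.kernel L2 k \<beta> x"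
    using two.wavelet_kernel[OF L(2)] by blast
  obtain B1 where B1: "0 < B1" and grow1: "\<And>k x \<beta>. \<beta> \<in> X1 (k + int 1) \<Longrightarrow>
      (\<integral>\<^sup>+z. ennreal (one.\<rho> k x z powr M1 * one.kernel L1 k \<beta> z) \<partial>one.M) \<le> ennreal (B1 * one.\<rho> k x \<beta> powr M1)"
  proof -
    show ?thesis by (rule one.kernel_growth[OF M(1) L(5)]) (fact that)
  qed
  obtain B2 where B2: "0 < B2" and grow2: "\<And>k x \<beta>. \<beta> \<in> X2 (k + int 1) \<Longrightarrow>
      (\<integral>\<^sup>+z. ennreal (two.\<rho> k x z powr M2 * two.kernel L2 k \<beta> z) \<partial>two.M) \<le> ennreal (B2 * two.\<rho> k x \<beta> powr M2)"
  proof -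
    show ?thesis by (rule two.kernel_growth[OF M(2) L(6)]) (fact that)
  qed
  \<comment> \<open>Built only from constants obtained before N1 and N2 are chosen.\<close>
  define E0 where "E0 = P1 * P2 * B1 * B2 * Co * Ca"
  have E0: "0 < E0" using P1 P2 B1 B2 Co Ca by (simp add: E0_def)
  \<comment> \<open>Each variable may contribute 1 / (4 E0), which makes the total error factor at
    most 1 / 2.\<close>
  have "\<forall>\<^sub>F N in sequentially. (8 * one.A ^ 3 * \<delta>1 ^ N \<le> 1 \<and> (\<delta>1 ^ N) powr \<eta>1 \<le> 1 / (4 * E0))
      \<and> (8 * two.A ^ 3 * \<delta>2 ^ N \<le> 1 \<and> (\<delta>2 ^ N) powr \<eta>2 \<le> 1 / (4 * E0))"
    using E0 by (intro eventually_conj eventually_cube_small one.delta_pos one.delta_less one.eta_pos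
        two.delta_pos two.delta_less two.eta_pos) auto
  then obtain N0 where N0: "\<And>N. N0 \<le> N \<Longrightarrow> 8 * one.A ^ 3 * \<delta>1 ^ N \<le> 1" "\<And>N. N0 \<le> N \<Longrightarrow> (\<delta>1 ^ N) powr \<eta>1 \<le> 1 / (4 * E0)"
      "\<And>N. N0 \<le> N \<Longrightarrow> 8 * two.A ^ 3 * \<delta>2 ^ N \<le> 1" "\<And>N. N0 \<le> N \<Longrightarrow> (\<delta>2 ^ N) powr \<eta>2 \<le> 1 / (4 * E0)"
    unfolding eventually_sequentially by meson
  show ?thesis
  proof (intro exI[of _ N0] allI impI)
    fix N1 N2 assume N: "N0 \<le> N1" "N0 \<le> N2"
    obtain G1 where G1: "0 < G1" and dec1: "\<And>k x \<beta> \<alpha>. \<beta> \<in> X1 (k + int 1) \<Longrightarrow> \<alpha> \<in> X1 (k + int N1) \<Longrightarrow>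
      (\<integral>\<^sup>+z. indicator (Q1 (k + int N1) \<alpha>) z * ennreal (one.kernel L1 k \<beta> z) \<partial>one.M) * one.wt M1 k x \<beta>
      \<le> ennreal (G1 * one.\<rho> k x \<alpha> powr (- s))"
    proof -
      show ?thesis by (rule one.kernel_cube_decay[OF s(1) L(7), of N1]) (fact that[unfolded M1_def])
    qed
    obtain G2 where G2: "0 < G2" and dec2: "\<And>k x \<beta> \<alpha>. \<beta> \<in> X2 (k + int 1) \<Longrightarrow> \<alpha> \<in> X2 (k + int N2) \<Longrightarrow>
      (\<integral>\<^sup>+z. indicator (Q2 (k + int N2) \<alpha>) z * ennreal (two.kernel L2 k \<beta> z) \<partial>two.M) * two.wt M2 k x \<beta>
      \<le> ennreal (G2 * two.\<rho> k x \<alpha> powr (- s))"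
    proof -
      show ?thesis by (rule two.kernel_cube_decay[OF s(1) L(8), of N2]) (fact that[unfolded M2_def])
    qed
    define e where "e = (\<delta>1 ^ N1) powr \<eta>1 + (\<delta>2 ^ N2) powr \<eta>2"
    have e: "0 \<le> e" "E0 * e \<le> 1 / 2"
    proof -
      have "e \<le> 1 / (4 * E0) + 1 / (4 * E0)"
        unfolding e_def by (intro add_mono N0 N)
      then have "E0 * e \<le> E0 * (1 / (4 * E0) + 1 / (4 * E0))"
        using E0 by (intro mult_left_mono) auto
      then show "E0 * e \<le> 1 / 2" using E0 by (simp add: field_simps)
    qed (simp add: e_def)
    define H where "H = P1 * P2 * G1 * G2"
    have H: "0 < H" using P1 P2 G1 G2 by (simp add: H_def)
    \<comment> \<open>The factor 2 comes from the absorption; the two powers pay for the passage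
      from the base point (x, y) to the centres of the cubes containing it.\<close>
    define C where "C = 2 * H * ((5 * one.A\<^sup>2) powr M1 * (5 * two.A\<^sup>2) powr M2)"
    show "\<exists>C>0. \<forall>c. (\<forall>k1 k2. \<exists>K. growth x0 y0 D1 D2 K (c k1 k2) k1 k2) \<longrightarrow>
      cube_dominated 1 1 N1 N2 s C (\<lambda>k1 \<beta>1 k2 \<beta>2. ncoef (c k1 k2) k1 k2 \<beta>1 \<beta>2)
      (\<lambda>k1 \<alpha>1 k2 \<alpha>2. inf_series (c k1 k2) k1 k2 N1 N2 \<alpha>1 \<alpha>2)"
      unfolding cube_dominated_def
    proof (intro exI[of _ C] conjI allI impI ballI)
      show "0 < C" using H by (simp add: C_def)
      fix cc :: "int \<Rightarrow> int \<Rightarrow> 'a \<Rightarrow> 'b \<Rightarrow> complex" and k1 k2 \<beta>1' \<beta>2' x y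
      assume \<beta>': "\<beta>1' \<in> X1 (k1 + int 1)" "\<beta>2' \<in> X2 (k2 + int 1)"
        and xy: "x \<in> Q1 (k1 + int 1) \<beta>1'" "y \<in> Q2 (k2 + int 1) \<beta>2'"
      define c where "c = cc k1 k2"
      assume "\<forall>k1 k2. \<exists>K. growth x0 y0 D1 D2 K (cc k1 k2) k1 k2"
      then obtain K where growth: "growth x0 y0 D1 D2 K c k1 k2" unfolding c_def by blast
      let ?I = "X1 (k1 + int N1)" and ?J = "X2 (k2 + int N2)"
      let ?t = "inf_series c k1 k2 N1 N2"
      let ?S = "weighted_sup c k1 k2 M1 M2 x y"
      let ?Z = "\<integral>\<^sup>+\<alpha>1. \<integral>\<^sup>+\<alpha>2. ?t \<alpha>1 \<alpha>2
        * one.wt s k1 x \<alpha>1 * two.wt s k2 y \<alpha>2 \<partial>count_space ?J \<partial>count_space ?I"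
      define Es where "Es = ennreal (Co * e) * (ennreal Ca * ?S)"
      define g1 where "g1 x' = ennreal (one.\<rho> k1 x x' powr M1)" for x'
      define g2 where "g2 y' = ennreal (two.\<rho> k2 y y' powr M2)" for y'
      \<comment> \<open>Both parts are shaped for integration: the infimum on the cube containing
        the point becomes a double sum of indicators, and the error a product of growing functions
        times the supremum at the fixed base point (x, y).\<close>
      have series_le: "ennreal (cmod (series c k1 k2 x' y'))
        \<le> double_sum ?I ?J ?t (\<lambda>\<alpha>. indicator (Q1 (k1 + int N1) \<alpha>)) (\<lambda>\<alpha>. indicator (Q2 (k2 + int N2) \<alpha>)) x' y' + Es * g1 x' * g2 y'" for x' y'
      proof -
        obtain \<alpha>1 where \<alpha>1: "\<alpha>1 \<in> ?I" "x' \<in> Q1 (k1 + int N1) \<alpha>1" using one.cube_cover by blast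
        obtain \<alpha>2 where \<alpha>2: "\<alpha>2 \<in> ?J" "y' \<in> Q2 (k2 + int N2) \<alpha>2" using two.cube_cover by blast
        have "ennreal (cmod (series c k1 k2 x' y')) \<le> ?t \<alpha>1 \<alpha>2 + ennreal (Co * e) * majorant c k1 k2 L1 L2 x' y'"
          unfolding e_def by (intro series_le_inf_series osc[OF growth N0(1)[OF N(1)] N0(3)[OF N(2)] \<alpha>1 _ \<alpha>2])
        also have "\<dots> \<le> ?t \<alpha>1 \<alpha>2 + ennreal (Co * e) * (ennreal Ca * ?S * g1 x' * g2 y')"
          unfolding g1_def g2_def by (intro add_left_mono mult_left_mono maj) auto
        also have "?t \<alpha>1 \<alpha>2 = double_sum ?I ?J ?t (\<lambda>\<alpha>. indicator (Q1 (k1 + int N1) \<alpha>)) (\<lambda>\<alpha>. indicator (Q2 (k2 + int N2) \<alpha>)) x' y'"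
          unfolding double_sum_left by (simp add: one.cube_sum[OF \<alpha>1] two.cube_sum[OF \<alpha>2])
        finally show ?thesis by (simp add: Es_def mult.assoc)
      qed
      \<comment> \<open>The right-hand side is the same for all \<beta>1 and \<beta>2, as taking the
        supremum requires.\<close>
      have one_coef: "ncoef c k1 k2 \<beta>1 \<beta>2 * one.wt M1 k1 x \<beta>1 * two.wt M2 k2 y \<beta>2
          \<le> ennreal H * ?Z + ennreal (1 / 2) * ?S"
        if \<beta>: "\<beta>1 \<in> new_points X1 k1" "\<beta>2 \<in> new_points X2 k2" for \<beta>1 \<beta>2
      proof -
        have \<beta>X: "\<beta>1 \<in> X1 (k1 + int 1)" "\<beta>2 \<in> X2 (k2 + int 1)"
          using \<beta> one.new_points_subset two.new_points_subset by auto
        define r1 where "r1 = one.wt M1 k1 x \<beta>1"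
        define r2 where "r2 = two.wt M2 k2 y \<beta>2"
        define h1 where "h1 x' = ennreal (P1 * one.kernel L1 k1 \<beta>1 x') * r1" for x'
        define h2 where "h2 y' = ennreal (P2 * two.kernel L2 k2 \<beta>2 y') * r2" for y'
        have [measurable]: "h1 \<in> borel_measurable one.M" "h2 \<in> borel_measurable two.M"
          "g1 \<in> borel_measurable one.M" "g2 \<in> borel_measurable two.M"
          by (simp_all add: h1_def[abs_def] h2_def[abs_def] g1_def[abs_def] g2_def[abs_def])
        have kernel_mass1: "(\<integral>\<^sup>+x'. ennreal (one.\<rho> k1 x x' powr M1) * ennreal (one.kernel L1 k1 \<beta>1 x') \<partial>one.M) * one.wt M1 k1 x \<beta>1 \<le> ennreal B1"
        proof -
          have "(\<integral>\<^sup>+x'. ennreal (one.\<rho> k1 x x' powr M1) * ennreal (one.kernel L1 k1 \<beta>1 x') \<partial>one.M) * one.wt M1 k1 x \<beta>1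
            \<le> ennreal (B1 * one.\<rho> k1 x \<beta>1 powr M1) * one.wt M1 k1 x \<beta>1"
            using grow1[OF \<beta>X(1), of x] by (intro mult_right_mono) (auto simp: ennreal_mult)
          also have "\<dots> = ennreal B1"
            using B1 by (simp add: ennreal_mult[symmetric] powr_minus)
          finally show ?thesis .
        qed
        have kernel_mass2: "(\<integral>\<^sup>+y'. ennreal (two.\<rho> k2 y y' powr M2) * ennreal (two.kernel L2 k2 \<beta>2 y') \<partial>two.M) * two.wt M2 k2 y \<beta>2 \<le> ennreal B2"
        proof -
          have "(\<integral>\<^sup>+y'. ennreal (two.\<rho> k2 y y' powr M2) * ennreal (two.kernel L2 k2 \<beta>2 y') \<partial>two.M) * two.wt M2 k2 y \<beta>2
            \<le> ennreal (B2 * two.\<rho> k2 y \<beta>2 powr M2) * two.wt M2 k2 y \<beta>2"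
            using grow2[OF \<beta>X(2), of y] by (intro mult_right_mono) (auto simp: ennreal_mult)
          also have "\<dots> = ennreal B2"
            using B2 by (simp add: ennreal_mult[symmetric] powr_minus)
          finally show ?thesis .
        qed
        define u where "u \<alpha> x' = indicator (Q1 (k1 + int N1) \<alpha>) x' * h1 x'" for \<alpha> x'
        define v where "v \<alpha> y' = indicator (Q2 (k2 + int N2) \<alpha>) y' * h2 y'" for \<alpha> y'
        have u: "u \<alpha> \<in> borel_measurable one.M" if "\<alpha> \<in> ?I" for \<alpha>
        proof -
          note [measurable] = one.sets_cube[OF that]
          show ?thesis unfolding u_def by measurable
        qed
        have v: "v \<alpha> \<in> borel_measurable two.M" if "\<alpha> \<in> ?J" for \<alpha>
        proof -
          note [measurable] = two.sets_cube[OF that]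
          show ?thesis unfolding v_def by measurable
        qed
        have "ncoef c k1 k2 \<beta>1 \<beta>2 * r1 * r2
          = ennreal (cmod (c \<beta>1 \<beta>2)) * (ennreal (one.mass k1 \<beta>1) * r1) * (ennreal (two.mass k2 \<beta>2) * r2)"
          using \<beta> by (simp add: ncoef_def ennreal_mult mult_ac)
        also have "\<dots> \<le> (\<integral>\<^sup>+y'. \<integral>\<^sup>+x'. ennreal (cmod (series c k1 k2 x' y')) * ennreal \<bar>\<psi>1 k1 \<beta>1 x'\<bar> * ennreal \<bar>\<psi>2 k2 \<beta>2 y'\<bar>
            \<partial>one.M \<partial>two.M) * (ennreal (one.mass k1 \<beta>1) * r1) * (ennreal (two.mass k2 \<beta>2) * r2)"
          by (intro mult_right_mono coefficient_le_integral[OF D growth \<beta>]) auto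
        also have "\<dots> \<le> (\<integral>\<^sup>+y'. \<integral>\<^sup>+x'. ennreal (cmod (series c k1 k2 x' y')) * ennreal \<bar>\<psi>1 k1 \<beta>1 x'\<bar> * ennreal \<bar>\<psi>2 k2 \<beta>2 y'\<bar>
            * ((ennreal (one.mass k1 \<beta>1) * r1) * (ennreal (two.mass k2 \<beta>2) * r2)) \<partial>one.M \<partial>two.M)"
          unfolding mult.assoc[of "nn_integral _ _"]
          by (rule order_trans[OF nn_integral_multc_le]) (intro nn_integral_mono nn_integral_multc_le)
        also have "\<dots> \<le> (\<integral>\<^sup>+y'. \<integral>\<^sup>+x'. double_sum ?I ?J ?t u v x' y' + Es * (g1 x' * h1 x') * (g2 y' * h2 y') \<partial>one.M \<partial>two.M)"
        proof (intro nn_integral_mono)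
          fix x' y'
          let ?F = "double_sum ?I ?J ?t (\<lambda>\<alpha>. indicator (Q1 (k1 + int N1) \<alpha>)) (\<lambda>\<alpha>. indicator (Q2 (k2 + int N2) \<alpha>)) x' y'"
          have k1: "ennreal \<bar>\<psi>1 k1 \<beta>1 x'\<bar> * (ennreal (one.mass k1 \<beta>1) * r1) \<le> h1 x'"
          proof -
            have "ennreal (one.mass k1 \<beta>1 * \<bar>\<psi>1 k1 \<beta>1 x'\<bar>) * r1 \<le> h1 x'"
              unfolding h1_def by (intro mult_right_mono ennreal_leI ker1 \<beta>) auto
            then show ?thesis by (simp add: ennreal_mult mult_ac)
          qed
          have k2: "ennreal \<bar>\<psi>2 k2 \<beta>2 y'\<bar> * (ennreal (two.mass k2 \<beta>2) * r2) \<le> h2 y'"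
          proof -
            have "ennreal (two.mass k2 \<beta>2 * \<bar>\<psi>2 k2 \<beta>2 y'\<bar>) * r2 \<le> h2 y'"
              unfolding h2_def by (intro mult_right_mono ennreal_leI ker2 \<beta>) auto
            then show ?thesis by (simp add: ennreal_mult mult_ac)
          qed
          \<comment> \<open>Wavelet, normalising factor and weight are grouped by variable, so that
            each group is at most \<open>h1\<close> or \<open>h2\<close>.\<close>
          have "ennreal (cmod (series c k1 k2 x' y')) * ennreal \<bar>\<psi>1 k1 \<beta>1 x'\<bar> * ennreal \<bar>\<psi>2 k2 \<beta>2 y'\<bar>
            * ((ennreal (one.mass k1 \<beta>1) * r1) * (ennreal (two.mass k2 \<beta>2) * r2))
            = ennreal (cmod (series c k1 k2 x' y')) * (ennreal \<bar>\<psi>1 k1 \<beta>1 x'\<bar> * (ennreal (one.mass k1 \<beta>1) * r1))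
              * (ennreal \<bar>\<psi>2 k2 \<beta>2 y'\<bar> * (ennreal (two.mass k2 \<beta>2) * r2))"
            by (simp only: mult_ac)
          also have "\<dots> \<le> (?F + Es * g1 x' * g2 y') * h1 x' * h2 y'"
            by (intro mult_mono series_le k1 k2) auto
          also have "\<dots> = ?F * h1 x' * h2 y' + Es * (g1 x' * h1 x') * (g2 y' * h2 y')"
            by (simp only: distrib_left distrib_right mult_ac)
          also have "?F * h1 x' * h2 y' = double_sum ?I ?J ?t u v x' y'"
            unfolding double_sum_def u_def v_def by (simp add: nn_integral_cmult[symmetric] mult_ac)
          finally show "ennreal (cmod (series c k1 k2 x' y')) * ennreal \<bar>\<psi>1 k1 \<beta>1 x'\<bar> * ennreal \<bar>\<psi>2 k2 \<beta>2 y'\<bar>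
            * ((ennreal (one.mass k1 \<beta>1) * r1) * (ennreal (two.mass k2 \<beta>2) * r2))
            \<le> double_sum ?I ?J ?t u v x' y' + Es * (g1 x' * h1 x') * (g2 y' * h2 y')" .
        qed
        also have "\<dots> = (\<integral>\<^sup>+\<alpha>1. \<integral>\<^sup>+\<alpha>2. ?t \<alpha>1 \<alpha>2 * (\<integral>\<^sup>+x. u \<alpha>1 x \<partial>one.M) * (\<integral>\<^sup>+y. v \<alpha>2 y \<partial>two.M) \<partial>count_space ?J \<partial>count_space ?I)
            + Es * (\<integral>\<^sup>+x'. g1 x' * h1 x' \<partial>one.M) * (\<integral>\<^sup>+y'. g2 y' * h2 y' \<partial>two.M)"
          by (intro nn_integral_double_sum_add_le one.countable_X two.countable_X u v) measurable
        \<comment> \<open>In the main term the kernels are restricted to small cubes and give decay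
          s with constants depending on N1 and N2. In the error term they meet the growth of
          \<open>g1\<close> and \<open>g2\<close>, with constants free of N1 and N2.\<close>
        also have "\<dots> \<le> (\<integral>\<^sup>+\<alpha>1. \<integral>\<^sup>+\<alpha>2. ?t \<alpha>1 \<alpha>2 * ennreal (P1 * (G1 * one.\<rho> k1 x \<alpha>1 powr (- s)))
              * ennreal (P2 * (G2 * two.\<rho> k2 y \<alpha>2 powr (- s))) \<partial>count_space ?J \<partial>count_space ?I)
            + Es * ennreal (P1 * B1) * ennreal (P2 * B2)"
        proof (intro add_mono mult_mono nn_integral_mono order_refl zero_le)
          fix \<alpha>1 assume "\<alpha>1 \<in> space (count_space ?I)"
          then have \<alpha>: "\<alpha>1 \<in> ?I" by simp
          show "(\<integral>\<^sup>+x'. u \<alpha>1 x' \<partial>one.M) \<le> ennreal (P1 * (G1 * one.\<rho> k1 x \<alpha>1 powr (- s)))"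
            unfolding u_def h1_def r1_def using P1
            by (intro one.nn_integral_kernel_scaled one.sets_cube borel_measurable_indicator dec1 \<beta>X \<alpha>) auto
        next
          fix \<alpha>2 assume "\<alpha>2 \<in> space (count_space ?J)"
          then have \<alpha>: "\<alpha>2 \<in> ?J" by simp
          show "(\<integral>\<^sup>+y'. v \<alpha>2 y' \<partial>two.M) \<le> ennreal (P2 * (G2 * two.\<rho> k2 y \<alpha>2 powr (- s)))"
            unfolding v_def h2_def r2_def using P2
            by (intro two.nn_integral_kernel_scaled two.sets_cube borel_measurable_indicator dec2 \<beta>X \<alpha>) auto
        next
          show "(\<integral>\<^sup>+x'. g1 x' * h1 x' \<partial>one.M) \<le> ennreal (P1 * B1)"
            unfolding g1_def h1_def r1_def using P1 B1
            by (intro one.nn_integral_kernel_scaled kernel_mass1) auto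
        next
          show "(\<integral>\<^sup>+y'. g2 y' * h2 y' \<partial>two.M) \<le> ennreal (P2 * B2)"
            unfolding g2_def h2_def r2_def using P2 B2
            by (intro two.nn_integral_kernel_scaled kernel_mass2) auto
        qed
        also have "(\<integral>\<^sup>+\<alpha>1. \<integral>\<^sup>+\<alpha>2. ?t \<alpha>1 \<alpha>2 * ennreal (P1 * (G1 * one.\<rho> k1 x \<alpha>1 powr (- s)))
              * ennreal (P2 * (G2 * two.\<rho> k2 y \<alpha>2 powr (- s))) \<partial>count_space ?J \<partial>count_space ?I) = ennreal H * ?Z"
          using P1 P2 G1 G2 by (simp add: H_def ennreal_mult nn_integral_cmult[symmetric] mult_ac)
        also have "Es * ennreal (P1 * B1) * ennreal (P2 * B2) = ennreal (E0 * e) * ?S"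
          using P1 P2 B1 B2 Co Ca e by (simp add: Es_def E0_def ennreal_mult mult_ac)
        also have "ennreal H * ?Z + ennreal (E0 * e) * ?S \<le> ennreal H * ?Z + ennreal (1 / 2) * ?S"
          by (intro add_left_mono mult_right_mono ennreal_leI e) auto
        finally show ?thesis by (simp add: r1_def r2_def)
      qed
      \<comment> \<open>Over all pairs of new points the weighted coefficient on the left has
        supremum \<open>?S\<close>, which also stands on the right with factor 1 / 2.\<close>
      have "?S \<le> ennreal H * ?Z + ennreal (1 / 2) * ?S"
        by (subst (1) weighted_sup_def, rule SUP_least, rule one_coef) auto
      then have S: "?S \<le> 2 * (ennreal H * ?Z)"
        by (rule ennreal_absorb_half) (rule weighted_sup_finite[OF D M(3,4) growth])
      have "ncoef c k1 k2 \<beta>1' \<beta>2' \<le> ?S * ennreal (one.\<rho> k1 x \<beta>1' powr M1) * ennreal (two.\<rho> k2 y \<beta>2' powr M2)"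
        by (rule ncoef_le_weighted_sup)
      also have "\<dots> \<le> 2 * (ennreal H * ?Z) * ennreal ((5 * one.A\<^sup>2) powr M1) * ennreal ((5 * two.A\<^sup>2) powr M2)"
        using one.cube_\<rho>(1)[OF \<beta>'(1) xy(1)] two.cube_\<rho>(1)[OF \<beta>'(2) xy(2)] M
        by (intro mult_mono S ennreal_leI powr_mono2) auto
      also have "\<dots> = ennreal C * ?Z"
        using H by (simp add: C_def ennreal_mult mult_ac)
      finally have "ncoef c k1 k2 \<beta>1' \<beta>2' \<le> ennreal C * ?Z" .
      then show "ncoef (cc k1 k2) k1 k2 \<beta>1' \<beta>2' \<le> ennreal C * (\<integral>\<^sup>+\<alpha>1. \<integral>\<^sup>+\<alpha>2. inf_series (cc k1 k2) k1 k2 N1 N2 \<alpha>1 \<alpha>2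
        * one.wt s k1 x \<alpha>1 * two.wt s k2 y \<alpha>2 \<partial>count_space ?J \<partial>count_space ?I)"
        by (simp only: c_def)
    qed
  qed
qed

theorem coeff_square_function_le:
  fixes p :: real
  assumes p: "0 < p" and \<beta>: "0 < b1" "b1 < \<eta>1" "0 < b2" "b2 < \<eta>2" and \<gamma>: "0 < \<gamma>1" "0 < \<gamma>2"
  shows "\<exists>N0::nat. \<forall>N1\<ge>N0. \<forall>N2\<ge>N0. \<exists>C::real. C > 0 \<and>
    (\<forall>f \<in> distributions S1 S2 x0 y0 \<eta>1 \<eta>2 b1 b2 \<gamma>1 \<gamma>2.
      Lp_norm (one.M \<Otimes>\<^sub>M two.M) p (coeff_square_function S1 S2 X1 X2 Q1 Q2 \<psi>1 \<psi>2 f)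
      \<le> ennreal C * Lp_norm (one.M \<Otimes>\<^sub>M two.M) p (inf_square_function X1 X2 Q1 Q2 \<psi>1 \<psi>2 N1 N2 f))"
proof -
  let ?c = "\<lambda>f k1 k2 \<beta>1 \<beta>2. wavelet_coeff \<psi>1 \<psi>2 f k1 \<beta>1 k2 \<beta>2"
  let ?L0 = "max (one.decay_exponent (p / 2)) (two.decay_exponent (p / 2))"
  obtain D1 D2 where D: "0 \<le> D1" "0 \<le> D2" and growth:
    "\<And>f k1 k2. f \<in> distributions S1 S2 x0 y0 \<eta>1 \<eta>2 b1 b2 \<gamma>1 \<gamma>2 \<Longrightarrow> \<exists>K. growth x0 y0 D1 D2 K (?c f k1 k2) k1 k2"
  proof -
    show ?thesis by (rule distributions_growth[OF \<beta> \<gamma>, of x0 y0]) (fact that)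
  qed
  \<comment> \<open>One exponent for three purposes: the one-parameter inequality at p / 2, summable
    weights in Cauchy-Schwarz, and domination of the growth exponents.\<close>
  define s where "s = max (max ?L0 (max D1 D2)) (max (2 * \<omega>1 + 1) (2 * \<omega>2 + 1))"
  have s: "?L0 \<le> s" "2 * \<omega>1 + 1 \<le> s" "2 * \<omega>2 + 1 \<le> s" by (auto simp: s_def)
  have \<omega>: "0 < \<omega>1" "0 < \<omega>2" by (rule one.omega_pos two.omega_pos)+
  have s': "0 \<le> s" "D1 \<le> s + 2 * \<omega>1" "D2 \<le> s + 2 * \<omega>2"
  proof -
    have "D1 \<le> s" "D2 \<le> s" by (auto simp: s_def)
    then show "0 \<le> s" "D1 \<le> s + 2 * \<omega>1" "D2 \<le> s + 2 * \<omega>2" using D \<omega> by linarith+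
  qed
  obtain N0 where N0: "\<forall>N1\<ge>N0. \<forall>N2\<ge>N0. \<exists>C>0. \<forall>c. (\<forall>k1 k2. \<exists>K. growth x0 y0 D1 D2 K (c k1 k2) k1 k2) \<longrightarrow>
      cube_dominated 1 1 N1 N2 s C (\<lambda>k1 \<beta>1 k2 \<beta>2. ncoef (c k1 k2) k1 k2 \<beta>1 \<beta>2)
      (\<lambda>k1 \<alpha>1 k2 \<alpha>2. inf_series (c k1 k2) k1 k2 N1 N2 \<alpha>1 \<alpha>2)"
    using ncoef_le_inf_series[OF D s', of x0 y0] by (rule exE)
  show ?thesis
  proof (intro exI[of _ N0] allI impI)
    fix N1 N2 assume N: "N0 \<le> N1" "N0 \<le> N2"
    obtain C where C: "0 < C" and C': "\<forall>c. (\<forall>k1 k2. \<exists>K. growth x0 y0 D1 D2 K (c k1 k2) k1 k2) \<longrightarrow>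
      cube_dominated 1 1 N1 N2 s C (\<lambda>k1 \<beta>1 k2 \<beta>2. ncoef (c k1 k2) k1 k2 \<beta>1 \<beta>2)
      (\<lambda>k1 \<alpha>1 k2 \<alpha>2. inf_series (c k1 k2) k1 k2 N1 N2 \<alpha>1 \<alpha>2)"
      using N0[rule_format, OF N] by (elim exE conjE)
    obtain K1 where K1: "0 < K1"
      "\<And>k x L. 2 * \<omega>1 + 1 \<le> L \<Longrightarrow> (\<integral>\<^sup>+\<alpha>. one.wt L k x \<alpha> \<partial>one.pts N1 k) \<le> ennreal K1"
      using one.sum_\<rho>[of N1] by metis
    obtain K2 where K2: "0 < K2"
      "\<And>k x L. 2 * \<omega>2 + 1 \<le> L \<Longrightarrow> (\<integral>\<^sup>+\<alpha>. two.wt L k x \<alpha> \<partial>two.pts N2 k) \<le> ennreal K2"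
      using two.sum_\<rho>[of N2] by metis
    \<comment> \<open>The square of the domination constant times the bounds K1 and K2 for the total
      weights over the centres of the small cubes, which enter through Cauchy-Schwarz.\<close>
    define B where "B = C\<^sup>2 * (K1 * K2)"
    have B: "0 < B" using C K1 K2 by (simp add: B_def)
    show "\<exists>C::real. C > 0 \<and> (\<forall>f \<in> distributions S1 S2 x0 y0 \<eta>1 \<eta>2 b1 b2 \<gamma>1 \<gamma>2.
      Lp_norm (one.M \<Otimes>\<^sub>M two.M) p (coeff_square_function S1 S2 X1 X2 Q1 Q2 \<psi>1 \<psi>2 f)
      \<le> ennreal C * Lp_norm (one.M \<Otimes>\<^sub>M two.M) p (inf_square_function X1 X2 Q1 Q2 \<psi>1 \<psi>2 N1 N2 f))"
    proof (rule cube_series_le[of "p / 2" 1 1 N1 N2])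
      show "0 < p / 2" using p by simp
      fix K :: real
      assume K: "0 < K" and key: "\<And>H b C L. ?L0 \<le> L \<Longrightarrow> 0 < C \<Longrightarrow>
        cube_dominated 1 1 N1 N2 L C H b \<Longrightarrow>
        (\<integral>\<^sup>+z. ennreal_powr (cube_series 1 1 H (fst z) (snd z)) (p / 2) \<partial>(one.M \<Otimes>\<^sub>M two.M))
        \<le> ennreal (C powr (p / 2) * K) * (\<integral>\<^sup>+z. ennreal_powr (cube_series N1 N2 b (fst z) (snd z)) (p / 2) \<partial>(one.M \<Otimes>\<^sub>M two.M))"
      show ?thesis
      proof (intro exI conjI ballI)
        show "0 < (B powr (p / 2) * K) powr (1 / p)" using B K by simp
        fix f assume f: "f \<in> distributions S1 S2 x0 y0 \<eta>1 \<eta>2 b1 b2 \<gamma>1 \<gamma>2"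
        show "Lp_norm (one.M \<Otimes>\<^sub>M two.M) p (coeff_square_function S1 S2 X1 X2 Q1 Q2 \<psi>1 \<psi>2 f)
          \<le> ennreal ((B powr (p / 2) * K) powr (1 / p)) * Lp_norm (one.M \<Otimes>\<^sub>M two.M) p (inf_square_function X1 X2 Q1 Q2 \<psi>1 \<psi>2 N1 N2 f)"
          unfolding inf_square_function_eq coeff_square_function_eq
        proof (rule Lp_norm_sqrt_le[OF p _ key[OF s(1) B]])
          show "0 < B powr (p / 2) * K" using B K by simp
          have dom: "cube_dominated 1 1 N1 N2 s C (\<lambda>k1 \<beta>1 k2 \<beta>2. ncoef (?c f k1 k2) k1 k2 \<beta>1 \<beta>2)
            (\<lambda>k1 \<alpha>1 k2 \<alpha>2. inf_series (?c f k1 k2) k1 k2 N1 N2 \<alpha>1 \<alpha>2)"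
            by (rule C'[rule_format]) (rule growth[OF f])
          show "cube_dominated 1 1 N1 N2 s B (sq_coef f) (\<lambda>k1 \<alpha>1 k2 \<alpha>2.
            INF z\<in>Q1 (k1 + int N1) \<alpha>1 \<times> Q2 (k2 + int N2) \<alpha>2. ennreal ((cmod (DD X1 X2 \<psi>1 \<psi>2 k1 k2 f z))\<^sup>2))"
            unfolding cube_dominated_def
          proof (intro allI ballI)
            fix k1 \<beta>1 k2 \<beta>2 x y
            assume \<beta>: "\<beta>1 \<in> X1 (k1 + int 1)" "\<beta>2 \<in> X2 (k2 + int 1)" and xy: "x \<in> Q1 (k1 + int 1) \<beta>1" "y \<in> Q2 (k2 + int 1) \<beta>2"
            let ?I = "X1 (k1 + int N1)" and ?J = "X2 (k2 + int N2)"
            let ?u = "\<lambda>\<alpha>. one.wt s k1 x \<alpha>" and ?v = "\<lambda>\<alpha>. two.wt s k2 y \<alpha>"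
            let ?t = "inf_series (?c f k1 k2) k1 k2 N1 N2"
            have t: "(?t \<alpha>1 \<alpha>2)\<^sup>2 = (INF z\<in>Q1 (k1 + int N1) \<alpha>1 \<times> Q2 (k2 + int N2) \<alpha>2. ennreal ((cmod (DD X1 X2 \<psi>1 \<psi>2 k1 k2 f z))\<^sup>2))" for \<alpha>1 \<alpha>2
              unfolding inf_series_def ennreal_powr_half_square
              by (simp add: DD_series[symmetric])
            have "ncoef (?c f k1 k2) k1 k2 \<beta>1 \<beta>2 \<le> ennreal C * (\<integral>\<^sup>+\<alpha>1. \<integral>\<^sup>+\<alpha>2. ?t \<alpha>1 \<alpha>2 * ?u \<alpha>1 * ?v \<alpha>2 \<partial>count_space ?J \<partial>count_space ?I)"
              using dom \<beta> xy unfolding cube_dominated_def by blast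
            then have "sq_coef f k1 \<beta>1 k2 \<beta>2 \<le> (ennreal C * (\<integral>\<^sup>+\<alpha>1. \<integral>\<^sup>+\<alpha>2. ?t \<alpha>1 \<alpha>2 * ?u \<alpha>1 * ?v \<alpha>2 \<partial>count_space ?J \<partial>count_space ?I))\<^sup>2"
              unfolding sq_coef_def by (rule power_mono) simp
            also have "\<dots> = ennreal (C\<^sup>2) * (\<integral>\<^sup>+\<alpha>1. \<integral>\<^sup>+\<alpha>2. ?t \<alpha>1 \<alpha>2 * ?u \<alpha>1 * ?v \<alpha>2 \<partial>count_space ?J \<partial>count_space ?I)\<^sup>2"
              using C by (simp add: power_mult_distrib ennreal_power)
            also have "\<dots> \<le> ennreal (C\<^sup>2) * (ennreal (K1 * K2) * (\<integral>\<^sup>+\<alpha>1. \<integral>\<^sup>+\<alpha>2. (?t \<alpha>1 \<alpha>2)\<^sup>2 * ?u \<alpha>1 * ?v \<alpha>2 \<partial>count_space ?J \<partial>count_space ?I))"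
              using K1 K2 s by (intro mult_left_mono double_sum_Cauchy_Schwarz) auto
            also have "\<dots> = ennreal B * (\<integral>\<^sup>+\<alpha>1. \<integral>\<^sup>+\<alpha>2. (?t \<alpha>1 \<alpha>2)\<^sup>2 * ?u \<alpha>1 * ?v \<alpha>2 \<partial>count_space ?J \<partial>count_space ?I)"
              using K1 K2 by (simp add: B_def ennreal_mult mult.assoc)
            finally show "sq_coef f k1 \<beta>1 k2 \<beta>2 \<le> ennreal B * (\<integral>\<^sup>+\<alpha>1. \<integral>\<^sup>+\<alpha>2.
                (INF z\<in>Q1 (k1 + int N1) \<alpha>1 \<times> Q2 (k2 + int N2) \<alpha>2. ennreal ((cmod (DD X1 X2 \<psi>1 \<psi>2 k1 k2 f z))\<^sup>2))
                * ?u \<alpha>1 * ?v \<alpha>2 \<partial>count_space ?J \<partial>count_space ?I)"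
              by (simp only: t)
          qed
        qed
      qed
    qed
  qed
qed

end

theorem theorem4p9:
  fixes S1 :: "'a qm_space" and S2 :: "'b qm_space"
    and \<omega>1 \<omega>2 \<delta>1 \<delta>2 \<eta>1 \<eta>2 \<beta>1 \<beta>2 \<gamma>1 \<gamma>2 p :: real
    and X1 :: "int \<Rightarrow> 'a set" and X2 :: "int \<Rightarrow> 'b set"
    and Q1 :: "int \<Rightarrow> 'a \<Rightarrow> 'a set" and Q2 :: "int \<Rightarrow> 'b \<Rightarrow> 'b set"
    and \<psi>1 :: "int \<Rightarrow> 'a \<Rightarrow> 'a \<Rightarrow> real" and \<psi>2 :: "int \<Rightarrow> 'b \<Rightarrow> 'b \<Rightarrow> real"
    and x0 :: 'a and y0 :: 'b
  assumes "homogeneous_type S1" and "homogeneous_type S2"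
    and "emeasure (qmeas S1) UNIV = \<infinity>" and "emeasure (qmeas S2) UNIV = \<infinity>"
    and "\<And>x r. r > 0 \<Longrightarrow> emeasure (qmeas S1) (qball S1 x r) > 0"
    and "\<And>x r. r > 0 \<Longrightarrow> emeasure (qmeas S2) (qball S2 x r) > 0"
    and "upper_dimension S1 \<omega>1" and "upper_dimension S2 \<omega>2"
    and "reference_points S1 \<delta>1 X1" and "reference_points S2 \<delta>2 X2"
    and "dyadic_cubes S1 \<delta>1 X1 Q1" and "dyadic_cubes S2 \<delta>2 X2 Q2"
    and "wavelet_basis S1 \<delta>1 X1 \<eta>1 \<psi>1" and "wavelet_basis S2 \<delta>2 X2 \<eta>2 \<psi>2"
    and "0 < \<beta>1" and "\<beta>1 < \<eta>1" and "0 < \<beta>2" and "\<beta>2 < \<eta>2"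
    and "\<gamma>1 > 0" and "\<gamma>2 > 0"
    and "max (\<omega>1 / (\<omega>1 + \<eta>1)) (\<omega>2 / (\<omega>2 + \<eta>2)) < p"
  shows
    "(\<forall>N1 N2 :: nat. \<exists>C::real. C > 0 \<and>
        (\<forall>f \<in> distributions S1 S2 x0 y0 \<eta>1 \<eta>2 \<beta>1 \<beta>2 \<gamma>1 \<gamma>2.
           Lp_norm (qmeas S1 \<Otimes>\<^sub>M qmeas S2) p (sup_square_function X1 X2 Q1 Q2 \<psi>1 \<psi>2 N1 N2 f)
           \<le> ennreal C * Lp_norm (qmeas S1 \<Otimes>\<^sub>M qmeas S2) p
                (coeff_square_function S1 S2 X1 X2 Q1 Q2 \<psi>1 \<psi>2 f))) \<and>
     (\<exists>N0::nat. \<forall>N1\<ge>N0. \<forall>N2\<ge>N0. \<exists>C::real. C > 0 \<and>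
        (\<forall>f \<in> distributions S1 S2 x0 y0 \<eta>1 \<eta>2 \<beta>1 \<beta>2 \<gamma>1 \<gamma>2.
           Lp_norm (qmeas S1 \<Otimes>\<^sub>M qmeas S2) p
             (coeff_square_function S1 S2 X1 X2 Q1 Q2 \<psi>1 \<psi>2 f)
           \<le> ennreal C * Lp_norm (qmeas S1 \<Otimes>\<^sub>M qmeas S2) p
                (inf_square_function X1 X2 Q1 Q2 \<psi>1 \<psi>2 N1 N2 f)))"
proof -
  have "0 < \<omega>1" "0 < \<eta>1"
    using \<open>upper_dimension S1 \<omega>1\<close> \<open>wavelet_basis S1 \<delta>1 X1 \<eta>1 \<psi>1\<close>
    by (simp_all add: upper_dimension_def wavelet_basis_def)
  then have "0 < \<omega>1 / (\<omega>1 + \<eta>1)" by simp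
  with \<open>max (\<omega>1 / (\<omega>1 + \<eta>1)) (\<omega>2 / (\<omega>2 + \<eta>2)) < p\<close> have p: "0 < p" by simp
  have \<delta>: "0 < \<delta>1" "\<delta>1 < 1" "0 < \<delta>2" "\<delta>2 < 1"
    using \<open>reference_points S1 \<delta>1 X1\<close> \<open>reference_points S2 \<delta>2 X2\<close> by (simp_all add: reference_points_def)
  interpret wavelet_pair S1 \<omega>1 \<delta>1 X1 Q1 \<eta>1 \<psi>1 S2 \<omega>2 \<delta>2 X2 Q2 \<eta>2 \<psi>2
    using assms \<delta> by unfold_locales
  show ?thesis
    using sup_square_function_le[OF p] coeff_square_function_le[OF p assms(15-20), of x0 y0] by blast
qed

end
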